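(* Let $L/K$ be a totally ramified abelian extension of local fields whose degree is a power of the residue characteristic $p>0$. Let $m$ be the exponent of $\mathrm{Gal}(L/K)$, and let $r$ (a divisor of $m$) be the number of $m$-th roots of unity contained in $K$. If $p=2$ and $8\mid m$, assume moreover that $r\neq 2$. Then $\mathrm{VC}(L/K)$ holds if and only if for all intermediate fields $K\subset E\subset F\subset L$ such that $F/E$ is cyclic of degree $r$, the extension $F/E$ is a unit root Kummer extension.
   Context: A local field is a field complete with respect to a discrete valuation; valuations $v_E$ etc. are normalized. A Galois extension $F/E$ with $\mathrm{Gal}(F/E)$ abelian of exponent $n$ and $E$ containing a primitive $n$-th root of unity is a Kummer extension; with $W=F^{*n}\cap E^*$ one has $F=E(\sqrt[n]{W})$, and $F/E$ is called a unit root Kummer extension if moreover $v_E(W)\subset n\mathbb{Z}$. An element $x\in L$ is normal over $K$ if its $\mathrm{Gal}(L/K)$-conjugates form a $K$-basis of $L$. With $d_{L/K}$ the valuation in $L$ of the different of $L/K$ and $e_{L/K}$ the ramification index, $\mathrm{VC}(L/K)$ is the statement: every $x\in L^*$ with $v_L(x)\equiv -d_{L/K}-1\pmod{e_{L/K}}$ is normal over $K$. *)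

theory Defs
  imports "HOL-Algebra.Algebra" "HOL-Number_Theory.Cong"
begin

section \<open>Galois extensions\<close>

text \<open>Throughout, an extension is given by a field \<open>R\<close> together with a subfield \<open>K\<close> of it; a
  subfield \<open>F\<close> of \<open>R\<close> is regarded as a field in its own right as \<open>R\<lparr>carrier := F\<rparr>\<close>.\<close>

text \<open>As in \<^const>\<open>AutoGroup\<close>, automorphisms are taken extensional, so that each is counted once.\<close>

definition galois_group :: "('a, 'b) ring_scheme \<Rightarrow> 'a set \<Rightarrow> ('a \<Rightarrow> 'a) monoid" where
  "galois_group R K = BijGroup (carrier R)
     \<lparr>carrier := {\<sigma> \<in> ring_iso R R \<inter> extensional (carrier R). \<forall>x\<in>K. \<sigma> x = x}\<rparr>"

definition galois_extension :: "('a, 'b) ring_scheme \<Rightarrow> 'a set \<Rightarrow> bool" where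
  "galois_extension R K \<longleftrightarrow> field R \<and> subfield K R \<and> ring.finite_dimension R K (carrier R) \<and>
     {x \<in> carrier R. \<forall>\<sigma>\<in>carrier (galois_group R K). \<sigma> x = x} = K"

definition abelian_extension :: "('a, 'b) ring_scheme \<Rightarrow> 'a set \<Rightarrow> bool" where
  "abelian_extension R K \<longleftrightarrow> galois_extension R K \<and> comm_group (galois_group R K)"

definition cyclic_extension :: "('a, 'b) ring_scheme \<Rightarrow> 'a set \<Rightarrow> nat \<Rightarrow> bool" where
  "cyclic_extension R K n \<longleftrightarrow> galois_extension R K \<and> cyclic_group (galois_group R K) \<and>
     ring.dimension R n K (carrier R)"

definition group_exponent :: "('a, 'b) monoid_scheme \<Rightarrow> nat" where
  "group_exponent G = (LEAST n. 0 < n \<and> (\<forall>g\<in>carrier G. g [^]\<^bsub>G\<^esub> n = \<one>\<^bsub>G\<^esub>))"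

text \<open>The set of conjugates is a basis only if the conjugates are pairwise distinct, because it has
  to have as many elements as the Galois group; so nothing is lost by enumerating the set.\<close>

definition normal_element :: "('a, 'b) ring_scheme \<Rightarrow> 'a set \<Rightarrow> 'a \<Rightarrow> bool" where
  "normal_element R K x \<longleftrightarrow> x \<in> carrier R \<and>
     (\<exists>Us. set Us = (\<lambda>\<sigma>. \<sigma> x) ` carrier (galois_group R K) \<and>
           ring.independent R K Us \<and> ring.Span R K Us = carrier R)"

text \<open>The trace of a Galois extension, as the sum of the conjugates.\<close>

definition galois_trace :: "('a, 'b) ring_scheme \<Rightarrow> 'a set \<Rightarrow> 'a \<Rightarrow> 'a" where
  "galois_trace R K x = (\<Oplus>\<^bsub>R\<^esub>\<sigma>\<in>carrier (galois_group R K). \<sigma> x)"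


section \<open>Local fields\<close>

text \<open>A valuation is a function to the integers whose value at \<open>\<zero>\<close> is irrelevant; \<open>val_ge n x\<close>
  says that the valuation of \<open>x\<close> is at least \<open>n\<close>, with the valuation of \<open>\<zero>\<close> being infinite.\<close>

definition val_ge :: "('a, 'b) ring_scheme \<Rightarrow> ('a \<Rightarrow> int) \<Rightarrow> int \<Rightarrow> 'a \<Rightarrow> bool" where
  "val_ge R v n x \<longleftrightarrow> x = \<zero>\<^bsub>R\<^esub> \<or> n \<le> v x"

text \<open>Residue fields are not assumed to be finite or perfect.\<close>

locale local_field = field R for R (structure) +
  fixes v :: "'a \<Rightarrow> int"
  assumes val_normalized: "v ` (carrier R - {\<zero>}) = UNIV"
    and val_mult: "\<lbrakk>x \<in> carrier R - {\<zero>}; y \<in> carrier R - {\<zero>}\<rbrakk> \<Longrightarrow> v (x \<otimes> y) = v x + v y"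
    and val_add: "\<lbrakk>x \<in> carrier R - {\<zero>}; y \<in> carrier R - {\<zero>}; x \<oplus> y \<noteq> \<zero>\<rbrakk>
      \<Longrightarrow> min (v x) (v y) \<le> v (x \<oplus> y)"
    and complete: "\<lbrakk>\<And>i::nat. s i \<in> carrier R;
        \<And>n. \<exists>N. \<forall>i\<ge>N. \<forall>j\<ge>N. val_ge R v n (s i \<ominus> s j)\<rbrakk>
      \<Longrightarrow> \<exists>l\<in>carrier R. \<forall>n. \<exists>N. \<forall>i\<ge>N. val_ge R v n (s i \<ominus> l)"

definition valuation_ring :: "('a, 'b) ring_scheme \<Rightarrow> ('a \<Rightarrow> int) \<Rightarrow> 'a set" where
  "valuation_ring R v = {x \<in> carrier R. val_ge R v 0 x}"

definition valuation_ideal :: "('a, 'b) ring_scheme \<Rightarrow> ('a \<Rightarrow> int) \<Rightarrow> 'a set" where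
  "valuation_ideal R v = {x \<in> carrier R. val_ge R v 1 x}"

definition residue_field :: "('a, 'b) ring_scheme \<Rightarrow> ('a \<Rightarrow> int) \<Rightarrow> 'a set ring" where
  "residue_field R v = R\<lparr>carrier := valuation_ring R v\<rparr> Quot valuation_ideal R v"

text \<open>\<^const>\<open>group.ord\<close> is \<open>0\<close> on elements of infinite order, as required for the characteristic.\<close>

definition ring_char :: "('a, 'b) ring_scheme \<Rightarrow> nat" where
  "ring_char R = group.ord (add_monoid R) \<one>\<^bsub>R\<^esub>"


section \<open>Extensions of local fields\<close>

text \<open>Let \<open>v\<close> be the normalized valuation of \<open>R\<close>. The image of \<open>K - {\<zero>}\<close> under \<open>v\<close> is a subgroup
  of the integers; its nonnegative generator is the ramification index \<open>e\<close> of \<open>R\<close> over \<open>K\<close>, and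
  \<open>v\<close> divided by \<open>e\<close> is the normalized valuation of \<open>K\<close>.\<close>

definition ram_index :: "('a, 'b) ring_scheme \<Rightarrow> ('a \<Rightarrow> int) \<Rightarrow> 'a set \<Rightarrow> int" where
  "ram_index R v K = Gcd (v ` (K - {\<zero>\<^bsub>R\<^esub>}))"

definition sub_valuation :: "('a, 'b) ring_scheme \<Rightarrow> ('a \<Rightarrow> int) \<Rightarrow> 'a set \<Rightarrow> 'a \<Rightarrow> int" where
  "sub_valuation R v K x = v x div ram_index R v K"

definition local_field_extension :: "('a, 'b) ring_scheme \<Rightarrow> ('a \<Rightarrow> int) \<Rightarrow> 'a set \<Rightarrow> bool" where
  "local_field_extension R v K \<longleftrightarrow> local_field R v \<and> subfield K R \<and>
     local_field (R\<lparr>carrier := K\<rparr>) (sub_valuation R v K)"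

definition totally_ramified :: "('a, 'b) ring_scheme \<Rightarrow> ('a \<Rightarrow> int) \<Rightarrow> 'a set \<Rightarrow> bool" where
  "totally_ramified R v K \<longleftrightarrow>
     (\<exists>n. ring.dimension R n K (carrier R) \<and> ram_index R v K = int n)"

text \<open>The inverse different and the different of a Galois extension of local fields.\<close>

definition codifferent :: "('a, 'b) ring_scheme \<Rightarrow> ('a \<Rightarrow> int) \<Rightarrow> 'a set \<Rightarrow> 'a set" where
  "codifferent R v K = {y \<in> carrier R. \<forall>z\<in>valuation_ring R v.
     galois_trace R K (y \<otimes>\<^bsub>R\<^esub> z) \<in> valuation_ring (R\<lparr>carrier := K\<rparr>) (sub_valuation R v K)}"

definition different :: "('a, 'b) ring_scheme \<Rightarrow> ('a \<Rightarrow> int) \<Rightarrow> 'a set \<Rightarrow> 'a set" where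
  "different R v K =
     {x \<in> carrier R. \<forall>y\<in>codifferent R v K. x \<otimes>\<^bsub>R\<^esub> y \<in> valuation_ring R v}"

text \<open>The valuation of a nonzero ideal is the least valuation of its nonzero elements.\<close>

definition different_exponent :: "('a, 'b) ring_scheme \<Rightarrow> ('a \<Rightarrow> int) \<Rightarrow> 'a set \<Rightarrow> int" where
  "different_exponent R v K = Inf (v ` (different R v K - {\<zero>\<^bsub>R\<^esub>}))"

definition VC :: "('a, 'b) ring_scheme \<Rightarrow> ('a \<Rightarrow> int) \<Rightarrow> 'a set \<Rightarrow> bool" where
  "VC R v K \<longleftrightarrow> (\<forall>x \<in> carrier R - {\<zero>\<^bsub>R\<^esub>}.
     [v x = - different_exponent R v K - 1] (mod ram_index R v K) \<longrightarrow> normal_element R K x)"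


section \<open>Kummer extensions\<close>

definition kummer_extension :: "('a, 'b) ring_scheme \<Rightarrow> 'a set \<Rightarrow> bool" where
  "kummer_extension F E \<longleftrightarrow> abelian_extension F E \<and>
     (\<exists>\<zeta>\<in>E - {\<zero>\<^bsub>F\<^esub>}. group.ord (mult_of F) \<zeta> = group_exponent (galois_group F E))"

definition kummer_set :: "('a, 'b) ring_scheme \<Rightarrow> 'a set \<Rightarrow> 'a set" where
  "kummer_set F E =
     (\<lambda>x. x [^]\<^bsub>F\<^esub> group_exponent (galois_group F E)) ` (carrier F - {\<zero>\<^bsub>F\<^esub>}) \<inter> (E - {\<zero>\<^bsub>F\<^esub>})"

text \<open>Here \<open>w\<close> is the normalized valuation of the base field \<open>E\<close>.\<close>

definition unit_root_kummer_extension ::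
    "('a, 'b) ring_scheme \<Rightarrow> 'a set \<Rightarrow> ('a \<Rightarrow> int) \<Rightarrow> bool" where
  "unit_root_kummer_extension F E w \<longleftrightarrow> kummer_extension F E \<and>
     (\<forall>x\<in>kummer_set F E. int (group_exponent (galois_group F E)) dvd w x)"

end

theory Submission
  imports Defs
begin

text \<open>Let \<open>G\<close> be the Galois group of \<open>L\<close> over \<open>K\<close>. Pairing with the trace form turns
 \<open>VC\<close> into the statement that every nonzero submodule of \<open>L\<close> over the group ring \<open>K[G]\<close> contains a unit.

 Let \<open>p\<close> divide \<open>r\<close> and \<open>\<zeta>\<close> be a root of unity of order \<open>r\<close>. Choose \<open>y\<close> in a submodule such that the group \<open>H\<close>
 of all automorphisms multiplying \<open>y\<close> by a power of \<open>\<zeta>\<close> is as large as possible. Lagrange resolvents show that \<open>G/H\<close> is cyclic and,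
 since the powers \<open>1, s, ..., s ^ (p ^ t - 1)\<close> of a root of unity \<open>s\<close> of order \<open>p ^ t * r\<close> are independent over \<open>K\<close>, that the
 submodule contains \<open>y\<close> times the fixed field of \<open>H\<close>. So a unit exists if \<open>y\<close> has the value of an element of that field,
 which is what unit root Kummer extensions provide.

 If \<open>r = 1\<close>, a unit always exists: in characteristic \<open>p\<close> a submodule has nonzero fixed vectors, and in characteristic 0 one
 adjoins a root of unity of order \<open>p\<close>, whose degree is prime to \<open>p\<close>, and descends by the trace. The valuation is
 extended by Chevalley's theorem, and completeness makes the extension invariant under automorphisms.\<close>

section \<open>Linear algebra over subfields\<close>

text \<open>The exception at 2 comes from the residues congruent to 1 modulo \<open>r\<close>.
  Modulo \<open>r * p ^ t\<close> they are generated by any \<open>1 + r * u\<close> with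
  \<open>p\<close> not dividing \<open>u\<close>, except for \<open>p = 2\<close>,
  \<open>r = 2\<close> and \<open>t\<close> at least 2: the odd residues modulo 8 are not cyclic.
  This is why 8 occurs in the theorem. The congruence in \<open>VC\<close> singles out, up to
  factors from \<open>K\<close>, the largest value at which traces cease to be integral. Multiplied
  by a unit, an element of this class still has nonzero trace, so it cannot be orthogonal to a
  submodule containing a unit. The criterion speaks of degree exactly \<open>r\<close> because an
  automorphism that multiplies \<open>y\<close> by \<open>\<zeta> [^] a\<close> with
  \<open>a\<close> prime to \<open>p\<close> already produces all powers of \<open>\<zeta>\<close>.
  When every exponent is divisible by \<open>p\<close>, the vector \<open>y\<close> is multiplied by
  an auxiliary one. If \<open>K\<close> has no root of unity of order \<open>p\<close>, Kummer
  theory starts only after adjoining one. An automorphism moving it then plays the part of the unit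
  root hypothesis, and the trace back to \<open>L\<close> keeps a unit because it maps 1 to a degree
  prime to \<open>p\<close>.\<close>

lemma (in field) subfield_closed:
 assumes "subfield K R"
 shows "K \<subseteq> carrier R" "!!x. x : K ==> x : carrier R" "\<zero> : K" "\<one> : K" "!!x y. x : K ==> y : K ==> x \<oplus> y : K" "!!x y. x : K ==> y : K ==> x \<otimes> y : K"
  "!!x. x : K ==> \<ominus> x : K" "!!x y. x : K ==> y : K ==> x \<ominus> y : K" "!!x. x : K ==> x ~= \<zero> ==> inv x : K" "!!x (i::nat). x : K ==> x [^] i : K"
proof -
 note S = subringE[OF subfieldE(1)[OF assms]]
 show "K \<subseteq> carrier R" "!!x. x : K ==> x : carrier R" "\<zero> : K" "\<one> : K" "!!x y. x : K ==> y : K ==> x \<oplus> y : K" "!!x y. x : K ==> y : K ==> x \<otimes> y : K"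
  "!!x. x : K ==> \<ominus> x : K" "!!x y. x : K ==> y : K ==> x \<ominus> y : K" using S by (auto simp: a_minus_def)
 show "!!x. x : K ==> x ~= \<zero> ==> inv x : K" using subfield_m_inv(1)[OF assms] by simp
 show "x [^] i : K" if "x : K" for x and i :: nat by (induct i) (use S that in auto)
qed

lemma (in field) subfield_finsum_closed:
 assumes "subfield K R" "!!i. i : I ==> f i : K"
 shows "(\<Oplus>i\<in>I. f i) : K"
proof (cases "finite I")
 case True
 thus ?thesis using assms(2)
 proof (induct I)
  case empty thus ?case using subfield_closed[OF assms(1)] by simp
 next
  case (insert i I)
  have "f : I \<rightarrow> carrier R" "f i : carrier R" using insert subfield_closed(2)[OF assms(1)] by auto
  thus ?case using insert subfield_closed(5)[OF assms(1)] by simp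
 qed
qed (use subfield_closed[OF assms(1)] in \<open>simp add: finsum_infinite\<close>)

lemma (in field) inv_closed [simp]: "x : carrier R ==> x ~= \<zero> ==> inv x : carrier R" using field_Units by auto

lemma (in field) inv_nonzero [simp]: "x : carrier R ==> x ~= \<zero> ==> inv x ~= \<zero>" using field_Units Units_inv_Units by auto

lemma (in field) field_inv [simp]: "x : carrier R ==> x ~= \<zero> ==> x \<otimes> inv x = \<one>" "x : carrier R ==> x ~= \<zero> ==> inv x \<otimes> x = \<one>" using field_Units by auto

lemma (in field) field_inv_cancel:
 assumes "x : carrier R" "x ~= \<zero>" "y : carrier R"
 shows "x \<otimes> (inv x \<otimes> y) = y" "inv x \<otimes> (x \<otimes> y) = y" using assms by (simp_all flip: m_assoc)

lemma (in field) field_inv_mult: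
 assumes "x : carrier R" "y : carrier R" "x ~= \<zero>" "y ~= \<zero>"
 shows "inv (x \<otimes> y) = inv x \<otimes> inv y"
proof (rule comm_inv_char)
 show "x \<otimes> y \<otimes> (inv x \<otimes> inv y) = \<one>"
 proof -
  have "x \<otimes> y \<otimes> (inv x \<otimes> inv y) = (x \<otimes> inv x) \<otimes> (y \<otimes> inv y)" using assms inv_closed[OF assms(1,3)] inv_closed[OF assms(2,4)] by algebra
  thus ?thesis using assms by simp
 qed
qed (use assms in auto)

lemma (in field) field_inv_inv: "x : carrier R ==> x ~= \<zero> ==> inv (inv x) = x" using field_Units by auto

lemma (in field) pow_nonzero: "x : carrier R ==> x ~= \<zero> ==> x [^] (i::nat) ~= \<zero>" by (induct i) (auto simp: integral_iff)

text \<open>Gaussian elimination, one equation at a time. The solution is sought in the subfield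
  \<open>K\<close> itself, as the orthogonality argument for the trace form requires; with
  \<open>K\<close> the whole field the lemma yields the bounds of Dedekind and Artin.\<close>

lemma (in field) linear_system_solution:
 assumes K: "subfield K R" and "finite I" "finite J" "card I < card J" and "!!i j. i : I ==> j : J ==> A i j : K"
 obtains y where "!!j. j : J ==> y j : K" "\<exists>j\<in>J. y j ~= \<zero>" "!!i. i : I ==> (\<Oplus>j\<in>J. A i j \<otimes> y j) = \<zero>"
proof -
 note Kc = subfield_closed[OF K]
 have "\<exists>y. (\<forall>j\<in>J. y j : K) \<and> (\<exists>j\<in>J. y j ~= \<zero>) \<and> (\<forall>i\<in>I. (\<Oplus>j\<in>J. A i j \<otimes> y j) = \<zero>)" using assms(2-)
 proof (induction I arbitrary: J A rule: finite_induct)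
  case empty
  hence "J ~= {}" by auto
  thus ?case using Kc by (intro exI[of _ "\<lambda>_. \<one>"]) auto
 next
  case (insert i0 I)
  show ?case
  proof (cases "\<forall>j\<in>J. A i0 j = \<zero>")
   case True
   obtain y where y: "\<forall>j\<in>J. y j : K" "\<exists>j\<in>J. y j ~= \<zero>" "\<forall>i\<in>I. (\<Oplus>j\<in>J. A i j \<otimes> y j) = \<zero>"
    using insert.IH[of J A] insert.prems insert.hyps by auto
   have "(\<Oplus>j\<in>J. A i0 j \<otimes> y j) = (\<Oplus>j\<in>J. \<zero>)" using True y(1) Kc by (intro finsum_cong') auto
   thus ?thesis using y by auto
  next
   case False
   then obtain j0 where j0: "j0 : J" "A i0 j0 ~= \<zero>" by auto
   define J' where "J' = J - {j0}"
   have J: "J = insert j0 J'" "j0 \<notin> J'" "finite J'" using j0 insert.prems J'_def by auto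
   define a where "a = inv (A i0 j0)"
   have AK: "A i j : K" if "i : insert i0 I" "j : J" for i j using insert.prems that by auto
   have aK: "a : K" using j0 AK Kc by (auto simp: a_def)
   \<comment> \<open>Adding \<open>c i\<close> times row \<open>i0\<close> to row \<open>i\<close>
     clears the pivot column \<open>j0\<close>.\<close>
   define c where "c = (\<lambda>i. \<ominus> (A i j0 \<otimes> a))"
   have cK: "c i : K" if "i : insert i0 I" for i using that aK AK j0 Kc by (auto simp: c_def)
   have card: "card I < card J'" using insert.prems insert.hyps J by auto
   obtain y' where y': "\<forall>j\<in>J'. y' j : K" "\<exists>j\<in>J'. y' j ~= \<zero>" "\<forall>i\<in>I. (\<Oplus>j\<in>J'. (A i j \<oplus> c i \<otimes> A i0 j) \<otimes> y' j) = \<zero>"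
    using insert.IH[of J' "\<lambda>i j. A i j \<oplus> c i \<otimes> A i0 j"] card J AK cK Kc by auto
   define s where "s = (\<lambda>i. \<Oplus>j\<in>J'. A i j \<otimes> y' j)"
   have sc: "s i : carrier R" if "i : insert i0 I" for i unfolding s_def using AK J y'(1) Kc that by simp
   \<comment> \<open>Row \<open>i0\<close> forces the value at the pivot; \<open>s i0\<close> is the
     contribution of the other unknowns.\<close>
   define y where "y = y'(j0 := \<ominus> (a \<otimes> s i0))"
   have sK: "s i0 : K" unfolding s_def using AK J y'(1) Kc by (intro subfield_finsum_closed[OF K]) auto
   have ycl: "\<forall>j\<in>J. y j : K" using y'(1) aK sK Kc J by (auto simp: y_def)
   have sum: "(\<Oplus>j\<in>J. A i j \<otimes> y j) = \<ominus> (A i j0 \<otimes> (a \<otimes> s i0)) \<oplus> s i" if i: "i : insert i0 I" for i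
   proof -
    have "(\<Oplus>j\<in>J. A i j \<otimes> y j) = A i j0 \<otimes> y j0 \<oplus> (\<Oplus>j\<in>J'. A i j \<otimes> y j)" using J i AK ycl Kc by simp
    also have "(\<Oplus>j\<in>J'. A i j \<otimes> y j) = s i" unfolding s_def y_def using J i AK y' Kc by (intro finsum_cong') auto
    also have "A i j0 \<otimes> y j0 = \<ominus> (A i j0 \<otimes> (a \<otimes> s i0))" using AK[OF i] j0 aK sK Kc by (auto simp: y_def r_minus)
    finally show ?thesis .
   qed
   have "(\<Oplus>j\<in>J. A i j \<otimes> y j) = \<zero>" if i: "i : insert i0 I" for i
   proof (cases "i = i0")
    case True
    have "A i0 j0 \<otimes> (a \<otimes> s i0) = s i0" using sc[of i0] AK[of i0 j0] j0 Kc by (simp add: a_def field_inv_cancel)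
    thus ?thesis using sum[OF i] sc[OF i] True by (simp add: l_neg)
   next
    case False
    hence iI: "i : I" using i by auto
    have "\<zero> = (\<Oplus>j\<in>J'. (A i j \<oplus> c i \<otimes> A i0 j) \<otimes> y' j)" using y'(3) iI by auto
    also have "\<dots> = (\<Oplus>j\<in>J'. A i j \<otimes> y' j \<oplus> c i \<otimes> (A i0 j \<otimes> y' j))"
    proof (intro finsum_cong' refl)
     fix j assume "j : J'"
     hence "A i j : carrier R" "A i0 j : carrier R" "y' j : carrier R" "c i : carrier R" using AK i J y'(1) Kc cK by auto
     thus "(A i j \<oplus> c i \<otimes> A i0 j) \<otimes> y' j = A i j \<otimes> y' j \<oplus> c i \<otimes> (A i0 j \<otimes> y' j)" by algebra
    qed (use AK i J y'(1) Kc cK in auto)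
    also have "\<dots> = s i \<oplus> (\<Oplus>j\<in>J'. c i \<otimes> (A i0 j \<otimes> y' j))" unfolding s_def using AK i J y'(1) Kc cK by simp
    also have "(\<Oplus>j\<in>J'. c i \<otimes> (A i0 j \<otimes> y' j)) = c i \<otimes> s i0"
     unfolding s_def using AK i J y'(1) Kc cK by (intro finsum_rdistr[symmetric]) auto
    finally have "s i \<oplus> c i \<otimes> s i0 = \<zero>" by simp
    moreover have "c i \<otimes> s i0 = \<ominus> (A i j0 \<otimes> (a \<otimes> s i0))" using AK[OF i] j0 aK sK Kc by (auto simp: c_def l_minus m_assoc)
    ultimately show ?thesis using sum[OF i] sc[OF i] AK[OF i j0(1)] aK sK Kc by (simp add: a_comm)
   qed
   moreover have "\<exists>j\<in>J. y j ~= \<zero>" using y'(2) J by (auto simp: y_def)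
   ultimately show ?thesis using ycl by auto
  qed
 qed
 thus ?thesis using that by auto
qed

text \<open>Dedekind's independence of characters. To remove \<open>h\<close> from a relation,
  evaluate it at \<open>f x y\<close> and subtract \<open>h y\<close> times its value at
  \<open>x\<close>: the term of \<open>h\<close> cancels, and that of \<open>g\<close> acquires the
  factor \<open>g y \<ominus> h y\<close>.\<close>

lemma (in field) characters_independent:
 assumes "finite S" and "!!g x. g : S ==> x : F ==> g x : carrier R" and "!!x y. x : F ==> y : F ==> f x y : F"
  and "!!g x y. g : S ==> x : F ==> y : F ==> g (f x y) = g x \<otimes> g y" and "!!g. g : S ==> \<exists>x\<in>F. g x ~= \<zero>"
  and "!!g h. g : S ==> h : S ==> g ~= h ==> \<exists>x\<in>F. g x ~= h x" and "!!g. g : S ==> a g : carrier R" and "!!x. x : F ==> (\<Oplus>g\<in>S. a g \<otimes> g x) = \<zero>" and "g : S"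
 shows "a g = \<zero>" using assms(1,2,4-)
proof (induction S arbitrary: a g rule: finite_induct)
 case (insert h S)
 have cl: "!!g x. g : insert h S ==> x : F ==> g x : carrier R" "!!g. g : insert h S ==> a g : carrier R" using insert.prems by auto
 have S0: "a g = \<zero>" if g: "g : S" for g
 proof -
  obtain y where y: "y : F" "g y ~= h y" using insert.prems(4)[of g h] insert.hyps g by auto
  have "(\<Oplus>g\<in>S. (a g \<otimes> (g y \<ominus> h y)) \<otimes> g x) = \<zero>" if x: "x : F" for x
  proof -
   let ?b = "\<lambda>g. a g \<otimes> g (f x y)" and ?c = "\<lambda>g. \<ominus> h y \<otimes> (a g \<otimes> g x)"
   have xy: "f x y : F" using assms(3) x y by auto
   have s1: "(\<Oplus>g\<in>insert h S. ?b g) = \<zero>" using insert.prems(6)[OF xy] .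
   have s2: "(\<Oplus>g\<in>insert h S. ?c g) = \<zero>" by (auto simp: cl x y insert.hyps finsum_rdistr[symmetric] insert.prems(6)[OF x] insert.prems)
   have "\<zero> = (\<Oplus>g\<in>insert h S. ?b g \<oplus> ?c g)" using s1 s2 cl x y xy by simp
   also have "\<dots> = (\<Oplus>g\<in>insert h S. (a g \<otimes> (g y \<ominus> h y)) \<otimes> g x)"
   proof (intro finsum_cong' refl)
    fix g assume g: "g : insert h S"
    have "a g : carrier R" "g x : carrier R" "g y : carrier R" "h y : carrier R" using g cl x y by auto
    moreover have "g (f x y) = g x \<otimes> g y" using insert.prems(2) g x y by auto
    ultimately show "?b g \<oplus> ?c g = (a g \<otimes> (g y \<ominus> h y)) \<otimes> g x" by (simp, algebra)
   qed (use cl x y in auto)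
   also have "\<dots> = (a h \<otimes> (h y \<ominus> h y)) \<otimes> h x \<oplus> (\<Oplus>g\<in>S. (a g \<otimes> (g y \<ominus> h y)) \<otimes> g x)" using insert.hyps cl x y by simp
   also have "(a h \<otimes> (h y \<ominus> h y)) \<otimes> h x = \<zero>" using cl x y by (simp add: a_minus_def r_neg)
   finally show ?thesis using cl x y by simp
  qed
  hence "a g \<otimes> (g y \<ominus> h y) = \<zero>" using insert.IH[of "\<lambda>g. a g \<otimes> (g y \<ominus> h y)" g] insert.prems g y by simp
  thus ?thesis using y cl g by (auto simp: integral_iff)
 qed
 have h0: "a h = \<zero>"
 proof -
  obtain x where x: "x : F" "h x ~= \<zero>" using insert.prems(3) by auto
  have "\<zero> = (\<Oplus>g\<in>insert h S. a g \<otimes> g x)" using insert.prems(6)[OF x(1)] by simp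
  also have "\<dots> = a h \<otimes> h x \<oplus> (\<Oplus>g\<in>S. a g \<otimes> g x)" using insert.hyps cl x by simp
  also have "(\<Oplus>g\<in>S. a g \<otimes> g x) = (\<Oplus>g\<in>S. \<zero>)" using S0 cl x by (intro finsum_cong') auto
  finally have "a h \<otimes> h x = \<zero>" using x cl by simp
  thus ?thesis using x cl integral_iff by simp
 qed
 show ?case using S0 h0 insert.prems by auto
qed simp

text \<open>The bridge from list-based linear combinations to finite sums, which can be reindexed
  and interchanged.\<close>

lemma (in field) combine_map:
 assumes "!!i. i < n ==> u i : carrier R" "!!i. i < n ==> c i : carrier R"
 shows "combine (map c [0..<n]) (map u [0..<n]) = (\<Oplus>i\<in>{..<n}. c i \<otimes> u i)" using assms
proof (induct n arbitrary: u c)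
 case (Suc n)
 have ran: "[0..<Suc n] = 0 # map Suc [0..<n]" by (subst upt_conv_Cons) (simp_all add: map_Suc_upt del: upt_Suc)
 have "combine (map c [0..<Suc n]) (map u [0..<Suc n]) = c 0 \<otimes> u 0 \<oplus> combine (map (c \<circ> Suc) [0..<n]) (map (u \<circ> Suc) [0..<n])"
  unfolding ran by simp
 also have "combine (map (c \<circ> Suc) [0..<n]) (map (u \<circ> Suc) [0..<n]) = (\<Oplus>i\<in>{..<n}. c (Suc i) \<otimes> u (Suc i))"
  using Suc(1)[of "u \<circ> Suc" "c \<circ> Suc"] Suc(2,3) by (simp add: comp_def)
 also have "\<dots> = (\<Oplus>i\<in>Suc ` {..<n}. c i \<otimes> u i)" using Suc(2,3) by (intro finsum_reindex[symmetric]) auto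
 also have "c 0 \<otimes> u 0 \<oplus> \<dots> = (\<Oplus>i\<in>insert 0 (Suc ` {..<n}). c i \<otimes> u i)" using Suc(2,3) by (intro finsum_insert[symmetric]) auto
 also have "insert 0 (Suc ` {..<n}) = {..<Suc n}" by (auto simp: less_Suc_eq_0_disj)
 finally show ?case .
qed simp

text \<open>Families instead of lists, so that the index set may be the Galois group itself and a
  repeated vector counts as a dependence.\<close>

definition (in ring) lin_indep :: "'a set \<Rightarrow> 'i set \<Rightarrow> ('i \<Rightarrow> 'a) \<Rightarrow> bool" where
 "lin_indep K J u \<longleftrightarrow> (\<forall>c. (\<forall>j\<in>J. c j : K) --> (\<Oplus>j\<in>J. c j \<otimes> u j) = \<zero> --> (\<forall>j\<in>J. c j = \<zero>))"

lemma (in field) lin_indep_imp_independent: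
 fixes n :: nat
 assumes K: "subfield K R" and u: "!!i. i < n ==> u i : carrier R" and li: "lin_indep K {..<n} u"
 shows "independent K (map u [0..<n])"
proof (rule trivial_combine_imp_independent[OF K])
 show "set (map u [0..<n]) \<subseteq> carrier R" using u by auto
 fix Ks assume Ks: "set Ks \<subseteq> K" "combine Ks (map u [0..<n]) = \<zero>"
 let ?U = "map u [0..<n]"
 have KR: "set Ks \<subseteq> carrier R" using Ks subfield_closed[OF K] by auto
 \<comment> \<open>A coefficient list may be longer or shorter than the list of vectors; normalizing
   truncates it or pads it with zeros.\<close>
 obtain Ks' where Ks': "set (take (length ?U) Ks) \<subseteq> set Ks'"
  "set Ks' \<subseteq> set (take (length ?U) Ks) \<union> {\<zero>}" "length Ks' = length ?U" "combine Ks' ?U = \<zero>"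
  using combine_normalize[OF KR _ Ks(2)] u by (metis (no_types, lifting) atLeastLessThan_iff image_subset_iff set_map set_upt)
 have K'K: "set Ks' \<subseteq> K" using Ks'(2) Ks(1) subfield_closed(3)[OF K] by (auto dest: in_set_takeD)
 have "Ks' = map (nth Ks') [0..<n]" using Ks'(3) by (metis length_map map_nth minus_nat.diff_0 length_upt)
 moreover have nK: "Ks' ! i : K" if "i < n" for i using K'K Ks'(3) that by auto
 ultimately have "(\<Oplus>i\<in>{..<n}. Ks' ! i \<otimes> u i) = \<zero>" using combine_map[of n u "nth Ks'"] Ks'(4) u subfield_closed(2)[OF K] by simp
 hence "\<forall>i\<in>{..<n}. Ks' ! i = \<zero>" using li[unfolded lin_indep_def] nK by simp
 hence "set Ks' \<subseteq> {\<zero>}" using Ks'(3) by (auto simp: in_set_conv_nth)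
 thus "set (take (length ?U) Ks) \<subseteq> {\<zero>}" using Ks'(1) by auto
qed

lemma (in field) Span_map:
 fixes n :: nat
 assumes K: "subfield K R" and u: "!!i. i < n ==> u i : carrier R"
 shows "x : Span K (map u [0..<n]) \<longleftrightarrow> (\<exists>c. (\<forall>i<n. c i : K) \<and> x = (\<Oplus>i\<in>{..<n}. c i \<otimes> u i))"
proof -
 have U: "set (map u [0..<n]) \<subseteq> carrier R" using u by auto
 have cm: "combine (map c [0..<n]) (map u [0..<n]) = (\<Oplus>i\<in>{..<n}. c i \<otimes> u i)" if "\<forall>i<n. c i : K" for c
  using that u subfield_closed[OF K] by (intro combine_map) auto
 show ?thesis
 proof
  assume "x : Span K (map u [0..<n])"
  then obtain Ks where Ks: "set Ks \<subseteq> K" "length Ks = n" "x = combine Ks (map u [0..<n])" using Span_mem_iff_length_version[OF K U] by auto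
  have "Ks = map (nth Ks) [0..<n]" using Ks(2) by (metis map_nth)
  moreover have "\<forall>i<n. Ks ! i : K" using Ks by auto
  ultimately show "\<exists>c. (\<forall>i<n. c i : K) \<and> x = (\<Oplus>i\<in>{..<n}. c i \<otimes> u i)" using cm[of "nth Ks"] Ks(3) by auto
 next
  assume "\<exists>c. (\<forall>i<n. c i : K) \<and> x = (\<Oplus>i\<in>{..<n}. c i \<otimes> u i)"
  then obtain c where c: "\<forall>i<n. c i : K" "x = (\<Oplus>i\<in>{..<n}. c i \<otimes> u i)" by auto
  show "x : Span K (map u [0..<n])" unfolding Span_mem_iff_length_version[OF K U] by (rule exI[of _ "map c [0..<n]"]) (use c cm in auto)
 qed
qed

lemma (in field) independent_imp_lin_indep:
 fixes n :: nat
 assumes K: "subfield K R" and u: "!!i. i < n ==> u i : carrier R" and ind: "independent K (map u [0..<n])"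
 shows "lin_indep K {..<n} u" unfolding lin_indep_def
proof (intro allI impI)
 fix c assume c: "\<forall>j\<in>{..<n}. c j : K" "(\<Oplus>j\<in>{..<n}. c j \<otimes> u j) = \<zero>"
 have "combine (map c [0..<n]) (map u [0..<n]) = \<zero>" using c u subfield_closed(2)[OF K] by (subst combine_map) auto
 moreover have "set (map c [0..<n]) \<subseteq> K" using c by auto
 ultimately have "set (take (length (map u [0..<n])) (map c [0..<n])) \<subseteq> {\<zero>}" using independent_imp_trivial_combine[OF K ind] by blast
 thus "\<forall>j\<in>{..<n}. c j = \<zero>" by (simp add: image_subset_iff)
qed

lemma (in field) lin_indep_reindex:
 assumes h: "bij_betw h I J" and u: "!!j. j : J ==> u j : carrier R" and K: "K \<subseteq> carrier R"
 shows "lin_indep K I (u \<circ> h) \<longleftrightarrow> lin_indep K J u"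
proof
 assume li: "lin_indep K I (u \<circ> h)"
 show "lin_indep K J u" unfolding lin_indep_def
 proof (intro allI impI)
  fix c assume c: "\<forall>j\<in>J. c j : K" "(\<Oplus>j\<in>J. c j \<otimes> u j) = \<zero>"
  have "(\<Oplus>i\<in>I. (c \<circ> h) i \<otimes> (u \<circ> h) i) = (\<Oplus>j\<in>h ` I. c j \<otimes> u j)"
   using h u K c unfolding bij_betw_def by (subst finsum_reindex) (auto simp: subset_iff)
  hence "(\<Oplus>i\<in>I. (c \<circ> h) i \<otimes> (u \<circ> h) i) = \<zero>" using c h by (simp add: bij_betw_def)
  moreover have "\<forall>i\<in>I. (c \<circ> h) i : K" using c h by (auto simp: bij_betw_def)
  ultimately have "\<forall>i\<in>I. (c \<circ> h) i = \<zero>" using li[unfolded lin_indep_def] by auto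
  thus "\<forall>j\<in>J. c j = \<zero>" using h by (auto simp: bij_betw_def)
 qed
next
 assume li: "lin_indep K J u"
 show "lin_indep K I (u \<circ> h)" unfolding lin_indep_def
 proof (intro allI impI)
  fix c assume c: "\<forall>j\<in>I. c j : K" "(\<Oplus>j\<in>I. c j \<otimes> (u \<circ> h) j) = \<zero>"
  let ?d = "c \<circ> inv_into I h"
  have "(\<Oplus>j\<in>h ` I. ?d j \<otimes> u j) = (\<Oplus>i\<in>I. ?d (h i) \<otimes> u (h i))" using h u K c unfolding bij_betw_def by (intro finsum_reindex) auto
  also have "\<dots> = (\<Oplus>j\<in>I. c j \<otimes> (u \<circ> h) j)" using u K c h unfolding bij_betw_def by (intro finsum_cong') auto
  finally have "(\<Oplus>j\<in>J. ?d j \<otimes> u j) = \<zero>" using c h by (simp add: bij_betw_def)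
  moreover have "\<forall>j\<in>J. ?d j : K" using c h by (auto simp: bij_betw_def)
  ultimately have "\<forall>j\<in>J. ?d j = \<zero>" using li[unfolded lin_indep_def] by auto
  thus "\<forall>j\<in>I. c j = \<zero>" using h by (auto simp: bij_betw_def)
 qed
qed

lemma (in field) lin_indep_card_le_dimension:
 assumes K: "subfield K R" and "dimension n K E" "finite J" "lin_indep K J u" "!!j. j : J ==> u j : E"
 shows "card J \<le> n"
proof -
 have E: "E \<subseteq> carrier R" using space_subgroup_props(1)[OF K assms(2)] .
 obtain h where h: "bij_betw h {..<card J} J" using ex_bij_betw_nat_finite[OF assms(3)] by (auto simp: lessThan_atLeast0)
 have uc: "(u \<circ> h) i : E" if "i < card J" for i using h that assms(5) by (auto simp: bij_betw_def)
 have "lin_indep K {..<card J} (u \<circ> h)" using lin_indep_reindex[OF h, of u K] assms(4,5) E subfield_closed(1)[OF K] by auto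
 hence "independent K (map (u \<circ> h) [0..<card J])" using lin_indep_imp_independent[OF K] uc E by blast
 thus ?thesis using independent_length_le_dimension[OF K assms(2)] uc by fastforce
qed

lemma (in field) lin_indep_spans:
 assumes K: "subfield K R" and dim: "dimension n K E" and "finite J" "card J = n" "lin_indep K J u" "!!j. j : J ==> u j : E" "x : E"
 obtains c where "!!j. j : J ==> c j : K" "x = (\<Oplus>j\<in>J. c j \<otimes> u j)"
proof -
 have E: "E \<subseteq> carrier R" using space_subgroup_props(1)[OF K dim] .
 obtain h where h: "bij_betw h {..<n} J" using ex_bij_betw_nat_finite[OF assms(3)] assms(4) by (auto simp: lessThan_atLeast0)
 have uc: "(u \<circ> h) i : E" if "i < n" for i using h that assms(6) by (auto simp: bij_betw_def)
 have "lin_indep K {..<n} (u \<circ> h)" using lin_indep_reindex[OF h, of u K] assms E by auto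
 hence "independent K (map (u \<circ> h) [0..<n])" using lin_indep_imp_independent[OF K] uc E by blast
 hence "Span K (map (u \<circ> h) [0..<n]) = E" using independent_length_eq_dimension[OF K dim, of "map (u \<circ> h) [0..<n]"] uc by fastforce
 then obtain c where c: "\<forall>i<n. c i : K" "x = (\<Oplus>i\<in>{..<n}. c i \<otimes> (u \<circ> h) i)" using Span_map[OF K, of n "u \<circ> h" x] uc E assms(7) by auto
 let ?d = "c \<circ> inv_into {..<n} h"
 have dh: "?d (h i) = c i" if "i < n" for i using h that by (simp add: bij_betw_def)
 have "(\<Oplus>j\<in>h ` {..<n}. ?d j \<otimes> u j) = (\<Oplus>i\<in>{..<n}. ?d (h i) \<otimes> u (h i))"
  using h uc E c subfield_closed(2)[OF K] unfolding bij_betw_def by (intro finsum_reindex) (auto simp: subset_iff)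
 also have "\<dots> = x" unfolding c(2) using dh uc E c subfield_closed(2)[OF K] by (intro finsum_cong') (auto simp: subset_iff)
 finally have "x = (\<Oplus>j\<in>J. ?d j \<otimes> u j)" using h by (simp add: bij_betw_def)
 moreover have "?d j : K" if "j : J" for j using c h that by (auto simp: bij_betw_def)
 ultimately show ?thesis using that by blast
qed

lemma (in field) dimension_basis:
 assumes K: "subfield K R" and dim: "dimension n K E"
 obtains u where "!!i. i < n ==> u i : E" "lin_indep K {..<n} u"
proof -
 obtain Vs where Vs: "set Vs \<subseteq> carrier R" "independent K Vs" "length Vs = n" "Span K Vs = E" using exists_base[OF K dim] by auto
 have eq: "Vs = map (nth Vs) [0..<n]" using Vs(3) by (metis map_nth)
 have "lin_indep K {..<n} (nth Vs)" using independent_imp_lin_indep[OF K, of n "nth Vs"] Vs eq by (metis nth_mem subsetD)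
 moreover have "Vs ! i : E" if "i < n" for i using Span_base_incl[OF K Vs(1)] Vs that by auto
 ultimately show ?thesis using that by auto
qed

section \<open>Finite groups of field automorphisms\<close>

definition fixed_field :: "('a, 'b) ring_scheme \<Rightarrow> ('a \<Rightarrow> 'a) set \<Rightarrow> 'a set" where "fixed_field R G = {x : carrier R. \<forall>g\<in>G. g x = x}"

lemma (in ring) additive_finsum:
 assumes "!!x y. x : carrier R ==> y : carrier R ==> F (x \<oplus> y) = F x \<oplus> F y" and "!!x. x : carrier R ==> F x : carrier R"
  and "finite I" "!!i. i : I ==> f i : carrier R"
 shows "F (\<Oplus>i\<in>I. f i) = (\<Oplus>i\<in>I. F (f i))" using assms(3,4)
proof (induction I)
 case empty
 have "F \<zero> \<oplus> F \<zero> = F \<zero> \<oplus> \<zero>" using assms(1)[of \<zero> \<zero>] assms(2)[of \<zero>] by simp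
 thus ?case using assms(2)[of \<zero>] by simp
next
 case (insert i I)
 thus ?case using assms(1,2) by simp
qed

lemma (in ring) finsum_swap:
 assumes "finite I" "finite J" "!!i j. i : I ==> j : J ==> f i j : carrier R"
 shows "(\<Oplus>i\<in>I. \<Oplus>j\<in>J. f i j) = (\<Oplus>j\<in>J. \<Oplus>i\<in>I. f i j)" using assms(1,3)
proof (induction I)
 case (insert i I)
 have "(\<Oplus>i\<in>insert i I. \<Oplus>j\<in>J. f i j) = (\<Oplus>j\<in>J. f i j) \<oplus> (\<Oplus>i\<in>I. \<Oplus>j\<in>J. f i j)" using insert by simp
 also have "(\<Oplus>i\<in>I. \<Oplus>j\<in>J. f i j) = (\<Oplus>j\<in>J. \<Oplus>i\<in>I. f i j)" using insert by auto
 also have "(\<Oplus>j\<in>J. f i j) \<oplus> \<dots> = (\<Oplus>j\<in>J. f i j \<oplus> (\<Oplus>i\<in>I. f i j))" using insert by simp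
 also have "\<dots> = (\<Oplus>j\<in>J. \<Oplus>i\<in>insert i I. f i j)"
 proof (intro finsum_cong' refl)
  fix j assume j: "j : J"
  show "f i j \<oplus> (\<Oplus>i\<in>I. f i j) = (\<Oplus>i\<in>insert i I. f i j)" using insert j by simp
 qed (use insert in \<open>auto intro!: finsum_closed\<close>)
 finally show ?case .
qed (use assms(2) in simp)

text \<open>Inverses are derived: a field endomorphism is injective, so composing with it permutes
  the finite set \<open>G\<close> and reaches the identity.\<close>

locale aut_group = field R for R (structure) + fixes G :: "('a \<Rightarrow> 'a) set"
 assumes finite_G: "finite G" and aut_hom: "g : G ==> g : ring_hom R R" and aut_ext: "g : G ==> g : extensional (carrier R)"
  and aut_id: "(\<lambda>x\<in>carrier R. x) : G" and aut_comp: "[|g : G; h : G|] ==> compose (carrier R) g h : G"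
begin

lemma aut_closed [simp]: "[|g : G; x : carrier R|] ==> g x : carrier R" using aut_hom ring_hom_closed by metis

lemma aut_add: "[|g : G; x : carrier R; y : carrier R|] ==> g (x \<oplus> y) = g x \<oplus> g y" using aut_hom ring_hom_add by metis

lemma aut_mult: "[|g : G; x : carrier R; y : carrier R|] ==> g (x \<otimes> y) = g x \<otimes> g y" using aut_hom ring_hom_mult by metis

lemma aut_one [simp]: "g : G ==> g \<one> = \<one>" using aut_hom ring_hom_one by auto

lemma aut_zero [simp]: "g : G ==> g \<zero> = \<zero>" using aut_hom ring_hom_zero ring_axioms by auto

lemma aut_uminus: assumes "g : G" "x : carrier R" shows "g (\<ominus> x) = \<ominus> g x"
proof -
 have "g (\<ominus> x) \<oplus> g x = \<zero>" using assms aut_add[of g "\<ominus> x" x] by (simp add: l_neg)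
 thus ?thesis using assms by (simp add: minus_equality)
qed

lemma aut_minus: "[|g : G; x : carrier R; y : carrier R|] ==> g (x \<ominus> y) = g x \<ominus> g y" by (simp add: a_minus_def aut_add aut_uminus)

lemma aut_pow: "[|g : G; x : carrier R|] ==> g (x [^] (i::nat)) = g x [^] i" by (induct i) (auto simp: aut_mult)

lemma aut_nonzero: assumes "g : G" "x : carrier R" "x ~= \<zero>" shows "g x ~= \<zero>"
proof
 assume "g x = \<zero>"
 hence "g (x \<otimes> inv x) = \<zero>" using assms by (subst aut_mult) auto
 thus False using assms by simp
qed

lemma aut_inv: assumes "g : G" "x : carrier R" "x ~= \<zero>" shows "g (inv x) = inv (g x)"
proof -
 have "g x \<otimes> g (inv x) = \<one>" using assms by (simp flip: aut_mult)
 thus ?thesis using assms by (metis aut_closed comm_inv_char inv_closed)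
qed

lemma aut_inj: "g : G ==> inj_on g (carrier R)"
proof (rule inj_onI)
 fix x y assume g: "g : G" and xy: "x : carrier R" "y : carrier R" "g x = g y"
 hence "g (x \<ominus> y) = \<zero>" by (simp add: aut_minus)
 thus "x = y" using aut_nonzero[OF g, of "x \<ominus> y"] xy by auto
qed

lemma aut_eqI: "[|g : G; h : G; !!x. x : carrier R ==> g x = h x|] ==> g = h" using aut_ext extensionalityI by metis

lemma aut_finsum:
 assumes "g : G" "finite I" "!!i. i : I ==> f i : carrier R"
 shows "g (\<Oplus>i\<in>I. f i) = (\<Oplus>i\<in>I. g (f i))" using assms aut_add by (intro additive_finsum) auto

lemma compose_bij: assumes "g : G" shows "bij_betw (compose (carrier R) g) G G"
proof -
 have "inj_on (compose (carrier R) g) G"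
 proof (rule inj_onI)
  fix h k assume hk: "h : G" "k : G" "compose (carrier R) g h = compose (carrier R) g k"
  show "h = k"
  proof (rule aut_eqI[OF hk(1,2)])
   fix x assume "x : carrier R"
   hence "g (h x) = g (k x)" using fun_cong[OF hk(3), of x] by (simp add: compose_def)
   thus "h x = k x" using aut_inj[OF assms] hk \<open>x : carrier R\<close> by (simp add: inj_on_eq_iff)
  qed
 qed
 moreover have "compose (carrier R) g ` G \<subseteq> G" using aut_comp assms by auto
 ultimately show ?thesis using finite_G by (simp add: bij_betw_def endo_inj_surj)
qed

lemma aut_inverse:
 assumes "g : G"
 obtains h where "h : G" "!!x. x : carrier R ==> g (h x) = x" "!!x. x : carrier R ==> h (g x) = x"
proof -
 obtain h where h: "h : G" "compose (carrier R) g h = (\<lambda>x\<in>carrier R. x)"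
  using compose_bij[OF assms] aut_id unfolding bij_betw_def by (metis imageE)
 have gh: "g (h x) = x" if "x : carrier R" for x using fun_cong[OF h(2), of x] that by (simp add: compose_def)
 have "h (g x) = x" if x: "x : carrier R" for x
 proof -
  have "g (h (g x)) = g x" using gh assms x by simp
  thus ?thesis using aut_inj[OF assms] h(1) assms x by (simp add: inj_on_eq_iff)
 qed
 thus ?thesis using that h(1) gh by simp
qed

lemma aut_iso: assumes "g : G" shows "g : ring_iso R R"
proof -
 obtain h where h: "h : G" "!!x. x : carrier R ==> g (h x) = x" using aut_inverse[OF assms] by metis
 have "g ` carrier R = carrier R"
 proof
  show "carrier R \<subseteq> g ` carrier R" using h aut_closed by (metis image_eqI subsetI)
 qed (use assms in auto)
 thus ?thesis using aut_inj[OF assms] aut_hom[OF assms] by (simp add: ring_iso_def bij_betw_def)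
qed

lemma sum_compose:
 assumes "g : G" "!!h. h : G ==> f h : carrier R"
 shows "(\<Oplus>h\<in>G. f (compose (carrier R) g h)) = (\<Oplus>h\<in>G. f h)"
proof -
 have b: "inj_on (compose (carrier R) g) G" "compose (carrier R) g ` G = G" using compose_bij[OF assms(1)] by (auto simp: bij_betw_def)
 show ?thesis using finsum_reindex[OF _ b(1), of f] b(2) assms(2) by simp
qed

abbreviation K where "K \<equiv> fixed_field R G"

lemma fixed_subfield: "subfield K R"
proof (rule subfieldI')
 show "subring K R"
 proof (rule subringI)
  show "!!h. h : K ==> \<ominus> h : K" by (auto simp: fixed_field_def aut_uminus)
  show "x \<otimes> y : K" "x \<oplus> y : K" if "x : K" "y : K" for x y
  proof -
   have "x : carrier R" "y : carrier R" "!!g. g : G ==> g x = x" "!!g. g : G ==> g y = y" using that by (auto simp: fixed_field_def)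
   thus "x \<otimes> y : K" "x \<oplus> y : K" by (simp_all add: fixed_field_def) (metis aut_mult, metis aut_add)
  qed
 qed (auto simp: fixed_field_def)
 show "!!k. k : K - {\<zero>} ==> inv k : K" by (auto simp: fixed_field_def aut_inv)
qed

lemmas Kc = subfield_closed[OF fixed_subfield]

lemma aut_fix: "[|g : G; x : K|] ==> g x = x" by (simp add: fixed_field_def)

definition tr where "tr x = (\<Oplus>g\<in>G. g x)"

lemma tr_closed [simp]: "x : carrier R ==> tr x : carrier R" unfolding tr_def by simp

lemma tr_fixed: assumes "x : carrier R" shows "tr x : K"
proof -
 have "g (tr x) = tr x" if g: "g : G" for g
 proof -
  have "g (tr x) = (\<Oplus>h\<in>G. g (h x))" unfolding tr_def using g assms finite_G by (intro aut_finsum) auto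
  also have "\<dots> = (\<Oplus>h\<in>G. compose (carrier R) g h x)" using assms g by (intro finsum_cong') (auto simp: compose_def)
  also have "\<dots> = tr x" unfolding tr_def using assms by (intro sum_compose[OF g]) auto
  finally show ?thesis .
 qed
 thus ?thesis using assms by (auto simp: fixed_field_def)
qed

lemma tr_add: "[|x : carrier R; y : carrier R|] ==> tr (x \<oplus> y) = tr x \<oplus> tr y"
proof -
 assume xy: "x : carrier R" "y : carrier R"
 have "tr (x \<oplus> y) = (\<Oplus>g\<in>G. g x \<oplus> g y)" unfolding tr_def using xy by (intro finsum_cong') (auto simp: aut_add)
 also have "\<dots> = tr x \<oplus> tr y" unfolding tr_def using xy by simp
 finally show ?thesis .
qed

lemma tr_smult: "[|c : K; x : carrier R|] ==> tr (c \<otimes> x) = c \<otimes> tr x"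
proof -
 assume cx: "c : K" "x : carrier R"
 have "tr (c \<otimes> x) = (\<Oplus>g\<in>G. c \<otimes> g x)" unfolding tr_def using cx Kc by (intro finsum_cong') (auto simp: aut_mult aut_fix)
 also have "\<dots> = c \<otimes> tr x" unfolding tr_def using cx Kc finite_G by (intro finsum_rdistr[symmetric]) auto
 finally show ?thesis .
qed

lemma tr_aut: assumes "g : G" "x : carrier R" shows "tr (g x) = tr x"
proof -
 obtain k where k: "k : G" "!!y. y : carrier R ==> g (k y) = y" "!!y. y : carrier R ==> k (g y) = y" using aut_inverse[OF assms(1)] by auto
 have inj: "inj_on (\<lambda>h. compose (carrier R) h g) G"
 proof (rule inj_onI)
  fix a b assume ab: "a : G" "b : G" "compose (carrier R) a g = compose (carrier R) b g"
  show "a = b"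
  proof (rule aut_eqI[OF ab(1,2)])
   fix x assume x: "x : carrier R"
   have "a (g (k x)) = b (g (k x))" using fun_cong[OF ab(3), of "k x"] x k by (simp add: compose_def)
   thus "a x = b x" using k x by simp
  qed
 qed
 have surj: "(\<lambda>h. compose (carrier R) h g) ` G = G" using inj aut_comp assms(1) finite_G by (intro endo_inj_surj) auto
 have "tr (g x) = (\<Oplus>h\<in>G. compose (carrier R) h g x)" unfolding tr_def using assms by (intro finsum_cong') (auto simp: compose_def)
 also have "\<dots> = (\<Oplus>h\<in>(\<lambda>h. compose (carrier R) h g) ` G. h x)" using assms surj by (intro finsum_reindex[symmetric, OF _ inj]) auto
 finally show ?thesis using surj by (simp add: tr_def)
qed

text \<open>A vanishing trace would be a relation among the distinct characters in \<open>G\<close>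
  with all coefficients 1, against Dedekind.\<close>

lemma tr_nonzero: obtains x where "x : carrier R" "tr x ~= \<zero>"
proof -
 have "\<exists>x\<in>carrier R. tr x ~= \<zero>"
 proof (rule ccontr)
  assume "\<not> ?thesis"
  hence *: "(\<Oplus>g\<in>G. \<one> \<otimes> g x) = \<zero>" if "x : carrier R" for x
   using that unfolding tr_def by (metis (no_types, lifting) Pi_I aut_closed finsum_cong' l_one)
  have "(\<lambda>_. \<one>) (\<lambda>x\<in>carrier R. x) = \<zero>"
  proof (rule characters_independent[of G "carrier R" "(\<otimes>)" "\<lambda>_. \<one>"])
   show "\<exists>x\<in>carrier R. g x ~= \<zero>" if "g : G" for g using aut_one[OF that] one_closed one_not_zero by metis
   show "\<exists>x\<in>carrier R. g x ~= h x" if "g : G" "h : G" "g ~= h" for g h using aut_eqI that by auto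
  qed (use finite_G aut_mult aut_id * in auto)
  thus False by simp
 qed
 thus ?thesis using that by auto
qed

end

text \<open>With more than \<open>d\<close> maps, the \<open>d\<close> equations saying that a
  combination of them vanishes on a basis have a nontrivial solution. By linearity over
  \<open>K\<close> the combination then vanishes on all of \<open>F\<close>, against
  Dedekind.\<close>

lemma (in field) card_homs_le_dimension:
 assumes K: "subfield K R" and F: "subfield F R" and dim: "dimension d K F" and S: "finite S"
  and cl: "!!g x. g : S ==> x : F ==> g x : carrier R" and add: "!!g x y. g : S ==> x : F ==> y : F ==> g (x \<oplus> y) = g x \<oplus> g y"
  and mult: "!!g x y. g : S ==> x : F ==> y : F ==> g (x \<otimes> y) = g x \<otimes> g y" and fx: "!!g x. g : S ==> x : K ==> g x = x"
  and dist: "!!g h. g : S ==> h : S ==> g ~= h ==> \<exists>x\<in>F. g x ~= h x"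
 shows "card S \<le> d"
proof (rule ccontr)
 assume "\<not> ?thesis"
 hence less: "d < card S" by simp
 note Fc = subfield_closed[OF F] and Kc = subfield_closed[OF K]
 have KF: "k : F" if "k : K" for k using space_subgroup_props(5)[OF K dim that Fc(4)] Kc that by simp
 obtain u where u: "!!i. i < d ==> u i : F" "lin_indep K {..<d} u" using dimension_basis[OF K dim] by auto
 obtain y where y: "!!g. g : S ==> y g : carrier R" "\<exists>g\<in>S. y g ~= \<zero>" "!!i. i : {..<d} ==> (\<Oplus>g\<in>S. g (u i) \<otimes> y g) = \<zero>"
  using linear_system_solution[OF carrier_is_subfield, of "{..<d}" S "\<lambda>i g. g (u i)"] S less cl u by auto
 have "(\<Oplus>g\<in>S. y g \<otimes> g x) = \<zero>" if x: "x : F" for x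
 proof -
  obtain c where c: "!!j. j : {..<d} ==> c j : K" "x = (\<Oplus>j\<in>{..<d}. c j \<otimes> u j)" using lin_indep_spans[OF K dim _ _ u(2) _ x] u(1) by auto
  have gx: "g x = (\<Oplus>j\<in>{..<d}. c j \<otimes> g (u j))" if g: "g : S" for g
  proof -
   interpret F: ring "R\<lparr>carrier := F\<rparr>" using subfieldE(1)[OF F] subring_is_ring by simp
   have "g (\<Oplus>j\<in>J. c j \<otimes> u j) = (\<Oplus>j\<in>J. c j \<otimes> g (u j)) \<and> (\<Oplus>j\<in>J. c j \<otimes> u j) : F" if "finite J" "J \<subseteq> {..<d}" for J using that
   proof (induct J)
    case empty
    have "g \<zero> \<oplus> g \<zero> = g \<zero> \<oplus> \<zero>" using add[OF g Fc(3) Fc(3)] cl[OF g Fc(3)] by simp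
    hence "g \<zero> = \<zero>" using cl[OF g Fc(3)] by simp
    thus ?case using Fc by simp
   next
    case (insert j J)
    have f: "c j : F" "u j : F" "c j : K" using insert c u KF by auto
    have "(\<Oplus>j\<in>insert j J. c j \<otimes> u j) = c j \<otimes> u j \<oplus> (\<Oplus>j\<in>J. c j \<otimes> u j)" using insert c u Fc Kc by (intro finsum_insert) auto
    moreover have "(\<Oplus>j\<in>insert j J. c j \<otimes> g (u j)) = c j \<otimes> g (u j) \<oplus> (\<Oplus>j\<in>J. c j \<otimes> g (u j))"
     using insert c u cl g Kc by (intro finsum_insert) auto
    ultimately show ?case using insert add[OF g] mult[OF g] fx[OF g] f Fc by auto
   qed
   thus ?thesis using c(2) by auto
  qed
  have "(\<Oplus>g\<in>S. y g \<otimes> g x) = (\<Oplus>g\<in>S. \<Oplus>j\<in>{..<d}. c j \<otimes> (g (u j) \<otimes> y g))"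
  proof (intro finsum_cong' refl)
   fix g assume g: "g : S"
   have "y g \<otimes> g x = (\<Oplus>j\<in>{..<d}. y g \<otimes> (c j \<otimes> g (u j)))" unfolding gx[OF g] using g y c u cl Kc by (intro finsum_rdistr) auto
   also have "\<dots> = (\<Oplus>j\<in>{..<d}. c j \<otimes> (g (u j) \<otimes> y g))" using g y c u cl Kc by (intro finsum_cong') (auto simp: m_ac)
   finally show "y g \<otimes> g x = (\<Oplus>j\<in>{..<d}. c j \<otimes> (g (u j) \<otimes> y g))" .
  qed (use y c u cl Kc in \<open>auto intro!: finsum_closed\<close>)
  also have "\<dots> = (\<Oplus>j\<in>{..<d}. \<Oplus>g\<in>S. c j \<otimes> (g (u j) \<otimes> y g))" using y c u cl Kc S by (intro finsum_swap) auto
  also have "\<dots> = (\<Oplus>j\<in>{..<d}. \<zero>)"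
  proof (intro finsum_cong' refl)
   fix j assume j: "j : {..<d}"
   have "(\<Oplus>g\<in>S. c j \<otimes> (g (u j) \<otimes> y g)) = c j \<otimes> (\<Oplus>g\<in>S. g (u j) \<otimes> y g)" using j y c u cl Kc S by (intro finsum_rdistr[symmetric]) auto
   thus "(\<Oplus>g\<in>S. c j \<otimes> (g (u j) \<otimes> y g)) = \<zero>" using y(3)[OF j] c(1)[OF j] Kc by simp
  qed auto
  finally show ?thesis by simp
 qed
 moreover have "\<exists>x\<in>F. g x ~= \<zero>" if "g : S" for g using fx[OF that Kc(4)] KF[OF Kc(4)] by (metis one_not_zero)
 ultimately have "y g = \<zero>" if "g : S" for g using characters_independent[of S F "(\<otimes>)" y g, OF S] cl mult dist y(1) Fc(6) that by simp
 thus False using y(2) by simp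
qed

section \<open>Artin's theorem on the degree over a fixed field\<close>

context aut_group
begin

text \<open>Artin's argument: the \<open>card G\<close> equations with coefficients
  \<open>g (u j)\<close> have a nontrivial solution in the large field. Applying all automorphisms
  and summing turns the unknowns into traces, which lie in \<open>K\<close>.\<close>

lemma not_lin_indep:
 assumes "finite J" "card G < card J" "!!j. j : J ==> u j : carrier R"
 shows "\<not> lin_indep K J u"
proof
 assume li: "lin_indep K J u"
 obtain y where y: "!!j. j : J ==> y j : carrier R" "\<exists>j\<in>J. y j ~= \<zero>" "!!g. g : G ==> (\<Oplus>j\<in>J. g (u j) \<otimes> y j) = \<zero>"
  using linear_system_solution[OF carrier_is_subfield finite_G assms(1,2), of "\<lambda>g j. g (u j)"] assms(3) by auto
 obtain j0 where j0: "j0 : J" "y j0 ~= \<zero>" using y(2) by auto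
 obtain z where z: "z : carrier R" "tr z ~= \<zero>" using tr_nonzero by auto
 \<comment> \<open>The solution is rescaled so that its entry at \<open>j0\<close> becomes
   \<open>z\<close>, whose trace is nonzero; otherwise taking traces might kill the whole
   relation.\<close>
 define a where "a = z \<otimes> inv (y j0)"
 have a: "a : carrier R" using z j0 y by (auto simp: a_def)
 have h0: "(\<Oplus>j\<in>J. u j \<otimes> h (a \<otimes> y j)) = \<zero>" if h: "h : G" for h
 proof -
  obtain g where g: "g : G" "!!x. x : carrier R ==> h (g x) = x" using aut_inverse[OF h] by metis
  \<comment> \<open>Applying \<open>h\<close> to the equation for its inverse \<open>g\<close>
    leaves \<open>u j\<close> bare and puts \<open>h\<close> on the unknown.\<close>
  have "\<zero> = h a \<otimes> h (\<Oplus>j\<in>J. g (u j) \<otimes> y j)" using y(3)[OF g(1)] h a by simp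
  also have "h (\<Oplus>j\<in>J. g (u j) \<otimes> y j) = (\<Oplus>j\<in>J. h (g (u j) \<otimes> y j))" using g h y assms by (intro aut_finsum) auto
  also have "h a \<otimes> \<dots> = (\<Oplus>j\<in>J. h a \<otimes> h (g (u j) \<otimes> y j))" using g h y assms a by (intro finsum_rdistr) auto
  also have "\<dots> = (\<Oplus>j\<in>J. u j \<otimes> h (a \<otimes> y j))" using g h y assms a by (intro finsum_cong') (auto simp: aut_mult m_ac)
  finally show ?thesis by simp
 qed
 have "\<zero> = (\<Oplus>h\<in>G. \<Oplus>j\<in>J. u j \<otimes> h (a \<otimes> y j))" using h0 by (subst finsum_cong'[where g="\<lambda>_. \<zero>"]) auto
 also have "\<dots> = (\<Oplus>j\<in>J. \<Oplus>h\<in>G. u j \<otimes> h (a \<otimes> y j))" using finite_G assms a y by (intro finsum_swap) auto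
 also have "\<dots> = (\<Oplus>j\<in>J. tr (a \<otimes> y j) \<otimes> u j)"
 proof (intro finsum_cong' refl)
  fix j assume j: "j : J"
  have "(\<Oplus>h\<in>G. u j \<otimes> h (a \<otimes> y j)) = u j \<otimes> tr (a \<otimes> y j)" unfolding tr_def using finite_G assms a y j by (intro finsum_rdistr[symmetric]) auto
  thus "(\<Oplus>h\<in>G. u j \<otimes> h (a \<otimes> y j)) = tr (a \<otimes> y j) \<otimes> u j" using assms a y j by (simp add: m_comm)
 qed (use assms a y in auto)
 finally have "(\<Oplus>j\<in>J. tr (a \<otimes> y j) \<otimes> u j) = \<zero>" by (rule sym)
 moreover have "\<forall>j\<in>J. tr (a \<otimes> y j) : K" using tr_fixed a y(1) by auto
 ultimately have "\<forall>j\<in>J. tr (a \<otimes> y j) = \<zero>" using li[unfolded lin_indep_def, THEN spec, of "\<lambda>j. tr (a \<otimes> y j)"] by blast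
 hence "tr (a \<otimes> y j0) = \<zero>" using j0 by simp
 moreover have "a \<otimes> y j0 = z" using z j0 y(1)[OF j0(1)] by (simp add: a_def m_assoc)
 ultimately show False using z by simp
qed

lemma independent_list_le: assumes "independent K Us" shows "length Us \<le> card G"
proof (rule ccontr)
 assume "\<not> ?thesis"
 hence less: "card G < card {..<length Us}" by simp
 have U: "Us ! i : carrier R" if "i < length Us" for i using independent_in_carrier[OF assms] that by auto
 have "independent K (map ((!) Us) [0..<length Us])" using assms by (simp add: map_nth)
 hence "lin_indep K {..<length Us} ((!) Us)" using independent_imp_lin_indep[OF fixed_subfield] U by simp
 thus False using not_lin_indep[OF _ less] U by auto
qed

theorem artin_dimension: "dimension (card G) K (carrier R)"
proof -
 obtain Us where Us: "independent K Us" "!!Vs. independent K Vs ==> length Vs \<le> length Us"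
  using ex_has_greatest_nat[of "independent K" "[]" length "Suc (card G)"] independent_list_le by (metis le_imp_less_Suc li_Nil)
 have "Span K Us = carrier R"
 proof (rule ccontr)
  assume "Span K Us ~= carrier R"
  moreover have "Span K Us \<subseteq> carrier R" using Span_in_carrier[OF Kc(1) independent_in_carrier[OF Us(1)]] .
  ultimately obtain u where "u : carrier R" "u \<notin> Span K Us" by blast
  hence "independent K (u # Us)" using Us by (intro li_Cons) auto
  thus False using Us(2) by fastforce
 qed
 hence dim: "dimension (length Us) K (carrier R)" using dimensionI[OF fixed_subfield Us(1)] by simp
 have "card G \<le> length Us"
 proof (rule card_homs_le_dimension[OF fixed_subfield carrier_is_subfield dim finite_G])
  show "\<exists>x\<in>carrier R. g x ~= h x" if "g : G" "h : G" "g ~= h" for g h using aut_eqI that by auto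
 qed (auto simp: aut_add aut_mult aut_fix)
 hence "length Us = card G" using independent_list_le[OF Us(1)] by simp
 thus ?thesis using dim by simp
qed

lemma subgroup_aut:
 assumes "H \<subseteq> G" "(\<lambda>x\<in>carrier R. x) : H" "!!g h. [|g : H; h : H|] ==> compose (carrier R) g h : H"
 shows "aut_group R H"
proof
 show "finite H" using assms finite_G finite_subset by blast
qed (use assms aut_hom aut_ext in auto)

text \<open>Distinct automorphisms may have equal restrictions; the restricted group is a quotient
  of \<open>G\<close>, realized as an image.\<close>

lemma restrict_aut_group:
 assumes F: "subfield F R" and st: "!!g x. g : G ==> x : F ==> g x : F"
 shows "aut_group (R\<lparr>carrier := F\<rparr>) ((\<lambda>g. restrict g F) ` G)" and "fixed_field (R\<lparr>carrier := F\<rparr>) ((\<lambda>g. restrict g F) ` G) = F \<inter> K"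
proof -
 note Fc = subfield_closed[OF F]
 interpret F: field "R\<lparr>carrier := F\<rparr>" using subfield_iff(2)[OF F] .
 show "aut_group (R\<lparr>carrier := F\<rparr>) ((\<lambda>g. restrict g F) ` G)"
 proof
  show "finite ((\<lambda>g. restrict g F) ` G)" using finite_G by simp
  fix g assume "g : (\<lambda>g. restrict g F) ` G"
  then obtain g' where g': "g' : G" "g = restrict g' F" by auto
  show "g : ring_hom (R\<lparr>carrier := F\<rparr>) (R\<lparr>carrier := F\<rparr>)" using g' st Fc by (intro ring_hom_memI) (auto simp: aut_add aut_mult)
  show "g : extensional (carrier (R\<lparr>carrier := F\<rparr>))" using g' by simp
  fix h assume "h : (\<lambda>g. restrict g F) ` G"
  then obtain h' where h': "h' : G" "h = restrict h' F" by auto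
  have "compose F g h = restrict (compose (carrier R) g' h') F" using g' h' st Fc by (auto simp: compose_def)
  thus "compose (carrier (R\<lparr>carrier := F\<rparr>)) g h : (\<lambda>g. restrict g F) ` G" using aut_comp[OF g'(1) h'(1)] by auto
 next
  have "(\<lambda>x\<in>F. x) = (\<lambda>g. restrict g F) (\<lambda>x\<in>carrier R. x)" using Fc by auto
  thus "(\<lambda>x\<in>carrier (R\<lparr>carrier := F\<rparr>). x) : (\<lambda>g. restrict g F) ` G" using aut_id by (simp del: restrict_restrict)
 qed
 show "fixed_field (R\<lparr>carrier := F\<rparr>) ((\<lambda>g. restrict g F) ` G) = F \<inter> K" using Fc by (auto simp: fixed_field_def)
qed

end

section \<open>Comparison with the Galois group of an extension\<close>

lemma carrier_galois_group: "carrier (galois_group R K) = {\<sigma> : ring_iso R R \<inter> extensional (carrier R). \<forall>x\<in>K. \<sigma> x = x}"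
 by (simp add: galois_group_def)

text \<open>There is no room for another automorphism: together with \<open>G\<close> it would
  exceed the degree, which is \<open>card G\<close> by Artin.\<close>

lemma (in aut_group) galois_group_eq: "carrier (galois_group R K) = G"
proof -
 let ?A = "carrier (galois_group R K)"
 have sub: "G \<subseteq> ?A" using aut_iso aut_ext aut_fix by (auto simp: carrier_galois_group)
 have hom: "\<sigma> : ring_hom R R" "\<sigma> : extensional (carrier R)" "!!x. x : K ==> \<sigma> x = x" if "\<sigma> : ?A" for \<sigma>
  using that by (auto simp: carrier_galois_group ring_iso_def)
 have bd: "card S \<le> card G" if S: "finite S" "S \<subseteq> ?A" for S
 proof (rule card_homs_le_dimension[OF fixed_subfield carrier_is_subfield artin_dimension S(1)])
  fix g h assume gh: "g : S" "h : S" "g ~= h"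
  thus "\<exists>x\<in>carrier R. g x ~= h x" using S hom(2) by (meson extensionalityI subsetD)
 qed (use S hom in \<open>auto dest: ring_hom_closed ring_hom_add ring_hom_mult simp: subset_iff\<close>)
 have "?A \<subseteq> G"
 proof
  fix \<sigma> assume "\<sigma> : ?A"
  hence "card (insert \<sigma> G) \<le> card G" using bd[of "insert \<sigma> G"] sub finite_G by auto
  thus "\<sigma> : G" using finite_G by (metis card_insert_disjoint not_less_eq_eq order_refl)
 qed
 thus ?thesis using sub by auto
qed

text \<open>Turns the definition of a Galois extension into an automorphism group; the Galois group
  is finite because the degree bounds the number of its elements.\<close>

lemma galois_extensionD:
 assumes "galois_extension R K"
 shows "aut_group R (carrier (galois_group R K))" "fixed_field R (carrier (galois_group R K)) = K"
proof -
 interpret field R using assms by (simp add: galois_extension_def)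
 let ?A = "carrier (galois_group R K)"
 show fx: "fixed_field R ?A = K" using assms by (simp add: galois_extension_def fixed_field_def)
 have K: "subfield K R" using assms by (simp add: galois_extension_def)
 obtain d where dim: "dimension d K (carrier R)" using assms by (auto simp: galois_extension_def)
 have hom: "\<sigma> : ring_hom R R" "\<sigma> : extensional (carrier R)" "!!x. x : K ==> \<sigma> x = x" if "\<sigma> : ?A" for \<sigma>
  using that by (auto simp: carrier_galois_group ring_iso_def)
 have bd: "card S \<le> d" if S: "finite S" "S \<subseteq> ?A" for S
 proof (rule card_homs_le_dimension[OF K carrier_is_subfield dim S(1)])
  fix g h assume gh: "g : S" "h : S" "g ~= h"
  thus "\<exists>x\<in>carrier R. g x ~= h x" using S hom(2) by (meson extensionalityI subsetD)
 qed (use S hom in \<open>auto dest: ring_hom_closed ring_hom_add ring_hom_mult simp: subset_iff\<close>)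
 have fin: "finite ?A"
 proof (rule ccontr)
  assume "infinite ?A"
  then obtain S where "finite S" "S \<subseteq> ?A" "card S = Suc d" using infinite_arbitrarily_large by blast
  thus False using bd[of S] by simp
 qed
 show "aut_group R ?A"
 proof
  show "finite ?A" by (rule fin)
  show "(\<lambda>x\<in>carrier R. x) : ?A" using subfield_closed(2)[OF K] by (auto simp: carrier_galois_group ring_iso_def ring_hom_def bij_betw_def)
  show "compose (carrier R) g h : ?A" if "g : ?A" "h : ?A" for g h
  proof -
   have gh: "g : ring_iso R R" "h : ring_iso R R" using that by (auto simp: carrier_galois_group)
   have "g \<circ> h : ring_iso R R" using ring_iso_set_trans[OF gh(2,1)] .
   hence "compose (carrier R) g h : ring_iso R R" by (auto simp: ring_iso_def ring_hom_def bij_betw_def compose_def inj_on_def)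
   thus ?thesis using that subfield_closed(2)[OF K] by (auto simp: carrier_galois_group compose_def)
  qed
 qed (use hom in auto)
qed

lemma (in aut_group) galois_extension: "galois_extension R K" using fixed_subfield artin_dimension finite_dimension_def
 unfolding galois_extension_def galois_group_eq by (auto simp: field_axioms fixed_field_def[of R G])

section \<open>Roots of unity\<close>

hide_const (open) Divisibility.prime

text \<open>Polynomials are lists with the leading coefficient first, hence the reversed
  range.\<close>

lemma (in ring) eval_coeffs:
 assumes "!!i. i < n ==> a i : carrier R" "x : carrier R"
 shows "eval (map a (rev [0..<n])) x = (\<Oplus>i\<in>{..<n}. a i \<otimes> x [^] i)" using assms
proof (induct n)
 case (Suc n)
 have "eval (map a (rev [0..<Suc n])) x = a n \<otimes> x [^] n \<oplus> eval (map a (rev [0..<n])) x" by simp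
 also have "\<dots> = a n \<otimes> x [^] n \<oplus> (\<Oplus>i\<in>{..<n}. a i \<otimes> x [^] i)" using Suc by simp
 also have "\<dots> = (\<Oplus>i\<in>insert n {..<n}. a i \<otimes> x [^] i)" using Suc by simp
 also have "insert n {..<n} = {..<Suc n}" by auto
 finally show ?case .
qed simp

lemma (in ring) coeff_coeffs: "coeff (map a (rev [0..<n])) i = (if i < n then a i else \<zero>)" by (induct n) auto

lemma (in field) few_roots:
 assumes p: "p : carrier (poly_ring R)" "p ~= []" and S: "S \<subseteq> carrier R" "!!x. x : S ==> eval p x = \<zero>"
 shows "finite S \<and> card S \<le> degree p"
proof -
 have "S \<subseteq> set_mset (roots p)" using S p roots_mem_iff_is_root[OF p(1)] by (auto simp: is_root_def)
 hence "finite S" "card S \<le> card (set_mset (roots p))" by (auto intro: finite_subset card_mono)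
 moreover have "card (set_mset (roots p)) \<le> size (roots p)" by (metis mset_set_set_mset_msubset size_mset_mono size_mset_set)
 ultimately show ?thesis using size_roots_le_degree[OF p(1)] by auto
qed

text \<open>Takes the place of the Vandermonde determinant: a polynomial of degree below
  \<open>n\<close> cannot have \<open>n\<close> roots.\<close>

lemma (in field) few_roots_coeffs:
 assumes a: "!!i. i < n ==> a i : carrier R" and S: "S \<subseteq> carrier R" "n \<le> card S"
  and z: "!!x. x : S ==> (\<Oplus>i\<in>{..<n}. a i \<otimes> x [^] i) = \<zero>" and "j < n"
 shows "a j = \<zero>"
proof -
 let ?l = "map a (rev [0..<n])"
 have l: "set ?l \<subseteq> carrier R" using a by auto
 show ?thesis
 proof (cases "normalize ?l = []")
  case True
  hence "coeff ?l j = \<zero>" using normalize_coeff[of ?l] by simp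
  thus ?thesis using coeff_coeffs[of a n j] \<open>j < n\<close> by simp
 next
  case False
  have p: "normalize ?l : carrier (poly_ring R)" using normalize_gives_polynomial[OF l] univ_poly_carrier by auto
  have "eval (normalize ?l) x = \<zero>" if "x : S" for x using eval_normalize[OF l] eval_coeffs[of n a x] a z[OF that] S that by auto
  hence "card S \<le> degree (normalize ?l)" using few_roots[OF p False S(1)] by simp
  moreover have "degree (normalize ?l) < n" using normalize_length_le[of ?l] False by (cases "normalize ?l") auto
  ultimately show ?thesis using S(2) by simp
 qed
qed

section \<open>Orders of residues congruent to 1 modulo \<open>r\<close>\<close>

lemma cong_power_p:
 fixes c r p :: nat
 assumes "prime p" "p dvd r" "c = 1 + r * u" "\<not> p dvd u" "p ~= 2 \<or> 4 dvd r"
 obtains u' where "c ^ p = 1 + (r * p) * u'" "\<not> p dvd u'"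
proof -
 have p2: "p \<ge> 2" using prime_ge_2_nat[OF assms(1)] .
 obtain w where w: "(1 + r * u) ^ p = 1 + r * u * p + (r * p) * (p * w)"
 proof -
  have bin: "(r * u + 1) ^ p = (\<Sum>k\<le>p. (p choose k) * (r * u) ^ k)" using binomial[of "r * u" 1 p] by simp
  have un: "{..p} = {0, 1} \<union> {2..p}" using p2 by auto
  have "(\<Sum>k\<le>p. (p choose k) * (r * u) ^ k) = 1 + p * (r * u) + (\<Sum>k\<in>{2..p}. (p choose k) * (r * u) ^ k)" unfolding un by simp
  \<comment> \<open>For \<open>k < p\<close> the binomial coefficient supplies a factor
    \<open>p\<close> besides the \<open>r * p\<close> contained in \<open>r ^ k\<close>; the term
    \<open>k = p\<close> has to supply \<open>r * p * p\<close> alone.\<close>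
  moreover have "r * p * p dvd (\<Sum>k\<in>{2..p}. (p choose k) * (r * u) ^ k)"
  proof (rule dvd_sum)
   fix k assume k: "k : {2..p}"
   have r2: "r * p * p dvd (p choose k) * r ^ k"
   proof (cases "k < p")
    case True
    have "p dvd (p choose k)" using k True assms(1) by (intro dvd_choose_prime) auto
    moreover have "r * p dvd r ^ k"
    proof -
     have "r * p dvd r ^ 2" using assms(2) by (simp add: power2_eq_square)
     also have "r ^ 2 dvd r ^ k" using k by (intro le_imp_power_dvd) auto
     finally show ?thesis .
    qed
    ultimately have "p * (r * p) dvd (p choose k) * r ^ k" by auto
    thus ?thesis by auto
   next
    case False
    hence kp: "k = p" using k by auto
    show ?thesis
    \<comment> \<open>For \<open>p = 2\<close> this last term is the square of \<open>r * u\<close>,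
      so a factor 4 of \<open>r\<close> is wanted; this is the origin of the exception in the
      theorem.\<close>
    proof (cases "p = 2")
     case True
     hence "4 dvd r" using assms(5) by auto
     hence "r * 4 dvd r * r" by auto
     thus ?thesis using True kp by auto
    next
     case False
     hence "3 \<le> k" using kp p2 by auto
     hence "r ^ 3 dvd r ^ k" by (rule le_imp_power_dvd)
     moreover have "r * p * p dvd r ^ 3" using assms(2) by (auto simp: power3_eq_cube)
     ultimately show ?thesis by auto
    qed
   qed
   have "r * p * p dvd ((p choose k) * r ^ k) * u ^ k" using r2 by simp
   thus "r * p * p dvd (p choose k) * (r * u) ^ k" by (simp add: power_mult_distrib mult_ac)
  qed
  then obtain w where "(\<Sum>k\<in>{2..p}. (p choose k) * (r * u) ^ k) = r * p * p * w" by auto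
  ultimately have "(1 + r * u) ^ p = 1 + r * u * p + (r * p) * (p * w)" using bin by simp
  thus ?thesis using that by auto
 qed
 have "c ^ p = 1 + (r * p) * (u + p * w)" using w assms(3) by (simp add: algebra_simps)
 moreover have "\<not> p dvd (u + p * w)" using assms(4) by (simp add: dvd_add_left_iff)
 ultimately show ?thesis using that by auto
qed

text \<open>Modulo \<open>r * p\<close> the powers of \<open>c\<close> are
  \<open>1 + r * u * i\<close>, so an exponent giving 1 is a multiple of \<open>p\<close>. Then pass
  to \<open>c ^ p\<close>, which has the same shape with \<open>r * p\<close> in place of
  \<open>r\<close>.\<close>

lemma order_mod_prime_power:
 fixes c r p :: nat
 assumes "prime p" "p dvd r" "c = 1 + r * u" "\<not> p dvd u" "t \<le> 1 \<or> p ~= 2 \<or> 4 dvd r" and "r > 0" "[c ^ i = 1] (mod (r * p ^ t))"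
 shows "p ^ t dvd i" using assms
proof (induction t arbitrary: c r u i)
 case (Suc t)
 note r0 = \<open>r > 0\<close>
 have pi: "p dvd i"
 proof -
  have "[c ^ i = 1 + r * u * i] (mod (r * p))"
  proof (induct i)
   case (Suc i)
   have "[c ^ Suc i = (1 + r * u) * (1 + r * u * i)] (mod (r * p))"
    using cong_mult[OF cong_refl Suc, of "1 + r * u"] \<open>c = 1 + r * u\<close> by simp
   moreover have "[(1 + r * u) * (1 + r * u * i) = 1 + r * u * Suc i] (mod (r * p))"
   proof -
    have "(1 + r * u) * (1 + r * u * i) = 1 + r * u * Suc i + r * (r * (u * u * i))" by simp
    moreover have "r * p dvd r * (r * (u * u * i))" using \<open>p dvd r\<close> by auto
    ultimately show ?thesis by (metis cong_add_lcancel_0_nat cong_0_iff)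
   qed
   ultimately show ?case using cong_trans by simp
  qed simp
  moreover have "[c ^ i = 1] (mod (r * p))" using Suc.prems(7) by (rule cong_dvd_modulus_nat) auto
  ultimately have "[1 + r * u * i = 1] (mod (r * p))" using cong_sym cong_trans by blast
  hence "r * p dvd r * u * i" using cong_add_lcancel_0_nat[of 1] cong_0_iff by blast
  hence "p dvd u * i" using r0 by simp
  thus ?thesis using assms(1) Suc.prems(4) prime_dvd_mult_iff by auto
 qed
 then obtain i' where i': "i = p * i'" by auto
 show ?case
 \<comment> \<open>At the first level divisibility by \<open>p\<close> is the whole claim;
   \<open>cong_power_p\<close>, and with it the condition at 2, enters from the second level
   on.\<close>
 proof (cases "t = 0")
  case False
  hence "p ~= 2 \<or> 4 dvd r" using Suc.prems(5) by auto
  then obtain u' where u': "c ^ p = 1 + (r * p) * u'" "\<not> p dvd u'" using cong_power_p[OF assms(1) Suc.prems(2,3,4)] by auto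
  have "[(c ^ p) ^ i' = 1] (mod (r * p * p ^ t))" using Suc.prems(7) i' by (simp add: power_mult mult.assoc)
  hence "p ^ t dvd i'" using Suc.IH[OF assms(1) _ u'] \<open>p ~= 2 \<or> 4 dvd r\<close> r0 prime_gt_0_nat[OF assms(1)] by auto
  thus ?thesis using i' by simp
 qed (use pi in simp)
qed simp

text \<open>Applied to a minimal polynomial, this shows that the exponents of the conjugates of a
  root of unity are closed under multiplication.\<close>

lemma (in field) polynomial_power_subst:
 assumes K: "subfield K R" and f: "set f \<subseteq> K"
 shows "\<exists>g\<in>carrier (K[X]). \<forall>x\<in>carrier R. eval g x = eval f (x [^] (e::nat))" using f
proof (induct f)
 case Nil
 thus ?case by (intro bexI[of _ "[]"]) auto
next
 case (Cons a f)
 then obtain g where g: "g : carrier (K[X])" "\<forall>x\<in>carrier R. eval g x = eval f (x [^] e)" by auto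
 note sr = subfieldE(1)[OF K]
 have gp: "polynomial K g" using g univ_poly_carrier by auto
 show ?case
 proof (cases "a = \<zero>")
  case True
  have "eval (a # f) (x [^] e) = eval g x" if "x : carrier R" for x
   using True g that Cons.prems subfield_closed[OF K] by (auto intro!: l_zero eval_in_carrier)
  thus ?thesis using g by auto
 next
  case False
  let ?m = "monom a (e * length f)"
  have mp: "polynomial K ?m" using monom_is_polynomial[OF sr] False Cons by auto
  have "poly_add ?m g : carrier (K[X])" using poly_add_closed[OF sr mp gp] univ_poly_carrier by blast
  moreover have "eval (poly_add ?m g) x = eval (a # f) (x [^] e)" if x: "x : carrier R" for x
  proof -
   have "eval (poly_add ?m g) x = eval ?m x \<oplus> eval g x" using polynomial_in_carrier[OF sr] mp gp x by (intro eval_poly_add) auto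
   also have "eval ?m x = a \<otimes> x [^] (e * length f)" using Cons subfield_closed[OF K] x by (intro eval_monom) auto
   finally show ?thesis using g x by (simp add: nat_pow_pow)
  qed
  ultimately show ?thesis by blast
 qed
qed

lemma (in field) pow_eq_pow_cong:
 assumes s: "s : carrier R" "s ~= \<zero>" and ord: "!!i::nat. s [^] i = \<one> \<longleftrightarrow> q dvd i"
 shows "s [^] (i::nat) = s [^] (j::nat) \<longleftrightarrow> [i = j] (mod q)"
proof -
 have *: "s [^] i = s [^] j \<longleftrightarrow> [i = j] (mod q)" if "i \<le> j" for i j :: nat
 proof -
  have e: "s [^] j = s [^] i \<otimes> s [^] (j - i)" using that s by (simp add: nat_pow_mult)
  have "s [^] i = s [^] j \<longleftrightarrow> s [^] (j - i) = \<one>"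
  proof
   assume "s [^] i = s [^] j"
   hence "s [^] i \<otimes> s [^] (j - i) = s [^] i \<otimes> \<one>" using e s by simp
   thus "s [^] (j - i) = \<one>" using s pow_nonzero[OF s] m_lcancel by blast
  qed (use e s in simp)
  thus ?thesis using ord that by (metis cong_altdef_nat cong_sym_eq)
 qed
 show ?thesis using *[of i j] *[of j i] by (metis cong_sym_eq nat_le_linear)
qed

lemma (in field) pow_dvd_eq_one:
 assumes "x : carrier R" "x [^] (a::nat) = \<one>" "a dvd b"
 shows "x [^] b = \<one>" using assms by (metis dvdE nat_pow_one nat_pow_pow)

lemma (in field) monic_polynomial:
 assumes K: "subfield K R" and c: "!!j. j < d ==> c j : K"
 shows "\<exists>f\<in>carrier (K[X]). f ~= [] \<and> degree f = d \<and> (\<forall>x\<in>carrier R. eval f x = x [^] d \<ominus> (\<Oplus>j\<in>{..<d}. c j \<otimes> x [^] j))"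
proof -
 note Kc = subfield_closed[OF K]
 let ?D = "map (\<lambda>i. if i = d then \<one> else \<ominus> c i) (rev [0..<Suc d])"
 have D: "?D : carrier (K[X])" using Kc c by (auto simp: univ_poly_carrier[symmetric] intro!: polynomialI)
 have "eval ?D x = x [^] d \<ominus> (\<Oplus>j\<in>{..<d}. c j \<otimes> x [^] j)" if x: "x : carrier R" for x
 proof -
  have "eval ?D x = (\<Oplus>i\<in>{..<Suc d}. (if i = d then \<one> else \<ominus> c i) \<otimes> x [^] i)" using x c Kc by (intro eval_coeffs) auto
  also have "{..<Suc d} = insert d {..<d}" by auto
  also have "(\<Oplus>i\<in>insert d {..<d}. (if i = d then \<one> else \<ominus> c i) \<otimes> x [^] i) = x [^] d \<oplus> (\<Oplus>i\<in>{..<d}. (if i = d then \<one> else \<ominus> c i) \<otimes> x [^] i)"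
   using x c Kc by simp
  also have "(\<Oplus>i\<in>{..<d}. (if i = d then \<one> else \<ominus> c i) \<otimes> x [^] i) = (\<Oplus>i\<in>{..<d}. \<ominus> \<one> \<otimes> (c i \<otimes> x [^] i))"
   using x c Kc by (intro finsum_cong') (auto simp: l_minus)
  also have "\<dots> = \<ominus> \<one> \<otimes> (\<Oplus>i\<in>{..<d}. c i \<otimes> x [^] i)" using x c Kc by (intro finsum_rdistr[symmetric]) auto
  also have "\<dots> = \<ominus> (\<Oplus>i\<in>{..<d}. c i \<otimes> x [^] i)" using x c Kc by (subst l_minus) auto
  finally show ?thesis by (simp add: a_minus_def)
 qed
 thus ?thesis by (intro bexI[OF _ D]) simp
qed

lemma (in field) binomial_polynomial:
 assumes K: "subfield K R" and b: "b : K" and d: "d > 0"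
 obtains f where "f : carrier (K[X])" "f ~= []" "degree f = d" "!!x. x : carrier R ==> eval f x = x [^] d \<ominus> b"
proof -
 note Kc = subfield_closed[OF K]
 let ?c = "\<lambda>j. if j = (0::nat) then b else \<zero>"
 have cK: "?c j : K" for j using b Kc(3) by simp
 obtain f where f: "f : carrier (K[X])" "f ~= []" "degree f = d" "!!x. x : carrier R ==> eval f x = x [^] d \<ominus> (\<Oplus>j\<in>{..<d}. ?c j \<otimes> x [^] j)"
  using monic_polynomial[OF K, of d ?c, OF cK] by auto
 have "(\<Oplus>j\<in>{..<d}. (if j = 0 then b else \<zero>) \<otimes> x [^] j) = b" if x: "x : carrier R" for x
 proof -
  have e: "{..<d} = insert 0 {0<..<d}" using d by auto
  have "(\<Oplus>j\<in>{..<d}. (if j = 0 then b else \<zero>) \<otimes> x [^] j) = b \<oplus> (\<Oplus>j\<in>{0<..<d}. (if j = 0 then b else \<zero>) \<otimes> x [^] j)"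
   unfolding e using x b Kc by simp
  also have "(\<Oplus>j\<in>{0<..<d}. (if j = 0 then b else \<zero>) \<otimes> x [^] j) = (\<Oplus>j\<in>{0<..<d}. \<zero>)" using x by (intro finsum_cong') auto
  finally show ?thesis using b Kc by simp
 qed
 thus ?thesis using that[OF f(1-3)] f(4) by simp
qed

text \<open>Counting roots: the \<open>q\<close> powers of \<open>s\<close> are distinct zeros of
  \<open>X ^ q - 1\<close>, which is the minimal polynomial times some \<open>Q\<close>. Neither
  factor has more zeros than its degree, and the degrees add up to \<open>q\<close>, so both bounds
  are attained.\<close>

lemma (in field) root_of_unity_conjugates:
 fixes q :: nat
 assumes K: "subfield K R" and q0: "q > 0" and s: "s : carrier R" and sq: "!!i::nat. s [^] i = \<one> \<longleftrightarrow> q dvd i"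
 defines "C \<equiv> {i\<in>{..<q}. eval (Irr K s) (s [^] i) = \<zero>}"
 shows "(algebraic over K) s" "card C = degree (Irr K s)" "!!f i. [|f : carrier (K[X]); eval f s = \<zero>; i : C|] ==> eval f (s [^] i) = \<zero>"
proof -
 note Kc = subfield_closed[OF K] and sr = subfieldE(1)[OF K]
 have s0: "s ~= \<zero>" using sq[of q] q0 nat_pow_zero[of q] by auto
 note scong = pow_eq_pow_cong[OF s s0 sq]
 have inj: "inj_on (\<lambda>c. s [^] c) {..<q}" using scong by (intro inj_onI) (auto simp: cong_less_modulus_unique_nat)
 obtain W where W: "W : carrier (K[X])" "W ~= []" and degW: "degree W = q" and evW: "!!x. x : carrier R ==> eval W x = x [^] q \<ominus> \<one>"
  using binomial_polynomial[OF K Kc(4) q0] by auto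
 have evWs: "eval W s = \<zero>" using evW s sq[of q] by simp
 thus alg: "(algebraic over K) s" using algebraicI[OF W] by simp
 define F where "F = Irr K s"
 note F = IrrE[OF K s alg, folded F_def] and Fmin = Irr_minimal[OF K s alg, folded F_def]
 have FR: "F : carrier (poly_ring R)" using F(1) sr by auto
 have F1: "degree F \<ge> 1" using pirreducible_degree[OF K F(1,2)] .
 have Fn: "F ~= []" using F1 by auto
 have Ceq: "C = {i\<in>{..<q}. eval F (s [^] i) = \<zero>}" by (simp add: C_def F_def)
 show "eval f (s [^] i) = \<zero>" if "f : carrier (K[X])" "eval f s = \<zero>" "i : C" for f i
  using pdivides_imp_root_sharing[OF FR Fmin[OF that(1,2)], of "s [^] i"] that(3) s by (simp add: Ceq)
 have Cs: "C \<subseteq> {..<q}" "finite C" by (auto simp: Ceq)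
 have "card ((\<lambda>i. s [^] i) ` C) \<le> degree F" using s by (intro few_roots[OF FR Fn, THEN conjunct2]) (auto simp: Ceq)
 hence le: "card C \<le> degree F" using inj_on_subset[OF inj Cs(1)] by (simp add: card_image)
 obtain Q where Q: "Q : carrier (poly_ring R)" "W = F \<otimes>\<^bsub>poly_ring R\<^esub> Q" using Fmin[OF W(1) evWs] by (auto simp: pdivides_def)
 have pm: "W = poly_mult F Q" using Q(2) by (simp add: univ_poly_mult)
 have Qn: "Q ~= []" using W(2) pm poly_mult_zero(2) polynomial_in_carrier FR univ_poly_carrier carrier_is_subring by blast
 have deg: "degree W = degree F + degree Q" using poly_mult_degree_eq[OF carrier_is_subring, of F Q] FR Q(1) Fn Qn
  unfolding pm by (auto simp: univ_poly_carrier)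
 let ?S = "(\<lambda>i. s [^] i) ` ({..<q} - C)"
 have "eval Q x = \<zero>" if "x : ?S" for x
 proof -
  obtain i where i: "i < q" "i \<notin> C" "x = s [^] i" using \<open>x : ?S\<close> by auto
  have "eval W x = \<zero>" using evW[of x] i s sq[of "i * q"] by (simp add: nat_pow_pow)
  moreover have "eval W x = eval F x \<otimes> eval Q x" unfolding pm using i s FR Q(1)
   by (intro eval_poly_mult) (auto simp: univ_poly_carrier[symmetric] dest: polynomial_incl)
  moreover have "eval F x : carrier R" "eval Q x : carrier R"
   using i s FR Q(1) by (auto simp: univ_poly_carrier[symmetric] dest: polynomial_incl intro!: eval_in_carrier)
  moreover have "eval F x ~= \<zero>" using i by (auto simp: Ceq)
  ultimately show ?thesis using integral_iff by simp
 qed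
 hence "card ?S \<le> degree Q" using few_roots[OF Q(1) Qn, of ?S] s by auto
 moreover have "card ?S = q - card C" using inj_on_subset[OF inj, of "{..<q} - C"] Cs by (subst card_image) (auto simp: card_Diff_subset)
 moreover have "card C \<le> q" using card_mono[OF _ Cs(1)] by simp
 ultimately show "card C = degree (Irr K s)" using deg degW le unfolding F_def by linarith
qed

text \<open>The conjugates of \<open>s\<close> over \<open>K\<close> are powers \<open>s\<^sup>c\<close>. If all such \<open>c\<close> were congruent to 1
 modulo \<open>r * p\<close>, then \<open>s [^] (p ^ (t - 1))\<close> would have no conjugate but itself; so some \<open>c\<close>
 generates the group of residues congruent to 1 modulo \<open>r\<close>.\<close>

lemma (in field) root_of_unity_degree:
 fixes p r t m :: nat
 assumes K: "subfield K R" and p: "prime p" "p dvd r" and rm: "r * p ^ t dvd m" and r0: "r > 0" and cond: "t \<le> 1 \<or> p ~= 2 \<or> 4 dvd r"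
  and roots: "!!x. x : K ==> x [^] m = \<one> ==> x [^] r = \<one>" and s: "s : carrier R" "s [^] (p ^ t) : K" "!!i::nat. s [^] (p ^ t * i) = \<one> \<longleftrightarrow> r dvd i"
  and d: "d > 0" "!!j. j < d ==> c j : K" "s [^] d = (\<Oplus>j\<in>{..<d}. c j \<otimes> s [^] j)"
 shows "p ^ t \<le> d"
proof (cases "t = 0")
 case False
 note Kc = subfield_closed[OF K] and sr = subfieldE(1)[OF K]
 have p0: "p > 0" using p prime_gt_0_nat by simp
 define q where "q = r * p ^ t"
 have q0: "q > 0" using r0 p0 by (simp add: q_def)
 have s0: "s ~= \<zero>" using r0 p0 nat_pow_zero s(3)[of r] by auto
 have sq: "s [^] i = \<one> \<longleftrightarrow> q dvd i" for i :: nat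
 proof
  assume "q dvd i"
  thus "s [^] i = \<one>" using s(3)[of r] pow_dvd_eq_one[OF s(1), of q i] by (simp add: q_def mult.commute)
 next
  assume i: "s [^] i = \<one>"
  have "s [^] (p ^ t * i) = \<one>" using i s(1) by (metis mult.commute nat_pow_one nat_pow_pow)
  hence "r dvd i" using s(3) by simp
  hence "p dvd i" using p by auto
  \<comment> \<open>The order of \<open>s\<close> is exactly \<open>q\<close>. The factors
    \<open>p\<close> of \<open>i\<close> are extracted one by one: a suitable power of
    \<open>s [^] i = \<one>\<close> is a statement about \<open>s [^] (p ^ t)\<close>, whose order
    \<open>r\<close> is a multiple of \<open>p\<close>.\<close>
  have "p ^ k dvd i" if "k \<le> t" for k using that
  proof (induct k)
   case (Suc k)
   then obtain i' where i': "i = p ^ k * i'" by auto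
   have "s [^] (p ^ t * i') = (s [^] i) [^] (p ^ (t - k))" using s(1) Suc i' by (simp add: nat_pow_pow mult_ac flip: power_add)
   hence "r dvd i'" using i s(3) by simp
   thus ?case using i' p by auto
  qed simp
  then obtain i' where "i = p ^ t * i'" by auto
  thus "q dvd i" using i s(3) by (simp add: q_def)
 qed
 note scong = pow_eq_pow_cong[OF s(1) s0 sq]
 have inj: "inj_on (\<lambda>c. s [^] c) {..<q}" using scong by (intro inj_onI) (auto simp: cong_less_modulus_unique_nat)
 note conj = root_of_unity_conjugates[OF K q0 s(1) sq]
 note alg = conj(1)
 define F where "F = Irr K s"
 note F = IrrE[OF K s(1) alg, folded F_def] and Fmin = Irr_minimal[OF K s(1) alg, folded F_def]
 have FK: "set F \<subseteq> K" using F(1) univ_poly_carrier polynomial_incl by blast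
 have FR: "F : carrier (poly_ring R)" using F(1) sr by auto
 have F1: "degree F \<ge> 1" using pirreducible_degree[OF K F(1,2)] .
 have Fn: "F ~= []" using F1 by auto
 have Fdiv: "eval f x = \<zero>" if "f : carrier (K[X])" "eval f s = \<zero>" "x : carrier R" "eval F x = \<zero>" for f x
  using pdivides_imp_root_sharing[OF FR Fmin[OF that(1,2)] that(3,4)] .
 define C where "C = {i\<in>{..<q}. eval F (s [^] i) = \<zero>}"
 have cardC: "degree F \<le> card C" using conj(2) by (simp add: C_def F_def)
 \<comment> \<open>A conjugate of \<open>s\<close> is also a zero of \<open>X ^ (p ^ t)\<close>
   minus \<open>s [^] (p ^ t)\<close>, a polynomial over \<open>K\<close>.\<close>
 have C1: "[i = 1] (mod r)" if "i : C" for i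
 proof -
  let ?b = "s [^] (p ^ t)"
  obtain B where BK: "B : carrier (K[X])" and evB: "!!x. x : carrier R ==> eval B x = x [^] (p ^ t) \<ominus> ?b"
   using binomial_polynomial[OF K s(2), of "p ^ t"] p0 by auto
  have "eval B s = \<zero>" using evB s(1) by simp
  hence "eval B (s [^] i) = \<zero>" using Fdiv[OF BK] that s(1) by (auto simp: C_def)
  hence "s [^] (i * p ^ t) = s [^] (p ^ t)" using evB[of "s [^] i"] s(1) by (simp add: nat_pow_pow)
  hence "[i * p ^ t = 1 * p ^ t] (mod r * p ^ t)" using scong by (simp add: q_def)
  thus ?thesis using p0 by (simp add: cong_def)
 qed
 obtain c0 where c0: "c0 : C" "\<not> [c0 = 1] (mod (r * p))"
 proof (rule ccontr)
  assume "\<not> thesis"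
  hence all: "[i = 1] (mod (r * p))" if "i : C" for i using that \<open>!!c0. c0 : C ==> \<not> [c0 = 1] (mod r * p) ==> thesis\<close> by auto
  \<comment> \<open>The element \<open>s [^] e\<close> has order \<open>r * p\<close>. If all
    exponents were 1 modulo \<open>r * p\<close>, it would equal all its conjugates and hence lie in
    \<open>K\<close>, where \<open>roots\<close> forbids such an order.\<close>
  define e where "e = p ^ (t - 1)"
  have ep: "e * p = p ^ t" using False by (simp add: e_def power_eq_if)
  have eK: "monom \<one> e : carrier (K[X])" using monom_is_polynomial[OF sr, of \<one> e] Kc(4) univ_poly_carrier by auto
  \<comment> \<open>The remainder \<open>h\<close> of \<open>X ^ e\<close> modulo \<open>F\<close>
    agrees with \<open>X ^ e\<close> at every conjugate of \<open>s\<close>. It takes a single value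
    at more points than its degree, so it is constant, and its coefficients are in
    \<open>K\<close>.\<close>
  obtain Q h where Qh: "Q : carrier (K[X])" "h : carrier (K[X])" "monom \<one> e = (F \<otimes>\<^bsub>K[X]\<^esub> Q) \<oplus>\<^bsub>K[X]\<^esub> h" "h = [] \<or> degree h < degree F"
   using subfield_long_division_theorem_shell[OF K eK F(1)] Fn by (auto simp: univ_poly_zero)
  have inR: "set f \<subseteq> carrier R" if "f : carrier (K[X])" for f using that polynomial_in_carrier[OF sr] univ_poly_carrier by auto
  have ev: "eval h x = x [^] e" if "x : carrier R" "eval F x = \<zero>" for x
  proof -
   have "x [^] e = eval (monom \<one> e) x" using that by (simp add: eval_monom)
   also have "\<dots> = eval (poly_mult F Q) x \<oplus> eval h x" unfolding Qh(3) univ_poly_add univ_poly_mult using inR F(1) Qh that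
    by (intro eval_poly_add poly_mult_in_carrier) auto
   also have "eval (poly_mult F Q) x = \<zero>" using inR[OF F(1)] inR[OF Qh(1)] that eval_in_carrier[of Q x] by (subst eval_poly_mult) auto
   finally show ?thesis using inR[OF Qh(2)] that eval_in_carrier[of h x] by simp
  qed
  let ?s1 = "s [^] e"
  have h1: "eval h (s [^] i) = ?s1" if i: "i : C" for i
  proof -
   have "[i * e = 1 * e] (mod (r * p * e))" using all[OF i] by (simp add: cong_def)
   moreover have "r * p * e = q" using ep by (simp add: q_def mult_ac)
   ultimately have "s [^] (i * e) = s [^] e" using scong by simp
   thus ?thesis using ev[of "s [^] i"] i s(1) by (simp add: C_def nat_pow_pow)
  qed
  have "?s1 : K"
  proof -
   define n where "n = length F - 1"
   let ?a = "\<lambda>i. if i = 0 then coeff h 0 \<ominus> ?s1 else coeff h i"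
   have hlen: "length h \<le> n" using Qh(4) by (auto simp: n_def)
   have n1: "n \<ge> 1" using F1 by (simp add: n_def)
   have hc: "coeff h i : K" for i
   proof -
    have "coeff h i : set h \<union> {\<zero>}" unfolding coeff_img(3)[symmetric] by simp
    moreover have "set h \<subseteq> K" using Qh(2) univ_poly_carrier polynomial_incl by blast
    ultimately show ?thesis using Kc(3) by auto
   qed
   have evh: "eval h x = (\<Oplus>i\<in>{..<n}. coeff h i \<otimes> x [^] i)" if x: "x : carrier R" for x
   proof -
    have "eval h x = (\<Oplus>i\<in>{..<length h}. coeff h i \<otimes> x [^] i)"
     using eval_coeffs[of "length h" "coeff h" x] hc Kc(2) x coeff_list[of h] by simp
    also have "\<dots> = (\<Oplus>i\<in>{..<n}. coeff h i \<otimes> x [^] i)"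
     using hlen hc Kc(2) x coeff_length[of h] by (intro add.finprod_mono_neutral_cong_left) auto
    finally show ?thesis .
   qed
   have "(\<Oplus>i\<in>{..<n}. ?a i \<otimes> x [^] i) = \<zero>" if x: "x : (\<lambda>i. s [^] i) ` C" for x
   proof -
    obtain i where i: "i : C" "x = s [^] i" using x by auto
    have xc: "x : carrier R" using i s by auto
    have nn: "{..<n} = insert 0 {0<..<n}" using n1 by auto
    have "(\<Oplus>i\<in>{..<n}. ?a i \<otimes> x [^] i) = (coeff h 0 \<ominus> ?s1) \<oplus> (\<Oplus>i\<in>{0<..<n}. ?a i \<otimes> x [^] i)" unfolding nn using xc hc Kc(2) s(1) by simp
    also have "(\<Oplus>i\<in>{0<..<n}. ?a i \<otimes> x [^] i) = (\<Oplus>i\<in>{0<..<n}. coeff h i \<otimes> x [^] i)" using xc hc Kc(2) by (intro finsum_cong') auto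
    finally have 1: "(\<Oplus>i\<in>{..<n}. ?a i \<otimes> x [^] i) = (coeff h 0 \<ominus> ?s1) \<oplus> (\<Oplus>i\<in>{0<..<n}. coeff h i \<otimes> x [^] i)" .
    have 2: "eval h x = coeff h 0 \<oplus> (\<Oplus>i\<in>{0<..<n}. coeff h i \<otimes> x [^] i)" unfolding evh[OF xc] nn using xc hc Kc(2) by simp
    define T where "T = (\<Oplus>i\<in>{0<..<n}. coeff h i \<otimes> x [^] i)"
    have cl: "T : carrier R" "coeff h 0 : carrier R" "?s1 : carrier R" using xc hc Kc(2) s(1) by (auto simp: T_def)
    have "coeff h 0 \<oplus> T = ?s1" using h1[OF i(1)] 2 i(2) by (simp add: T_def)
    hence "(coeff h 0 \<ominus> ?s1) \<oplus> T = ?s1 \<ominus> ?s1" using cl by (metis a_minus_def a_ac(1,2) a_inv_closed)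
    thus ?thesis using 1 cl by (simp add: T_def)
   qed
   moreover have "n \<le> card ((\<lambda>i. s [^] i) ` C)" using cardC inj by (subst card_image) (auto simp: C_def inj_on_def n_def)
   ultimately have "?a 0 = \<zero>" by (intro few_roots_coeffs[of n ?a "(\<lambda>i. s [^] i) ` C" 0]) (use n1 hc Kc(2) s(1) in auto)
   hence "coeff h 0 \<ominus> ?s1 = \<zero>" by simp
   hence "coeff h 0 = ?s1" using hc Kc(2) s(1) by simp
   thus ?thesis using hc by metis
  qed
  moreover have "?s1 [^] m = \<one>" using rm ep q_def s(1) sq nat_pow_pow by simp
  ultimately have "?s1 [^] r = \<one>" by (rule roots)
  hence "q dvd e * r" using s(1) sq by (simp add: nat_pow_pow)
  hence "r * (p * e) dvd r * e" using ep by (simp add: q_def mult_ac)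
  hence "p * e dvd 1 * e" using r0 by simp
  moreover have "e ~= 0" using p0 by (simp add: e_def)
  ultimately have "p * e \<le> 1 * e" by simp
  thus False using \<open>e ~= 0\<close> prime_gt_1_nat[OF p(1)] by simp
 qed
 obtain u where u: "c0 = 1 + r * u" "\<not> p dvd u"
 proof -
  have "c0 ~= 0"
  proof
   assume "c0 = 0"
   hence "[0 = 1] (mod r)" using C1[OF c0(1)] by simp
   hence "r = 1" by (metis cong_0_1_nat)
   thus False using p by auto
  qed
  then obtain u where u: "c0 = 1 + r * u" using C1[OF c0(1)] by (metis add.commute cong_to_1_nat dvdE le_add_diff_inverse2 less_one not_le)
  moreover have "\<not> p dvd u"
  proof
   assume "p dvd u"
   hence "r * p dvd r * u" by simp
   hence "[1 + r * u = 1] (mod (r * p))" using cong_add_lcancel_0_nat[of 1] cong_0_iff by blast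
   thus False using c0(2) u by simp
  qed
  ultimately show ?thesis using that by auto
 qed
 \<comment> \<open>Exponents of conjugates multiply: \<open>F(X ^ (c0 ^ i))\<close> vanishes at
   \<open>s\<close>, hence at the conjugate \<open>s [^] c0\<close>.\<close>
 have powF: "eval F (s [^] (c0 ^ i)) = \<zero>" for i
 proof (induct i)
  case 0 thus ?case using F(4) s(1) by simp
 next
  case (Suc i)
  obtain g where g: "g : carrier (K[X])" "\<forall>x\<in>carrier R. eval g x = eval F (x [^] (c0 ^ i))" using polynomial_power_subst[OF K FK] by auto
  have "eval g s = \<zero>" using g s(1) Suc by simp
  hence "eval g (s [^] c0) = \<zero>" using Fdiv[OF g(1)] c0(1) s(1) by (auto simp: C_def)
  thus ?case using g(2) s(1) by (simp add: nat_pow_pow)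
 qed
 have "inj_on (\<lambda>i. s [^] (c0 ^ i)) {..<p ^ t}"
 proof -
  have *: "i = j" if "i < p ^ t" "j < p ^ t" "i \<le> j" "s [^] (c0 ^ i) = s [^] (c0 ^ j)" for i j
  proof -
   have "[c0 ^ i * 1 = c0 ^ i * c0 ^ (j - i)] (mod q)" using that scong by (simp flip: power_add)
   moreover have "coprime (c0 ^ i) q"
   proof -
    have "coprime c0 r" unfolding u(1) by (metis add.commute coprime_commute coprime_iff_gcd_eq_1 gcd_add_mult gcd_1_nat mult.commute)
    hence "coprime c0 p" using p by auto
    thus ?thesis using \<open>coprime c0 r\<close> by (simp add: q_def)
   qed
   ultimately have "[1 = c0 ^ (j - i)] (mod q)" using cong_mult_lcancel_nat by blast
   hence "p ^ t dvd j - i" using order_mod_prime_power[OF p u cond r0, of "j - i"] by (simp add: q_def cong_sym_eq)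
   thus ?thesis using that by (metis diff_is_0_eq' dvd_imp_le gr0I leD less_imp_diff_less diffs0_imp_equal)
  qed
  show ?thesis by (rule inj_onI) (metis * lessThan_iff nat_le_linear)
 qed
 hence "p ^ t = card ((\<lambda>i. s [^] (c0 ^ i)) ` {..<p ^ t})" by (simp add: card_image)
 also have "\<dots> \<le> degree F" using few_roots[OF FR Fn, of "(\<lambda>i. s [^] (c0 ^ i)) ` {..<p ^ t}"] powF s(1) by auto
 also have "degree F \<le> d"
 proof -
  obtain D where D: "D : carrier (K[X])" "D ~= []" "degree D = d"
   and ev: "!!x. x : carrier R ==> eval D x = x [^] d \<ominus> (\<Oplus>j\<in>{..<d}. c j \<otimes> x [^] j)" using monic_polynomial[OF K, of d c, OF d(2)] by auto
  have "eval D s = \<zero>" unfolding ev[OF s(1)] d(3)[symmetric] using s(1) by simp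
  hence "F pdivides D" by (rule Fmin[OF D(1)])
  hence "degree F \<le> degree D" using pdivides_imp_degree_le[OF carrier_is_subring FR _ D(2)] D(1) sr by auto
  thus ?thesis using D(3) by simp
 qed
 finally show ?thesis .
qed (use d in simp)

section \<open>Resolvents in Galois submodules\<close>

text \<open>An element outside the group generated by some \<open>\<sigma>\<close> of maximal order
  leads to \<open>g'\<close> outside with \<open>g' [^] p\<close> inside. Either a power of
  \<open>\<sigma>\<close> corrects \<open>g'\<close> to an element of order \<open>p\<close>, which
  \<open>unique\<close> puts into the cyclic group, or the order of \<open>g'\<close> exceeds that
  of \<open>\<sigma>\<close>.\<close>

lemma (in comm_group) p_group_cyclic:
 fixes p \<mu> :: nat
 assumes p: "prime p" and ex: "!!g. g : carrier G ==> g [^] (p ^ \<mu>) = \<one>"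
  and unique: "!!g s. [|g : carrier G; s : carrier G; g ~= \<one>; s ~= \<one>; g [^] p = \<one>; s [^] p = \<one>|] ==> \<exists>j::nat. g \<otimes> s [^] j = \<one>"
 shows "\<exists>\<sigma>\<in>carrier G. \<exists>t. ord \<sigma> = p ^ t \<and> (\<forall>g\<in>carrier G. \<exists>i::nat. g = \<sigma> [^] i)"
proof -
 have ordp: "\<exists>t\<le>\<mu>. ord g = p ^ t" if "g : carrier G" for g using ex[OF that] pow_eq_id[OF that] divides_primepow_nat[OF p] by auto
 define \<tau> where "\<tau> = (\<lambda>g. SOME t. t \<le> \<mu> \<and> ord g = p ^ t)"
 have \<tau>: "\<tau> g \<le> \<mu>" "ord g = p ^ \<tau> g" if "g : carrier G" for g using someI_ex[OF ordp[OF that, unfolded Bex_def]] by (auto simp: \<tau>_def)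
 obtain \<sigma> where \<sigma>: "\<sigma> : carrier G" "!!g. g : carrier G ==> \<tau> g \<le> \<tau> \<sigma>"
  using ex_has_greatest_nat[of "\<lambda>g. g : carrier G" \<one> \<tau> "Suc \<mu>"] \<tau>(1) by (metis le_imp_less_Suc one_closed)
 define t where "t = \<tau> \<sigma>"
 have ord\<sigma>: "ord \<sigma> = p ^ t" using \<tau>(2)[OF \<sigma>(1)] by (simp add: t_def)
 have p0: "p > 0" "p > 1" using prime_gt_0_nat[OF p] prime_gt_1_nat[OF p] .
 let ?S = "range (\<lambda>i::nat. \<sigma> [^] i)"
 have Smult: "x \<otimes> y : ?S" if "x : ?S" "y : ?S" for x y using that \<sigma>(1) by (auto simp: nat_pow_mult)
 have Spow: "x [^] i : ?S" if "x : ?S" for x and i :: nat using that \<sigma>(1) by (auto simp: nat_pow_pow)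
 have Sinv: "inv x : ?S" if xS: "x : ?S" for x
 proof -
  obtain i where i: "x = \<sigma> [^] (i::nat)" using xS by auto
  have "x \<otimes> x [^] (p ^ \<mu> - 1) = x [^] (p ^ \<mu>)" using i \<sigma>(1) p0 by (metis One_nat_def Suc_pred nat_pow_Suc2 nat_pow_closed zero_less_power)
  hence "inv x = x [^] (p ^ \<mu> - 1)" using i \<sigma>(1) ex by (metis inv_equality m_comm nat_pow_closed)
  thus ?thesis using Spow[OF xS] by simp
 qed
 have "g : ?S" if g: "g : carrier G" for g
 proof (rule ccontr)
  assume gS: "g \<notin> ?S"
  define u where "u = (LEAST u. g [^] (p ^ u) : ?S)"
  have "g [^] (p ^ \<mu>) : ?S" using ex[OF g] by (metis nat_pow_0 rangeI)
  hence u1: "g [^] (p ^ u) : ?S" unfolding u_def by (rule LeastI)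
  have u0: "u > 0" using u1 gS g by auto
  define g' where "g' = g [^] (p ^ (u - 1))"
  have g'c: "g' : carrier G" using g by (simp add: g'_def)
  have g'S: "g' \<notin> ?S" using not_less_Least[of "u - 1" "\<lambda>u. g [^] (p ^ u) : ?S"] u0 by (auto simp: g'_def u_def)
  have "g' [^] p = g [^] (p ^ u)" using g u0 by (simp add: g'_def nat_pow_pow power_eq_if mult.commute)
  then obtain i where i: "g' [^] p = \<sigma> [^] (i::nat)" using u1 by auto
  have t0: "t > 0"
  proof (rule ccontr)
   assume "\<not> t > 0"
   hence "ord g' = 1" using \<sigma>(2)[OF g'c] \<tau>(2)[OF g'c] by (simp add: t_def)
   hence "g' = \<one>" using g'c ord_eq_1 by simp
   thus False using g'S by (metis nat_pow_0 rangeI)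
  qed
  define s where "s = \<sigma> [^] (p ^ (t - 1))"
  have s: "s : carrier G" "s : ?S" "s ~= \<one>" "s [^] p = \<one>"
  proof -
   show "s : carrier G" "s : ?S" using \<sigma>(1) by (auto simp: s_def)
   have "\<not> p ^ t dvd p ^ (t - 1)" using t0 p0 by (simp add: dvd_power_iff_le)
   thus "s ~= \<one>" using pow_eq_id[OF \<sigma>(1)] ord\<sigma> by (simp add: s_def)
   have "p ^ (t - 1) * p = p ^ t" using t0 by (simp add: power_eq_if)
   thus "s [^] p = \<one>" using pow_eq_id[OF \<sigma>(1)] ord\<sigma> \<sigma>(1) by (simp add: s_def nat_pow_pow)
  qed
  show False
  proof (cases "p dvd i")
   case True
   then obtain i' where i': "i = i' * p" by (metis dvdE mult.commute)
   define x where "x = \<sigma> [^] i'"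
   have x: "x : ?S" "x : carrier G" using \<sigma>(1) by (auto simp: x_def)
   have xp: "x [^] p = g' [^] p" using i i' \<sigma>(1) by (simp add: x_def nat_pow_pow)
   define g'' where "g'' = g' \<otimes> inv x"
   have g'': "g'' : carrier G" using g'c x by (simp add: g''_def)
   have g'e: "g' = g'' \<otimes> x" using g'c x by (simp add: g''_def m_assoc)
   have "g'' ~= \<one>" using g'e g'S x by auto
   moreover have "g'' [^] p = \<one>" using xp g'c x by (simp add: g''_def nat_pow_distrib nat_pow_inv)
   ultimately obtain j where j: "g'' \<otimes> s [^] (j::nat) = \<one>" using unique[OF g'' s(1)] s by auto
   hence "g'' = inv (s [^] j)" using g'' s by (metis inv_equality nat_pow_closed)
   hence "g'' : ?S" using Sinv Spow s(2) by simp
   thus False using Smult[of g'' x] x g'e g'S by simp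
  next
   case False
   have tt: "p ^ t = p * p ^ (t - 1)" using t0 by (simp add: power_eq_if)
   have "g' [^] (p ^ t) = \<sigma> [^] (i * p ^ (t - 1))" unfolding tt using i g'c \<sigma>(1) by (simp flip: nat_pow_pow)
   moreover have "\<not> p ^ t dvd i * p ^ (t - 1)" unfolding tt using False p0 by simp
   ultimately have "g' [^] (p ^ t) ~= \<one>" using pow_eq_id[OF \<sigma>(1)] ord\<sigma> by simp
   moreover have "ord g' dvd p ^ t" using \<sigma>(2)[OF g'c] \<tau>(2)[OF g'c] by (simp add: t_def le_imp_power_dvd)
   ultimately show False using pow_eq_id[OF g'c] by simp
  qed
 qed
 thus ?thesis using \<sigma>(1) ord\<sigma> by auto
qed

section \<open>Group structure of the automorphisms and submodules over the group ring\<close>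

context aut_group
begin

abbreviation GG where "GG \<equiv> galois_group R K"

abbreviation gpow (infixr "\<up>" 75) where "g \<up> i \<equiv> g [^]\<^bsub>GG\<^esub> i"

lemma aut_Bij: "g : G ==> g : Bij (carrier R)" using aut_iso aut_ext by (auto simp: Bij_def ring_iso_def)

lemma GG_simps [simp]: "carrier GG = G" "\<one>\<^bsub>GG\<^esub> = (\<lambda>x\<in>carrier R. x)" "[|g : G; h : G|] ==> g \<otimes>\<^bsub>GG\<^esub> h = compose (carrier R) g h"
 using galois_group_eq aut_Bij by (auto simp: galois_group_def BijGroup_def)

lemma GG_group: "group GG"
proof (rule groupI)
 fix g assume "g : carrier GG"
 hence g: "g : G" by simp
 obtain h where h: "h : G" "!!x. x : carrier R ==> h (g x) = x" using aut_inverse[OF g] by metis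
 thus "\<exists>h\<in>carrier GG. h \<otimes>\<^bsub>GG\<^esub> g = \<one>\<^bsub>GG\<^esub>" using g by (auto simp: compose_def fun_eq_iff)
next
 fix x y z assume xyz: "x : carrier GG" "y : carrier GG" "z : carrier GG"
 thus "x \<otimes>\<^bsub>GG\<^esub> y \<otimes>\<^bsub>GG\<^esub> z = x \<otimes>\<^bsub>GG\<^esub> (y \<otimes>\<^bsub>GG\<^esub> z)" by (simp add: aut_comp) (simp add: compose_def fun_eq_iff)
next
 fix x assume "x : carrier GG"
 hence x: "x : G" "x : carrier R \<rightarrow> carrier R" "x : extensional (carrier R)" using aut_ext by auto
 thus "\<one>\<^bsub>GG\<^esub> \<otimes>\<^bsub>GG\<^esub> x = x" using aut_id by simp
qed (auto simp: aut_comp aut_id)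

sublocale GG: group "galois_group R (fixed_field R G)" by (rule GG_group)

lemma pow_in [simp]: "g : G ==> g \<up> (i::nat) : G" using GG.nat_pow_closed[of g i] by simp

lemma pow_0_apply [simp]: "x : carrier R ==> (g \<up> (0::nat)) x = x" by simp

lemma pow_Suc_apply: "[|g : G; x : carrier R|] ==> (g \<up> Suc i) x = g ((g \<up> i) x)"
 using GG.nat_pow_Suc2[of g i] by (simp add: compose_def del: GG.nat_pow_Suc)

lemma pow_add_apply: "[|g : G; x : carrier R|] ==> (g \<up> (i + j)) x = (g \<up> i) ((g \<up> (j::nat)) x)"
 by (simp add: compose_def flip: GG.nat_pow_mult)

lemma mult_apply: "[|g : G; h : G; x : carrier R|] ==> (g \<otimes>\<^bsub>GG\<^esub> h) x = g (h x)" by (simp add: compose_def)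

definition submodule :: "'a set \<Rightarrow> bool" where "submodule N \<longleftrightarrow> N \<subseteq> carrier R \<and> \<zero> : N \<and> (\<forall>x\<in>N. \<forall>y\<in>N. x \<oplus> y : N) \<and>
   (\<forall>c\<in>K. \<forall>x\<in>N. c \<otimes> x : N) \<and> (\<forall>g\<in>G. \<forall>x\<in>N. g x : N)"

lemma submoduleD:
 assumes "submodule N"
 shows "N \<subseteq> carrier R" "!!x. x : N ==> x : carrier R" "\<zero> : N" "!!x y. x : N ==> y : N ==> x \<oplus> y : N"
  "!!c x. c : K ==> x : N ==> c \<otimes> x : N" "!!g x. g : G ==> x : N ==> g x : N" using assms by (auto simp: submodule_def)

lemma submodule_finsum:
 assumes N: "submodule N" and "finite I" "!!i. i : I ==> f i : N"
 shows "(\<Oplus>i\<in>I. f i) : N" using assms(2,3)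
proof (induct I)
 case (insert i I)
 thus ?case using submoduleD[OF N] by simp
qed (use submoduleD[OF N] in simp)

end

locale ab_aut_group = aut_group +
 assumes aut_commute: "[|g : G; h : G; x : carrier R|] ==> g (h x) = h (g x)"
begin

lemma GG_comm: "comm_group GG" using aut_commute by (intro GG.group_comm_groupI) (auto simp: compose_def)

end

text \<open>Here \<open>m\<close> is a power of \<open>p\<close> annihilating \<open>G\<close>, and
  \<open>\<zeta>\<close> generates the \<open>m\<close>-th roots of unity of the fixed field. In
  \<open>cond\<close> the hypothesis at 2 takes the form in which it is used: a power of 2 that is
  divisible by 2 and differs from 2 is divisible by 4.\<close>

locale kummer_data = ab_aut_group +
 fixes p r m :: nat and \<zeta> :: 'a
 assumes p: "prime p" and m: "\<exists>\<mu>. m = p ^ \<mu>" and pr: "p dvd r" and rm: "r dvd m"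
  and exponent: "!!g x. [|g : G; x : carrier R|] ==> (g [^]\<^bsub>galois_group R (fixed_field R G)\<^esub> m) x = x"
  and zetaK: "\<zeta> : fixed_field R G" and zeta_ord: "!!i::nat. \<zeta> [^] i = \<one> \<longleftrightarrow> r dvd i"
  and roots: "!!x. [|x : fixed_field R G; x [^] m = \<one>|] ==> \<exists>i::nat. x = \<zeta> [^] i" and cond: "p ~= 2 \<or> 4 dvd r \<or> \<not> 8 dvd m"
begin

lemma m0: "m > 0" and r0: "r > 0" and p0: "p > 0" "p > 1" using m rm p prime_gt_1_nat by (auto intro!: gr0I)

lemma zetac [simp]: "\<zeta> : carrier R" using zetaK Kc by auto

lemma zeta0: "\<zeta> ~= \<zero>" using zeta_ord[of r] r0 by (auto simp: nat_pow_zero)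

lemma zeta_powK [simp]: "\<zeta> [^] (i::nat) : K" using zetaK Kc by auto

lemma zeta_pow_nonzero [simp]: "\<zeta> [^] (i::nat) ~= \<zero>" using pow_nonzero[OF zetac zeta0] .

lemma zeta_eq: "\<zeta> [^] (i::nat) = \<zeta> [^] (j::nat) \<longleftrightarrow> [i = j] (mod r)" by (rule pow_eq_pow_cong[OF zetac zeta0 zeta_ord])

lemma zeta_inv: "\<zeta> [^] (i * (r - 1)) \<otimes> \<zeta> [^] i = \<one>"
proof -
 have "i * (r - 1) + i = r * i" using r0 by (simp add: algebra_simps)
 thus ?thesis using zeta_ord[of "r * i"] by (simp add: nat_pow_mult)
qed

definition eigen :: "'a \<Rightarrow> ('a \<Rightarrow> 'a) set" where "eigen y = {g : G. \<exists>i::nat. g y = \<zeta> [^] i \<otimes> y}"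

lemma eigen_G: "g : eigen y ==> g : G" by (simp add: eigen_def)

lemma eigen_subgroup: assumes y: "y : carrier R" shows "subgroup (eigen y) GG"
proof (rule GG.subgroupI)
 show "eigen y \<subseteq> carrier GG" by (auto simp: eigen_def)
 show "eigen y ~= {}" using aut_id y by (auto simp: eigen_def intro!: exI[of _ "0::nat"])
next
 fix g h assume "g : eigen y" "h : eigen y"
 then obtain i j where gh: "g : G" "h : G" "g y = \<zeta> [^] (i::nat) \<otimes> y" "h y = \<zeta> [^] (j::nat) \<otimes> y" by (auto simp: eigen_def)
 have "(g \<otimes>\<^bsub>GG\<^esub> h) y = \<zeta> [^] (j + i) \<otimes> y" using gh y by (simp add: mult_apply aut_mult aut_fix m_assoc flip: nat_pow_mult del: GG_simps(3))
 thus "g \<otimes>\<^bsub>GG\<^esub> h : eigen y" using gh by (auto simp: eigen_def aut_comp)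
next
 fix g assume "g : eigen y"
 then obtain i where g: "g : G" "g y = \<zeta> [^] (i::nat) \<otimes> y" by (auto simp: eigen_def)
 let ?h = "inv\<^bsub>GG\<^esub> g"
 have h: "?h : G" using GG.inv_closed[of g] g by simp
 have "?h (g y) = y" using GG.l_inv[of g] g h y mult_apply[of ?h g y] by simp
 hence "\<zeta> [^] i \<otimes> ?h y = y" using g h y by (simp add: aut_mult aut_fix)
 hence "\<zeta> [^] (i * (r - 1)) \<otimes> (\<zeta> [^] i \<otimes> ?h y) = \<zeta> [^] (i * (r - 1)) \<otimes> y" by simp
 hence "?h y = \<zeta> [^] (i * (r - 1)) \<otimes> y" using zeta_inv[of i] h y by (simp flip: m_assoc)
 thus "inv\<^bsub>GG\<^esub> g : eigen y" using h by (auto simp: eigen_def)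
qed

lemma eigen_aut_group: assumes "y : carrier R" shows "aut_group R (eigen y)"
proof (rule subgroup_aut)
 show "eigen y \<subseteq> G" by (auto simp: eigen_def)
 show "(\<lambda>x\<in>carrier R. x) : eigen y" using subgroup.one_closed[OF eigen_subgroup[OF assms]] by simp
 show "compose (carrier R) g h : eigen y" if "g : eigen y" "h : eigen y" for g h
  using subgroup.m_closed[OF eigen_subgroup[OF assms] that] that eigen_G by simp
qed

text \<open>For each of the \<open>p\<close> solutions \<open>d\<close> of
  \<open>d [^] p \<otimes> \<zeta> [^] (p * e) = \<one>\<close>, the translates of \<open>y\<close>
  weighted with the powers of \<open>d\<close> sum to an eigenvector of \<open>g\<close>. It stays
  an eigenvector for \<open>eigen y\<close> because \<open>G\<close> is abelian.\<close>

lemma resolvent: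
 assumes N: "submodule N" and y: "y : N" "y ~= \<zero>" and g: "g : G" and gp: "(g \<up> p) y = \<zeta> [^] (p * e) \<otimes> y"
 shows "\<exists>z\<in>N. z ~= \<zero> \<and> g : eigen z \<and> eigen y \<subseteq> eigen z"
proof -
 note Nd = submoduleD[OF N]
 have yc: "y : carrier R" using y Nd by auto
 \<comment> \<open>The exponent of \<open>d j\<close>: as \<open>\<zeta>\<close> has order
   \<open>r\<close>, \<open>e * (r - 1)\<close> stands for \<open>- e\<close>, and the multiples of
   \<open>r div p\<close> run through the \<open>p\<close>-th roots of unity.\<close>
 define k where "k = (\<lambda>j. e * (r - 1) + j * (r div p))"
 define d where "d = (\<lambda>j. \<zeta> [^] k j)"
 have dK: "d j : K" "d j : carrier R" for j by (auto simp: d_def)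
 have rp: "r div p * p = r" using pr by simp
 have dp: "d j [^] p \<otimes> \<zeta> [^] (p * e) = \<one>" for j
 proof -
  have "k j * p + p * e = p * (e * (r - 1) + e) + j * (r div p * p)" by (simp add: k_def algebra_simps)
  also have "e * (r - 1) + e = e * r" using r0 by (simp add: algebra_simps)
  finally have "r dvd k j * p + p * e" using rp by simp
  thus ?thesis using zeta_ord by (simp add: d_def nat_pow_pow nat_pow_mult)
 qed
 define w where "w = (\<lambda>i::nat. (g \<up> i) y)"
 have gi: "w i : N" "w i : carrier R" for i using Nd(6)[OF pow_in[OF g] y(1)] Nd by (auto simp: w_def)
 have w0: "w 0 = y" and wSuc: "g (w i) = w (Suc i)" and wp: "w p = \<zeta> [^] (p * e) \<otimes> y" for i
  using pow_Suc_apply[OF g yc, of i] yc gp by (simp_all add: w_def del: GG.nat_pow_Suc)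
 define z where "z = (\<lambda>j. \<Oplus>i\<in>{..<p}. d j [^] i \<otimes> w i)"
 have zN: "z j : N" for j unfolding z_def using gi dK Nd Kc by (intro submodule_finsum[OF N]) auto
 have zc: "z j : carrier R" for j using zN Nd by auto
 \<comment> \<open>If all resolvents vanished, the polynomial with coefficients \<open>w i\<close>
   and degree below \<open>p\<close> would have the \<open>p\<close> zeros \<open>d j\<close>, and
   its constant term \<open>w 0 = y\<close> would be zero.\<close>
 have "\<exists>j. z j ~= \<zero>"
 proof (rule ccontr)
  assume "\<not> ?thesis"
  hence z0: "z j = \<zero>" for j by auto
  have inj: "inj_on d {..<p}"
  proof (rule inj_onI)
   fix i j assume ij: "i : {..<p}" "j : {..<p}" "d i = d j"
   hence "[i * (r div p) = j * (r div p)] (mod p * (r div p))"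
    using zeta_eq[of "k i" "k j"] rp by (simp add: d_def k_def cong_add_lcancel_nat mult.commute)
   hence "[i = j] (mod p)" using rp r0 by (auto simp: cong_def simp flip: mult_mod_left)
   thus "i = j" using ij cong_less_modulus_unique_nat by auto
  qed
  have "w 0 = \<zero>"
  proof (rule few_roots_coeffs[of p w "d ` {..<p}" 0])
   show "p \<le> card (d ` {..<p})" using inj by (simp add: card_image)
   fix x assume "x : d ` {..<p}"
   then obtain j where j: "x = d j" by auto
   have "(\<Oplus>i\<in>{..<p}. w i \<otimes> x [^] i) = z j" unfolding z_def j using gi dK by (intro finsum_cong') (auto simp: m_comm)
   thus "(\<Oplus>i\<in>{..<p}. w i \<otimes> x [^] i) = \<zero>" using z0 by simp
  qed (use gi dK p0 in auto)
  thus False using y w0 by simp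
 qed
 then obtain j where j: "z j ~= \<zero>" by auto
 \<comment> \<open>The product shifts the summation index by one; the new term at \<open>p\<close>
   is the old one at 0 by the choice of \<open>d j\<close>.\<close>
 have "d j \<otimes> g (z j) = z j"
 proof -
  let ?f = "\<lambda>i. d j [^] i \<otimes> w i"
  have fc: "?f i : carrier R" for i using gi dK by auto
  have "g (z j) = (\<Oplus>i\<in>{..<p}. d j [^] i \<otimes> w (Suc i))" by (auto simp: z_def g fc aut_finsum gi dK finsum_cong' aut_mult aut_pow aut_fix wSuc)
  hence "d j \<otimes> g (z j) = (\<Oplus>i\<in>{..<p}. d j \<otimes> (d j [^] i \<otimes> w (Suc i)))" using gi dK by (simp add: finsum_rdistr)
  also have "\<dots> = (\<Oplus>i\<in>{..<p}. ?f (Suc i))" using gi dK by (intro finsum_cong') (auto simp: m_ac)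
  also have "\<dots> = (\<Oplus>i\<in>Suc ` {..<p}. ?f i)" using fc by (intro finsum_reindex[symmetric]) auto
  also have "Suc ` {..<p} = insert p {0<..<p}" using p0 by (simp add: lessThan_atLeast0) auto
  also have "(\<Oplus>i\<in>insert p {0<..<p}. ?f i) = ?f p \<oplus> (\<Oplus>i\<in>{0<..<p}. ?f i)" using fc by simp
  also have "?f p = ?f 0"
  proof -
   have "?f p = (d j [^] p \<otimes> \<zeta> [^] (p * e)) \<otimes> y" using wp dK yc by (simp add: m_assoc)
   thus ?thesis using dp w0 by simp
  qed
  also have "?f 0 \<oplus> (\<Oplus>i\<in>{0<..<p}. ?f i) = (\<Oplus>i\<in>insert 0 {0<..<p}. ?f i)" using fc gi by simp
  also have "insert 0 {0<..<p} = {..<p}" using p0 by auto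
  finally show ?thesis by (simp add: z_def)
 qed
 hence "\<zeta> [^] (k j * (r - 1)) \<otimes> (\<zeta> [^] k j \<otimes> g (z j)) = \<zeta> [^] (k j * (r - 1)) \<otimes> z j" by (simp add: d_def)
 hence "g (z j) = \<zeta> [^] (k j * (r - 1)) \<otimes> z j" using zeta_inv[of "k j"] g zc by (simp flip: m_assoc)
 hence gz: "g : eigen (z j)" using g by (auto simp: eigen_def)
 have "h : eigen (z j)" if hy: "h : eigen y" for h
 proof -
  obtain i where h: "h : G" "h y = \<zeta> [^] (i::nat) \<otimes> y" using hy by (auto simp: eigen_def)
  have "h (z j) = (\<Oplus>l\<in>{..<p}. h (d j [^] l \<otimes> w l))" unfolding z_def using h gi dK by (intro aut_finsum) auto
  also have "\<dots> = (\<Oplus>l\<in>{..<p}. \<zeta> [^] i \<otimes> (d j [^] l \<otimes> w l))"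
  by (auto simp: w_def aut_commute[OF h(1) pow_in[OF g] yc] h g yc aut_mult aut_fix gi dK aut_pow m_lcomm)
  also have "\<dots> = \<zeta> [^] i \<otimes> z j" unfolding z_def using gi dK by (intro finsum_rdistr[symmetric]) auto
  finally show ?thesis using h by (auto simp: eigen_def)
 qed
 thus ?thesis using zN j gz by auto
qed

end

lemma (in ring) dimension_subring:
 assumes E: "subring E R" and dim: "ring.dimension (R\<lparr>carrier := E\<rparr>) n K V"
 shows "dimension n K V" using dim
proof (induct rule: ring.dimension.induct[OF subring_is_ring[OF E], consumes 1])
 case (1 K)
 thus ?case by simp
next
 case (2 v V n K)
 thus ?case using Suc_dim[of v V n K] subringE(1)[OF E] line_extension_consistent[OF E] by auto
qed

text \<open>The action of a companion matrix on coordinates. One formula serves both the orbit of an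
  automorphism and the powers of a root, which is what makes the two comparable.\<close>

lemma (in ring) finsum_shift:
 fixes d :: nat
 assumes "d > 0" "!!j. u j : carrier R" "!!j. j < d ==> c j : carrier R" "!!j. j < d ==> e j : carrier R" and "u d = (\<Oplus>j\<in>{..<d}. c j \<otimes> u j)"
 shows "(\<Oplus>j\<in>{..<d}. e j \<otimes> u (Suc j)) = (\<Oplus>j\<in>{..<d}. ((if j = 0 then \<zero> else e (j - 1)) \<oplus> e (d - 1) \<otimes> c j) \<otimes> u j)"
proof -
 obtain d' where d': "d = Suc d'" using assms(1) by (cases d) auto
 have ins: "{..<Suc d'} = insert d' {..<d'}" by auto
 have "(\<Oplus>j\<in>{..<d}. e j \<otimes> u (Suc j)) = e d' \<otimes> u d \<oplus> (\<Oplus>j\<in>{..<d'}. e j \<otimes> u (Suc j))" unfolding d' ins using assms d' by simp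
 also have "(\<Oplus>j\<in>{..<d'}. e j \<otimes> u (Suc j)) = (\<Oplus>j\<in>{..<d}. (if j = 0 then \<zero> else e (j - 1)) \<otimes> u j)"
 proof -
  have "(\<Oplus>j\<in>{..<d}. (if j = 0 then \<zero> else e (j - 1)) \<otimes> u j) = (\<Oplus>j\<in>insert 0 (Suc ` {..<d'}). (if j = 0 then \<zero> else e (j - 1)) \<otimes> u j)"
   unfolding d' by (simp add: lessThan_Suc_eq_insert_0)
  also have "\<dots> = \<zero> \<otimes> u 0 \<oplus> (\<Oplus>j\<in>Suc ` {..<d'}. (if j = 0 then \<zero> else e (j - 1)) \<otimes> u j)" using assms d' by (subst finsum_insert) auto
  also have "(\<Oplus>j\<in>Suc ` {..<d'}. (if j = 0 then \<zero> else e (j - 1)) \<otimes> u j) = (\<Oplus>j\<in>{..<d'}. e j \<otimes> u (Suc j))"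
   using assms d' by (subst finsum_reindex) auto
  finally show ?thesis using assms d' by simp
 qed
 also have "e d' \<otimes> u d = (\<Oplus>j\<in>{..<d}. e d' \<otimes> (c j \<otimes> u j))" unfolding assms(5) using assms d' by (intro finsum_rdistr) auto
 also have "(\<Oplus>j\<in>{..<d}. e d' \<otimes> (c j \<otimes> u j)) \<oplus> (\<Oplus>j\<in>{..<d}. (if j = 0 then \<zero> else e (j - 1)) \<otimes> u j)
   = (\<Oplus>j\<in>{..<d}. e d' \<otimes> (c j \<otimes> u j) \<oplus> (if j = 0 then \<zero> else e (j - 1)) \<otimes> u j)" using assms d' by simp
 also have "\<dots> = (\<Oplus>j\<in>{..<d}. ((if j = 0 then \<zero> else e (j - 1)) \<oplus> e (d - 1) \<otimes> c j) \<otimes> u j)"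
 proof (intro finsum_cong' refl)
  fix j assume j: "j : {..<d}"
  define f where "f = (if j = 0 then \<zero> else e (j - 1))"
  have "f : carrier R" "e d' : carrier R" "c j : carrier R" "u j : carrier R" using assms d' j by (auto simp: f_def)
  hence "e d' \<otimes> (c j \<otimes> u j) \<oplus> f \<otimes> u j = (f \<oplus> e d' \<otimes> c j) \<otimes> u j" by (simp add: l_distr m_assoc a_comm)
  thus "e d' \<otimes> (c j \<otimes> u j) \<oplus> (if j = 0 then \<zero> else e (j - 1)) \<otimes> u j =
    ((if j = 0 then \<zero> else e (j - 1)) \<oplus> e (d - 1) \<otimes> c j) \<otimes> u j" using d' by (simp add: f_def)
 qed (use assms d' in auto)
 finally show ?thesis .
qed

section \<open>Independence of an orbit and the eigenspace inside a submodule\<close>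

context kummer_data
begin

lemma coprime_r: "\<not> p dvd a ==> coprime r a"
proof -
 assume a: "\<not> p dvd a"
 obtain j where "r = p ^ j" using m rm divides_primepow_nat[OF p] by auto
 thus "coprime r a" using a p by (simp add: prime_imp_coprime)
qed

lemma eigen_pow:
 assumes "y : carrier R" "\<tau> : G" "(\<tau> \<up> (k::nat)) y = \<zeta> [^] a \<otimes> y"
 shows "(\<tau> \<up> (k * i)) y = \<zeta> [^] (a * i) \<otimes> y"
proof (induct i)
 case (Suc i)
 have "(\<tau> \<up> (k * Suc i)) y = (\<tau> \<up> k) ((\<tau> \<up> (k * i)) y)" using pow_add_apply[OF assms(2,1), of k "k * i"] by simp
 also have "\<dots> = \<zeta> [^] (a * i) \<otimes> (\<zeta> [^] a \<otimes> y)" using Suc assms by (simp add: aut_mult aut_fix)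
 also have "\<dots> = \<zeta> [^] (a * Suc i) \<otimes> y" using assms by (simp add: m_assoc[symmetric] nat_pow_mult add.commute)
 finally show ?case .
qed (use assms in simp)

lemma zeta_smult_eq:
 assumes "y : carrier R" "y ~= \<zero>" "\<zeta> [^] (a::nat) \<otimes> y = \<zeta> [^] (b::nat) \<otimes> y"
 shows "[a = b] (mod r)" using assms m_rcancel[of y "\<zeta> [^] a" "\<zeta> [^] b"] zeta_eq by auto

lemma zeta_smult_one:
 assumes "y : carrier R" "y ~= \<zero>" "\<zeta> [^] (a::nat) \<otimes> y = y"
 shows "r dvd a" using zeta_smult_eq[OF assms(1,2), of a 0] assms by (simp add: cong_0_iff)

text \<open>On the span of the orbit, \<open>\<tau>\<close> is a \<open>K\<close>-linear map with
  cyclic vector \<open>y\<close>. A shortest relation gives its characteristic polynomial, of degree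
  \<open>d\<close> say, and a zero \<open>s\<close> of it satisfies
  \<open>s [^] (p ^ t) = \<zeta> [^] a\<close>, a root of unity of order \<open>r\<close> because
  \<open>p\<close> does not divide \<open>a\<close>. Then \<open>root_of_unity_degree\<close> bounds
  \<open>d\<close> from below by \<open>p ^ t\<close>.\<close>

lemma orbit_lin_indep:
 assumes y: "y : carrier R" "y ~= \<zero>" and \<tau>: "\<tau> : G" and eig: "(\<tau> \<up> (p ^ t)) y = \<zeta> [^] a \<otimes> y" and ta: "t = 0 \<or> \<not> p dvd a"
 shows "lin_indep K {..<p ^ t} (\<lambda>i. (\<tau> \<up> i) y)"
proof -
 define w where "w = (\<lambda>i::nat. (\<tau> \<up> i) y)"
 have wc: "w i : carrier R" for i using y \<tau> by (simp add: w_def)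
 have w0: "w 0 = y" using y by (simp add: w_def)
 have wSuc: "w (Suc i) = \<tau> (w i)" for i using pow_Suc_apply[OF \<tau> y(1)] by (simp add: w_def del: GG.nat_pow_Suc)
 have li1: "lin_indep K {..<Suc 0} w" unfolding lin_indep_def using y Kc w0 integral_iff by (auto simp: lessThan_Suc)
 have "lin_indep K {..<p ^ t} w"
 proof (cases "t = 0")
  case True
  thus ?thesis using li1 by simp
 next
  case False
  hence pa: "\<not> p dvd a" using ta by simp
  \<comment> \<open>The automorphism \<open>\<tau> \<up> m\<close> is the identity, whereas
    \<open>\<tau> \<up> (p ^ t)\<close> multiplies \<open>y\<close> by a root of unity of order
    exactly \<open>r\<close>.\<close>
  have rpm: "r * p ^ t dvd m"
  proof -
   obtain \<mu> where \<mu>: "m = p ^ \<mu>" using m by auto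
   have "t \<le> \<mu>"
   proof (rule ccontr)
    assume "\<not> t \<le> \<mu>"
    hence "p ^ t = m * p ^ (t - \<mu>)" using \<mu> by (simp flip: power_add)
    moreover have "(\<tau> \<up> (m * p ^ (t - \<mu>))) y = \<zeta> [^] (0 * p ^ (t - \<mu>)) \<otimes> y" using exponent[OF \<tau> y(1)] y by (intro eigen_pow[OF y(1) \<tau>]) simp
    ultimately have "\<zeta> [^] a \<otimes> y = y" using eig y by simp
    hence "r dvd a" using zeta_smult_one[OF y] by simp
    thus False using pa pr by auto
   qed
   then obtain m' where m': "m = p ^ t * m'" using \<mu> by (metis dvdE le_imp_power_dvd)
   have "\<zeta> [^] (a * m') \<otimes> y = y" using eigen_pow[OF y(1) \<tau> eig, of m'] exponent[OF \<tau> y(1)] m' by simp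
   hence "r dvd a * m'" using zeta_smult_one[OF y] by simp
   hence "r dvd m'" using coprime_r[OF pa] coprime_dvd_mult_right_iff by auto
   thus ?thesis using m' by simp
  qed
  \<comment> \<open>For \<open>p = 2\<close> and \<open>t\<close> at least 2 the number
    \<open>r * p ^ t\<close> is divisible by 8, hence so is \<open>m\<close>, and
    \<open>cond\<close> yields \<open>4 dvd r\<close>.\<close>
  have cond': "t \<le> 1 \<or> p ~= 2 \<or> 4 dvd r"
  proof (rule ccontr)
   assume c: "\<not> ?thesis"
   hence "(2::nat) ^ 2 dvd p ^ t" using le_imp_power_dvd[of 2 t "2::nat"] by auto
   hence "2 * 2 ^ 2 dvd r * p ^ t" using pr c by auto
   hence "8 dvd m" using rpm dvd_trans by simp
   thus False using cond c by auto
  qed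
  show ?thesis
  proof (rule ccontr)
   assume nli: "\<not> lin_indep K {..<p ^ t} w"
   \<comment> \<open>The least length of a dependent initial piece of the orbit; with
     \<open>d = D - 1\<close>, the translate \<open>w d\<close> is a combination of the preceding
     ones.\<close>
   define D where "D = (LEAST d. \<not> lin_indep K {..<d} w)"
   have D1: "\<not> lin_indep K {..<D} w" unfolding D_def using nli by (rule LeastI)
   have D2: "D \<le> p ^ t" unfolding D_def using nli by (rule Least_le)
   have Dmin: "lin_indep K {..<d} w" if "d < D" for d using not_less_Least[of d] that unfolding D_def by auto
   have "D ~= 0" using D1 by (auto simp: lin_indep_def)
   moreover have "D ~= Suc 0" using D1 li1 by auto
   ultimately obtain d where d: "D = Suc d" "d > 0" by (cases D) auto
   have lid: "lin_indep K {..<d} w" using Dmin d by simp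
   obtain c where c: "\<forall>j\<in>{..<Suc d}. c j : K" "(\<Oplus>j\<in>{..<Suc d}. c j \<otimes> w j) = \<zero>" "\<not> (\<forall>j\<in>{..<Suc d}. c j = \<zero>)"
    using D1 unfolding d(1) lin_indep_def by auto
   have cR: "c j : carrier R" if "j < Suc d" for j using c(1) that Kc by auto
   have ins: "{..<Suc d} = insert d {..<d}" by auto
   have sum: "c d \<otimes> w d \<oplus> (\<Oplus>j\<in>{..<d}. c j \<otimes> w j) = \<zero>" using c(2) cR wc unfolding ins by simp
   have sc: "(\<Oplus>j\<in>{..<d}. c j \<otimes> w j) : carrier R" using cR wc by simp
   have cd: "c d ~= \<zero>"
   proof
    assume "c d = \<zero>"
    hence "(\<Oplus>j\<in>{..<d}. c j \<otimes> w j) = \<zero>" using sum sc wc by simp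
    hence "\<forall>j\<in>{..<d}. c j = \<zero>" using lid c(1) unfolding lin_indep_def by auto
    thus False using c(3) \<open>c d = \<zero>\<close> by (auto simp: less_Suc_eq)
   qed
   define c' where "c' = (\<lambda>j. \<ominus> (inv (c d)) \<otimes> c j)"
   have c'K: "c' j : K" if "j < d" for j using that c(1) cd Kc by (auto simp: c'_def)
   have wd: "w d = (\<Oplus>j\<in>{..<d}. c' j \<otimes> w j)"
   proof -
    have "(\<Oplus>j\<in>{..<d}. c' j \<otimes> w j) = (\<Oplus>j\<in>{..<d}. \<ominus> (inv (c d)) \<otimes> (c j \<otimes> w j))"
     using cR wc cd by (intro finsum_cong') (auto simp: c'_def m_assoc)
    also have "\<dots> = \<ominus> (inv (c d)) \<otimes> (\<Oplus>j\<in>{..<d}. c j \<otimes> w j)" using cR wc cd by (intro finsum_rdistr[symmetric]) auto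
    also have "(\<Oplus>j\<in>{..<d}. c j \<otimes> w j) = \<ominus> (c d \<otimes> w d)" using sum sc wc cR by (metis a_comm lessI m_closed minus_equality)
    also have "\<ominus> (inv (c d)) \<otimes> \<dots> = w d" using cR cd wc by (simp add: l_minus r_minus field_inv_cancel)
    finally show ?thesis by simp
   qed
   \<comment> \<open>The field itself may contain no zero of the characteristic polynomial, so
     \<open>s\<close> is taken in an algebraic closure.\<close>
   define M where "M = alg_closure"
   define \<iota> where "\<iota> = (indexed_const :: 'a \<Rightarrow> ('a list \<times> nat) multiset \<Rightarrow> 'a)"
   interpret M: algebraic_closure M "\<iota> ` carrier R" unfolding M_def \<iota>_def by (rule alg_closureE)
   have hom: "\<iota> : ring_hom R M" unfolding M_def \<iota>_def by (rule alg_closureE)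
   interpret \<iota>: ring_hom_ring R M \<iota> using hom by (intro ring_hom_ringI2 ring_axioms M.ring_axioms)
   have \<iota>inj: "inj_on \<iota> (carrier R)" using \<iota>.img_is_subfield(1)[OF carrier_is_subfield] by simp
   have \<iota>K: "subfield (\<iota> ` K) M" using \<iota>.img_is_subfield(2)[OF fixed_subfield] by simp
   have c'M: "\<iota> (c' j) : carrier M" if "j < d" for j using c'K[OF that] Kc by auto
   obtain f where f: "f : carrier (poly_ring M)" "f ~= []" "degree f = d"
    "!!x. x : carrier M ==> M.eval f x = x [^]\<^bsub>M\<^esub> d \<ominus>\<^bsub>M\<^esub> (\<Oplus>\<^bsub>M\<^esub>j\<in>{..<d}. \<iota> (c' j) \<otimes>\<^bsub>M\<^esub> x [^]\<^bsub>M\<^esub> j)"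
    using M.monic_polynomial[OF M.carrier_is_subfield, of d "\<lambda>j. \<iota> (c' j)", OF c'M] by auto
   have "size (M.roots f) = d" using M.roots_over_carrier[OF f(1)] f(3) M.splitted_def by simp
   then obtain s where "s \<in># M.roots f" using d(2) by (metis multiset_nonemptyE size_empty less_irrefl)
   hence s: "s : carrier M" "M.eval f s = \<zero>\<^bsub>M\<^esub>" using M.roots_mem_iff_is_root[OF f(1)] by (auto simp: M.is_root_def)
   have sM: "(\<Oplus>\<^bsub>M\<^esub>j\<in>{..<d}. \<iota> (c' j) \<otimes>\<^bsub>M\<^esub> s [^]\<^bsub>M\<^esub> j) : carrier M" using c'M s by simp
   have sd: "s [^]\<^bsub>M\<^esub> d = (\<Oplus>\<^bsub>M\<^esub>j\<in>{..<d}. \<iota> (c' j) \<otimes>\<^bsub>M\<^esub> s [^]\<^bsub>M\<^esub> j)" by (rule iffD1[OF M.r_right_minus_eq[OF M.nat_pow_closed[OF s(1)] sM]])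
     (unfold f(4)[OF s(1), symmetric], rule s(2))
   \<comment> \<open>The translates of \<open>y\<close> and the powers of \<open>s\<close> obey the
     same recursion, so the same coefficients express both. What is known about
     \<open>w (p ^ t)\<close> thereby becomes a statement about \<open>s\<close>.\<close>
   have rel: "\<exists>e. (\<forall>j<d. e j : K) \<and> w i = (\<Oplus>j\<in>{..<d}. e j \<otimes> w j) \<and> s [^]\<^bsub>M\<^esub> i = (\<Oplus>\<^bsub>M\<^esub>j\<in>{..<d}. \<iota> (e j) \<otimes>\<^bsub>M\<^esub> s [^]\<^bsub>M\<^esub> j)" for i
   proof (induct i)
    case 0
    have ins0: "{..<d} = insert 0 {0<..<d}" using d by auto
    have "(\<Oplus>j\<in>{..<d}. (if j = 0 then \<one> else \<zero>) \<otimes> w j) = w 0 \<oplus> (\<Oplus>j\<in>{0<..<d}. (if j = 0 then \<one> else \<zero>) \<otimes> w j)" unfolding ins0 using wc by simp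
    also have "(\<Oplus>j\<in>{0<..<d}. (if j = 0 then \<one> else \<zero>) \<otimes> w j) = (\<Oplus>j\<in>{0<..<d}. \<zero>)" using wc by (intro finsum_cong') auto
    finally have 1: "w 0 = (\<Oplus>j\<in>{..<d}. (if j = 0 then \<one> else \<zero>) \<otimes> w j)" using wc by simp
    have "(\<Oplus>\<^bsub>M\<^esub>j\<in>{..<d}. \<iota> (if j = 0 then \<one> else \<zero>) \<otimes>\<^bsub>M\<^esub> s [^]\<^bsub>M\<^esub> j)
     = \<one>\<^bsub>M\<^esub> \<oplus>\<^bsub>M\<^esub> (\<Oplus>\<^bsub>M\<^esub>j\<in>{0<..<d}. \<iota> (if j = 0 then \<one> else \<zero>) \<otimes>\<^bsub>M\<^esub> s [^]\<^bsub>M\<^esub> j)" unfolding ins0 using s by simp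
    also have "(\<Oplus>\<^bsub>M\<^esub>j\<in>{0<..<d}. \<iota> (if j = 0 then \<one> else \<zero>) \<otimes>\<^bsub>M\<^esub> s [^]\<^bsub>M\<^esub> j) = (\<Oplus>\<^bsub>M\<^esub>j\<in>{0<..<d}. \<zero>\<^bsub>M\<^esub>)" using s by (intro M.finsum_cong') auto
    finally have 2: "s [^]\<^bsub>M\<^esub> (0::nat) = (\<Oplus>\<^bsub>M\<^esub>j\<in>{..<d}. \<iota> (if j = 0 then \<one> else \<zero>) \<otimes>\<^bsub>M\<^esub> s [^]\<^bsub>M\<^esub> j)" by simp
    show ?case using 1 2 Kc by (intro exI[of _ "\<lambda>j. if j = 0 then \<one> else \<zero>"]) auto
   next
    case (Suc i)
    then obtain e where e: "!!j. j < d ==> e j : K" "w i = (\<Oplus>j\<in>{..<d}. e j \<otimes> w j)"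
     "s [^]\<^bsub>M\<^esub> i = (\<Oplus>\<^bsub>M\<^esub>j\<in>{..<d}. \<iota> (e j) \<otimes>\<^bsub>M\<^esub> s [^]\<^bsub>M\<^esub> j)" by auto
    have eR: "e j : carrier R" if "j < d" for j using e(1)[OF that] Kc by auto
    have c'R: "c' j : carrier R" if "j < d" for j using c'K[OF that] Kc by auto
    let ?e = "\<lambda>j. (if j = 0 then \<zero> else e (j - 1)) \<oplus> e (d - 1) \<otimes> c' j"
    have "w (Suc i) = (\<Oplus>j\<in>{..<d}. \<tau> (e j \<otimes> w j))" unfolding wSuc e(2) using \<tau> eR wc by (intro aut_finsum) auto
    also have "\<dots> = (\<Oplus>j\<in>{..<d}. e j \<otimes> w (Suc j))" using \<tau> e(1) eR wc by (intro finsum_cong') (auto simp: aut_mult aut_fix wSuc)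
    also have "\<dots> = (\<Oplus>j\<in>{..<d}. ?e j \<otimes> w j)" by (rule finsum_shift[OF d(2) wc c'R eR wd])
    finally have 1: "w (Suc i) = (\<Oplus>j\<in>{..<d}. ?e j \<otimes> w j)" .
    have "s [^]\<^bsub>M\<^esub> Suc i = s \<otimes>\<^bsub>M\<^esub> (\<Oplus>\<^bsub>M\<^esub>j\<in>{..<d}. \<iota> (e j) \<otimes>\<^bsub>M\<^esub> s [^]\<^bsub>M\<^esub> j)"
     using e(3) M.m_comm[OF s(1) M.nat_pow_closed[OF s(1)], of i] by simp
    also have "\<dots> = (\<Oplus>\<^bsub>M\<^esub>j\<in>{..<d}. s \<otimes>\<^bsub>M\<^esub> (\<iota> (e j) \<otimes>\<^bsub>M\<^esub> s [^]\<^bsub>M\<^esub> j))" using s eR by (intro M.finsum_rdistr) auto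
    also have "\<dots> = (\<Oplus>\<^bsub>M\<^esub>j\<in>{..<d}. \<iota> (e j) \<otimes>\<^bsub>M\<^esub> s [^]\<^bsub>M\<^esub> Suc j)" using s eR by (intro M.finsum_cong') (auto simp: M.m_ac)
    also have "\<dots> = (\<Oplus>\<^bsub>M\<^esub>j\<in>{..<d}. ((if j = 0 then \<zero>\<^bsub>M\<^esub> else \<iota> (e (j - 1))) \<oplus>\<^bsub>M\<^esub> \<iota> (e (d - 1)) \<otimes>\<^bsub>M\<^esub> \<iota> (c' j)) \<otimes>\<^bsub>M\<^esub> s [^]\<^bsub>M\<^esub> j)"
     using s eR c'R by (intro M.finsum_shift[OF d(2) _ _ _ sd]) auto
    also have "\<dots> = (\<Oplus>\<^bsub>M\<^esub>j\<in>{..<d}. \<iota> (?e j) \<otimes>\<^bsub>M\<^esub> s [^]\<^bsub>M\<^esub> j)" using s eR c'R by (intro M.finsum_cong') auto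
    finally have 2: "s [^]\<^bsub>M\<^esub> Suc i = (\<Oplus>\<^bsub>M\<^esub>j\<in>{..<d}. \<iota> (?e j) \<otimes>\<^bsub>M\<^esub> s [^]\<^bsub>M\<^esub> j)" .
    have "?e j : K" if "j < d" for j using that e(1) c'K Kc by auto
    thus ?case using 1 2 by (intro exI[of _ ?e]) blast
   qed
   define b where "b = \<zeta> [^] a"
   have b: "b : K" "b : carrier R" by (auto simp: b_def)
   have spt: "s [^]\<^bsub>M\<^esub> (p ^ t) = \<iota> b"
   proof -
    obtain e where e: "!!j. j < d ==> e j : K" "w (p ^ t) = (\<Oplus>j\<in>{..<d}. e j \<otimes> w j)"
     "s [^]\<^bsub>M\<^esub> (p ^ t) = (\<Oplus>\<^bsub>M\<^esub>j\<in>{..<d}. \<iota> (e j) \<otimes>\<^bsub>M\<^esub> s [^]\<^bsub>M\<^esub> j)" using rel[of "p ^ t"] by auto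
    have eR: "e j : carrier R" if "j < d" for j using e(1)[OF that] Kc by auto
    have ins0: "{..<d} = insert 0 {0<..<d}" using d by auto
    have "w (p ^ t) = b \<otimes> w 0" using eig w0 by (simp add: w_def b_def)
    \<comment> \<open>Since the first \<open>d\<close> translates are independent,
      \<open>w (p ^ t) = b \<otimes> w 0\<close> determines its coefficients: \<open>b\<close> at 0
      and zero elsewhere.\<close>
    have "(\<Oplus>j\<in>{..<d}. (e j \<ominus> (if j = 0 then b else \<zero>)) \<otimes> w j) = (e 0 \<ominus> b) \<otimes> w 0 \<oplus> (\<Oplus>j\<in>{0<..<d}. (e j \<ominus> (if j = 0 then b else \<zero>)) \<otimes> w j)"
     unfolding ins0 using wc eR b d by simp
    also have "(\<Oplus>j\<in>{0<..<d}. (e j \<ominus> (if j = 0 then b else \<zero>)) \<otimes> w j) = (\<Oplus>j\<in>{0<..<d}. e j \<otimes> w j)"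
     using wc eR by (intro finsum_cong') (auto simp: a_minus_def)
    finally have 1: "(\<Oplus>j\<in>{..<d}. (e j \<ominus> (if j = 0 then b else \<zero>)) \<otimes> w j) = (e 0 \<ominus> b) \<otimes> w 0 \<oplus> (\<Oplus>j\<in>{0<..<d}. e j \<otimes> w j)" .
    have 2: "w (p ^ t) = e 0 \<otimes> w 0 \<oplus> (\<Oplus>j\<in>{0<..<d}. e j \<otimes> w j)" unfolding e(2) ins0 using wc eR d by simp
    define T where "T = (\<Oplus>j\<in>{0<..<d}. e j \<otimes> w j)"
    have cl: "T : carrier R" "e 0 : carrier R" using wc eR d by (auto simp: T_def)
    have "b \<otimes> w 0 = e 0 \<otimes> w 0 \<oplus> T" using 2 \<open>w (p ^ t) = b \<otimes> w 0\<close> by (simp add: T_def)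
    moreover have "(e 0 \<ominus> b) \<otimes> w 0 \<oplus> T = (e 0 \<otimes> w 0 \<oplus> T) \<ominus> b \<otimes> w 0" using cl b(2) wc[of 0] by algebra
    ultimately have "(e 0 \<ominus> b) \<otimes> w 0 \<oplus> T = \<zero>" using b(2) wc[of 0] by (metis a_minus_def m_closed r_neg)
    hence "\<forall>j\<in>{..<d}. e j \<ominus> (if j = 0 then b else \<zero>) = \<zero>"
     using lid[unfolded lin_indep_def, THEN spec, of "\<lambda>j. e j \<ominus> (if j = 0 then b else \<zero>)"] 1 e(1) b Kc by (auto simp: T_def)
    hence ej: "e j = (if j = 0 then b else \<zero>)" if "j < d" for j
     using that eR[OF that] b r_right_minus_eq[of "e j" "if j = 0 then b else \<zero>"] by auto
    have "s [^]\<^bsub>M\<^esub> (p ^ t) = \<iota> b \<oplus>\<^bsub>M\<^esub> (\<Oplus>\<^bsub>M\<^esub>j\<in>{0<..<d}. \<iota> (e j) \<otimes>\<^bsub>M\<^esub> s [^]\<^bsub>M\<^esub> j)" unfolding e(3) ins0 using s b d ej by simp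
    also have "(\<Oplus>\<^bsub>M\<^esub>j\<in>{0<..<d}. \<iota> (e j) \<otimes>\<^bsub>M\<^esub> s [^]\<^bsub>M\<^esub> j) = (\<Oplus>\<^bsub>M\<^esub>j\<in>{0<..<d}. \<zero>\<^bsub>M\<^esub>)" using s ej by (intro M.finsum_cong') auto
    finally show ?thesis using b by simp
   qed
   have "p ^ t \<le> d"
   proof (rule M.root_of_unity_degree[OF \<iota>K p pr rpm r0 cond' _ s(1) _ _ d(2) _ sd])
    show "s [^]\<^bsub>M\<^esub> (p ^ t) : \<iota> ` K" using spt b by auto
    show "!!j. j < d ==> \<iota> (c' j) : \<iota> ` K" using c'K by auto
    fix x assume x: "x : \<iota> ` K" "x [^]\<^bsub>M\<^esub> m = \<one>\<^bsub>M\<^esub>"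
    then obtain k where k: "k : K" "x = \<iota> k" by auto
    have "\<iota> (k [^] m) = \<iota> \<one>" using x k Kc by (simp add: \<iota>.hom_nat_pow)
    hence "k [^] m = \<one>" using inj_onD[OF \<iota>inj, of "k [^] m" \<one>] k Kc(2) by simp
    then obtain i where "k = \<zeta> [^] (i::nat)" using roots k by auto
    hence "k [^] r = \<one>" using zeta_ord[of "i * r"] by (simp add: nat_pow_pow)
    thus "x [^]\<^bsub>M\<^esub> r = \<one>\<^bsub>M\<^esub>" using k Kc \<iota>.hom_nat_pow[of k r] by simp
   next
    fix i :: nat
    have "s [^]\<^bsub>M\<^esub> (p ^ t * i) = \<iota> (\<zeta> [^] (a * i))" using s spt \<iota>.hom_nat_pow[of b i] by (simp add: b_def nat_pow_pow flip: M.nat_pow_pow)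
    hence "s [^]\<^bsub>M\<^esub> (p ^ t * i) = \<one>\<^bsub>M\<^esub> \<longleftrightarrow> \<zeta> [^] (a * i) = \<one>" using \<iota>inj by (metis \<iota>.hom_one inj_onD nat_pow_closed one_closed zetac)
    also have "\<dots> \<longleftrightarrow> r dvd i" using zeta_ord coprime_r[OF pa] coprime_dvd_mult_right_iff by simp
    finally show "s [^]\<^bsub>M\<^esub> (p ^ t * i) = \<one>\<^bsub>M\<^esub> \<longleftrightarrow> r dvd i" .
   qed
   thus False using D2 d by simp
  qed
 qed
 thus ?thesis by (simp add: w_def)
qed

text \<open>For \<open>y\<close> with \<open>eigen y\<close> as large as possible, the translates of
  \<open>y\<close> by a generator of the cyclic quotient lie in \<open>y\<close> times the fixed
  field of \<open>eigen y\<close>. They are independent, and their number is at least the degree of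
  that field over \<open>K\<close>, so they span.\<close>

theorem submodule_contains_eigenspace:
 assumes N: "submodule N" and "N ~= {\<zero>}"
 obtains y \<tau> t a where "y : N" "y ~= \<zero>" "!!e. e : fixed_field R (eigen y) ==> y \<otimes> e : N"
  "\<tau> : G" "(\<tau> \<up> (p ^ t)) y = \<zeta> [^] (a::nat) \<otimes> y" "t = 0 \<or> \<not> p dvd a" "!!g. g : G ==> \<exists>i::nat. \<exists>h\<in>eigen y. g = h \<otimes>\<^bsub>GG\<^esub> \<tau> \<up> i"
  "\<tau> \<up> (p ^ t) : eigen y"
proof -
 note Nd = submoduleD[OF N]
 have "\<exists>y. y : N \<and> y ~= \<zero>" using assms Nd by auto
 moreover have "card (eigen y) < Suc (card G)" for y using card_mono[OF finite_G, of "eigen y"] by (auto simp: eigen_def)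
 ultimately obtain y where y: "y : N" "y ~= \<zero>" and ymax: "!!z. z : N ==> z ~= \<zero> ==> card (eigen z) \<le> card (eigen y)"
  using ex_has_greatest_nat[of "\<lambda>y. y : N \<and> y ~= \<zero>" _ "\<lambda>y. card (eigen y)" "Suc (card G)"] by metis
 have yc: "y : carrier R" using y Nd by auto
 define H where "H = eigen y"
 have HG: "h : G" if "h : H" for h using that eigen_G by (simp add: H_def)
 interpret C: comm_group GG by (rule GG_comm)
 have Hs: "subgroup H GG" unfolding H_def by (rule eigen_subgroup[OF yc])
 interpret H: normal H GG using C.subgroup_imp_normal[OF Hs] .
 define Q where "Q = GG Mod H"
 interpret Q: comm_group Q unfolding Q_def using C.abelian_FactGroup[OF Hs] .
 define \<phi> where "\<phi> = (\<lambda>a. H #>\<^bsub>GG\<^esub> a)"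
 interpret \<phi>: group_hom GG Q \<phi>
  using H.r_coset_hom_Mod by (intro group_hom.intro group_hom_axioms.intro GG_group Q.group_axioms) (simp add: \<phi>_def Q_def)
 have carQ: "carrier Q = \<phi> ` G" by (simp add: Q_def \<phi>_def carrier_FactGroup)
 have oneQ: "\<one>\<^bsub>Q\<^esub> = H" by (simp add: Q_def)
 have \<phi>H: "\<phi> g = \<one>\<^bsub>Q\<^esub> \<longleftrightarrow> g : H" if "g : G" for g
  unfolding oneQ \<phi>_def using GG.coset_join1[OF _ _ Hs, of g] GG.coset_join2[OF _ Hs, of g] that by auto
 have \<phi>pow: "\<phi> (g \<up> (i::nat)) = \<phi> g [^]\<^bsub>Q\<^esub> i" if "g : G" for g i using \<phi>.hom_nat_pow[of g i] that by simp
 have claim: "\<exists>a. (x \<up> p) y = \<zeta> [^] (a::nat) \<otimes> y \<and> \<not> p dvd a" if x: "x : G" "x \<notin> H" "x \<up> p : H" for x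
 proof -
  obtain a where a: "(x \<up> p) y = \<zeta> [^] (a::nat) \<otimes> y" using x(3) by (auto simp: H_def eigen_def)
  have "\<not> p dvd a"
  proof
   assume "p dvd a"
   then obtain e where "a = p * e" by auto
   then obtain z where z: "z : N" "z ~= \<zero>" "x : eigen z" "eigen y \<subseteq> eigen z" using resolvent[OF N y x(1)] a by auto
   have "finite (eigen z)" using finite_G by (simp add: eigen_def)
   hence "eigen y = eigen z" using z ymax[OF z(1,2)] by (simp add: card_seteq)
   thus False using z x by (simp add: H_def)
  qed
  thus ?thesis using a by auto
 qed
 obtain \<mu> where \<mu>: "m = p ^ \<mu>" using m by auto
 have "\<exists>U\<in>carrier Q. \<exists>t. Q.ord U = p ^ t \<and> (\<forall>V\<in>carrier Q. \<exists>i::nat. V = U [^]\<^bsub>Q\<^esub> i)"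
 proof (rule Q.p_group_cyclic[OF p, of \<mu>])
  fix U assume "U : carrier Q"
  then obtain g where g: "g : G" "U = \<phi> g" by (auto simp: carQ)
  have "g \<up> m = (\<lambda>x\<in>carrier R. x)" using exponent[OF g(1)] g aut_id by (intro aut_eqI) auto
  hence "g \<up> m : H" using subgroup.one_closed[OF Hs] by simp
  thus "U [^]\<^bsub>Q\<^esub> (p ^ \<mu>) = \<one>\<^bsub>Q\<^esub>" using g \<phi>pow[OF g(1), of m] \<phi>H[of "g \<up> m"] \<mu> by simp
 next
  fix U W assume UW: "U : carrier Q" "W : carrier Q" "U ~= \<one>\<^bsub>Q\<^esub>" "W ~= \<one>\<^bsub>Q\<^esub>" "U [^]\<^bsub>Q\<^esub> p = \<one>\<^bsub>Q\<^esub>" "W [^]\<^bsub>Q\<^esub> p = \<one>\<^bsub>Q\<^esub>"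
  then obtain g s where g: "g : G" "U = \<phi> g" and s: "s : G" "W = \<phi> s" by (auto simp: carQ)
  have gH: "g \<notin> H" "g \<up> p : H" and sH: "s \<notin> H" "s \<up> p : H" using UW g s \<phi>H[of g] \<phi>H[of s] \<phi>H[of "g \<up> p"] \<phi>H[of "s \<up> p"] \<phi>pow by auto
  obtain a b where a: "(g \<up> p) y = \<zeta> [^] (a::nat) \<otimes> y" and b: "(s \<up> p) y = \<zeta> [^] (b::nat) \<otimes> y" "\<not> p dvd b"
   using claim[OF g(1) gH] claim[OF s(1) sH] by auto
  have "coprime b p" using prime_imp_coprime[OF p b(2)] by (simp add: coprime_commute)
  then obtain x where x: "[b * x = 1] (mod p)" using cong_solve_coprime_nat by auto
  \<comment> \<open>Solves \<open>b * j + a = 0\<close> modulo \<open>p\<close>, with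
    \<open>(p - 1) * a\<close> in the role of \<open>- a\<close>. Then \<open>g\<close> times
    \<open>s \<up> j\<close> has a \<open>p\<close>-th power whose exponent is divisible by
    \<open>p\<close>, so by \<open>claim\<close> it lies in \<open>H\<close>.\<close>
  define j where "j = x * ((p - 1) * a)"
  have "[b * j + a = 1 * ((p - 1) * a) + a] (mod p)" unfolding j_def mult.assoc[symmetric] using x by (intro cong_add cong_mult) auto
  also have "1 * ((p - 1) * a) + a = p * a" using p0 by (simp add: algebra_simps)
  finally have pj: "p dvd b * j + a" by (simp add: cong_dvd_iff)
  let ?x = "g \<otimes>\<^bsub>GG\<^esub> s \<up> j"
  have sj: "s \<up> j : G" using s by simp
  have xG: "?x : G" using g sj GG.m_closed[of g "s \<up> j"] by simp
  have "?x \<up> p = (g \<up> p) \<otimes>\<^bsub>GG\<^esub> (s \<up> (p * j))" using g s by (simp add: C.nat_pow_distrib GG.nat_pow_pow mult.commute del: GG_simps(3))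
  hence xp: "(?x \<up> p) y = \<zeta> [^] (b * j + a) \<otimes> y" using g s yc eigen_pow[OF yc s(1) b(1), of j] a
   by (simp add: mult_apply aut_mult aut_fix m_assoc[symmetric] nat_pow_mult del: GG_simps(3))
  hence "?x \<up> p : H" using xG by (auto simp: H_def eigen_def)
  have "?x : H"
  proof (rule ccontr)
   assume "?x \<notin> H"
   then obtain a' where a': "(?x \<up> p) y = \<zeta> [^] (a'::nat) \<otimes> y" "\<not> p dvd a'" using claim[OF xG _ \<open>?x \<up> p : H\<close>] by auto
   hence "[a' = b * j + a] (mod r)" using zeta_smult_eq[OF yc y(2)] xp by simp
   hence "[a' = b * j + a] (mod p)" using pr cong_dvd_modulus_nat by simp
   thus False using a' pj cong_dvd_iff by auto
  qed
  hence "\<phi> g \<otimes>\<^bsub>Q\<^esub> \<phi> s [^]\<^bsub>Q\<^esub> j = \<one>\<^bsub>Q\<^esub>" using \<phi>H[OF xG] \<phi>.hom_mult[of g "s \<up> j"] \<phi>pow[OF s(1)] g sj by simp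
  thus "\<exists>j::nat. U \<otimes>\<^bsub>Q\<^esub> W [^]\<^bsub>Q\<^esub> j = \<one>\<^bsub>Q\<^esub>" using g s by auto
 qed
 then obtain \<tau> t where \<tau>: "\<tau> : G" and ord: "Q.ord (\<phi> \<tau>) = p ^ t" and gen: "!!g. g : G ==> \<exists>i::nat. \<phi> g = \<phi> \<tau> [^]\<^bsub>Q\<^esub> i" by (auto simp: carQ)
 have \<tau>H: "\<tau> \<up> i : H \<longleftrightarrow> p ^ t dvd i" for i :: nat using \<phi>H[of "\<tau> \<up> i"] \<phi>pow[OF \<tau>, of i] Q.pow_eq_id[of "\<phi> \<tau>" i] ord \<tau> by simp
 have dec: "\<exists>i::nat. \<exists>h\<in>H. g = h \<otimes>\<^bsub>GG\<^esub> \<tau> \<up> i" if g: "g : G" for g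
 proof -
  obtain i where "\<phi> g = \<phi> (\<tau> \<up> (i::nat))" using gen[OF g] \<phi>pow[OF \<tau>] by auto
  hence "g : H #>\<^bsub>GG\<^esub> \<tau> \<up> i" using GG.rcos_self[OF _ Hs, of g] g by (simp add: \<phi>_def)
  thus ?thesis by (auto simp: r_coset_def)
 qed
 have ptH: "\<tau> \<up> (p ^ t) : H" using \<tau>H by simp
 then obtain a where eig: "(\<tau> \<up> (p ^ t)) y = \<zeta> [^] (a::nat) \<otimes> y" by (auto simp: H_def eigen_def)
 have ta: "t = 0 \<or> \<not> p dvd a"
 proof (cases "t = 0")
  case False
  let ?x = "\<tau> \<up> (p ^ (t - 1))"
  have e: "p ^ (t - 1) * p = p ^ t" using False by (simp add: power_eq_if)
  have xp: "?x \<up> p = \<tau> \<up> (p ^ t)" using e \<tau> by (simp add: GG.nat_pow_pow)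
  have "\<not> p ^ t dvd p ^ (t - 1)" using False p0 by (simp add: dvd_power_iff_le)
  hence "?x \<notin> H" using \<tau>H by simp
  then obtain a' where a': "(?x \<up> p) y = \<zeta> [^] (a'::nat) \<otimes> y" "\<not> p dvd a'" using claim[of ?x] \<tau> ptH xp by auto
  hence "[a' = a] (mod r)" using zeta_smult_eq[OF yc y(2)] eig xp by simp
  hence "[a' = a] (mod p)" using pr cong_dvd_modulus_nat by simp
  thus ?thesis using a' cong_dvd_iff by auto
 qed simp
 let ?E = "fixed_field R H"
 interpret HA: aut_group R H unfolding H_def by (rule eigen_aut_group[OF yc])
 note Ec = HA.Kc and Es = HA.fixed_subfield
 have KE: "K \<subseteq> ?E" using HG by (auto simp: fixed_field_def)
 have st: "g x : ?E" if "g : G" "x : ?E" for g x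
 proof -
  have "h (g x) = g x" if "h : H" for h
   using aut_commute[OF HG[OF that] \<open>g : G\<close>, of x] \<open>x : ?E\<close> that by (metis (mono_tags, lifting) fixed_field_def mem_Collect_eq)
  thus ?thesis using that by (auto simp: fixed_field_def)
 qed
 define A where "A = (\<lambda>g. restrict g ?E) ` G"
 interpret A: aut_group "R\<lparr>carrier := ?E\<rparr>" A unfolding A_def by (rule restrict_aut_group(1)[where F = ?E, OF Es]) (rule st)
 have "fixed_field (R\<lparr>carrier := ?E\<rparr>) A = K" unfolding A_def using restrict_aut_group(2)[where F = ?E, OF Es] st KE by auto
 hence dimE: "dimension (card A) K ?E" using A.artin_dimension by (intro dimension_subring[OF subfieldE(1)[OF Es]]) simp
 \<comment> \<open>Modulo \<open>H\<close> every automorphism is a power of \<open>\<tau>\<close>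
   with exponent below \<open>p ^ t\<close>, and \<open>H\<close> acts trivially on
   \<open>?E\<close>.\<close>
 have cardA: "card A \<le> p ^ t"
 proof -
  have "A \<subseteq> (\<lambda>i. restrict (\<tau> \<up> i) ?E) ` {..<p ^ t}"
  proof
   fix f assume "f : A"
   then obtain g where g: "g : G" "f = restrict g ?E" by (auto simp: A_def)
   obtain i h where ih: "h : H" "g = h \<otimes>\<^bsub>GG\<^esub> \<tau> \<up> (i::nat)" using dec[OF g(1)] by auto
   have "g x = (\<tau> \<up> (i mod p ^ t)) x" if x: "x : ?E" for x
   proof -
    have xc: "x : carrier R" using x by (simp add: fixed_field_def)
    have "g x = h ((\<tau> \<up> i) x)" using ih HG \<tau> xc by (simp add: mult_apply del: GG_simps(3))
    also have "\<dots> = (\<tau> \<up> i) x" using st[OF pow_in[OF \<tau>] x] ih by (simp add: fixed_field_def)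
    also have "\<dots> = (\<tau> \<up> (i mod p ^ t)) ((\<tau> \<up> (p ^ t * (i div p ^ t))) x)"
     using pow_add_apply[OF \<tau> xc, of "i mod p ^ t" "p ^ t * (i div p ^ t)"] by simp
    also have "(\<tau> \<up> (p ^ t * (i div p ^ t))) x = x" using \<tau>H[of "p ^ t * (i div p ^ t)"] x by (simp add: fixed_field_def)
    finally show ?thesis .
   qed
   hence "f = restrict (\<tau> \<up> (i mod p ^ t)) ?E" using g by auto
   thus "f : (\<lambda>i. restrict (\<tau> \<up> i) ?E) ` {..<p ^ t}" using p0 by auto
  qed
  hence "card A \<le> card ((\<lambda>i. restrict (\<tau> \<up> i) ?E) ` {..<p ^ t})" by (intro card_mono) auto
  also have "\<dots> \<le> p ^ t" using card_image_le[of "{..<p ^ t}"] by simp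
  finally show ?thesis .
 qed
 define w where "w = (\<lambda>i::nat. (\<tau> \<up> i) y)"
 have wc: "w i : carrier R" "w i : N" for i using y(1) \<tau> Nd by (auto simp: w_def)
 have liw: "lin_indep K {..<p ^ t} w" unfolding w_def by (rule orbit_lin_indep[OF yc y(2) \<tau> eig ta])
 \<comment> \<open>An \<open>h\<close> in \<open>H\<close> multiplies \<open>y\<close> and all its
   translates by the same power of \<open>\<zeta>\<close>, since \<open>G\<close> is abelian and
   fixes \<open>\<zeta>\<close>.\<close>
 have wE: "inv y \<otimes> w i : ?E" for i
 proof -
  have "h (inv y \<otimes> w i) = inv y \<otimes> w i" if h: "h : H" for h
  proof -
   obtain l where l: "h y = \<zeta> [^] (l::nat) \<otimes> y" using h by (auto simp: H_def eigen_def)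
   have "h (w i) = (\<tau> \<up> i) (h y)" unfolding w_def using aut_commute[OF HG[OF h] pow_in[OF \<tau>] yc] .
   also have "\<dots> = \<zeta> [^] l \<otimes> w i" using l yc \<tau> by (simp add: aut_mult aut_fix w_def)
   finally have hw: "h (w i) = \<zeta> [^] l \<otimes> w i" .
   have "h (inv y \<otimes> w i) = inv (\<zeta> [^] l \<otimes> y) \<otimes> (\<zeta> [^] l \<otimes> w i)" using HG[OF h] yc y(2) wc hw l by (simp add: aut_mult aut_inv)
   also have "inv (\<zeta> [^] l \<otimes> y) = inv (\<zeta> [^] l) \<otimes> inv y" using yc y(2) by (intro comm_inv_char) (auto simp: m_ac simp flip: m_assoc)
   also have "inv (\<zeta> [^] l) \<otimes> inv y \<otimes> (\<zeta> [^] l \<otimes> w i) = (inv (\<zeta> [^] l) \<otimes> \<zeta> [^] l) \<otimes> (inv y \<otimes> w i)" using yc y(2) wc by (simp add: m_ac)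
   finally show ?thesis using yc y(2) wc by simp
  qed
  thus ?thesis using yc y(2) wc by (auto simp: fixed_field_def)
 qed
 have ywi: "y \<otimes> (inv y \<otimes> w i) = w i" for i using yc y(2) wc field_inv_cancel(1) by simp
 have liw': "lin_indep K {..<p ^ t} (\<lambda>i. inv y \<otimes> w i)" unfolding lin_indep_def
 proof (intro allI impI)
  fix c assume c: "\<forall>j\<in>{..<p ^ t}. c j : K" "(\<Oplus>j\<in>{..<p ^ t}. c j \<otimes> (inv y \<otimes> w j)) = \<zero>"
  have cR: "c j : carrier R" if "j < p ^ t" for j using c that Kc by auto
  have "(\<Oplus>j\<in>{..<p ^ t}. c j \<otimes> w j) = (\<Oplus>j\<in>{..<p ^ t}. y \<otimes> (c j \<otimes> (inv y \<otimes> w j)))"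
   using cR yc y(2) wc ywi by (intro finsum_cong') (auto simp: m_lcomm[of y])
  also have "\<dots> = y \<otimes> (\<Oplus>j\<in>{..<p ^ t}. c j \<otimes> (inv y \<otimes> w j))" using cR yc y(2) wc by (intro finsum_rdistr[symmetric]) auto
  finally show "\<forall>j\<in>{..<p ^ t}. c j = \<zero>" using c liw yc unfolding lin_indep_def by simp
 qed
 have "p ^ t \<le> card A" using lin_indep_card_le_dimension[OF fixed_subfield dimE _ liw'] wE by simp
 hence dimE': "dimension (p ^ t) K ?E" using dimE cardA by simp
 have "y \<otimes> e : N" if e: "e : ?E" for e
 proof -
  obtain c where c: "!!j. j : {..<p ^ t} ==> c j : K" "e = (\<Oplus>j\<in>{..<p ^ t}. c j \<otimes> (inv y \<otimes> w j))"
   using lin_indep_spans[OF fixed_subfield dimE' _ _ liw' _ e] wE by auto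
  have cR: "c j : carrier R" if "j < p ^ t" for j using c that Kc by auto
  have "y \<otimes> e = (\<Oplus>j\<in>{..<p ^ t}. y \<otimes> (c j \<otimes> (inv y \<otimes> w j)))" unfolding c(2) using cR yc y(2) wc by (intro finsum_rdistr) auto
  also have "\<dots> = (\<Oplus>j\<in>{..<p ^ t}. c j \<otimes> w j)" using cR yc y(2) wc ywi by (intro finsum_cong') (auto simp: m_lcomm[of y])
  also have "\<dots> : N" using c(1) wc Nd by (intro submodule_finsum[OF N]) auto
  finally show ?thesis .
 qed
 thus ?thesis using that[OF y _ \<tau> eig ta] dec ptH by (simp add: H_def)
qed

end

section \<open>Normal elements and units\<close>

text \<open>Neither normalized nor complete, so as to cover the valuations of subfields and the
  scaled extension to a cyclotomic field as well.\<close>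

locale valuation = field R for R (structure) +
 fixes v :: "'a \<Rightarrow> int"
 assumes v_mult: "[|x : carrier R - {\<zero>}; y : carrier R - {\<zero>}|] ==> v (x \<otimes> y) = v x + v y"
  and v_add: "[|x : carrier R - {\<zero>}; y : carrier R - {\<zero>}; x \<oplus> y ~= \<zero>|] ==> min (v x) (v y) \<le> v (x \<oplus> y)"
begin

lemma v_one [simp]: "v \<one> = 0" using v_mult[of \<one> \<one>] by simp

lemma v_inv: "x : carrier R ==> x ~= \<zero> ==> v (inv x) = - v x" using v_mult[of x "inv x"] by simp

lemma v_uminus: assumes "x : carrier R" "x ~= \<zero>" shows "v (\<ominus> x) = v x"
proof -
 have "\<ominus> (\<ominus> \<one>) ~= \<zero>" by simp
 hence 1: "\<ominus> \<one> : carrier R" "\<ominus> \<one> ~= \<zero>" by auto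
 have "v (\<ominus> \<one> \<otimes> \<ominus> \<one>) = v (\<ominus> \<one>) + v (\<ominus> \<one>)" using v_mult by simp
 hence "v (\<ominus> \<one>) = 0" by (simp add: l_minus)
 moreover have "\<ominus> x = \<ominus> \<one> \<otimes> x" using assms by (simp add: l_minus)
 ultimately show ?thesis using v_mult[of "\<ominus> \<one>" x] assms by simp
qed

lemma v_pow: "x : carrier R ==> x ~= \<zero> ==> v (x [^] (i::nat)) = int i * v x" by (induct i) (auto simp: v_mult pow_nonzero algebra_simps)

lemma subfield_powers:
 assumes x: "x : F - {\<zero>}" and F: "subfield F R"
 shows "\<exists>y\<in>F - {\<zero>}. v y = i * v x"
proof (cases "i \<ge> 0")
 case True
 have "x [^] nat i : F - {\<zero>}" using x subfield_closed[OF F] pow_nonzero by auto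
 moreover have "v (x [^] nat i) = i * v x" using x subfield_closed[OF F] True by (subst v_pow) auto
 ultimately show ?thesis by blast
next
 case False
 have "inv x : F - {\<zero>}" using x subfield_closed[OF F] by auto
 hence "(inv x) [^] nat (-i) : F - {\<zero>}" using subfield_closed[OF F] pow_nonzero by auto
 moreover have "v ((inv x) [^] nat (-i)) = i * v x" using x subfield_closed[OF F] False by (subst v_pow) (auto simp: v_inv)
 ultimately show ?thesis by blast
qed

abbreviation vge :: "int \<Rightarrow> 'a \<Rightarrow> bool" where "vge \<equiv> val_ge R v"

lemma vge_zero [simp]: "vge a \<zero>" by (simp add: val_ge_def)

lemma vge_nonzero: "x ~= \<zero> ==> vge a x \<longleftrightarrow> a \<le> v x" by (simp add: val_ge_def)

lemma vge_self [simp]: "vge (v x) x" by (simp add: val_ge_def)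

lemma vge_mono: "vge a x ==> b \<le> a ==> vge b x" by (auto simp: val_ge_def)

lemma vge_add: "[|x : carrier R; y : carrier R; vge a x; vge a y|] ==> vge a (x \<oplus> y)"
 using v_add[of x y] by (cases "x = \<zero>"; cases "y = \<zero>"; cases "x \<oplus> y = \<zero>") (auto simp: val_ge_def)

lemma vge_uminus: "[|x : carrier R; vge a x|] ==> vge a (\<ominus> x)" using v_uminus[of x] by (cases "x = \<zero>") (auto simp: val_ge_def)

lemma vge_minus: "[|x : carrier R; y : carrier R; vge a x; vge a y|] ==> vge a (x \<ominus> y)"
 using vge_add[of x "\<ominus> y"] vge_uminus[of y] by (simp add: a_minus_def)

lemma vge_mult: "[|x : carrier R; y : carrier R; vge a x; vge b y|] ==> vge (a + b) (x \<otimes> y)"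
 using v_mult[of x y] by (cases "x = \<zero>"; cases "y = \<zero>") (auto simp: val_ge_def)

lemma vge_finsum:
 assumes "finite J" "!!j. j : J ==> f j : carrier R" "!!j. j : J ==> vge a (f j)"
 shows "vge a (\<Oplus>j\<in>J. f j)" using assms
proof (induct J)
 case (insert j J)
 thus ?case by (auto intro!: vge_add)
qed simp

lemma v_add_strict:
 assumes "x : carrier R" "y : carrier R" "x ~= \<zero>" "vge (v x + 1) y"
 shows "x \<oplus> y ~= \<zero> \<and> v (x \<oplus> y) = v x"
proof (cases "y = \<zero>")
 case False
 hence y: "v x < v y" using assms by (simp add: vge_nonzero)
 have nz: "x \<oplus> y ~= \<zero>" using assms minus_equality v_uminus[of y] False y by auto
 have "v (x \<oplus> y) \<ge> v x" using v_add[of x y] assms False nz y by auto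
 moreover have "v (x \<oplus> y) \<le> v x"
 proof (rule ccontr)
  assume "\<not> ?thesis"
  hence "vge (v x + 1) (x \<oplus> y)" by (simp add: val_ge_def)
  hence "vge (v x + 1) ((x \<oplus> y) \<ominus> y)" using assms by (intro vge_minus) auto
  moreover have "(x \<oplus> y) \<ominus> y = x" using assms by (simp add: a_minus_def a_assoc r_neg)
  ultimately show False using assms by (simp add: vge_nonzero)
 qed
 ultimately show ?thesis using nz by simp
qed (use assms in simp)

lemma dominant_sum:
 assumes J: "finite J" "j0 : J" and f: "!!j. j : J ==> f j : carrier R" and "f j0 ~= \<zero>" and "!!j. j : J ==> j ~= j0 ==> vge (v (f j0) + 1) (f j)"
 shows "(\<Oplus>j\<in>J. f j) ~= \<zero>" "v (\<Oplus>j\<in>J. f j) = v (f j0)" "vge (v (f j0) + 1) ((\<Oplus>j\<in>J. f j) \<ominus> f j0)"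
proof -
 define T where "T = (\<Oplus>j\<in>J - {j0}. f j)"
 have T: "T : carrier R" using f by (auto simp: T_def)
 have ins: "J = insert j0 (J - {j0})" using J by auto
 have sum: "(\<Oplus>j\<in>J. f j) = f j0 \<oplus> T" unfolding T_def using f J by (subst ins, subst finsum_insert) auto
 have "vge (v (f j0) + 1) T" unfolding T_def using assms by (intro vge_finsum) auto
 thus "(\<Oplus>j\<in>J. f j) ~= \<zero>" "v (\<Oplus>j\<in>J. f j) = v (f j0)" "vge (v (f j0) + 1) ((\<Oplus>j\<in>J. f j) \<ominus> f j0)"
  using v_add_strict[of "f j0" T] sum T f[OF J(2)] \<open>f j0 ~= \<zero>\<close> by (auto simp: a_minus_def a_comm[of "f j0"] a_assoc r_neg)
qed

text \<open>The term of least value is unique, so it dominates the sum. The last conjunct remembers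
  the leading term, from which residues are read off.\<close>

lemma distinct_valuations:
 assumes J: "finite J" and f: "!!j. j : J ==> f j : carrier R" and dist: "!!i j. [|i : J; j : J; i ~= j; f i ~= \<zero>; f j ~= \<zero>|] ==> v (f i) ~= v (f j)"
  and nz: "\<exists>j\<in>J. f j ~= \<zero>"
 shows "\<exists>j0\<in>J. f j0 ~= \<zero> \<and> (\<Oplus>j\<in>J. f j) ~= \<zero> \<and> v (\<Oplus>j\<in>J. f j) = v (f j0) \<and>
  (\<forall>j\<in>J. vge (v (f j0)) (f j)) \<and> vge (v (f j0) + 1) ((\<Oplus>j\<in>J. f j) \<ominus> f j0)"
proof -
 let ?S = "{j : J. f j ~= \<zero>}"
 have "finite ?S" "?S ~= {}" using J nz by auto
 hence "\<exists>j0\<in>?S. \<forall>j\<in>?S. v (f j0) \<le> v (f j)"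
  by (intro bexI[of _ "arg_min_on (v \<circ> f) ?S"]) (use arg_min_if_finite(1)[of ?S "v \<circ> f"] arg_min_least[of ?S _ "v \<circ> f"] in auto)
 then obtain j0 where j0: "j0 : ?S" "!!j. j : ?S ==> v (f j0) \<le> v (f j)" by blast
 have *: "vge (v (f j0) + 1) (f j)" if j: "j : J" "j ~= j0" for j
 proof (cases "f j = \<zero>")
  case False
  hence "v (f j0) ~= v (f j)" using dist[of j j0] j j0(1) by auto
  thus ?thesis using j0(2)[of j] j False by (simp add: vge_nonzero)
 qed simp
 have "vge (v (f j0)) (f j)" if "j : J" for j using *[OF that] vge_mono[of "v (f j0) + 1" "f j"] by (cases "j = j0") auto
 thus ?thesis using dominant_sum[OF J, of j0 f] f j0(1) * by auto
qed

end

text \<open>By Artin's theorem \<open>card G\<close> is the degree over the fixed field; total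
  ramification says that it is also the index of the value group of the fixed field.\<close>

locale ram_aut = aut_group R G + valuation R v for R (structure) and G and v +
 assumes v_K: "x : fixed_field R G - {\<zero>} ==> int (card G) dvd v x" and v_K_gen: "\<exists>x\<in>fixed_field R G - {\<zero>}. v x = int (card G)"
  and v_unif: "\<exists>x\<in>carrier R - {\<zero>}. v x = 1"
begin

abbreviation n where "n \<equiv> card G"

lemma n0: "n > 0" using finite_G aut_id card_gt_0_iff by auto

lemma ex_val: obtains x where "x : carrier R" "x ~= \<zero>" "v x = i"
proof -
 obtain x where "x : carrier R - {\<zero>}" "v x = 1" using v_unif by auto
 thus ?thesis using subfield_powers[OF _ carrier_is_subfield, of x i] that by auto
qed

lemma ex_val_K: assumes "int n dvd i" obtains x where "x : K" "x ~= \<zero>" "v x = i"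
proof -
 obtain x where x: "x : K - {\<zero>}" "v x = int n" using v_K_gen by auto
 obtain j where "i = int n * j" using assms by auto
 thus ?thesis using subfield_powers[OF x(1) fixed_subfield, of j] that x by (auto simp: mult.commute)
qed

definition unif where "unif = (SOME x. x : carrier R - {\<zero>} \<and> v x = 1)"

lemma unif: "unif : carrier R" "unif ~= \<zero>" "v unif = 1"
 using someI_ex[of "\<lambda>x. x : carrier R - {\<zero>} \<and> v x = 1"] v_unif by (auto simp: unif_def)

lemma v_K_mult: "[|c : K; c ~= \<zero>; x : carrier R; x ~= \<zero>|] ==> [v (c \<otimes> x) = v x] (mod int n)"
proof -
 assume a: "c : K" "c ~= \<zero>" "x : carrier R" "x ~= \<zero>"
 hence "v (c \<otimes> x) = v c + v x" using Kc by (intro v_mult) auto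
 moreover have "int n dvd v c" using v_K a by auto
 ultimately show ?thesis by (simp add: cong_iff_dvd_diff)
qed

lemma K_combination:
 assumes J: "finite J" and u: "!!j. j : J ==> u j : carrier R" "!!j. j : J ==> u j ~= \<zero>"
  and dist: "!!i j. [|i : J; j : J; i ~= j|] ==> \<not> [v (u i) = v (u j)] (mod int n)" and c: "!!j. j : J ==> c j : K" and nz: "\<exists>j\<in>J. c j ~= \<zero>"
  and x: "x = (\<Oplus>j\<in>J. c j \<otimes> u j)"
 shows "\<exists>j0\<in>J. c j0 ~= \<zero> \<and> x ~= \<zero> \<and> v x = v (c j0 \<otimes> u j0) \<and> [v x = v (u j0)] (mod int n) \<and>
  (\<forall>j\<in>J. vge (v x) (c j \<otimes> u j)) \<and> vge (v x + 1) (x \<ominus> c j0 \<otimes> u j0)"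
proof -
 let ?f = "\<lambda>j. c j \<otimes> u j"
 have f: "?f j : carrier R" if "j : J" for j using u c Kc that by auto
 have f0: "?f j ~= \<zero> \<longleftrightarrow> c j ~= \<zero>" if "j : J" for j using u[OF that] c[OF that] Kc integral_iff by auto
 have cv: "[v (?f j) = v (u j)] (mod int n)" if "j : J" "c j ~= \<zero>" for j using v_K_mult c u that by auto
 have d: "v (?f i) ~= v (?f j)" if ij: "i : J" "j : J" "i ~= j" "?f i ~= \<zero>" "?f j ~= \<zero>" for i j by (metis cv cong_sym ij f0 cong_trans dist)
 have "\<exists>j\<in>J. ?f j ~= \<zero>" using nz f0 by simp
 from distinct_valuations[of J ?f, OF J f d this]
 obtain j0 where j0: "j0 : J" "?f j0 ~= \<zero>" "x ~= \<zero>" "v x = v (?f j0)" "\<forall>j\<in>J. vge (v x) (?f j)" "vge (v x + 1) (x \<ominus> ?f j0)" unfolding x by auto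
 moreover have "c j0 ~= \<zero>" using j0 f0 by simp
 ultimately show ?thesis using cv by auto
qed

text \<open>Elements whose values represent all classes modulo \<open>n\<close> form a basis:
  combinations over \<open>K\<close> cannot cancel, because values on \<open>K\<close> are multiples
  of \<open>n\<close>, and the number of these elements is the degree.\<close>

lemma distinct_basis:
 assumes u: "!!j. j < n ==> u j : carrier R" "!!j. j < n ==> u j ~= \<zero>" "!!j. j < n ==> [v (u j) = int j] (mod int n)" and x: "x : carrier R"
 shows "\<exists>c. (\<forall>j<n. c j : K) \<and> x = (\<Oplus>j\<in>{..<n}. c j \<otimes> u j) \<and> (x ~= \<zero> --> (\<exists>j0<n. c j0 ~= \<zero> \<and> v x = v (c j0 \<otimes> u j0) \<and> [v x = int j0] (mod int n) \<and>
   (\<forall>j<n. vge (v x) (c j \<otimes> u j)) \<and> vge (v x + 1) (x \<ominus> c j0 \<otimes> u j0)))"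
proof -
 have d: "\<not> [v (u i) = v (u j)] (mod int n)" if "i : {..<n}" "j : {..<n}" "i ~= j" for i j
 proof
  assume "[v (u i) = v (u j)] (mod int n)"
  hence "[int i = int j] (mod int n)" using u(3) that cong_trans cong_sym by (metis lessThan_iff)
  thus False using that by (simp add: cong_int_iff cong_less_modulus_unique_nat)
 qed
 have comb: "\<exists>j0\<in>{..<n}. c j0 ~= \<zero> \<and> y ~= \<zero> \<and> v y = v (c j0 \<otimes> u j0) \<and> [v y = v (u j0)] (mod int n) \<and>
  (\<forall>j\<in>{..<n}. vge (v y) (c j \<otimes> u j)) \<and> vge (v y + 1) (y \<ominus> c j0 \<otimes> u j0)"
  if "!!j. j < n ==> c j : K" "\<exists>j\<in>{..<n}. c j ~= \<zero>" "y = (\<Oplus>j\<in>{..<n}. c j \<otimes> u j)" for c y by (rule K_combination) (use u d that in auto)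
 have "lin_indep K {..<n} u" unfolding lin_indep_def using comb by auto
 then obtain c where c: "!!j. j : {..<n} ==> c j : K" "x = (\<Oplus>j\<in>{..<n}. c j \<otimes> u j)"
  using lin_indep_spans[OF fixed_subfield artin_dimension, of "{..<n}" u x] u x by auto
 have "\<exists>j0<n. c j0 ~= \<zero> \<and> v x = v (c j0 \<otimes> u j0) \<and> [v x = int j0] (mod int n) \<and>
   (\<forall>j<n. vge (v x) (c j \<otimes> u j)) \<and> vge (v x + 1) (x \<ominus> c j0 \<otimes> u j0)" if x0: "x ~= \<zero>"
 proof -
  have "\<exists>j\<in>{..<n}. c j ~= \<zero>"
  proof (rule ccontr)
   assume "\<not> ?thesis"
   hence "x = (\<Oplus>j\<in>{..<n}. \<zero>)" unfolding c(2) using u by (intro finsum_cong') auto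
   thus False using x0 by simp
  qed
  then obtain j0 where j0: "j0 < n" "c j0 ~= \<zero>" "v x = v (c j0 \<otimes> u j0)" "[v x = v (u j0)] (mod int n)"
   "\<forall>j<n. vge (v x) (c j \<otimes> u j)" "vge (v x + 1) (x \<ominus> c j0 \<otimes> u j0)" using comb[of c x] c by auto
  moreover have "[v x = int j0] (mod int n)" using cong_trans[OF j0(4) u(3)[OF j0(1)]] .
  ultimately show ?thesis by blast
 qed
 thus ?thesis using c by auto
qed

lemma unif_pow: "unif [^] (j::nat) : carrier R" "unif [^] (j::nat) ~= \<zero>" "v (unif [^] (j::nat)) = int j"
 using unif pow_nonzero v_pow[OF unif(1,2), of j] by auto

lemma unif_basis:
 assumes "x : carrier R"
 shows "\<exists>c. (\<forall>j<n. c j : K) \<and> x = (\<Oplus>j\<in>{..<n}. c j \<otimes> unif [^] j) \<and>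
  (x ~= \<zero> --> (\<exists>j0<n. c j0 ~= \<zero> \<and> v x = v (c j0 \<otimes> unif [^] j0) \<and> [v x = int j0] (mod int n) \<and>
   (\<forall>j<n. vge (v x) (c j \<otimes> unif [^] j)) \<and> vge (v x + 1) (x \<ominus> c j0 \<otimes> unif [^] j0)))"
 by (rule distinct_basis[of "\<lambda>j. unif [^] j" x]) (use unif_pow assms in auto)

text \<open>Values on \<open>K\<close> are multiples of \<open>n\<close>, so none lies strictly
  between \<open>- n\<close> and 0.\<close>

lemma K_val_nonneg: "[|c : K; vge (1 - int n) c|] ==> vge 0 c"
proof (cases "c = \<zero>")
 case False
 assume c: "c : K" "vge (1 - int n) c"
 then obtain q where q: "v c = int n * q" using v_K[of c] False by auto
 have "q \<ge> 0"
 proof (rule ccontr)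
  assume "\<not> ?thesis"
  hence "int n * q \<le> int n * (-1)" by (intro mult_left_mono) auto
  thus False using c q False by (simp add: vge_nonzero)
 qed
 thus ?thesis using q False by (simp add: vge_nonzero)
qed simp

text \<open>The residue extension is trivial: value 0 forces the leading term in the basis of powers
  of a uniformizer to be the one with exponent 0.\<close>

lemma residue_K:
 assumes x: "x : carrier R" "x ~= \<zero>" "v x = 0"
 obtains k where "k : K" "k ~= \<zero>" "v k = 0" "vge 1 (x \<ominus> k)"
proof -
 obtain c where c: "!!j. j < n ==> c j : K" and ex: "\<exists>j0<n. c j0 ~= \<zero> \<and> v x = v (c j0 \<otimes> unif [^] j0) \<and> [v x = int j0] (mod int n) \<and>
   (\<forall>j<n. vge (v x) (c j \<otimes> unif [^] j)) \<and> vge (v x + 1) (x \<ominus> c j0 \<otimes> unif [^] j0)" using unif_basis[OF x(1)] x(2) by auto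
 obtain j0 where j0: "j0 < n" "c j0 ~= \<zero>" "v x = v (c j0 \<otimes> unif [^] j0)" "[v x = int j0] (mod int n)"
  "vge (v x + 1) (x \<ominus> c j0 \<otimes> unif [^] j0)" using ex by auto
 hence "[int j0 = int 0] (mod int n)" using x by (simp add: cong_sym_eq)
 hence "[j0 = 0] (mod n)" using cong_int_iff by blast
 hence "j0 = 0" using j0(1) cong_less_modulus_unique_nat by simp
 thus ?thesis using that[of "c 0"] j0 c x Kc by auto
qed

lemma residue_K2:
 assumes x: "x : carrier R" "x ~= \<zero>" and y: "y : carrier R" "y ~= \<zero>" and "v x = v y"
 obtains k z where "k : K" "k ~= \<zero>" "v k = 0" "z : carrier R" "vge (v y + 1) z" "x = k \<otimes> y \<oplus> z"
proof -
 have "v (x \<otimes> inv y) = 0" using assms by (simp add: v_mult v_inv)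
 then obtain k where k: "k : K" "k ~= \<zero>" "v k = 0" "vge 1 (x \<otimes> inv y \<ominus> k)"
  using residue_K[of "x \<otimes> inv y"] assms(1-4) integral_iff[of x "inv y"] by auto
 let ?z = "(x \<otimes> inv y \<ominus> k) \<otimes> y"
 have kc: "k : carrier R" using k Kc by auto
 have "vge (1 + v y) ?z" using k kc assms by (intro vge_mult) auto
 moreover have "x = k \<otimes> y \<oplus> ?z" by (auto simp: kc x y a_minus_def l_distr l_minus a_lcomm[of "k \<otimes> y"] r_neg m_assoc)
 ultimately show ?thesis using that[of k ?z] k kc x y by (simp add: add.commute)
qed

lemma tr_zero [simp]: "tr \<zero> = \<zero>" using tr_smult[OF Kc(3), of \<one>] by simp

lemma tr_finsum: "[|finite I; !!i. i : I ==> f i : carrier R|] ==> tr (\<Oplus>i\<in>I. f i) = (\<Oplus>i\<in>I. tr (f i))" using tr_add by (intro additive_finsum) auto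

section \<open>The inverse different and values at which traces do not vanish\<close>

definition inv_diff where "inv_diff = {y : carrier R. \<forall>z\<in>carrier R. vge 0 z --> vge 0 (tr (y \<otimes> z))}"

lemma inv_diff_mult: "[|y : inv_diff; z : carrier R; vge 0 z|] ==> y \<otimes> z : inv_diff"
 using vge_mult[of z _ 0 0] by (auto simp: inv_diff_def m_assoc)

text \<open>A fractional ideal is given by one inequality once it is known to contain a nonzero
  element and to differ from the whole field.\<close>

lemma inv_diff_bound: "\<exists>d. \<forall>y\<in>carrier R - {\<zero>}. y : inv_diff \<longleftrightarrow> - d \<le> v y"
proof -
 have up: "y' : inv_diff" if "y : inv_diff" "y ~= \<zero>" "y' : carrier R" "y' ~= \<zero>" "v y \<le> v y'" for y y'
 proof -
  have yc: "y : carrier R" using that by (simp add: inv_diff_def)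
  have "vge 0 (inv y \<otimes> y')" using that yc integral_iff by (subst vge_nonzero) (auto simp: v_mult v_inv)
  hence "y \<otimes> (inv y \<otimes> y') : inv_diff" using that yc by (intro inv_diff_mult) auto
  thus ?thesis using that yc by (simp add: field_inv_cancel)
 qed
 obtain y0 where y0: "y0 : inv_diff" "y0 ~= \<zero>"
 proof -
  \<comment> \<open>Bounds the denominators of the traces of the powers of the uniformizer; a factor
    from \<open>K\<close> of value at least \<open>B\<close> clears them all.\<close>
  define B where "B = (\<Sum>j<n. \<bar>v (tr (unif [^] j))\<bar>)"
  have B: "- v (tr (unif [^] j)) \<le> B" if "j < n" for j
  proof -
   have "\<bar>v (tr (unif [^] j))\<bar> \<le> B" unfolding B_def using that by (intro member_le_sum) auto
   thus ?thesis by linarith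
  qed
  obtain y0 where y: "y0 : K" "y0 ~= \<zero>" "v y0 = int n * B" using ex_val_K[of "int n * B"] by auto
  have "B \<ge> 0" unfolding B_def by simp
  moreover have "int n \<ge> 1" using n0 by simp
  ultimately have vy: "B \<le> v y0" unfolding y(3) by (metis mult_le_cancel_right1 not_less)
  have yc: "y0 : carrier R" using y Kc by auto
  have "vge 0 (tr (y0 \<otimes> z))" if z: "z : carrier R" "vge 0 z" for z
  proof (cases "z = \<zero>")
   case False
   obtain c where c: "!!j. j < n ==> c j : K" "z = (\<Oplus>j\<in>{..<n}. c j \<otimes> unif [^] j)"
    and ex: "\<exists>j0<n. c j0 ~= \<zero> \<and> v z = v (c j0 \<otimes> unif [^] j0) \<and> [v z = int j0] (mod int n) \<and>
     (\<forall>j<n. vge (v z) (c j \<otimes> unif [^] j)) \<and> vge (v z + 1) (z \<ominus> c j0 \<otimes> unif [^] j0)" using unif_basis[OF z(1)] False by auto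
   have cR: "c j : carrier R" if "j < n" for j using c(1)[OF that] Kc by auto
   \<comment> \<open>From \<open>v z \<ge> 0\<close> one gets only \<open>v (c j) \<ge> - j\<close>,
     but this exceeds \<open>- n\<close>, and values on \<open>K\<close> are multiples of
     \<open>n\<close>.\<close>
   have cj: "vge 0 (c j)" if j: "j < n" for j
   proof (rule K_val_nonneg[OF c(1)[OF j]])
    show "vge (1 - int n) (c j)"
    proof (cases "c j = \<zero>")
     case cz: False
     have "0 \<le> v z" using z False by (simp add: vge_nonzero)
     also have "v z \<le> v (c j \<otimes> unif [^] j)" using ex j cz cR[OF j] unif_pow integral_iff by (auto simp: vge_nonzero)
     also have "\<dots> = v (c j) + int j" using cz cR[OF j] unif_pow by (simp add: v_mult)
     finally show ?thesis using j cz by (simp add: vge_nonzero)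
    qed simp
   qed
   have term_: "vge 0 ((y0 \<otimes> c j) \<otimes> tr (unif [^] j))" if j: "j < n" for j
   proof (cases "tr (unif [^] j) = \<zero>")
    case tz: False
    have "vge (B + 0 + (- B)) ((y0 \<otimes> c j) \<otimes> tr (unif [^] j))"
     using yc cR[OF j] cj[OF j] unif vy B[OF j] y(2) tz by (intro vge_mult) (auto simp: vge_nonzero)
    thus ?thesis by simp
   qed (use yc cR[OF j] in simp)
   have "tr (y0 \<otimes> z) = y0 \<otimes> tr z" using tr_smult y z by simp
   also have "tr z = (\<Oplus>j\<in>{..<n}. tr (c j \<otimes> unif [^] j))" unfolding c(2) using tr_add cR unif by (intro additive_finsum) auto
   also have "\<dots> = (\<Oplus>j\<in>{..<n}. c j \<otimes> tr (unif [^] j))" using tr_smult c(1) cR unif by (intro finsum_cong') auto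
   also have "y0 \<otimes> \<dots> = (\<Oplus>j\<in>{..<n}. y0 \<otimes> (c j \<otimes> tr (unif [^] j)))" using yc cR unif by (intro finsum_rdistr) auto
   also have "\<dots> = (\<Oplus>j\<in>{..<n}. (y0 \<otimes> c j) \<otimes> tr (unif [^] j))" using yc cR unif by (intro finsum_cong') (auto simp: m_assoc)
   finally show ?thesis using vge_finsum[of "{..<n}" "\<lambda>j. (y0 \<otimes> c j) \<otimes> tr (unif [^] j)" 0] term_ yc cR unif by simp
  qed (use yc in simp)
  thus ?thesis using that[of y0] y yc by (auto simp: inv_diff_def)
 qed
 obtain y1 where y1: "y1 : carrier R" "y1 ~= \<zero>" "y1 \<notin> inv_diff"
 proof -
  obtain x where x: "x : carrier R" "tr x ~= \<zero>" using tr_nonzero by auto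
  \<comment> \<open>Large enough that scaling by an element of \<open>K\<close> of value
    \<open>- n * e\<close> makes the nonzero trace of \<open>x\<close> nonintegral.\<close>
  define e where "e = \<bar>v (tr x)\<bar> + 1"
  obtain k where k: "k : K" "k ~= \<zero>" "v k = int n * (- e)" using ex_val_K[of "int n * (-e)"] by auto
  have kc: "k : carrier R" using k Kc by auto
  have "int n * e \<ge> 1 * e" using n0 by (intro mult_right_mono) (auto simp: e_def)
  moreover have "v k = - (int n * e)" using k(3) by simp
  moreover have "e > v (tr x)" by (simp add: e_def)
  ultimately have "v k + v (tr x) < 0" by linarith
  moreover have "v (tr (k \<otimes> x)) = v k + v (tr x)" using tr_smult[OF k(1) x(1)] k x kc by (simp add: v_mult)
  moreover have "tr (k \<otimes> x) ~= \<zero>" using tr_smult[OF k(1) x(1)] k x kc integral_iff by simp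
  ultimately have "\<not> vge 0 (tr ((k \<otimes> x) \<otimes> \<one>))" using kc x by (simp add: vge_nonzero)
  moreover have "vge 0 \<one>" by (simp add: vge_nonzero)
  ultimately have "k \<otimes> x \<notin> inv_diff" unfolding inv_diff_def by auto
  moreover have "x ~= \<zero>" using x by auto
  moreover have "k \<otimes> x : carrier R" "k \<otimes> x ~= \<zero>" if "x ~= \<zero>" using that kc k x(1) integral_iff by auto
  ultimately show ?thesis using that[of "k \<otimes> x"] by simp
 qed
 obtain ym where ym: "ym : inv_diff \<and> ym ~= \<zero>" "!!y. y : inv_diff \<and> y ~= \<zero> ==> nat (v ym - v y1) \<le> nat (v y - v y1)"
  using ex_has_least_nat[of "\<lambda>y. y : inv_diff \<and> y ~= \<zero>" y0 "\<lambda>y. nat (v y - v y1)"] y0 by auto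
 have big: "v y1 < v y" if "y : inv_diff" "y ~= \<zero>" for y using up[OF that y1(1,2)] y1(3) by linarith
 have "y : inv_diff \<longleftrightarrow> v ym \<le> v y" if y: "y : carrier R - {\<zero>}" for y
 proof
  assume "y : inv_diff"
  thus "v ym \<le> v y" using ym(2)[of y] big[of y] y by auto
 qed (use up[of ym y] ym(1) y in auto)
 thus ?thesis by (intro exI[of _ "- v ym"]) auto
qed

text \<open>The exponent of the different, read off from the inverse ideal;
  \<open>different_exponent_eq\<close> identifies it with the official definition.\<close>

definition dif where "dif = (SOME d. \<forall>y\<in>carrier R - {\<zero>}. y : inv_diff \<longleftrightarrow> - d \<le> v y)"

lemma inv_diff_iff: "[|y : carrier R; y ~= \<zero>|] ==> y : inv_diff \<longleftrightarrow> - dif \<le> v y"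
 using someI_ex[OF inv_diff_bound] unfolding dif_def[symmetric] by simp

lemma tr_vge: "[|y : carrier R; vge (- dif) y|] ==> vge 0 (tr y)"
proof -
 assume y: "y : carrier R" "vge (- dif) y"
 show ?thesis
 proof (cases "y = \<zero>")
  case True
  thus ?thesis by simp
 next
  case False
  hence "y : inv_diff" using inv_diff_iff y by (simp add: vge_nonzero)
  moreover have "vge 0 \<one>" by (simp add: vge_nonzero)
  ultimately have "vge 0 (tr (y \<otimes> \<one>))" unfolding inv_diff_def by auto
  thus ?thesis using y by simp
 qed
qed

text \<open>By the choice of \<open>dif\<close>, some element of value \<open>- dif - 1\<close> has
  a nonintegral trace. As the residue extension is trivial, it equals \<open>x\<close> times a unit
  of \<open>K\<close> up to an element of the inverse different, whose trace is integral.\<close>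

lemma tr_at_diff:
 assumes x: "x : carrier R" "x ~= \<zero>" "v x = - dif - 1"
 shows "\<not> vge 0 (tr x)"
proof
 assume trx: "vge 0 (tr x)"
 obtain y where y: "y : carrier R" "y ~= \<zero>" "v y = - dif - 1" using ex_val by auto
 hence "y \<notin> inv_diff" using inv_diff_iff by simp
 then obtain z where z: "z : carrier R" "vge 0 z" "\<not> vge 0 (tr (y \<otimes> z))" using y by (auto simp: inv_diff_def)
 have z0: "z ~= \<zero>" using z y by auto
 have yz: "y \<otimes> z : carrier R" "y \<otimes> z ~= \<zero>" using y z by auto
 have "v (y \<otimes> z) = v x"
 proof -
  have "0 \<le> v z" using z(2) z0 by (simp add: vge_nonzero)
  hence "v x \<le> v (y \<otimes> z)" using y z(1) z0 x by (simp add: v_mult)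
  moreover have "\<not> - dif \<le> v (y \<otimes> z)" using z(3) tr_vge[OF yz(1)] yz by (auto simp: vge_nonzero)
  ultimately show ?thesis using x by simp
 qed
 then obtain k z' where k: "k : K" "k ~= \<zero>" "v k = 0" "z' : carrier R" "vge (v x + 1) z'" "y \<otimes> z = k \<otimes> x \<oplus> z'"
  using residue_K2[OF yz x(1,2)] by auto
 have kc: "k : carrier R" using k Kc by auto
 have "tr (y \<otimes> z) = k \<otimes> tr x \<oplus> tr z'" using tr_add tr_smult k x kc by simp
 moreover have "vge (0 + 0) (k \<otimes> tr x)" using trx k kc x by (intro vge_mult) (auto simp: vge_nonzero)
 moreover have "vge 0 (tr z')" using k x by (intro tr_vge) auto
 ultimately show False using z(3) vge_add[of "k \<otimes> tr x" "tr z'" 0] kc x k by simp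
qed

text \<open>Factors from \<open>K\<close> shift the value by any multiple of \<open>n\<close> and
  can be taken out of the trace.\<close>

lemma tr_nonzero_at:
 assumes x: "x : carrier R" "x ~= \<zero>" "[v x = - dif - 1] (mod int n)"
 shows "tr x ~= \<zero>"
proof -
 have "[- dif - 1 = v x] (mod int n)" using x(3) by (rule cong_sym)
 hence "int n dvd (- dif - 1 - v x)" by (simp add: cong_iff_dvd_diff)
 then obtain k where k: "k : K" "k ~= \<zero>" "v k = - dif - 1 - v x" using ex_val_K by auto
 have kc: "k : carrier R" using k Kc by auto
 have "\<not> vge 0 (tr (k \<otimes> x))" using k kc x integral_iff by (intro tr_at_diff) (auto simp: v_mult)
 thus ?thesis using tr_smult k kc x by auto
qed

lemma tr_nondegenerate:
 assumes "y : carrier R" "!!z. z : carrier R ==> tr (z \<otimes> y) = \<zero>"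
 shows "y = \<zero>"
proof (rule ccontr)
 assume y: "y ~= \<zero>"
 obtain t where t: "t : carrier R" "tr t ~= \<zero>" using tr_nonzero by auto
 have "tr (t \<otimes> inv y \<otimes> y) = \<zero>" using assms y t by simp
 thus False using t assms y by (simp add: m_assoc)
qed

section \<open>Normal elements and orthogonality under the trace form\<close>

definition units_in_submodules where "units_in_submodules \<longleftrightarrow> (\<forall>N. submodule N --> N ~= {\<zero>} --> (\<exists>x\<in>N. x ~= \<zero> \<and> v x = 0))"

lemma lin_indep_normal:
 assumes x: "x : carrier R" and li: "lin_indep K G (\<lambda>g. g x)"
 shows "normal_element R K x"
proof -
 obtain h where h: "bij_betw h {..<n} G" using ex_bij_betw_nat_finite[OF finite_G] by (auto simp: lessThan_atLeast0)
 let ?U = "map ((\<lambda>g. g x) \<circ> h) [0..<n]"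
 have hG: "h i : G" if "i < n" for i using h that by (auto simp: bij_betw_def)
 have "lin_indep K {..<n} ((\<lambda>g. g x) \<circ> h)" using lin_indep_reindex[OF h, of "\<lambda>g. g x" K] li x Kc(1) by simp
 hence ind: "independent K ?U" using lin_indep_imp_independent[OF fixed_subfield] x hG by simp
 moreover have "set ?U \<subseteq> carrier R" using x hG by auto
 hence "Span K ?U = carrier R" using independent_length_eq_dimension[OF fixed_subfield artin_dimension ind] by simp
 moreover have "set ?U = (\<lambda>g. g x) ` (h ` {..<n})" by auto
 hence "set ?U = (\<lambda>g. g x) ` G" using h by (simp add: bij_betw_def)
 ultimately show ?thesis using x galois_group_eq unfolding normal_element_def by metis
qed

text \<open>The elements orthogonal to \<open>y\<close> form a space over \<open>K\<close>;
  containing a spanning set of conjugates, it is everything, and the trace form is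
  nondegenerate.\<close>

lemma normal_span:
 assumes "normal_element R K x" "y : carrier R" "!!g. g : G ==> tr (g x \<otimes> y) = \<zero>"
 shows "y = \<zero>"
proof (rule tr_nondegenerate[OF assms(2)])
 obtain Us where Us: "set Us = (\<lambda>g. g x) ` G" "Span K Us = carrier R" and x: "x : carrier R"
  using assms(1) unfolding normal_element_def by auto
 define V where "V = {z : carrier R. tr (z \<otimes> y) = \<zero>}"
 note tr0 = tr_zero
 have "subalgebra K V R"
 proof (intro subalgebra.intro subalgebra_axioms.intro)
  show "subgroup V (add_monoid R)"
  proof (rule add.subgroupI)
   show "\<ominus> a : V" if a: "a : V" for a
   proof -
    have ac: "a : carrier R" "tr (a \<otimes> y) = \<zero>" using a by (auto simp: V_def)
    have "tr (\<ominus> \<one> \<otimes> (a \<otimes> y)) = \<ominus> \<one> \<otimes> tr (a \<otimes> y)" using ac assms(2) Kc by (intro tr_smult) auto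
    thus ?thesis using ac assms(2) by (simp add: V_def l_minus)
   qed
  qed (use assms(2) tr0 in \<open>auto simp: V_def l_distr tr_add intro!: exI[of _ \<zero>]\<close>)
  show "k \<otimes> z : V" if "k : K" "z : V" for k z using that assms(2) Kc by (auto simp: V_def m_assoc tr_smult)
 qed
 moreover have "set Us \<subseteq> V" using Us assms x by (auto simp: V_def)
 ultimately have "Span K Us \<subseteq> V" using subalgebra_Span_incl[OF fixed_subfield] by simp
 thus "tr (z \<otimes> y) = \<zero>" if "z : carrier R" for z using that Us by (auto simp: V_def)
qed

text \<open>Fewer than \<open>n\<close> linear conditions on the \<open>n\<close> coordinates with
  respect to the powers of a uniformizer.\<close>

lemma orthogonal_exists:
 assumes "finite I" "card I < n" "!!i. i : I ==> w i : carrier R"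
 obtains y where "y : carrier R" "y ~= \<zero>" "!!i. i : I ==> tr (w i \<otimes> y) = \<zero>"
proof -
 obtain c where c: "!!j. j : {..<n} ==> c j : K" "\<exists>j\<in>{..<n}. c j ~= \<zero>" "!!i. i : I ==> (\<Oplus>j\<in>{..<n}. tr (w i \<otimes> unif [^] j) \<otimes> c j) = \<zero>"
  using linear_system_solution[OF fixed_subfield assms(1), of "{..<n}" "\<lambda>i j. tr (w i \<otimes> unif [^] j)"] assms(2,3) tr_fixed unif(1) by auto
 have cR: "c j : carrier R" if "j < n" for j using c(1) Kc that by auto
 define y where "y = (\<Oplus>j\<in>{..<n}. c j \<otimes> unif [^] j)"
 have y: "y : carrier R" unfolding y_def using cR unif by simp
 have dist: "\<not> [v (unif [^] i) = v (unif [^] j)] (mod int n)" if "i : {..<n}" "j : {..<n}" "i ~= j" for i j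
  using that unif_pow cong_less_modulus_unique_nat by (auto simp: cong_int_iff)
 have "y ~= \<zero>" using K_combination[of "{..<n}" "\<lambda>j. unif [^] j" c y, OF _ unif_pow(1,2) dist] c(1,2) y_def by blast
 moreover have "tr (w i \<otimes> y) = \<zero>" if i: "i : I" for i
 proof -
  have "w i \<otimes> y = (\<Oplus>j\<in>{..<n}. w i \<otimes> (c j \<otimes> unif [^] j))" unfolding y_def using cR unif assms(3)[OF i] by (intro finsum_rdistr) auto
  moreover have "tr (\<Oplus>j\<in>{..<n}. w i \<otimes> (c j \<otimes> unif [^] j)) = (\<Oplus>j\<in>{..<n}. tr (w i \<otimes> (c j \<otimes> unif [^] j)))"
   using cR unif assms(3)[OF i] by (intro tr_finsum) auto
  ultimately have "tr (w i \<otimes> y) = (\<Oplus>j\<in>{..<n}. tr (w i \<otimes> (c j \<otimes> unif [^] j)))" by simp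
  also have "\<dots> = (\<Oplus>j\<in>{..<n}. tr (w i \<otimes> unif [^] j) \<otimes> c j)"
  proof (intro finsum_cong' refl)
   fix j assume j: "j : {..<n}"
   have "w i \<otimes> (c j \<otimes> unif [^] j) = c j \<otimes> (w i \<otimes> unif [^] j)" using cR[of j] unif assms(3)[OF i] j by (simp add: m_lcomm)
   thus "tr (w i \<otimes> (c j \<otimes> unif [^] j)) = tr (w i \<otimes> unif [^] j) \<otimes> c j"
    using tr_smult[OF c(1)[OF j], of "w i \<otimes> unif [^] j"] cR[of j] unif assms(3)[OF i] j by (simp add: m_comm)
  qed (use cR unif assms(3)[OF i] in auto)
  finally show ?thesis using c(3)[OF i] by simp
 qed
 ultimately show ?thesis using that y by simp
qed

text \<open>If the conjugates of \<open>x\<close> were dependent, the vectors orthogonal to all of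
  them would form a nonzero submodule. A unit \<open>u\<close> in it would satisfy
  \<open>tr (x \<otimes> u) = \<zero>\<close>, although \<open>x \<otimes> u\<close> lies in the
  value class where traces do not vanish.\<close>

theorem normal_if_units:
 assumes U: units_in_submodules and x: "x : carrier R" "x ~= \<zero>" "[v x = - dif - 1] (mod int n)"
 shows "normal_element R K x"
proof (rule lin_indep_normal[OF x(1)], unfold lin_indep_def, intro allI impI, rule ccontr)
 fix c assume c: "\<forall>g\<in>G. c g : K" "(\<Oplus>g\<in>G. c g \<otimes> g x) = \<zero>" and "\<not> (\<forall>g\<in>G. c g = \<zero>)"
 then obtain g0 where g0: "g0 : G" "c g0 ~= \<zero>" by blast
 have cR: "c g : carrier R" if "g : G" for g using c(1) Kc that by auto
 \<comment> \<open>Orthogonality to \<open>n - 1\<close> conjugates can be arranged by counting; the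
   relation, in which \<open>g0\<close> occurs, then gives it for the remaining one.\<close>
 obtain y where y: "y : carrier R" "y ~= \<zero>" "!!g. g : G - {g0} ==> tr (g x \<otimes> y) = \<zero>"
  using orthogonal_exists[of "G - {g0}" "\<lambda>g. g x"] finite_G g0 n0 x(1) by auto
 note tr0 = tr_zero
 have g0y: "tr (g0 x \<otimes> y) = \<zero>"
 proof -
  have "\<zero> = (\<Oplus>g\<in>G. c g \<otimes> g x) \<otimes> y" using c(2) y by simp
  also have "\<dots> = (\<Oplus>g\<in>G. (c g \<otimes> g x) \<otimes> y)" using finite_G cR x y by (intro finsum_ldistr) auto
  finally have "tr (\<Oplus>g\<in>G. (c g \<otimes> g x) \<otimes> y) = \<zero>" using tr0 by simp
  moreover have "tr (\<Oplus>g\<in>G. (c g \<otimes> g x) \<otimes> y) = (\<Oplus>g\<in>G. tr ((c g \<otimes> g x) \<otimes> y))" using finite_G cR x y by (intro tr_finsum) auto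
  moreover have "\<dots> = (\<Oplus>g\<in>G. c g \<otimes> tr (g x \<otimes> y))" using cR x y c tr_smult by (intro finsum_cong') (auto simp: m_assoc)
  moreover have "(\<Oplus>g\<in>insert g0 (G - {g0}). c g \<otimes> tr (g x \<otimes> y)) = c g0 \<otimes> tr (g0 x \<otimes> y) \<oplus> (\<Oplus>g\<in>G - {g0}. c g \<otimes> tr (g x \<otimes> y))"
   using finite_G g0 cR x y by (intro finsum_insert) auto
  moreover have "insert g0 (G - {g0}) = G" using g0 by auto
  moreover have "(\<Oplus>g\<in>G - {g0}. c g \<otimes> tr (g x \<otimes> y)) = (\<Oplus>g\<in>G - {g0}. \<zero>)" using y(3) cR by (intro finsum_cong') auto
  ultimately have "c g0 \<otimes> tr (g0 x \<otimes> y) = \<zero>" using cR g0 x y by simp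
  thus ?thesis using integral_iff[of "c g0" "tr (g0 x \<otimes> y)"] cR g0 x y by auto
 qed
 define N where "N = {y : carrier R. \<forall>g\<in>G. tr (g x \<otimes> y) = \<zero>}"
 have "submodule N" unfolding submodule_def
 proof (intro conjI ballI)
  fix a b assume "a : N" "b : N"
  thus "a \<oplus> b : N" using x by (auto simp: N_def r_distr tr_add)
 next
  fix k a assume k: "k : K" "a : N"
  have "tr (g x \<otimes> (k \<otimes> a)) = \<zero>" if g: "g : G" for g using k Kc x g m_lcomm N_def tr_smult[of k "g x \<otimes> a"] by simp
  thus "k \<otimes> a : N" using k Kc by (auto simp: N_def)
 next
  fix h a assume h: "h : G" "a : N"
  obtain h' where h': "h' : G" "!!x. x : carrier R ==> h (h' x) = x" using aut_inverse[OF h(1)] by metis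
  have "tr (g x \<otimes> h a) = \<zero>" if g: "g : G" for g
  proof -
   have "g x \<otimes> h a = h (compose (carrier R) h' g x \<otimes> a)" using h h' g x by (simp add: aut_mult N_def compose_def)
   hence "tr (g x \<otimes> h a) = tr (compose (carrier R) h' g x \<otimes> a)" using h x aut_comp[OF h'(1) g] by (simp add: tr_aut N_def)
   thus ?thesis using h aut_comp[OF h'(1) g] by (simp add: N_def)
  qed
  thus "h a : N" using h by (auto simp: N_def)
 qed (use tr0 x in \<open>auto simp: N_def\<close>)
 moreover have "y : N" using y g0y by (auto simp: N_def)
 ultimately obtain u where u: "u : N" "u ~= \<zero>" "v u = 0" using U y(2) unfolding units_in_submodules_def by auto
 have uc: "u : carrier R" using u by (simp add: N_def)
 have "tr (x \<otimes> u) = \<zero>" using u aut_id x by (auto simp: N_def)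
 moreover have "tr (x \<otimes> u) ~= \<zero>" using x u uc integral_iff by (intro tr_nonzero_at) (auto simp: v_mult)
 ultimately show False by simp
qed

text \<open>A nonzero submodule \<open>N\<close> without units yields an \<open>x\<close> in the
  critical value class that is not normal: the vector dual to 1 in a basis adapted to
  \<open>N\<close>. It is orthogonal to \<open>N\<close>, hence so are all its conjugates.\<close>

theorem units_if_normal:
 assumes VC: "!!x. [|x : carrier R; x ~= \<zero>; [v x = - dif - 1] (mod int n)|] ==> normal_element R K x"
 shows units_in_submodules
proof (unfold units_in_submodules_def, intro allI impI, rule ccontr)
 fix N assume N: "submodule N" "N ~= {\<zero>}" and no: "\<not> (\<exists>x\<in>N. x ~= \<zero> \<and> v x = 0)"
 note Nd = submoduleD[OF N(1)]
 have no0: "\<not> [v x = 0] (mod int n)" if x: "x : N" "x ~= \<zero>" for x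
 proof
  assume "[v x = 0] (mod int n)"
  hence "int n dvd - v x" by (simp add: cong_0_iff)
  then obtain k where k: "k : K" "k ~= \<zero>" "v k = - v x" using ex_val_K by blast
  have "v (k \<otimes> x) = 0" "k \<otimes> x ~= \<zero>" using k x Kc Nd integral_iff by (auto simp: v_mult)
  thus False using no Nd(5)[OF k(1) x(1)] by auto
 qed
 \<comment> \<open>An adapted basis has one vector for each value class, taken from \<open>N\<close>
   whenever \<open>N\<close> meets the class. As \<open>N\<close> has no value in the class of 0,
   the vector there is 1.\<close>
 define P where "P = (\<lambda>j y. y : N \<and> y ~= \<zero> \<and> [v y = int j] (mod int n))"
 define u where "u = (\<lambda>j. if \<exists>y. P j y then SOME y. P j y else unif [^] j)"
 have uP: "P j (u j)" if "\<exists>y. P j y" for j using someI_ex[OF that] that by (simp add: u_def)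
 have uN: "u j = unif [^] j" if "\<nexists>y. P j y" for j using that unfolding u_def by auto
 have u: "u j : carrier R" "u j ~= \<zero>" "[v (u j) = int j] (mod int n)" for j
 proof -
  have "u j : carrier R \<and> u j ~= \<zero> \<and> [v (u j) = int j] (mod int n)"
  proof (cases "\<exists>y. P j y")
   case True
   thus ?thesis using uP[OF True] Nd(2) by (simp add: P_def)
  next
   case False
   thus ?thesis using uN[OF False] unif_pow by simp
  qed
  thus "u j : carrier R" "u j ~= \<zero>" "[v (u j) = int j] (mod int n)" by auto
 qed
 have "\<not> (\<exists>y. P 0 y)" using no0 by (auto simp: P_def)
 hence u0: "u 0 = \<one>" using uN[of 0] by simp
 have dist: "\<not> [v (u i) = v (u j)] (mod int n)" if "i : {..<n}" "j : {..<n}" "i ~= j" for i j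
 proof
  assume "[v (u i) = v (u j)] (mod int n)"
  hence "[int i = int j] (mod int n)" using u(3) cong_trans cong_sym by metis
  thus False using that by (simp add: cong_int_iff cong_less_modulus_unique_nat)
 qed
 obtain x0 where x0: "x0 : carrier R" "x0 ~= \<zero>" "!!j. j : {0<..<n} ==> tr (u j \<otimes> x0) = \<zero>"
  using orthogonal_exists[of "{0<..<n}" u] u(1) n0 by auto
 have expand: "\<exists>c. (\<forall>j<n. c j : K) \<and> z = (\<Oplus>j\<in>{..<n}. c j \<otimes> u j) \<and> (z ~= \<zero> --> (\<forall>j<n. vge (v z) (c j \<otimes> u j)))" if "z : carrier R" for z
  using distinct_basis[of u z] u that by blast
 have ins: "{..<n} = insert 0 {0<..<n}" using n0 by auto
 have trx: "tr (z \<otimes> x0) = c 0 \<otimes> tr x0" if c: "!!j. j < n ==> c j : K" "z = (\<Oplus>j\<in>{..<n}. c j \<otimes> u j)" for c z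
 proof -
  have cR: "c j : carrier R" if "j < n" for j using c(1) Kc that by auto
  have "z \<otimes> x0 = (\<Oplus>j\<in>{..<n}. (c j \<otimes> u j) \<otimes> x0)" unfolding c(2) using cR u x0 by (intro finsum_ldistr) auto
  moreover have "tr (\<Oplus>j\<in>{..<n}. (c j \<otimes> u j) \<otimes> x0) = (\<Oplus>j\<in>{..<n}. tr ((c j \<otimes> u j) \<otimes> x0))" using cR u x0 by (intro tr_finsum) auto
  ultimately have "tr (z \<otimes> x0) = (\<Oplus>j\<in>{..<n}. tr ((c j \<otimes> u j) \<otimes> x0))" by simp
  also have "\<dots> = (\<Oplus>j\<in>{..<n}. c j \<otimes> tr (u j \<otimes> x0))" using cR c(1) u x0 tr_smult by (intro finsum_cong') (auto simp: m_assoc)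
  also have "\<dots> = c 0 \<otimes> tr (u 0 \<otimes> x0) \<oplus> (\<Oplus>j\<in>{0<..<n}. c j \<otimes> tr (u j \<otimes> x0))" unfolding ins using cR u x0 n0 by simp
  also have "(\<Oplus>j\<in>{0<..<n}. c j \<otimes> tr (u j \<otimes> x0)) = (\<Oplus>j\<in>{0<..<n}. \<zero>)" using x0 cR by (intro finsum_cong') auto
  finally show ?thesis using u0 cR[OF n0] x0 by simp
 qed
 have t0: "tr x0 ~= \<zero>"
 proof
  assume t: "tr x0 = \<zero>"
  have "x0 = \<zero>"
  proof (rule tr_nondegenerate[OF x0(1)])
   fix z assume "z : carrier R"
   then obtain c where c: "!!j. j < n ==> c j : K" "z = (\<Oplus>j\<in>{..<n}. c j \<otimes> u j)" using expand by auto
   thus "tr (z \<otimes> x0) = \<zero>" using trx[OF c] t c(1)[OF n0] Kc by simp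
  qed
  thus False using x0 by simp
 qed
 define a where "a = inv (tr x0)"
 have a: "a : K" "a : carrier R" "a ~= \<zero>" "a \<otimes> tr x0 = \<one>" using tr_fixed[OF x0(1)] t0 Kc by (auto simp: a_def)
 define x where "x = a \<otimes> x0"
 have x: "x : carrier R" "x ~= \<zero>" using a x0 integral_iff by (auto simp: x_def)
 \<comment> \<open>Pairing with \<open>x\<close> reads off the coefficient of 1 in the adapted
   basis.\<close>
 have trx': "tr (z \<otimes> x) = c 0" if c: "!!j. j < n ==> c j : K" "z = (\<Oplus>j\<in>{..<n}. c j \<otimes> u j)" for c z
 proof -
  have cR: "c j : carrier R" if "j < n" for j using c(1) Kc that by auto
  have zc: "z : carrier R" unfolding c(2) using cR u by simp
  have "z \<otimes> x = a \<otimes> (z \<otimes> x0)" using zc a x0 by (simp add: x_def m_lcomm)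
  hence "tr (z \<otimes> x) = a \<otimes> (c 0 \<otimes> tr x0)" using tr_smult a zc x0 trx[OF c] by simp
  also have "\<dots> = c 0 \<otimes> (a \<otimes> tr x0)" using a(2) cR[OF n0] x0(1) by (intro m_lcomm) auto
  also have "\<dots> = c 0" unfolding a(4) using cR[OF n0] by simp
  finally show ?thesis .
 qed
 have big: "vge 0 (tr (z \<otimes> x))" if z: "z : carrier R" "vge (1 - int n) z" for z
 proof (cases "z = \<zero>")
  case True
  thus ?thesis using x by simp
 next
  case False
  obtain c where c: "!!j. j < n ==> c j : K" "z = (\<Oplus>j\<in>{..<n}. c j \<otimes> u j)"
   and ex: "\<forall>j<n. vge (v z) (c j \<otimes> u j)" using expand[OF z(1)] False by auto
  have "vge (v z) (c 0)" using ex n0 u0 c(1)[OF n0] Kc by auto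
  hence "vge (1 - int n) (c 0)" using z False by (auto simp: vge_nonzero elim: vge_mono)
  hence "vge 0 (c 0)" by (rule K_val_nonneg[OF c(1)[OF n0]])
  thus ?thesis using trx'[OF c] by simp
 qed
 \<comment> \<open>Pairing with \<open>x\<close> is integral on all elements of value at least
   \<open>1 - n\<close>, but not on an element of \<open>K\<close> of value \<open>- n\<close>; this
   pins down the value of \<open>x\<close>.\<close>
 have "v x = int n - dif - 1"
 proof -
  obtain t where t: "t : carrier R" "t ~= \<zero>" "v t = 1 - int n" using ex_val by auto
  have "x \<otimes> t : inv_diff" unfolding inv_diff_def
  proof (intro CollectI conjI ballI impI)
   fix z assume z: "z : carrier R" "vge 0 z"
   have "vge ((1 - int n) + 0) (t \<otimes> z)" using t z by (intro vge_mult) (auto simp: vge_nonzero)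
   hence "vge 0 (tr (t \<otimes> z \<otimes> x))" using t z by (intro big) auto
   thus "vge 0 (tr (x \<otimes> t \<otimes> z))" using t z x by (simp add: m_ac)
  qed (use t x in auto)
  hence 1: "- dif \<le> v x + (1 - int n)" using inv_diff_iff[of "x \<otimes> t"] t x integral_iff by (simp add: v_mult)
  obtain k where k: "k : K" "k ~= \<zero>" "v k = - int n" using ex_val_K[of "- int n"] by auto
  have kc: "k : carrier R" using k Kc by auto
  have "tr (x \<otimes> k \<otimes> \<one>) = k" using tr_smult k x tr_smult[OF a(1) x0(1)] a(4) x_def kc m_comm by simp
  moreover have "\<not> vge 0 k" using k n0 by (simp add: vge_nonzero)
  moreover have "vge 0 \<one>" by (simp add: vge_nonzero)
  ultimately have "x \<otimes> k \<notin> inv_diff" unfolding inv_diff_def by auto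
  hence 2: "\<not> - dif \<le> v x - int n" using inv_diff_iff[of "x \<otimes> k"] k kc x integral_iff by (simp add: v_mult)
  show ?thesis using 1 2 by simp
 qed
 hence nx: "normal_element R K x" using x by (intro VC) (auto simp: cong_iff_dvd_diff)
 \<comment> \<open>The part \<open>b\<close> of \<open>y\<close> formed by basis vectors outside
   \<open>N\<close> lies in \<open>N\<close> itself. If 1 occurred in it, the leading vector of
   \<open>b\<close> would be outside \<open>N\<close> although \<open>N\<close> meets its value
   class.\<close>
 have trN: "tr (y \<otimes> x) = \<zero>" if y: "y : N" for y
 proof -
  have yc: "y : carrier R" using y Nd by auto
  obtain c where c: "!!j. j < n ==> c j : K" "y = (\<Oplus>j\<in>{..<n}. c j \<otimes> u j)" using expand[OF yc] by auto
  have cR: "c j : carrier R" if "j < n" for j using c(1) Kc that by auto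
  let ?S = "{j\<in>{..<n}. u j : N}" and ?T = "{j\<in>{..<n}. u j \<notin> N}"
  define b where "b = (\<Oplus>j\<in>?T. c j \<otimes> u j)"
  have "y = (\<Oplus>j\<in>?S \<union> ?T. c j \<otimes> u j)" unfolding c(2) by (rule arg_cong[where f = "\<lambda>A. finsum R _ A"]) auto
  also have "\<dots> = (\<Oplus>j\<in>?S. c j \<otimes> u j) \<oplus> b" unfolding b_def using cR u by (intro finsum_Un_disjoint) auto
  finally have yb: "y = (\<Oplus>j\<in>?S. c j \<otimes> u j) \<oplus> b" .
  have sN: "(\<Oplus>j\<in>?S. c j \<otimes> u j) : N" using c(1) Nd by (intro submodule_finsum[OF N(1)]) auto
  have bc: "b : carrier R" unfolding b_def using cR u by simp
  have sc: "(\<Oplus>j\<in>?S. c j \<otimes> u j) : carrier R" using sN Nd by auto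
  have "b = y \<oplus> \<ominus> \<one> \<otimes> (\<Oplus>j\<in>?S. c j \<otimes> u j)" using yb bc sc by (simp add: l_minus a_comm[of _ b] a_assoc r_neg)
  hence bN: "b : N" using Nd(4)[OF y Nd(5)[OF _ sN]] Kc(4,7) by simp
  have "c 0 = \<zero>"
  proof (rule ccontr)
   assume c0: "c 0 ~= \<zero>"
   have "0 : ?T" using n0 u0 no0[of \<one>] by auto
   hence nz: "\<exists>j\<in>?T. c j ~= \<zero>" using c0 by auto
   have "\<exists>j0\<in>?T. c j0 ~= \<zero> \<and> b ~= \<zero> \<and> v b = v (c j0 \<otimes> u j0) \<and> [v b = v (u j0)] (mod int n) \<and>
     (\<forall>j\<in>?T. vge (v b) (c j \<otimes> u j)) \<and> vge (v b + 1) (b \<ominus> c j0 \<otimes> u j0)"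
    by (rule K_combination[OF _ _ _ _ _ nz b_def]) (use u dist c(1) in auto)
   then obtain j0 where j0: "j0 : ?T" "b ~= \<zero>" "[v b = v (u j0)] (mod int n)" by blast
   have "P j0 b" using bN j0(2) cong_trans[OF j0(3) u(3)] unfolding P_def by simp
   hence "u j0 : N" using uP[of j0] by (auto simp: P_def)
   thus False using j0(1) by simp
  qed
  thus ?thesis using trx'[OF c] by simp
 qed
 obtain y where y: "y : N" "y ~= \<zero>" using N(2) Nd(3) by auto
 have yc: "y : carrier R" using y Nd by auto
 have "tr (g x \<otimes> y) = \<zero>" if g: "g : G" for g
 proof -
  obtain g' where g': "g' : G" "!!x. x : carrier R ==> g (g' x) = x" using aut_inverse[OF g] by metis
  have "g x \<otimes> y = g (x \<otimes> g' y)" using g g' x yc by (simp add: aut_mult)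
  hence "tr (g x \<otimes> y) = tr (g' y \<otimes> x)" using g g' x yc by (simp add: tr_aut m_comm)
  thus ?thesis using trN Nd(6)[OF g'(1) y(1)] by simp
 qed
 hence "y = \<zero>" by (rule normal_span[OF nx yc])
 thus False using y by simp
qed

end

section \<open>Cyclic extensions and intermediate fields\<close>

context aut_group
begin

text \<open>A cyclic group consists of the integer powers of a generator; finiteness reduces these
  to natural exponents.\<close>

lemma cyclic_group_iff: "cyclic_group GG \<longleftrightarrow> (\<exists>s\<in>G. \<forall>g\<in>G. \<exists>i::nat. g = s \<up> i)"
proof -
 have "carrier GG = range (\<lambda>i::int. s \<up> i) \<longleftrightarrow> (\<forall>g\<in>G. \<exists>i::nat. g = s \<up> i)" if s: "s : G" for s
 proof -
  have "range (\<lambda>i::int. s \<up> i) = generate GG {s}" using GG.generate_pow[of s] s by auto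
  also have "\<dots> = {s \<up> i |i::nat. i : UNIV}" using GG.generate_pow_on_finite_carrier[of s] s finite_G by simp
  finally have eq: "range (\<lambda>i::int. s \<up> i) = {s \<up> i |i::nat. i : UNIV}" .
  have "{s \<up> i |i::nat. i : UNIV} \<subseteq> G" using s by auto
  thus ?thesis unfolding eq GG_simps(1) by auto
 qed
 thus ?thesis unfolding GG.cyclic_group by simp
qed

lemma exponent_cyclic:
 assumes s: "s : G" "!!g. g : G ==> \<exists>i::nat. g = s \<up> i"
 shows "GG.ord s = card G" "group_exponent GG = card G"
proof -
 have "generate GG {s} = {s \<up> i |i::nat. i : UNIV}" using GG.generate_pow_on_finite_carrier[of s] s finite_G by simp
 also have "\<dots> = G" using s by auto
 finally show o: "GG.ord s = card G" using GG.generate_pow_card[of s] s by simp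
 have "card G > 0" using finite_G aut_id card_gt_0_iff by auto
 thus "group_exponent GG = card G" unfolding group_exponent_def
 proof (intro Least_equality conjI ballI)
  fix g assume "g : carrier GG"
  thus "g \<up> card G = \<one>\<^bsub>GG\<^esub>" using GG.pow_order_eq_1[of g] by (simp add: order_def)
 next
  fix l :: nat assume l: "0 < l \<and> (\<forall>g\<in>carrier GG. g \<up> l = \<one>\<^bsub>GG\<^esub>)"
  hence "s \<up> l = \<one>\<^bsub>GG\<^esub>" using s by simp
  hence "GG.ord s dvd l" using GG.pow_eq_id[of s l] s(1) by simp
  thus "card G \<le> l" using o l by auto
 qed
qed

lemma cyclic_extension_iff: "cyclic_extension R K r \<longleftrightarrow> card G = r \<and> (\<exists>s\<in>G. \<forall>g\<in>G. \<exists>i::nat. g = s \<up> i)"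
 using dimension_is_inj[OF fixed_subfield artin_dimension, of r] artin_dimension galois_extension
 unfolding cyclic_extension_def cyclic_group_iff by auto

end

context ab_aut_group
begin

definition stab :: "'a set \<Rightarrow> ('a \<Rightarrow> 'a) set" where "stab F = {g : G. \<forall>x\<in>F. g x = x}"

lemma stab_aut_group: "F \<subseteq> carrier R ==> aut_group R (stab F)"
proof (rule subgroup_aut)
 assume F: "F \<subseteq> carrier R"
 show "(\<lambda>x\<in>carrier R. x) : stab F" using F aut_id by (auto simp: stab_def)
 fix g h assume "g : stab F" "h : stab F"
 thus "compose (carrier R) g h : stab F" using F aut_comp by (simp add: stab_def compose_def subset_iff)
qed (auto simp: stab_def)

lemma fixed_field_stable:
 assumes "A \<subseteq> G" "g : G" "x : fixed_field R A" shows "g x : fixed_field R A"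
proof -
 have "h (g x) = g x" if "h : A" for h using assms that aut_commute[of h g x] by (auto simp: fixed_field_def subset_iff)
 thus ?thesis using assms by (auto simp: fixed_field_def)
qed

text \<open>Galois correspondence by counting. Restrictions of \<open>G\<close> to \<open>E\<close>
  that agree on \<open>F\<close> differ by an element of \<open>stab F\<close> and so agree on
  \<open>E\<close>. Hence the degree of \<open>E\<close>, which is the number of these restrictions,
  is at most that of \<open>F\<close>.\<close>

theorem fixed_field_stab:
 assumes F: "subfield F R" and KF: "K \<subseteq> F"
 shows "fixed_field R (stab F) = F"
proof -
 note Fc = subfield_closed[OF F]
 define E where "E = fixed_field R (stab F)"
 have FE: "F \<subseteq> E" using Fc(1) by (auto simp: E_def fixed_field_def stab_def)
 interpret H: aut_group R "stab F" by (rule stab_aut_group[OF Fc(1)])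
 have E: "subfield E R" unfolding E_def by (rule H.fixed_subfield)
 note Ec = subfield_closed[OF E]
 let ?S = "(\<lambda>g. restrict g E) ` G"
 have st: "g x : E" if "g : G" "x : E" for g x using fixed_field_stable[of "stab F" g x] that by (auto simp: E_def stab_def)
 interpret S: aut_group "R\<lparr>carrier := E\<rparr>" ?S using restrict_aut_group(1)[where F = E] E st by simp
 have "fixed_field (R\<lparr>carrier := E\<rparr>) ?S = K" using restrict_aut_group(2)[where F = E] E st KF FE by auto
 hence "ring.dimension (R\<lparr>carrier := E\<rparr>) (card ?S) K E" using S.artin_dimension by simp
 hence dimE: "dimension (card ?S) K E" using dimension_subring[OF subfieldE(1)[OF E]] by simp
 have "subalgebra K F R"
 proof (intro subalgebra.intro subalgebra_axioms.intro)
  show "subgroup F (add_monoid R)" using subring.axioms(1)[OF subfieldE(1)[OF F]] .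
 qed (use KF Fc in auto)
 hence "finite_dimension K F" using subalbegra_incl_imp_finite_dimension[OF fixed_subfield _ _ FE] finite_dimensionI[OF dimE] by simp
 then obtain d where d: "dimension d K F" by auto
 obtain u where u: "!!i. i < d ==> u i : F" "lin_indep K {..<d} u" using dimension_basis[OF fixed_subfield d] by auto
 have "d \<le> card ?S" using lin_indep_card_le_dimension[OF fixed_subfield dimE _ u(2)] u(1) FE by auto
 moreover have "card ?S \<le> d"
 proof (rule card_homs_le_dimension[OF fixed_subfield F d])
  fix g h assume "g : ?S" "h : ?S" and ne: "g ~= h"
  then obtain g' h' where gh: "g' : G" "h' : G" "g = restrict g' E" "h = restrict h' E" by auto
  show "\<exists>x\<in>F. g x ~= h x"
  proof (rule ccontr)
   assume "\<not> ?thesis"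
   hence eq: "g' x = h' x" if "x : F" for x using that gh FE by (auto split: if_splits)
   obtain k where k: "k : G" "!!x. x : carrier R ==> h' (k x) = x" "!!x. x : carrier R ==> k (h' x) = x" using aut_inverse[OF gh(2)] by auto
   have "compose (carrier R) k g' : stab F" using aut_comp[OF k(1) gh(1)] eq k(3) Fc by (auto simp: stab_def compose_def)
   hence "compose (carrier R) k g' x = x" if "x : E" for x using that by (auto simp: E_def fixed_field_def)
   hence "k (g' x) = x" if "x : E" for x using that Ec(2) by (metis compose_eq)
   hence "h' (k (g' x)) = h' x" if "x : E" for x using that by simp
   hence "g' x = h' x" if "x : E" for x using that k(2) gh Ec by simp
   hence "g = h" using gh by auto
   thus False using ne by simp
  qed
 qed (use finite_G FE Ec KF in \<open>auto simp: aut_add aut_mult aut_fix subset_iff\<close>)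
 ultimately have dc: "card {..<d} = card ?S" by simp
 have "x : F" if x: "x : E" for x
 proof -
  obtain c where c: "!!j. j : {..<d} ==> c j : K" "x = (\<Oplus>j\<in>{..<d}. c j \<otimes> u j)"
   using lin_indep_spans[OF fixed_subfield dimE _ dc u(2) _ x] u(1) FE by auto
  show ?thesis unfolding c(2) using c(1) u(1) KF by (intro subfield_finsum_closed[OF F] Fc(6)) auto
 qed
 thus ?thesis using FE E_def by auto
qed

lemma subfield_stable: "[|subfield F R; K \<subseteq> F; g : G; x : F|] ==> g x : F"
 using fixed_field_stable[of "stab F" g x] fixed_field_stab[of F] by (auto simp: stab_def)

text \<open>Presents \<open>F\<close> over the fixed field of \<open>A\<close> as a field with an
  automorphism group of its own. Powers are then formed in the Galois group of the smaller field, so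
  their values have to be compared.\<close>

lemma intermediate_aut_group:
 assumes F: "subfield F R" "K \<subseteq> F" and A: "aut_group R A" "A \<subseteq> G" "fixed_field R A \<subseteq> F"
 shows "ab_aut_group (R\<lparr>carrier := F\<rparr>) ((\<lambda>g. restrict g F) ` A)" "fixed_field (R\<lparr>carrier := F\<rparr>) ((\<lambda>g. restrict g F) ` A) = fixed_field R A"
  "g : A ==> x : F ==> (restrict g F [^]\<^bsub>galois_group (R\<lparr>carrier := F\<rparr>) (fixed_field R A)\<^esub> (i::nat)) x = (g \<up> i) x"
proof -
 interpret A: aut_group R A by (rule A(1))
 have st: "g x : F" if "g : A" "x : F" for g x using that A(2) subfield_stable[OF F] by auto
 interpret B: aut_group "R\<lparr>carrier := F\<rparr>" "(\<lambda>g. restrict g F) ` A" using A.restrict_aut_group(1)[where F = F] F(1) st by simp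
 note Fc = subfield_closed[OF F(1)]
 show "ab_aut_group (R\<lparr>carrier := F\<rparr>) ((\<lambda>g. restrict g F) ` A)" using A(2) st aut_commute Fc by unfold_locales (auto simp: subset_iff)
 show eq: "fixed_field (R\<lparr>carrier := F\<rparr>) ((\<lambda>g. restrict g F) ` A) = fixed_field R A"
  using A.restrict_aut_group(2)[where F = F] F(1) st A(3) by auto
 assume g: "g : A" and x: "x : F"
 hence gi: "restrict g F : (\<lambda>g. restrict g F) ` A" "g : G" using A(2) by auto
 have "(restrict g F [^]\<^bsub>galois_group (R\<lparr>carrier := F\<rparr>) (fixed_field R A)\<^esub> i) x = (g \<up> i) x \<and> (g \<up> i) x : F"
 proof (induct i)
  case 0
  thus ?case using B.pow_0_apply[of x "restrict g F"] x Fc by (simp add: eq)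
 next
  case (Suc i)
  have "(restrict g F [^]\<^bsub>galois_group (R\<lparr>carrier := F\<rparr>) (fixed_field R A)\<^esub> Suc i) x =
    restrict g F ((restrict g F [^]\<^bsub>galois_group (R\<lparr>carrier := F\<rparr>) (fixed_field R A)\<^esub> i) x)"
   by (rule B.pow_Suc_apply[OF gi(1), of x i, unfolded eq]) (use x in simp)
  also have "\<dots> = restrict g F ((g \<up> i) x)" by (simp only: Suc)
  also have "\<dots> = g ((g \<up> i) x)" using Suc by simp
  finally show ?case using pow_Suc_apply[OF gi(2), of x i] Fc(2)[OF x] st[OF g, of "(g \<up> i) x"] Suc by (simp only: simp_thms)
 qed
 thus "(restrict g F [^]\<^bsub>galois_group (R\<lparr>carrier := F\<rparr>) (fixed_field R A)\<^esub> i) x = (g \<up> i) x" by simp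
qed

end

lemma (in field) nat_pow_consistent_field: "x [^]\<^bsub>R\<lparr>carrier := F\<rparr>\<^esub> (i::nat) = x [^] i" by (induct i) auto

lemma (in field) ord_mult_of:
 assumes F: "subfield F R" and z: "z : F" "z ~= \<zero>" and o: "!!i::nat. z [^] i = \<one> \<longleftrightarrow> r dvd i"
 shows "group.ord (Ring_Divisibility.mult_of (R\<lparr>carrier := F\<rparr>)) z = r"
proof -
 interpret F: field "R\<lparr>carrier := F\<rparr>" using subfield_iff(2)[OF F] .
 let ?M = "Ring_Divisibility.mult_of (R\<lparr>carrier := F\<rparr>)"
 \<comment> \<open>Two constants are called \<open>mult_of\<close>; \<open>field_mult_group\<close>
   speaks of the other one.\<close>
 interpret M: group ?M using F.field_mult_group by (simp add: Ring_Divisibility.mult_of_def Multiplicative_Group.mult_of_def)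
 have "M.ord z dvd i \<longleftrightarrow> r dvd i" for i
 proof -
  have "z [^]\<^bsub>?M\<^esub> i = \<one>\<^bsub>?M\<^esub> \<longleftrightarrow> M.ord z dvd i" using z by (intro M.pow_eq_id) simp
  moreover have "z [^]\<^bsub>?M\<^esub> i = z [^] i" using nat_pow_consistent_field[of F z i] by (simp add: Ring_Divisibility.nat_pow_mult_of)
  ultimately show ?thesis using o by simp
 qed
 thus ?thesis by (meson dvd_antisym dvd_refl)
qed

lemma (in field) pow_eq_one_imp:
 assumes z: "z : carrier R" "z ~= \<zero>" and o: "!!i::nat. z [^] i = \<one> \<longleftrightarrow> r dvd i" and r: "r > 0" and x: "x : carrier R" "x [^] r = \<one>"
 shows "\<exists>i::nat. x = z [^] i"
proof (rule ccontr)
 assume no: "\<not> ?thesis"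
 let ?S = "(\<lambda>i. z [^] i) ` {..<r}"
 have "inj_on (\<lambda>i. z [^] i) {..<r}" using pow_eq_pow_cong[OF z o] cong_less_modulus_unique_nat by (auto simp: inj_on_def)
 hence "card ?S = r" by (simp add: card_image)
 moreover have "x \<notin> ?S" using no by auto
 ultimately have card: "card (insert x ?S) = Suc r" by simp
 obtain f where f: "f : carrier (poly_ring R)" "f ~= []" "degree f = r" "!!x. x : carrier R ==> eval f x = x [^] r \<ominus> \<one>"
  using binomial_polynomial[OF carrier_is_subfield one_closed r] by auto
 have "y : carrier R \<and> y [^] r = \<one>" if y: "y : insert x ?S" for y
 proof (cases "y = x")
  case False
  then obtain i :: nat where "y = z [^] i" using y by auto
  thus ?thesis using o[of "i * r"] z(1) by (simp add: nat_pow_pow)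
 qed (use x in simp)
 hence "insert x ?S \<subseteq> carrier R" "!!y. y : insert x ?S ==> eval f y = \<zero>" using f(4) by auto
 hence "card (insert x ?S) \<le> degree f" using few_roots[OF f(1,2)] by blast
 thus False unfolding card f(3) by simp
qed

lemma subgroup_int_Gcd:
 fixes S :: "int set"
 assumes add: "!!a b. a : S ==> b : S ==> a + b : S" and neg: "!!a. a : S ==> - a : S" and pos: "a : S" "a > 0"
 shows "Gcd S : S" "Gcd S > 0"
proof -
 obtain d where d: "d : S \<and> d > 0" "!!y. y : S \<and> y > 0 ==> nat d \<le> nat y" using ex_has_least_nat[of "\<lambda>y. y : S \<and> y > 0" a nat] pos by auto
 have "0 : S" using add[OF pos(1) neg[OF pos(1)]] by simp
 hence "int i * d : S" for i by (induct i) (use d add in \<open>auto simp: algebra_simps\<close>)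
 hence mult: "j * d : S" for j
 proof (cases "j \<ge> 0")
  case True
  thus ?thesis using \<open>int (nat j) * d : S\<close> by simp
 next
  case False
  thus ?thesis using neg[OF \<open>int (nat (-j)) * d : S\<close>] by simp
 qed
 have "d dvd y" if y: "y : S" for y
 proof (rule ccontr)
  assume "\<not> d dvd y"
  hence "y mod d ~= 0" by auto
  moreover have "y mod d \<ge> 0" "y mod d < d" using d(1) by auto
  moreover have "y mod d = y + (- (y div d)) * d" by (simp add: minus_div_mult_eq_mod[symmetric])
  hence "y mod d : S" using add[OF y mult[of "- (y div d)"]] by simp
  ultimately show False using d(2)[of "y mod d"] by auto
 qed
 hence "d dvd Gcd S" by simp
 moreover have "Gcd S dvd d" using d(1) by simp
 ultimately have "Gcd S = d" using d(1) by (metis Gcd_int_greater_eq_0 abs_of_nonneg abs_of_pos zdvd_antisym_abs)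
 thus "Gcd S : S" "Gcd S > 0" using d(1) by auto
qed

section \<open>Unit root Kummer extensions\<close>

text \<open>\<open>ram_index\<close> is defined as a \<open>Gcd\<close>; that it is the value of an
  element rests on the values forming a group.\<close>

lemma (in valuation) Gcd_values:
 assumes F: "subfield F R" and x: "x : F - {\<zero>}" "v x > 0"
 shows "Gcd (v ` (F - {\<zero>})) : v ` (F - {\<zero>})" "Gcd (v ` (F - {\<zero>})) > 0"
proof -
 let ?V = "v ` (F - {\<zero>})"
 note Fc = subfield_closed[OF F]
 have "a + b : ?V" if ab: "a : ?V" "b : ?V" for a b
 proof -
  obtain a' b' where "a = v a'" "b = v b'" "a' : F - {\<zero>}" "b' : F - {\<zero>}" using ab by auto
  thus ?thesis using Fc v_mult[of a' b'] integral_iff[of a' b'] by (intro image_eqI[of _ _ "a' \<otimes> b'"]) auto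
 qed
 moreover have "- a : ?V" if a: "a : ?V" for a
 proof -
  obtain a' where "a = v a'" "a' : F - {\<zero>}" using a by auto
  thus ?thesis using Fc v_inv[of a'] by (intro image_eqI[of _ _ "inv a'"]) auto
 qed
 moreover have "v x : ?V" using x by simp
 ultimately show "Gcd ?V : ?V" "Gcd ?V > 0" using subgroup_int_Gcd[of ?V "v x"] x(2) by blast+
qed

text \<open>A Lagrange resolvent of \<open>s\<close> weighted with the inverse powers of
  \<open>\<omega>\<close> is an eigenvector. By Dedekind it is nonzero for some \<open>x\<close>,
  since the powers of \<open>s\<close> below its order are distinct.\<close>

lemma (in aut_group) eigenvector_exists:
 assumes s: "s : G" and w: "\<omega> : K" "\<omega> [^] GG.ord s = \<one>"
 shows "\<exists>y\<in>carrier R. y ~= \<zero> \<and> s y = \<omega> \<otimes> y"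
proof (rule ccontr)
 assume no: "\<not> ?thesis"
 \<comment> \<open>Here \<open>p\<close> is the order of \<open>s\<close>, not the residue
   characteristic.\<close>
 define p where "p = GG.ord s"
 have p0: "p > 0" using GG.ord_ge_1[of s] finite_G s by (simp add: p_def)
 have wc: "\<omega> : carrier R" using w Kc by auto
 have w0: "\<omega> [^] (i::nat) ~= \<zero>" for i
 proof -
  have "\<omega> ~= \<zero>" using w(2) p0 nat_pow_zero[of p] p_def by auto
  thus ?thesis using pow_nonzero[OF wc] by simp
 qed
 define P where "P = (\<lambda>i. s \<up> (i::nat))"
 have PG: "P i : G" for i using s by (simp add: P_def)
 have PS: "P (Suc i) x = s (P i x)" if "x : carrier R" for i x using pow_Suc_apply[OF s that] by (simp add: P_def)
 have P0: "P 0 x = x" if "x : carrier R" for x using pow_0_apply[OF that] by (simp add: P_def)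
 have Pp: "P p x = x" if "x : carrier R" for x using s that by (simp add: P_def p_def)
 have inj: "inj_on P {..<p}"
 proof (rule inj_onI)
  fix i j assume ij: "i : {..<p}" "j : {..<p}" "P i = P j"
  have "int p dvd int j - int i" using GG.int_pow_eq[of s "int i" "int j"] s ij(3) by (simp add: P_def p_def int_pow_int)
  thus "i = j" using ij(1,2) by (metis cong_iff_dvd_diff cong_int_iff cong_less_modulus_unique_nat lessThan_iff)
 qed
 \<comment> \<open>This is the power of \<open>\<omega>\<close> with exponent \<open>- i\<close>, as
   \<open>\<omega> [^] p = \<one>\<close>.\<close>
 define b where "b = (\<lambda>i. \<omega> [^] ((p - 1) * i))"
 have bc: "b i : carrier R" "b i : K" for i using wc w(1) Kc(10) by (auto simp: b_def)
 have bS: "b i = \<omega> \<otimes> b (Suc i)" for i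
 proof -
  have "\<omega> \<otimes> b (Suc i) = \<omega> [^] (1 + (p - 1) * Suc i)" using wc by (simp add: b_def m_comm)
  also have "1 + (p - 1) * Suc i = (p - 1) * i + p" using p0 by simp
  also have "\<omega> [^] ((p - 1) * i + p) = b i" using w(2) wc by (simp add: b_def p_def flip: nat_pow_mult)
  finally show ?thesis by simp
 qed
 have bp: "b p = b 0"
 proof -
  have "b p = (\<omega> [^] p) [^] (p - 1)" using wc by (simp add: b_def nat_pow_pow mult.commute)
  thus ?thesis using w(2) by (simp add: b_def p_def)
 qed
 have sum0: "(\<Oplus>i\<in>{..<p}. b i \<otimes> P i x) = \<zero>" if x: "x : carrier R" for x
 proof -
  let ?y = "\<Oplus>i\<in>{..<p}. b i \<otimes> P i x"
  have c: "b i \<otimes> P i x : carrier R" for i using bc PG x by simp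
  have c': "b i \<otimes> P i x = b j \<otimes> P j x" if "i = p" "j = 0" for i j using that bp Pp P0 x by simp
  have "s ?y = (\<Oplus>i\<in>{..<p}. s (b i \<otimes> P i x))" using s c by (intro aut_finsum) auto
  also have "\<dots> = (\<Oplus>i\<in>{..<p}. \<omega> \<otimes> (b (Suc i) \<otimes> P (Suc i) x))"
  proof (intro finsum_cong' refl)
   fix i
   have "s (b i \<otimes> P i x) = b i \<otimes> P (Suc i) x" using s bc PG x by (simp add: aut_mult aut_fix PS)
   thus "s (b i \<otimes> P i x) = \<omega> \<otimes> (b (Suc i) \<otimes> P (Suc i) x)" using bS[of i] wc bc PG x by (simp add: m_assoc)
  qed (use wc c in auto)
  also have "\<dots> = \<omega> \<otimes> (\<Oplus>i\<in>{..<p}. b (Suc i) \<otimes> P (Suc i) x)" using wc c by (intro finsum_rdistr[symmetric]) auto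
  also have "(\<Oplus>i\<in>{..<p}. b (Suc i) \<otimes> P (Suc i) x) = ?y"
  proof -
   obtain p' where p': "p = Suc p'" using p0 by (cases p) auto
   have "(\<Oplus>i\<in>{..p'}. b (Suc i) \<otimes> P (Suc i) x) \<oplus> b 0 \<otimes> P 0 x = (\<Oplus>i\<in>{..Suc p'}. b i \<otimes> P i x)" using c by (intro finsum_Suc2[symmetric]) auto
   also have "\<dots> = b p \<otimes> P p x \<oplus> (\<Oplus>i\<in>{..p'}. b i \<otimes> P i x)" unfolding p' using c by simp
   also have "b p \<otimes> P p x = b 0 \<otimes> P 0 x" by (rule c') auto
   finally have "(\<Oplus>i\<in>{..p'}. b (Suc i) \<otimes> P (Suc i) x) \<oplus> b 0 \<otimes> P 0 x = (\<Oplus>i\<in>{..p'}. b i \<otimes> P i x) \<oplus> b 0 \<otimes> P 0 x" using c by (simp add: a_comm)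
   hence "(\<Oplus>i\<in>{..p'}. b (Suc i) \<otimes> P (Suc i) x) = (\<Oplus>i\<in>{..p'}. b i \<otimes> P i x)" using c by simp
   thus ?thesis by (simp add: p' lessThan_Suc_atMost)
  qed
  finally have "s ?y = \<omega> \<otimes> ?y" .
  moreover have "?y : carrier R" using c by simp
  ultimately show ?thesis using no by auto
 qed
 \<comment> \<open>Dedekind's lemma sums over automorphisms; \<open>ix\<close> recovers the exponent
   of a power of \<open>s\<close>.\<close>
 define ix where "ix = inv_into {..<p} P"
 have ix: "ix (P i) = i" if "i < p" for i using inj that by (simp add: ix_def)
 have "b (ix (P 0)) = \<zero>"
 proof (rule characters_independent[where F = "carrier R" and f = "\<lambda>x y. x \<otimes> y" and S = "P ` {..<p}" and a = "\<lambda>g. b (ix g)"])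
  fix g h assume gh: "g : P ` {..<p}" "h : P ` {..<p}" "g ~= h"
  thus "\<exists>x\<in>carrier R. g x ~= h x" using aut_eqI[of g h] PG by auto
 next
  fix g assume "g : P ` {..<p}"
  thus "\<exists>x\<in>carrier R. g x ~= \<zero>" using PG by (intro bexI[of _ \<one>]) auto
 next
  fix x assume x: "x : carrier R"
  have "(\<Oplus>g\<in>P ` {..<p}. b (ix g) \<otimes> g x) = (\<Oplus>i\<in>{..<p}. b (ix (P i)) \<otimes> P i x)" using inj bc PG x by (intro finsum_reindex) auto
  also have "\<dots> = (\<Oplus>i\<in>{..<p}. b i \<otimes> P i x)" using ix bc PG x by (intro finsum_cong') auto
  finally show "(\<Oplus>g\<in>P ` {..<p}. b (ix g) \<otimes> g x) = \<zero>" using sum0[OF x] by simp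
 qed (use PG bc p0 in \<open>auto simp: aut_mult\<close>)
 thus False using w0 by (simp add: b_def)
qed

locale ab_ram_aut = ab_aut_group R G + ram_aut R G v for R (structure) and G and v
begin

text \<open>The eigenvectors with eigenvalue \<open>\<zeta>\<close> of a generator of
  \<open>F\<close> over \<open>E\<close> form a nonzero submodule, so one of them is a unit
  \<open>u\<close>. Any \<open>w\<close> with \<open>w [^] r\<close> in \<open>E\<close> is a power
  of \<open>u\<close> times an element of \<open>E\<close>, so its value is one of
  \<open>E\<close>.\<close>

theorem units_imp_unit_root:
 assumes U: units_in_submodules and z: "\<zeta> : K" "!!i::nat. \<zeta> [^] i = \<one> \<longleftrightarrow> r dvd i" and r: "r > 0"
  and E: "subfield E R" "K \<subseteq> E" and F: "subfield F R" "E \<subseteq> F" and cyc: "cyclic_extension (R\<lparr>carrier := F\<rparr>) E r"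
 shows "unit_root_kummer_extension (R\<lparr>carrier := F\<rparr>) E (sub_valuation R v E)"
proof -
 note Fc = subfield_closed[OF F(1)] and Ec = subfield_closed[OF E(1)]
 have KF: "K \<subseteq> F" using E F by auto
 have z0: "\<zeta> ~= \<zero>" "\<zeta> : carrier R" using z(1) z(2)[of r] r Kc by (auto simp: nat_pow_zero)
 have fE: "fixed_field R (stab E) = E" by (rule fixed_field_stab[OF E])
 have stG: "stab E \<subseteq> G" by (auto simp: stab_def)
 note I = intermediate_aut_group[OF F(1) KF stab_aut_group[OF Ec(1)] stG, unfolded fE, OF F(2)]
 define B where "B = (\<lambda>g. restrict g F) ` stab E"
 let ?F = "R\<lparr>carrier := F\<rparr>"
 interpret B: ab_aut_group ?F B unfolding B_def by (rule I(1))
 have BE: "fixed_field ?F B = E" unfolding B_def by (rule I(2))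
 obtain s' where s': "s' : B" "!!g. g : B ==> \<exists>i::nat. g = s' [^]\<^bsub>galois_group ?F E\<^esub> i" and card: "card B = r"
  using cyc B.cyclic_extension_iff[of r] unfolding BE by auto
 have exp: "group_exponent (galois_group ?F E) = r" and ord: "group.ord (galois_group ?F E) s' = r"
  using B.exponent_cyclic[OF s'(1)] s'(2) card unfolding BE by auto
 obtain s where s: "s : stab E" "s' = restrict s F" using s'(1) by (auto simp: B_def)
 hence sG: "s : G" and sE: "!!x. x : E ==> s x = x" by (auto simp: stab_def)
 define N where "N = {x : F. s x = \<zeta> \<otimes> x}"
 have N: "submodule N" unfolding submodule_def
 proof (intro conjI ballI)
  fix x y assume "x : N" "y : N"
  thus "x \<oplus> y : N" using Fc z0 sG by (simp add: N_def aut_add r_distr)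
 next
  fix c x assume "c : K" "x : N"
  thus "c \<otimes> x : N" using Fc z0 sG KF by (auto simp: N_def aut_mult aut_fix m_lcomm)
 next
  fix g x assume g: "g : G" and x: "x : N"
  hence "s (g x) = g (\<zeta> \<otimes> x)" using aut_commute[OF sG g, of x] Fc by (simp add: N_def)
  also have "\<dots> = \<zeta> \<otimes> g x" using g x z0 z(1) Fc by (simp add: N_def aut_mult aut_fix)
  finally show "g x : N" using x subfield_stable[OF F(1) KF g] by (simp add: N_def)
 qed (use Fc z0 sG in \<open>auto simp: N_def\<close>)
 have "\<exists>y\<in>N. y ~= \<zero>"
 using z(2)[of r] nat_pow_consistent_field[of F \<zeta> r] B.eigenvector_exists[OF s'(1), of \<zeta>] ord z(1) E(2) BE s(2) N_def by auto
 then obtain u where u: "u : N" "u ~= \<zero>" "v u = 0" using U N unfolding units_in_submodules_def by auto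
 hence uF: "u : F" "u : carrier R" "s u = \<zeta> \<otimes> u" using Fc by (auto simp: N_def)
 have main: "int r dvd sub_valuation R v E x" if x: "x : E" and w: "w : F" "w ~= \<zero>" "x = w [^] r" for x w
 proof -
  have wc: "w : carrier R" "s w : carrier R" using w Fc sG by auto
  have "s (w [^] r) = w [^] r" using sE x w by simp
  hence sw: "(s w) [^] r = w [^] r" using aut_pow[OF sG wc(1)] by simp
  have "(s w \<otimes> inv w) [^] r = (s w) [^] r \<otimes> (inv w) [^] r" using wc w by (simp add: nat_pow_distrib)
  also have "\<dots> = (w \<otimes> inv w) [^] r" unfolding sw using wc w by (intro nat_pow_distrib[symmetric]) auto
  finally have "(s w \<otimes> inv w) [^] r = \<one>" unfolding field_inv(1)[OF wc(1) w(2)] by simp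
  \<comment> \<open>The quotient is an \<open>r\<close>-th root of unity, hence a power of
    \<open>\<zeta>\<close>.\<close>
  then obtain i :: nat where i: "s w \<otimes> inv w = \<zeta> [^] i" using pow_eq_one_imp[OF z0(2,1) z(2) r] wc w by (meson inv_closed m_closed)
  have "s w = (s w \<otimes> inv w) \<otimes> w" using wc w by (simp add: m_assoc)
  hence swi: "s w = \<zeta> [^] i \<otimes> w" using i by simp
  have ui: "u [^] i : F" "u [^] i : carrier R" "u [^] i ~= \<zero>" using uF Fc u pow_nonzero by auto
  have zi: "\<zeta> [^] i : carrier R" "\<zeta> [^] i ~= \<zero>" using z0 pow_nonzero by auto
  define q where "q = w \<otimes> inv (u [^] i)"
  have q: "q : F" "q : carrier R" "q ~= \<zero>" using w ui Fc integral_iff by (auto simp: q_def)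
  have "s (u [^] i) = \<zeta> [^] i \<otimes> u [^] i" using aut_pow[OF sG] uF z0 by (simp add: nat_pow_distrib)
  moreover have "s (q \<otimes> u [^] i) = s q \<otimes> s (u [^] i)" using sG q ui by (simp add: aut_mult)
  moreover have "q \<otimes> u [^] i = w" using wc ui by (simp add: q_def m_assoc)
  ultimately have "s q \<otimes> (\<zeta> [^] i \<otimes> u [^] i) = q \<otimes> (\<zeta> [^] i \<otimes> u [^] i)" using swi m_lcomm[of q "\<zeta> [^] i" "u [^] i"] q zi ui by simp
  hence "s q = q" using m_rcancel[of "\<zeta> [^] i \<otimes> u [^] i" "s q" q] q zi ui integral_iff sG by auto
  hence sq': "s' q = q" using q s(2) by simp
  have "g q = q" if g: "g : B" for g
  proof -
   have "(s' [^]\<^bsub>galois_group ?F E\<^esub> (j::nat)) q = q" for j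
   proof (induct j)
    case (Suc j)
    thus ?case using B.pow_Suc_apply[OF s'(1), of q j] sq' q(1) unfolding BE by simp
   qed (use B.pow_0_apply[of q s'] q in \<open>simp add: BE\<close>)
   thus ?thesis using s'(2)[OF g] by auto
  qed
  hence qE: "q : E" using q BE by (auto simp: fixed_field_def)
  have "v q = v w" using wc w ui u uF by (simp add: q_def v_mult v_inv v_pow)
  moreover have "ram_index R v E dvd v q" using qE q by (simp add: ram_index_def)
  ultimately obtain k where k: "v w = ram_index R v E * k" by auto
  have "v x = ram_index R v E * (int r * k)" using w wc k by (simp add: v_pow)
  \<comment> \<open>If the index were 0, integer division by it would return 0, which is divisible
    as well.\<close>
  thus ?thesis by (cases "ram_index R v E = 0") (auto simp: sub_valuation_def)
 qed
 have "abelian_extension ?F E" using cyc B.GG_comm unfolding BE by (simp add: cyclic_extension_def abelian_extension_def)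
 moreover have "\<exists>\<zeta>\<in>E - {\<zero>\<^bsub>?F\<^esub>}. group.ord (Ring_Divisibility.mult_of ?F) \<zeta> = r" using ord_mult_of[OF F(1) _ z0(1) z(2)] z(1) z0 KF E by auto
 ultimately show ?thesis unfolding unit_root_kummer_extension_def kummer_extension_def kummer_set_def exp
  using main nat_pow_consistent_field by auto
qed

end

text \<open>The assumption \<open>unit_root\<close> is the criterion of the theorem.
  \<open>exponent_attained\<close> makes \<open>m\<close> the exact exponent and thereby provides an
  automorphism of order \<open>p\<close> that is a power with exponent
  \<open>m div p\<close>.\<close>

locale kummer_ram = kummer_data R G p r m \<zeta> + ram_aut R G v for R (structure) and G p r m \<zeta> v +
 assumes unit_root: "[|subfield E R; subfield F R; fixed_field R G \<subseteq> E; E \<subseteq> F; cyclic_extension (R\<lparr>carrier := F\<rparr>) E r|]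
  ==> unit_root_kummer_extension (R\<lparr>carrier := F\<rparr>) E (sub_valuation R v E)"
  and exponent_attained: "\<exists>h\<in>G. \<exists>x\<in>carrier R. (h [^]\<^bsub>galois_group R (fixed_field R G)\<^esub> (m div p)) x ~= x"
begin

lemma eigen_pow_one:
 assumes "y : carrier R" "h : G" "h y = \<zeta> [^] (a::nat) \<otimes> y"
 shows "(h \<up> (i::nat)) y = \<zeta> [^] (a * i) \<otimes> y" using eigen_pow[OF assms(1,2), of 1 a i] GG.nat_pow_eone[of h] assms by simp

lemma eigen_full:
 assumes y: "y : carrier R" and t: "\<tau> : eigen y" and gen: "!!g. g : G ==> \<exists>i::nat. \<exists>h\<in>eigen y. g = h \<otimes>\<^bsub>GG\<^esub> \<tau> \<up> i"
 shows "eigen y = G"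
proof -
 have ti: "\<tau> \<up> (i::nat) : eigen y" for i
 proof (induct i)
  case 0
  show ?case unfolding GG.nat_pow_0 by (rule subgroup.one_closed[OF eigen_subgroup[OF y]])
 next
  case (Suc i)
  show ?case unfolding GG.nat_pow_Suc by (rule subgroup.m_closed[OF eigen_subgroup[OF y] Suc t])
 qed
 have "g : eigen y" if g: "g : G" for g using gen[OF g] ti subgroup.m_closed[OF eigen_subgroup[OF y]] by auto
 thus ?thesis using eigen_G by auto
qed

text \<open>Adjoining \<open>y\<close> to the fixed field \<open>E\<close> of \<open>A\<close> gives
  a cyclic extension of degree \<open>r\<close>: \<open>A\<close> acts on \<open>y\<close> through
  powers of \<open>\<zeta>\<close>, and some power of \<open>h\<close> acts by
  \<open>\<zeta>\<close> itself. As \<open>y [^] r\<close> is in the Kummer set, \<open>r\<close>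
  divides its value over \<open>E\<close>, so the value of \<open>y\<close> is one of
  \<open>E\<close>.\<close>

lemma valuation_in_fixed_field:
 assumes y: "y : carrier R" "y ~= \<zero>" and A: "aut_group R A" "A \<subseteq> eigen y" and h: "h : A" "h y = \<zeta> [^] (a::nat) \<otimes> y" "\<not> p dvd a"
 shows "\<exists>e\<in>fixed_field R A. e ~= \<zero> \<and> v e = v y"
proof -
 interpret A: aut_group R A by (rule A(1))
 have AG: "A \<subseteq> G" using A(2) eigen_G by auto
 have pow_A: "(g \<up> (i::nat)) : A" if g: "g : A" for g i
 proof (induct i)
  case (Suc i)
  have "g \<up> Suc i = compose (carrier R) (g \<up> i) g" using g AG by auto
  thus ?case using A.aut_comp[OF Suc g] by simp
 qed (use A.aut_id in \<open>simp del: restrict_apply\<close>)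
 \<comment> \<open>The inverse of \<open>a\<close> modulo \<open>r\<close> exists because
   \<open>r\<close> is a power of \<open>p\<close>; \<open>h \<up> b\<close> then multiplies
   \<open>y\<close> by \<open>\<zeta>\<close>.\<close>
 obtain b where b: "[a * b = Suc 0] (mod r)" using coprime_r[OF h(3)] cong_solve_coprime_nat[of a r] coprime_commute by auto
 define k where "k = h \<up> b"
 have kA: "k : A" and kG: "k : G" using pow_A[OF h(1)] AG by (auto simp: k_def)
 have hG: "h : G" using h(1) AG by auto
 have "(h \<up> b) y = \<zeta> [^] (a * b) \<otimes> y" by (rule eigen_pow_one[OF y(1) hG h(2)])
 moreover have "\<zeta> [^] (a * b) = \<zeta> [^] Suc 0" using zeta_eq b by blast
 ultimately have ky: "k y = \<zeta> [^] (1::nat) \<otimes> y" by (simp add: k_def)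
 have kiy: "(k \<up> i) y = \<zeta> [^] i \<otimes> y" for i :: nat using eigen_pow_one[OF y(1) kG ky, of i] by simp
 \<comment> \<open>The field generated by \<open>y\<close> over \<open>E\<close> is obtained as the
   fixed field of the stabilizer of \<open>y\<close>.\<close>
 define A0 where "A0 = {g : A. g y = y}"
 have "aut_group R A0" unfolding A0_def by (rule A.subgroup_aut) (use A.aut_id A.aut_comp y in \<open>auto simp: compose_def\<close>)
 then interpret A0: aut_group R A0 .
 define E where "E = fixed_field R A"
 define F where "F = fixed_field R A0"
 have E: "subfield E R" and F: "subfield F R" unfolding E_def F_def by (rule A.fixed_subfield A0.fixed_subfield)+
 note Ec = subfield_closed[OF E] and Fc = subfield_closed[OF F]
 have EF: "E \<subseteq> F" and KE: "K \<subseteq> E" using AG by (auto simp: E_def F_def A0_def fixed_field_def)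
 hence KF: "K \<subseteq> F" by auto
 note I = intermediate_aut_group[OF F KF A(1) AG, folded E_def, OF EF]
 let ?F = "R\<lparr>carrier := F\<rparr>"
 define B where "B = (\<lambda>g. restrict g F) ` A"
 interpret B: ab_aut_group ?F B unfolding B_def by (rule I(1))
 have BE: "fixed_field ?F B = E" unfolding B_def by (rule I(2))
 have yF: "y : F" using y by (auto simp: F_def A0_def fixed_field_def)
 let ?s = "restrict k F"
 have sB: "?s : B" using kA by (simp add: B_def)
 have spow: "(?s [^]\<^bsub>galois_group ?F E\<^esub> (i::nat)) x = (k \<up> i) x" if "x : F" for i x by (rule I(3)[OF kA that])
 have spowB: "?s [^]\<^bsub>galois_group ?F E\<^esub> (i::nat) : B" for i using B.pow_in[OF sB, of i] unfolding BE .
 have gen: "\<exists>i::nat. g = ?s [^]\<^bsub>galois_group ?F E\<^esub> i" if g: "g : B" for g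
 proof -
  obtain g' where g': "g' : A" "g = restrict g' F" using g by (auto simp: B_def)
  obtain i :: nat where i: "g' y = \<zeta> [^] i \<otimes> y" using g'(1) A(2) by (auto simp: eigen_def)
  obtain k' where k': "k' : A" "!!x. x : carrier R ==> (k \<up> i) (k' x) = x" "!!x. x : carrier R ==> k' ((k \<up> i) x) = x"
   using A.aut_inverse[OF pow_A[OF kA, of i]] by auto
  have "k' (g' y) = y" using i kiy[of i] k'(3)[OF y(1)] by simp
  hence "compose (carrier R) k' g' : A0" using A.aut_comp[OF k'(1) g'(1)] y by (simp add: A0_def compose_eq)
  hence "compose (carrier R) k' g' x = x" if "x : F" for x using that by (auto simp: F_def fixed_field_def)
  hence "k' (g' x) = x" if "x : F" for x using that Fc(2) by (metis compose_eq)
  hence "(k \<up> i) x = g' x" if "x : F" for x using that k'(2)[of "g' x"] A.aut_closed[OF g'(1)] Fc(2) by simp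
  hence "g = ?s [^]\<^bsub>galois_group ?F E\<^esub> i" using spow[of _ i] g' by (intro B.aut_eqI[OF g spowB]) simp
  thus ?thesis by blast
 qed
 have "?s [^]\<^bsub>galois_group ?F E\<^esub> i = \<one>\<^bsub>galois_group ?F E\<^esub> \<longleftrightarrow> r dvd i" for i :: nat
 proof
  assume "?s [^]\<^bsub>galois_group ?F E\<^esub> i = \<one>\<^bsub>galois_group ?F E\<^esub>"
  hence "(?s [^]\<^bsub>galois_group ?F E\<^esub> i) y = y" using B.GG_simps(2) yF unfolding BE by simp
  thus "r dvd i" using spow[OF yF, of i] kiy[of i] zeta_smult_one[OF y] by simp
 next
  assume "r dvd i"
  hence "(k \<up> i) y = y" using kiy[of i] zeta_ord[of i] y by simp
  hence "k \<up> i : A0" using pow_A[OF kA] by (simp add: A0_def)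
  hence "(?s [^]\<^bsub>galois_group ?F E\<^esub> i) x = x" if "x : F" for x using that spow[OF that, of i] by (auto simp: F_def fixed_field_def)
  hence "?s [^]\<^bsub>galois_group ?F E\<^esub> i = (\<lambda>x\<in>carrier ?F. x)" by (intro B.aut_eqI[OF spowB B.aut_id]) simp
  thus "?s [^]\<^bsub>galois_group ?F E\<^esub> i = \<one>\<^bsub>galois_group ?F E\<^esub>" using B.GG_simps(2) unfolding BE by simp
 qed
 hence "group.ord (galois_group ?F E) ?s dvd i \<longleftrightarrow> r dvd i" for i using B.GG.pow_eq_id[of ?s i] sB B.GG_simps(1) unfolding BE by simp
 hence ord: "group.ord (galois_group ?F E) ?s = r" by (meson dvd_antisym dvd_refl)
 have exp: "card B = r" "group_exponent (galois_group ?F E) = r" using B.exponent_cyclic[OF sB] gen ord unfolding BE by auto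
 have "cyclic_extension ?F E r" using B.cyclic_extension_iff[of r] exp(1) sB gen unfolding BE by auto
 hence "unit_root_kummer_extension ?F E (sub_valuation R v E)" by (rule unit_root[OF E F KE EF])
 hence dv: "int r dvd sub_valuation R v E x" if "x : kummer_set ?F E" for x using that exp(2) by (simp add: unit_root_kummer_extension_def)
 have yr: "y [^] r : E"
 proof -
  have "g (y [^] r) = y [^] r" if g: "g : A" for g
  proof -
   obtain i :: nat where i: "g y = \<zeta> [^] i \<otimes> y" using g A(2) by (auto simp: eigen_def)
   have "g (y [^] r) = (\<zeta> [^] i) [^] r \<otimes> y [^] r" using A.aut_pow[OF g y(1)] i y by (simp add: nat_pow_distrib)
   also have "(\<zeta> [^] i) [^] r = \<one>" using zeta_ord[of "i * r"] by (simp add: nat_pow_pow)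
   finally show ?thesis using y by simp
  qed
  thus ?thesis using y by (simp add: E_def fixed_field_def)
 qed
 have "y [^] r : kummer_set ?F E" unfolding kummer_set_def exp(2)
  using yF y yr pow_nonzero[OF y, of r] nat_pow_consistent_field[of F y r] by (intro IntI image_eqI[of _ _ y]) auto
 hence dvr: "int r dvd v (y [^] r) div ram_index R v E" using dv by (simp add: sub_valuation_def)
 let ?V = "v ` (E - {\<zero>})"
 obtain x where x: "x : K - {\<zero>}" "v x = int n" using v_K_gen by auto
 hence "Gcd ?V : ?V \<and> Gcd ?V > 0" using Gcd_values[OF E, of x] KE n0 by auto
 then obtain e where e: "e : E - {\<zero>}" "v e = ram_index R v E" "ram_index R v E > 0"
  unfolding ram_index_def by (metis (no_types, lifting) imageE)
 have "ram_index R v E dvd v (y [^] r)" using yr pow_nonzero[OF y] by (simp add: ram_index_def)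
 then obtain q where q: "int r * v y = ram_index R v E * q" using v_pow[OF y] by auto
 hence "int r dvd q" using dvr e(3) v_pow[OF y] by simp
 then obtain l where "q = int r * l" by auto
 hence "v y = l * v e" using q r0 e(2) by simp
 thus ?thesis using subfield_powers[OF e(1) E, of l] unfolding E_def by auto
qed

text \<open>Meant for vectors that \<open>G\<close> multiplies by powers of \<open>\<zeta>\<close>
  with exponents divisible by \<open>p\<close>, to which \<open>valuation_in_fixed_field\<close>
  does not apply: multiplying by the vector found here makes an exponent prime to \<open>p\<close>.
  Its source is the eigenspace of an automorphism \<open>h1\<close> of order \<open>p\<close> for an
  eigenvalue \<open>\<omega>\<close> of order \<open>p\<close>.\<close>

lemma full_character:
 obtains y h a where "y : carrier R" "y ~= \<zero>" "eigen y = G" "h : G" "h y = \<zeta> [^] (a::nat) \<otimes> y" "\<not> p dvd a"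
proof -
 obtain h x0 where h: "h : G" "x0 : carrier R" "(h \<up> (m div p)) x0 ~= x0" using exponent_attained by auto
 define h1 where "h1 = h \<up> (m div p)"
 have h1: "h1 : G" using h by (simp add: h1_def)
 have pm: "p dvd m" using pr rm by auto
 define s where "s = r div p"
 have sp: "s * p = r" using pr by (simp add: s_def)
 define \<omega> where "\<omega> = \<zeta> [^] s"
 have wc: "\<omega> : carrier R" "\<omega> : K" by (auto simp: \<omega>_def)
 have h1p: "(h1 \<up> p) x = x" if "x : carrier R" for x
  using exponent[OF h(1) that] h(1) pm GG.nat_pow_pow[of h "m div p" p] by (simp add: h1_def)
 define V where "V = {x : carrier R. h1 x = \<omega> \<otimes> x}"
 have V: "submodule V" unfolding submodule_def
 proof (intro conjI ballI)
  fix x y assume "x : V" "y : V"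
  thus "x \<oplus> y : V" using h1 wc by (simp add: V_def aut_add r_distr)
 next
  fix c x assume "c : K" "x : V"
  thus "c \<otimes> x : V" using h1 wc Kc by (auto simp: V_def aut_mult aut_fix m_lcomm)
 next
  fix g x assume g: "g : G" and x: "x : V"
  hence "h1 (g x) = g (\<omega> \<otimes> x)" using aut_commute[OF h1 g, of x] by (simp add: V_def)
  also have "\<dots> = \<omega> \<otimes> g x" using g x wc by (simp add: V_def aut_mult aut_fix)
  finally show "g x : V" using x g by (simp add: V_def)
 qed (use wc h1 in \<open>auto simp: V_def\<close>)
 have "V ~= {\<zero>}"
 proof
  assume V0: "V = {\<zero>}"
  have "h1 ~= \<one>\<^bsub>GG\<^esub>" using h by (auto simp: h1_def)
  moreover have "h1 \<up> p = \<one>\<^bsub>GG\<^esub>" using aut_eqI[of "h1 \<up> p" "\<one>\<^bsub>GG\<^esub>"] h1 h1p aut_id by simp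
  hence "GG.ord h1 dvd p" using GG.pow_eq_id[of h1 p] h1 by simp
  ultimately have "GG.ord h1 = p" using p h1 GG.ord_eq_1[of h1] by (auto simp: prime_nat_iff)
  moreover have "\<omega> [^] p = \<one>" using zeta_ord[of r] sp by (simp add: \<omega>_def nat_pow_pow)
  ultimately show False using eigenvector_exists[OF h1 wc(2)] V0 by (auto simp: V_def)
 qed
 then obtain y \<tau> t a where y: "y : V" "y ~= \<zero>" and \<tau>: "\<tau> : G" "(\<tau> \<up> (p ^ t)) y = \<zeta> [^] (a::nat) \<otimes> y"
  and ta: "t = 0 \<or> \<not> p dvd a" and gen: "!!g. g : G ==> \<exists>i::nat. \<exists>h\<in>eigen y. g = h \<otimes>\<^bsub>GG\<^esub> \<tau> \<up> i"
  using submodule_contains_eigenspace[OF V] by metis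
 have yc: "y : carrier R" using y by (simp add: V_def)
 show thesis
 proof (cases "p dvd a")
  case True
  hence t0: "t = 0" using ta by simp
  have eG: "eigen y = G" using \<tau> GG.nat_pow_eone[of \<tau>] t0 power_0 eigen_def nat_pow_Suc eigen_full[OF yc _ gen] by auto
  obtain b :: nat where b: "h y = \<zeta> [^] b \<otimes> y" using h(1) eG by (auto simp: eigen_def)
  have "(h \<up> (m div p)) y = \<zeta> [^] (b * (m div p)) \<otimes> y" by (rule eigen_pow_one[OF yc h(1) b])
  hence "\<zeta> [^] (b * (m div p)) \<otimes> y = \<zeta> [^] s \<otimes> y" using y by (simp add: V_def h1_def \<omega>_def)
  hence c: "[b * (m div p) = s] (mod r)" by (rule zeta_smult_eq[OF yc y(2)])
  \<comment> \<open>If \<open>p\<close> divided \<open>b\<close>, then \<open>b * (m div p)\<close>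
    would be a multiple of \<open>m\<close>, hence of \<open>r\<close>, and \<open>h1\<close> would
    fix \<open>y\<close>; but it multiplies \<open>y\<close> by \<open>\<omega>\<close>.\<close>
  have "\<not> p dvd b"
  proof
   assume "p dvd b"
   hence "p * (m div p) dvd b * (m div p)" by simp
   hence "r dvd b * (m div p)" using pm rm by auto
   hence "r dvd s" using c by (simp add: cong_def dvd_eq_mod_eq_0)
   hence "r \<le> s" using sp by auto
   moreover have "s > 0" using sp r0 by auto
   hence "s < s * p" using p0 by simp
   ultimately show False using sp by simp
  qed
  thus thesis using that[OF yc y(2) eG h(1) b] by simp
 next
  case False
  \<comment> \<open>The product of the first \<open>i\<close> translates of \<open>y\<close>. At
    \<open>i = p ^ t\<close> it is an eigenvector of \<open>\<tau>\<close> too, hence of all of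
    \<open>G\<close>.\<close>
  define P where "P = rec_nat \<one> (\<lambda>i q. q \<otimes> (\<tau> \<up> i) y)"
  have P0: "P 0 = \<one>" and PS: "P (Suc i) = P i \<otimes> (\<tau> \<up> i) y" for i by (auto simp: P_def)
  have ti: "\<tau> \<up> (i::nat) : G" for i using \<tau> by simp
  have tic: "(\<tau> \<up> (i::nat)) y : carrier R" "(\<tau> \<up> (i::nat)) y ~= \<zero>" for i using ti yc y aut_nonzero by auto
  have P: "P i : carrier R \<and> P i ~= \<zero>" for i by (induct i) (use tic integral_iff in \<open>auto simp: P0 PS\<close>)
  have eP: "g (P i) = \<zeta> [^] (b * i) \<otimes> P i" if g: "g : G" "g y = \<zeta> [^] (b::nat) \<otimes> y" for g b i
  proof (induct i)
   case 0
   thus ?case using g by (simp add: P0)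
  next
   case (Suc i)
   have "g ((\<tau> \<up> i) y) = (\<tau> \<up> i) (\<zeta> [^] b \<otimes> y)" using aut_commute[OF g(1) ti yc] g(2) by simp
   also have "\<dots> = \<zeta> [^] b \<otimes> (\<tau> \<up> i) y" using aut_mult[OF ti] aut_fix[OF ti] yc by simp
   finally have "g (P (Suc i)) = (\<zeta> [^] (b * i) \<otimes> P i) \<otimes> (\<zeta> [^] b \<otimes> (\<tau> \<up> i) y)" using Suc P tic g by (simp add: PS aut_mult)
   also have "\<dots> = (\<zeta> [^] (b * i) \<otimes> \<zeta> [^] b) \<otimes> P (Suc i)" using P[of i] tic[of i] by (simp add: PS m_ac)
   finally show ?case by (simp add: nat_pow_mult add.commute)
  qed
  \<comment> \<open>Telescoping: \<open>\<tau>\<close> moves every factor to the next one.\<close>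
  have tP: "\<tau> (P i) \<otimes> y = P i \<otimes> (\<tau> \<up> i) y" for i
  proof (induct i)
   case 0
   thus ?case using \<tau> yc by (simp add: P0)
  next
   case (Suc i)
   have Pc: "P i : carrier R" "\<tau> (P i) : carrier R" "(\<tau> \<up> Suc i) y : carrier R" "(\<tau> \<up> i) y : carrier R"
    using P[of i] \<tau> tic[of i] tic[of "Suc i"] by auto
   have "\<tau> (P (Suc i)) \<otimes> y = (\<tau> (P i) \<otimes> (\<tau> \<up> Suc i) y) \<otimes> y" unfolding PS pow_Suc_apply[OF \<tau>(1) yc] using \<tau> Pc by (simp add: aut_mult)
   also have "\<dots> = (\<tau> (P i) \<otimes> y) \<otimes> (\<tau> \<up> Suc i) y" using Pc yc by (simp add: m_ac del: nat_pow_Suc)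
   also have "\<dots> = P (Suc i) \<otimes> (\<tau> \<up> Suc i) y" by (simp only: Suc PS)
   finally show ?case .
  qed
  let ?P = "P (p ^ t)"
  have Pc: "?P : carrier R" "?P ~= \<zero>" using P by auto
  have "\<tau> ?P \<otimes> y = (\<zeta> [^] a \<otimes> ?P) \<otimes> y" using tP[of "p ^ t"] \<tau>(2) Pc yc by (simp add: m_ac)
  hence tau: "\<tau> ?P = \<zeta> [^] a \<otimes> ?P" using m_rcancel[OF y(2) yc, of "\<tau> ?P" "\<zeta> [^] a \<otimes> ?P"] Pc \<tau> by simp
  have "eigen ?P = G"
  proof -
   have "\<tau> : eigen ?P" using \<tau> tau by (auto simp: eigen_def)
   moreover have "eigen y \<subseteq> eigen ?P" using eP by (auto simp: eigen_def)
   ultimately show ?thesis using eigen_full[OF Pc(1)] gen by blast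
  qed
  thus thesis using that[OF Pc _ \<tau>(1) tau False] by simp
 qed
qed

text \<open>In every case the aim is an \<open>e\<close> in the fixed field of
  \<open>eigen y\<close> with the value of \<open>y\<close>; then \<open>y \<otimes> inv e\<close>
  is a unit in \<open>N\<close>.\<close>

theorem unit_root_imp_units: "units_in_submodules" unfolding units_in_submodules_def
proof (intro allI impI)
 fix N assume N: "submodule N" "N ~= {\<zero>}"
 obtain y \<tau> t a where y: "y : N" "y ~= \<zero>" and ye: "!!e. e : fixed_field R (eigen y) ==> y \<otimes> e : N"
  and \<tau>: "\<tau> : G" "(\<tau> \<up> (p ^ t)) y = \<zeta> [^] (a::nat) \<otimes> y"
  and ta: "t = 0 \<or> \<not> p dvd a" and gen: "!!g. g : G ==> \<exists>i::nat. \<exists>h\<in>eigen y. g = h \<otimes>\<^bsub>GG\<^esub> \<tau> \<up> i" and te: "\<tau> \<up> (p ^ t) : eigen y"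
  using submodule_contains_eigenspace[OF N] by metis
 have yc: "y : carrier R" using y submoduleD[OF N(1)] by auto
 have "\<exists>e\<in>fixed_field R (eigen y). e ~= \<zero> \<and> v e = v y"
 proof (cases "p dvd a")
  case False
  thus ?thesis using valuation_in_fixed_field[OF yc y(2) eigen_aut_group[OF yc] _ te \<tau>(2)] by simp
 next
  case True
  hence t0: "t = 0" using ta by simp
  have eG: "eigen y = G" using te GG.nat_pow_eone[of \<tau>] \<tau>(1) t0 power_0 eigen_full[OF yc _ gen] by simp
  obtain y1 h c where y1: "y1 : carrier R" "y1 ~= \<zero>" "eigen y1 = G" "h : G" "h y1 = \<zeta> [^] (c::nat) \<otimes> y1" "\<not> p dvd c" by (rule full_character)
  obtain b :: nat where b: "h y = \<zeta> [^] b \<otimes> y" using y1(4) eG by (auto simp: eigen_def)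
  obtain e1 where e1: "e1 : K" "e1 ~= \<zero>" "v e1 = v y1" using valuation_in_fixed_field[OF y1(1,2) aut_group_axioms _ y1(4,5,6)] y1(3) by auto
  show ?thesis
  proof (cases "p dvd b")
   case False
   thus ?thesis using valuation_in_fixed_field[OF yc y(2) aut_group_axioms _ y1(4) b] eG by auto
  next
   \<comment> \<open>The exponents of \<open>y1\<close> and of \<open>y \<otimes> y1\<close> at
     \<open>h\<close> are both prime to \<open>p\<close>, so the values of these two vectors come
     from \<open>K\<close>; so does the difference, the value of \<open>y\<close>.\<close>
   case True
   have prod: "g (y \<otimes> y1) = \<zeta> [^] (i + j) \<otimes> (y \<otimes> y1)" if "g : G" "g y = \<zeta> [^] (i::nat) \<otimes> y" "g y1 = \<zeta> [^] (j::nat) \<otimes> y1" for g i j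
    using that yc y1(1) by (simp add: aut_mult m_ac flip: nat_pow_mult)
   have yy: "y \<otimes> y1 : carrier R" "y \<otimes> y1 ~= \<zero>" using yc y y1 integral_iff by auto
   have "g : eigen (y \<otimes> y1)" if g: "g : G" for g
   proof -
    obtain i :: nat where i: "g y = \<zeta> [^] i \<otimes> y" using g eG by (auto simp: eigen_def)
    obtain j :: nat where j: "g y1 = \<zeta> [^] j \<otimes> y1" using g y1(3) by (auto simp: eigen_def)
    show ?thesis using prod[OF g i j] g by (auto simp: eigen_def)
   qed
   moreover have "\<not> p dvd b + c" using True y1(6) by (simp add: dvd_add_right_iff)
   ultimately obtain e2 where e2: "e2 : K" "e2 ~= \<zero>" "v e2 = v (y \<otimes> y1)"
    using valuation_in_fixed_field[OF yy aut_group_axioms _ y1(4) prod[OF y1(4) b y1(5)]] by auto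
   have ec: "e1 : carrier R" "e2 : carrier R" using e1 e2 Kc by auto
   have "v (e2 \<otimes> inv e1) = v y" using e1 e2 ec yc y y1 by (simp add: v_mult v_inv)
   moreover have "e2 \<otimes> inv e1 : K" "e2 \<otimes> inv e1 ~= \<zero>" using e1 e2 Kc integral_iff by auto
   ultimately show ?thesis unfolding eG by auto
  qed
 qed
 then obtain e where e: "e : fixed_field R (eigen y)" "e ~= \<zero>" "v e = v y" by blast
 interpret H: aut_group R "eigen y" by (rule eigen_aut_group[OF yc])
 have ec: "e : carrier R" "inv e : fixed_field R (eigen y)" using e H.Kc by auto
 have "v (y \<otimes> inv e) = 0" "y \<otimes> inv e ~= \<zero>" using e ec yc y integral_iff by (auto simp: v_mult v_inv)
 thus "\<exists>x\<in>N. x ~= \<zero> \<and> v x = 0" using ye[OF ec(2)] by auto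
qed

end

section \<open>Fixed vectors and extension of valuation rings\<close>

context ab_aut_group
begin

lemma nat_in_fixed: "[(i::nat)] \<cdot> \<one> : K" by (induct i) (use Kc in auto)

text \<open>A vector with maximal stabilizer is fixed. Otherwise some \<open>h\<close> moves it
  while \<open>h \<up> p\<close> fixes it. In characteristic \<open>p\<close> the operator
  \<open>h - 1\<close> is then nilpotent on its translates, and the last nonzero image under its
  powers is fixed by \<open>h\<close> and by the old stabilizer.\<close>

lemma char_p_fixed_vector:
 assumes p: "prime p" "[p] \<cdot> \<one> = \<zero>" and card: "card G = p ^ k" and N: "submodule N" "N ~= {\<zero>}"
 shows "\<exists>y\<in>N. y ~= \<zero> \<and> y : K"
proof -
 note Nd = submoduleD[OF N(1)]
 obtain y0 where "y0 : N" "y0 ~= \<zero>" using N(2) Nd(3) by auto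
 moreover have "card {g : G. g y = y} < Suc (card G)" for y using finite_G by (auto intro: le_imp_less_Suc card_mono)
 ultimately obtain y where y: "y : N \<and> y ~= \<zero>" and ymax: "!!z. z : N \<and> z ~= \<zero> ==> card {g : G. g z = z} \<le> card {g : G. g y = y}"
  using ex_has_greatest_nat[of "\<lambda>y. y : N \<and> y ~= \<zero>" y0 "\<lambda>y. card {g : G. g y = y}" "Suc (card G)"] by auto
 have yc: "y : carrier R" using y Nd by auto
 have "g y = y" if g: "g : G" for g
 proof (rule ccontr)
  assume "g y ~= y"
  hence g0: "(g \<up> (p ^ 0)) y ~= y" using GG.nat_pow_eone[of g] g by simp
  have gk: "(g \<up> (p ^ k)) y = y" using GG.pow_order_eq_1[of g] g yc card by (simp add: order_def)
  obtain l where l: "(g \<up> (p ^ l)) y ~= y" "(g \<up> (p ^ Suc l)) y = y"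
  proof -
   have "\<exists>l. (g \<up> (p ^ l)) y ~= y \<and> (g \<up> (p ^ Suc l)) y = y"
   proof (rule ccontr)
    assume no: "\<not> ?thesis"
    have "(g \<up> (p ^ l)) y ~= y" for l by (induct l) (use g0 no in blast)+
    thus False using gk by simp
   qed
   thus ?thesis using that by auto
  qed
  define h where "h = g \<up> (p ^ l)"
  have h: "h : G" "h y ~= y" using g l by (auto simp: h_def)
  have hp: "(h \<up> p) y = y" using l(2) g GG.nat_pow_pow[of g "p ^ l" p] by (simp add: h_def mult.commute)
  define w where "w = (\<lambda>i::nat. (h \<up> i) y)"
  have wN: "w i : N" and wc: "w i : carrier R" for i using y h Nd(2,6) by (auto simp: w_def)
  have hw: "h (w i) = w (Suc i)" for i using pow_Suc_apply[OF h(1) yc] by (simp add: w_def)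
  have w0: "w 0 = y" and wp: "w p = y" using yc hp by (auto simp: w_def)
  define q where "q = (\<lambda>i j. [(i choose j)] \<cdot> \<one>)"
  have qK: "q i j : K" and qc: "q i j : carrier R" for i j using nat_in_fixed by (auto simp: q_def)
  \<comment> \<open>Up to signs and powers of \<open>h\<close>, \<open>z j\<close> is the image of
    \<open>y\<close> under the power of \<open>h - 1\<close> with exponent \<open>p - 1 - j\<close>.
    Binomial coefficients avoid iterating the operator.\<close>
  define z where "z = (\<lambda>j. \<Oplus>i\<in>{..<p}. q i j \<otimes> w i)"
  have zN: "z j : N" for j unfolding z_def using wN qK Nd by (intro submodule_finsum[OF N(1)]) auto
  have zc: "z j : carrier R" for j using zN Nd by auto
  obtain p' where p': "p = Suc p'" using p by (cases p) auto
  have hz: "h (z j) = (\<Oplus>i\<in>{..<p}. q i j \<otimes> w (Suc i))" for j by (auto simp: z_def h qc wc aut_finsum qK hw finsum_cong' aut_mult aut_fix)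
  have shift: "(\<Oplus>i\<in>{..<p}. q (Suc i) j \<otimes> w (Suc i)) = z j" if j: "j < p" for j
  proof -
   \<comment> \<open>The ends of the shifted sum match: the inner binomial coefficients of
     \<open>p\<close> vanish in characteristic \<open>p\<close>, and for \<open>j = 0\<close> both
     terms are \<open>y\<close>.\<close>
   have qp: "q p j \<otimes> w p = q 0 j \<otimes> w 0"
   proof (cases "j = 0")
    case False
    hence "p dvd (p choose j)" using p(1) j by (intro dvd_choose_prime) auto
    then obtain c where "p choose j = p * c" by auto
    hence "q p j = \<zero>" using p(2) add.nat_pow_pow[of \<one> c p] by (simp add: q_def)
    moreover have "q 0 j = \<zero>" using False by (simp add: q_def binomial_eq_0)
    ultimately show ?thesis using wc by simp
   qed (use w0 wp in \<open>simp add: q_def\<close>)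
   have c: "q i j \<otimes> w i : carrier R" for i using qc wc by simp
   have "(\<Oplus>i\<in>{..p'}. q (Suc i) j \<otimes> w (Suc i)) \<oplus> q 0 j \<otimes> w 0 = (\<Oplus>i\<in>{..Suc p'}. q i j \<otimes> w i)" using c by (intro finsum_Suc2[symmetric]) auto
   also have "\<dots> = q p j \<otimes> w p \<oplus> (\<Oplus>i\<in>{..p'}. q i j \<otimes> w i)" unfolding p' using c by simp
   finally have "(\<Oplus>i\<in>{..p'}. q (Suc i) j \<otimes> w (Suc i)) \<oplus> q 0 j \<otimes> w 0 =
    (\<Oplus>i\<in>{..p'}. q i j \<otimes> w i) \<oplus> q 0 j \<otimes> w 0" unfolding qp using c by (simp add: a_comm)
   thus ?thesis using c by (simp add: z_def p' lessThan_Suc_atMost)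
  qed
  have rel: "z (Suc j) = h (z (Suc j)) \<oplus> h (z j)" if j: "Suc j < p" for j
  proof -
   have "z (Suc j) = (\<Oplus>i\<in>{..<p}. q i (Suc j) \<otimes> w (Suc i) \<oplus> q i j \<otimes> w (Suc i))" unfolding shift[OF j, symmetric]
   proof (intro finsum_cong' refl)
    fix i
    have "q (Suc i) (Suc j) = q i (Suc j) \<oplus> q i j"
     using add.nat_pow_mult[of \<one> "i choose Suc j" "i choose j"] by (simp add: q_def add.commute)
    thus "q (Suc i) (Suc j) \<otimes> w (Suc i) = q i (Suc j) \<otimes> w (Suc i) \<oplus> q i j \<otimes> w (Suc i)" using qc wc by (simp add: l_distr)
   qed (use qc wc in auto)
   also have "\<dots> = h (z (Suc j)) \<oplus> h (z j)" unfolding hz using qc wc by simp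
   finally show ?thesis .
  qed
  have "z p' ~= \<zero>"
  proof -
   have "z p' = (\<Oplus>i\<in>insert p' {..<p'}. q i p' \<otimes> w i)" by (simp add: z_def p' lessThan_Suc)
   also have "\<dots> = q p' p' \<otimes> w p' \<oplus> (\<Oplus>i\<in>{..<p'}. q i p' \<otimes> w i)" using qc wc by simp
   also have "(\<Oplus>i\<in>{..<p'}. q i p' \<otimes> w i) = (\<Oplus>i\<in>{..<p'}. \<zero>)" using wc by (intro finsum_cong') (auto simp: q_def binomial_eq_0)
   finally have "z p' = w p'" using wc by (simp add: q_def)
   thus ?thesis using aut_nonzero[of "h \<up> p'" y] h yc y by (simp add: w_def)
  qed
  then obtain j where j: "j = (LEAST j. z j ~= \<zero>)" "z j ~= \<zero>" "j \<le> p'" using LeastI[of "\<lambda>j. z j ~= \<zero>" p'] Least_le[of "\<lambda>j. z j ~= \<zero>" p'] by simp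
  have hzj: "h (z j) = z j"
  proof (cases j)
   case 0
   thus ?thesis using hz[of 0] shift[of 0] p' by (simp add: q_def)
  next
   case (Suc i)
   have "z i = \<zero>" using not_less_Least[of i "\<lambda>j. z j ~= \<zero>"] j(1) Suc by auto
   thus ?thesis using rel[of i] Suc j(3) p' h zc by simp
  qed
  have "f (z j) = z j" if f: "f : G" "f y = y" for f
  proof -
   have "f (w i) = w i" for i using aut_commute[OF f(1), of "h \<up> i" y] f h yc by (simp add: w_def)
   moreover have "f (z j) = (\<Oplus>i\<in>{..<p}. f (q i j \<otimes> w i))" unfolding z_def using f qc wc by (intro aut_finsum) auto
   moreover have "\<dots> = (\<Oplus>i\<in>{..<p}. q i j \<otimes> f (w i))" using f qc wc qK by (intro finsum_cong') (auto simp: aut_mult aut_fix)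
   ultimately show ?thesis by (simp add: z_def)
  qed
  hence "{g : G. g y = y} \<subset> {g : G. g (z j) = z j}" using hzj h by auto
  hence "card {g : G. g y = y} < card {g : G. g (z j) = z j}" using finite_G by (intro psubset_card_mono) auto
  thus False using ymax[of "z j"] zN j(2) by simp
 qed
 hence "y : K" using yc by (simp add: fixed_field_def)
 thus ?thesis using y by auto
qed

end

text \<open>Let \<open>V\<close> be maximal among the subrings containing \<open>D\<close> but not
  \<open>inv t\<close>. Elements of \<open>1 - t V\<close> are invertible in \<open>V\<close>, and
  for \<open>x\<close> outside \<open>V\<close> some polynomial in \<open>x\<close> with
  coefficients in \<open>t V\<close> equals 1. Shortest relations of this kind for both
  \<open>x\<close> and \<open>inv x\<close> would shorten each other.\<close>

theorem (in field) exists_valuation_ring: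
 assumes D: "subring D R" and t: "t : D" "t ~= \<zero>" "inv t \<notin> D"
 shows "\<exists>V. subring V R \<and> D \<subseteq> V \<and> inv t \<notin> V \<and> (\<forall>x\<in>carrier R. x ~= \<zero> --> x : V \<or> inv x : V)"
proof -
 define A where "A = {V. subring V R \<and> D \<subseteq> V \<and> inv t \<notin> V}"
 have tc: "t : carrier R" using subringE(1)[OF D] t by auto
 have "\<exists>M\<in>A. \<forall>W\<in>A. M \<subseteq> W --> W = M"
 proof (rule subset_Zorn_nonempty)
  show "A ~= {}" using D t by (auto simp: A_def)
  fix C assume C: "C ~= {}" "subset.chain A C"
  have CA: "V : A" if "V : C" for V using C(2) that by (auto simp: subset.chain_def)
  have two: "\<exists>V\<in>C. x : V \<and> y : V" if xy: "x : \<Union>C" "y : \<Union>C" for x y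
  proof -
   obtain V W where VW: "V : C" "W : C" "x : V" "y : W" using xy by auto
   hence "V \<subseteq> W \<or> W \<subseteq> V" using C(2) by (auto simp: subset.chain_def)
   thus ?thesis using VW by auto
  qed
  have sub: "subring V R" if "V : C" for V using CA[OF that] by (simp add: A_def)
  have "subring (\<Union>C) R"
  proof (rule subringI)
   show "\<Union>C \<subseteq> carrier R" using subringE(1)[OF sub] by auto
   show "\<one> : \<Union>C" using subringE(3)[OF sub] C(1) by auto
   show "\<ominus> h : \<Union>C" if "h : \<Union>C" for h using that subringE(5)[OF sub] by auto
   show "h1 \<otimes> h2 : \<Union>C" if h: "h1 : \<Union>C" "h2 : \<Union>C" for h1 h2 using two[OF h] subringE(6)[OF sub] by auto
   show "h1 \<oplus> h2 : \<Union>C" if h: "h1 : \<Union>C" "h2 : \<Union>C" for h1 h2 using two[OF h] subringE(7)[OF sub] by auto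
  qed
  thus "\<Union>C : A" using CA C(1) by (auto simp: A_def)
 qed
 then obtain V where V: "V : A" and Vmax: "!!W. W : A ==> V \<subseteq> W ==> W = V" by blast
 have Vs: "subring V R" "D \<subseteq> V" "inv t \<notin> V" using V by (auto simp: A_def)
 note Vc = subringE[OF Vs(1)]
 have VcR: "x : carrier R" if "x : V" for x using Vc(1) that by auto
 have tV: "t : V" using Vs t by auto
 define J where "J = (\<lambda>a. t \<otimes> a) ` V"
 have JV: "J \<subseteq> V" using Vc(6)[OF tV] by (auto simp: J_def)
 have Jc: "x : carrier R" if "x : J" for x using JV VcR that by auto
 have J0: "\<zero> : J" using Vc(2) tc by (auto simp: J_def intro!: image_eqI[of _ _ \<zero>])
 have Jadd: "a \<oplus> b : J" if "a : J" "b : J" for a b using that Vc(7) VcR tc by (auto simp: J_def r_distr[symmetric])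
 have Jmult: "a \<otimes> b : J" if "a : J" "b : V" for a b using that Vc(6) VcR tc by (auto simp: J_def m_assoc)
 have J1: "\<one> \<notin> J"
 proof
  assume "\<one> : J"
  then obtain a where a: "a : V" "\<one> = t \<otimes> a" by (auto simp: J_def)
  have "inv t = inv t \<otimes> (t \<otimes> a)" unfolding a(2)[symmetric] using tc t by simp
  hence "inv t = a" using field_inv_cancel(2)[OF tc t(2) VcR[OF a(1)]] by simp
  thus False using a Vs by simp
 qed
 have nz: "\<one> \<ominus> s ~= \<zero>" if "s : J" for s using that J1 Jc by auto
 \<comment> \<open>Inverting the elements of \<open>1 - J\<close> does not create
   \<open>inv t\<close>, as otherwise 1 would lie in \<open>J\<close>; maximality then puts the
   inverses into \<open>V\<close>.\<close>
 have unit: "inv (\<one> \<ominus> s) : V" if s: "s : J" for s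
 proof -
  define W where "W = {a \<otimes> inv (\<one> \<ominus> s) |a s. a : V \<and> s : J}"
  have mem: "a \<otimes> inv (\<one> \<ominus> s) : W" if "a : V" "s : J" for a s using that by (auto simp: W_def)
  have minusV: "\<one> \<ominus> s : V" if "s : J" for s using that JV Vc by (auto simp: a_minus_def)
  have VW: "V \<subseteq> W"
  proof
   fix a assume a: "a : V"
   have "inv (\<one> \<ominus> \<zero>) = \<one>" by (simp add: a_minus_def)
   thus "a : W" using mem[OF a J0] VcR[OF a] by simp
  qed
  have prod: "\<exists>s''\<in>J. (\<one> \<ominus> s) \<otimes> (\<one> \<ominus> s') = \<one> \<ominus> s''" if s: "s : J" "s' : J" for s s'
  proof (intro bexI)
   show "(\<one> \<ominus> s) \<otimes> (\<one> \<ominus> s') = \<one> \<ominus> (s \<oplus> s' \<otimes> (\<one> \<ominus> s))" using Jc[OF s(1)] Jc[OF s(2)] by algebra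
   show "s \<oplus> s' \<otimes> (\<one> \<ominus> s) : J" using s minusV by (intro Jadd Jmult) auto
  qed
  have "subring W R"
  proof (rule subringI)
   show "W \<subseteq> carrier R" using VcR minusV nz by (auto simp: W_def)
   show "\<one> : W" using VW Vc by auto
   fix x assume "x : W"
   then obtain a s where a: "a : V" "s : J" "x = a \<otimes> inv (\<one> \<ominus> s)" by (auto simp: W_def)
   have sc: "\<one> \<ominus> s : carrier R" "\<one> \<ominus> s ~= \<zero>" using a(2) minusV VcR nz by auto
   show "\<ominus> x : W" using mem[of "\<ominus> a" s] a VcR sc Vc(5) by (simp add: l_minus)
   fix y assume "y : W"
   then obtain b s' where b: "b : V" "s' : J" "y = b \<otimes> inv (\<one> \<ominus> s')" by (auto simp: W_def)
   have sc': "\<one> \<ominus> s' : carrier R" "\<one> \<ominus> s' ~= \<zero>" using b(2) minusV VcR nz by auto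
   obtain s'' where s'': "s'' : J" "(\<one> \<ominus> s) \<otimes> (\<one> \<ominus> s') = \<one> \<ominus> s''" using prod[OF a(2) b(2)] by auto
   have i: "inv (\<one> \<ominus> s'') = inv (\<one> \<ominus> s) \<otimes> inv (\<one> \<ominus> s')" using s''(2)[symmetric] field_inv_mult sc sc' by simp
   have abc: "a : carrier R" "b : carrier R" "inv (\<one> \<ominus> s) : carrier R" "inv (\<one> \<ominus> s') : carrier R" using a b VcR sc sc' by auto
   have "x \<otimes> y = (a \<otimes> b) \<otimes> inv (\<one> \<ominus> s'')" unfolding a(3) b(3) i using abc by (simp only: m_ac m_closed)
   thus "x \<otimes> y : W" using mem[OF _ s''(1)] Vc(6) a b by simp
   have "x \<oplus> y = (a \<otimes> (\<one> \<ominus> s') \<oplus> b \<otimes> (\<one> \<ominus> s)) \<otimes> inv (\<one> \<ominus> s'')"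
   proof -
    have "(a \<otimes> (\<one> \<ominus> s') \<oplus> b \<otimes> (\<one> \<ominus> s)) \<otimes> inv (\<one> \<ominus> s'') =
     (a \<otimes> inv (\<one> \<ominus> s)) \<otimes> ((\<one> \<ominus> s') \<otimes> inv (\<one> \<ominus> s')) \<oplus> (b \<otimes> inv (\<one> \<ominus> s')) \<otimes> ((\<one> \<ominus> s) \<otimes> inv (\<one> \<ominus> s))"
     unfolding i using abc sc(1) sc'(1) by algebra
    thus ?thesis using sc sc' abc by (simp add: a b)
   qed
   moreover have "a \<otimes> (\<one> \<ominus> s') \<oplus> b \<otimes> (\<one> \<ominus> s) : V" using a b minusV Vc by auto
   ultimately show "x \<oplus> y : W" using mem[OF _ s''(1)] by simp
  qed
  moreover have "inv t \<notin> W"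
  proof
   assume "inv t : W"
   then obtain a s where a: "a : V" "s : J" "inv t = a \<otimes> inv (\<one> \<ominus> s)" by (auto simp: W_def)
   have sc: "\<one> \<ominus> s : carrier R" "\<one> \<ominus> s ~= \<zero>" "s : carrier R" using a(2) nz Jc by auto
   have "t \<otimes> inv t \<otimes> (\<one> \<ominus> s) = t \<otimes> (a \<otimes> inv (\<one> \<ominus> s)) \<otimes> (\<one> \<ominus> s)" using a(3) by simp
   hence "\<one> \<ominus> s = t \<otimes> a" using sc tc t VcR[OF a(1)] by (simp add: m_assoc)
   hence "\<one> = t \<otimes> a \<oplus> s" using sc by (metis a_minus_def add.inv_solve_right' one_closed)
   moreover have "t \<otimes> a \<oplus> s : J" using a by (intro Jadd) (auto simp: J_def)
   ultimately show False using J1 by simp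
  qed
  ultimately have "W = V" using VW Vs by (intro Vmax) (auto simp: A_def)
  thus ?thesis using mem[OF Vc(3) s] minusV[OF s] nz[OF s] VcR by auto
 qed
 define Q where "Q = (\<lambda>x n. \<exists>a. (\<forall>i\<le>n. a i : J) \<and> (\<Oplus>i\<in>{..n::nat}. a i \<otimes> x [^] i) = \<one>)"
 \<comment> \<open>The ring \<open>V[x]\<close> is strictly larger than \<open>V\<close>, so it
   contains \<open>inv t\<close>; multiplying such an expression by \<open>t\<close> moves the
   coefficients into \<open>J\<close>.\<close>
 have Q: "\<exists>n. Q x n" if x: "x : carrier R" "x \<notin> V" for x
 proof (rule ccontr)
  assume no: "\<nexists>n. Q x n"
  let ?E = "simple_extension V x"
  have sE: "subring ?E R" by (rule simple_extension_is_subring[OF Vs(1) x(1)])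
  have VE: "V \<subseteq> ?E" using simple_extension_incl[OF Vc(1) x(1)] by simp
  have "inv t \<notin> ?E"
  proof
   assume "inv t : ?E"
   then obtain f where f: "f : carrier (V[X])" "inv t = eval f x" using simple_extension_as_eval_img[OF Vc(1) x(1)] by auto
   have fV: "set f \<subseteq> V" using f(1) univ_poly_carrier polynomial_incl by blast
   have cV: "coeff f i : V" for i
   proof -
    have "coeff f i : set f \<union> {\<zero>}" unfolding coeff_img(3)[symmetric] by simp
    thus ?thesis using fV Vc(2) by auto
   qed
   have "eval f x = (\<Oplus>i\<in>{..<length f}. coeff f i \<otimes> x [^] i)" using eval_coeffs[of "length f" "coeff f" x] cV VcR x(1) by (simp add: coeff_list)
   also have "\<dots> = (\<Oplus>i\<in>{..length f}. coeff f i \<otimes> x [^] i)"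
   proof -
    have "(\<Oplus>i\<in>{..length f}. coeff f i \<otimes> x [^] i) = (\<Oplus>i\<in>insert (length f) {..<length f}. coeff f i \<otimes> x [^] i)"
     by (rule arg_cong[where f = "\<lambda>A. finsum R _ A"]) auto
    also have "\<dots> = coeff f (length f) \<otimes> x [^] length f \<oplus> (\<Oplus>i\<in>{..<length f}. coeff f i \<otimes> x [^] i)" using cV VcR x(1) by simp
    also have "coeff f (length f) = \<zero>" by (simp add: coeff_length)
    finally show ?thesis using cV VcR x(1) by simp
   qed
   finally have e: "inv t = (\<Oplus>i\<in>{..length f}. coeff f i \<otimes> x [^] i)" using f by simp
   have "\<one> = t \<otimes> (\<Oplus>i\<in>{..length f}. coeff f i \<otimes> x [^] i)" using e tc t by (metis field_inv(1))
   also have "\<dots> = (\<Oplus>i\<in>{..length f}. t \<otimes> (coeff f i \<otimes> x [^] i))" using cV VcR x(1) tc by (intro finsum_rdistr) auto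
   also have "\<dots> = (\<Oplus>i\<in>{..length f}. (t \<otimes> coeff f i) \<otimes> x [^] i)" using cV VcR x(1) tc by (intro finsum_cong') (auto simp: m_assoc)
   finally have "Q x (length f)" using cV unfolding Q_def J_def by (intro exI[of _ "\<lambda>i. t \<otimes> coeff f i"]) auto
   thus False using no by simp
  qed
  hence "?E = V" using sE VE Vs by (intro Vmax) (auto simp: A_def)
  thus False using simple_extension_mem[OF Vs(1) x(1)] x(2) by simp
 qed
 have reduce: "\<exists>n'<n. Q x n'" if x: "x : carrier R" "x ~= \<zero>" and nm: "Q x n" "Q (inv x) m" "m \<le> n" for x n m
 proof -
  obtain a where a: "!!i. i \<le> n ==> a i : J" "(\<Oplus>i\<in>{..n}. a i \<otimes> x [^] i) = \<one>" using nm by (auto simp: Q_def)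
  obtain b where b: "!!i. i \<le> m ==> b i : J" "(\<Oplus>i\<in>{..m}. b i \<otimes> (inv x) [^] i) = \<one>" using nm by (auto simp: Q_def)
  have ix: "inv x : carrier R" using x by simp
  let ?u = "inv (\<one> \<ominus> b 0)"
  have b0: "b 0 : J" "b 0 : carrier R" "\<one> \<ominus> b 0 ~= \<zero>" using b(1)[of 0] Jc nz by auto
  have u: "?u : V" "?u : carrier R" using unit[OF b0(1)] VcR by auto
  have bc: "b i : carrier R" if "i \<le> m" for i using b(1) Jc that by auto
  have ac: "a i : carrier R" if "i \<le> n" for i using a(1) Jc that by auto
  have n0: "n > 0"
  proof (rule ccontr)
   assume "\<not> n > 0"
   hence "a 0 = \<one>" using a(2) ac by simp
   thus False using a(1)[of 0] J1 by simp
  qed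
  have s1: "(\<Oplus>j\<in>{1..m}. b j \<otimes> (inv x) [^] j) = \<one> \<ominus> b 0"
  proof -
   have "{..m} = insert 0 {1..m}" by auto
   hence "\<one> = (\<Oplus>j\<in>insert 0 {1..m}. b j \<otimes> (inv x) [^] j)" using b(2) by simp
   also have "\<dots> = b 0 \<otimes> (inv x) [^] (0::nat) \<oplus> (\<Oplus>j\<in>{1..m}. b j \<otimes> (inv x) [^] j)" using bc ix by simp
   finally have "\<one> = b 0 \<oplus> (\<Oplus>j\<in>{1..m}. b j \<otimes> (inv x) [^] j)" using b0 by simp
   moreover have "(\<Oplus>j\<in>{1..m}. b j \<otimes> (inv x) [^] j) : carrier R" using bc ix by simp
   ultimately have "\<one> \<ominus> b 0 = b 0 \<oplus> (\<Oplus>j\<in>{1..m}. b j \<otimes> (inv x) [^] j) \<ominus> b 0" by simp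
   thus ?thesis using b0 \<open>(\<Oplus>j\<in>{1..m}. b j \<otimes> (inv x) [^] j) : carrier R\<close> by (simp add: a_minus_def a_comm[of "b 0"] a_assoc r_neg)
  qed
  \<comment> \<open>The relation for \<open>inv x\<close>, freed of its constant term and multiplied
    by \<open>a n \<otimes> x [^] n\<close>, replaces the top term of the relation for
    \<open>x\<close> by lower ones; \<open>m \<le> n\<close> keeps the exponents natural.\<close>
  define e where "e = (\<lambda>j. a n \<otimes> ?u \<otimes> b j)"
  have eJ: "e j : J" if "j \<le> m" for j using a(1)[of n] u b(1)[OF that] JV by (auto simp: e_def intro!: Jmult)
  have ec: "e j : carrier R" if "j \<le> m" for j using eJ[OF that] Jc by auto
  have top: "a n \<otimes> x [^] n = (\<Oplus>j\<in>{1..m}. e j \<otimes> x [^] (n - j))"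
  proof -
   have "?u \<otimes> (\<one> \<ominus> b 0) = \<one>" using b0 by simp
   hence "a n \<otimes> x [^] n = (a n \<otimes> ?u \<otimes> x [^] n) \<otimes> (\<one> \<ominus> b 0)" using ac[of n] x b0 by (simp add: m_ac)
   also have "\<dots> = (a n \<otimes> ?u \<otimes> x [^] n) \<otimes> (\<Oplus>j\<in>{1..m}. b j \<otimes> (inv x) [^] j)" by (simp only: s1)
   also have "\<dots> = (\<Oplus>j\<in>{1..m}. (a n \<otimes> ?u \<otimes> x [^] n) \<otimes> (b j \<otimes> (inv x) [^] j))" using ac[of n] u x bc by (intro finsum_rdistr) auto
   also have "\<dots> = (\<Oplus>j\<in>{1..m}. e j \<otimes> x [^] (n - j))"
   proof (intro finsum_cong' refl)
    fix j assume j: "j : {1..m}"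
    have bj: "b j : carrier R" using j bc by simp
    have "x [^] n \<otimes> (inv x) [^] j = x [^] (n - j) \<otimes> (x [^] j \<otimes> (inv x) [^] j)" using j nm(3) x by (simp add: nat_pow_mult flip: m_assoc)
    also have "x [^] j \<otimes> (inv x) [^] j = (x \<otimes> inv x) [^] j" by (intro nat_pow_distrib[symmetric]) (use x ix in auto)
    finally have xx: "x [^] n \<otimes> (inv x) [^] j = x [^] (n - j)" using x by simp
    have "(a n \<otimes> ?u \<otimes> x [^] n) \<otimes> (b j \<otimes> (inv x) [^] j) = e j \<otimes> (x [^] n \<otimes> (inv x) [^] j)"
     unfolding e_def using ac[of n] u(2) x(1) ix bj by (simp only: m_ac m_closed nat_pow_closed)
    thus "(a n \<otimes> ?u \<otimes> x [^] n) \<otimes> (b j \<otimes> (inv x) [^] j) = e j \<otimes> x [^] (n - j)" by (simp only: xx)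
   qed (use ec x in auto)
   finally show ?thesis .
  qed
  define e' where "e' = (\<lambda>i. if n - i \<le> m then e (n - i) else \<zero>)"
  have e'J: "e' i : J" for i using eJ J0 by (simp add: e'_def)
  have e'c: "e' i : carrier R" for i using e'J Jc by auto
  have rev: "(\<Oplus>j\<in>{1..m}. e j \<otimes> x [^] (n - j)) = (\<Oplus>i\<in>{..<n}. e' i \<otimes> x [^] i)"
  proof -
   have "(\<Oplus>i\<in>{..<n}. e' i \<otimes> x [^] i) = (\<Oplus>i\<in>{n - m..<n}. e' i \<otimes> x [^] i)"
    using e'c x by (intro add.finprod_mono_neutral_cong_left[symmetric, where g = "\<lambda>i. e' i \<otimes> x [^] i"]) (auto simp: e'_def)
   also have "{n - m..<n} = (\<lambda>j. n - j) ` {1..m}"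
    using nm(3) by (auto simp: image_iff) (metis Suc_le_eq diff_diff_cancel diff_le_mono2 less_imp_le_nat zero_less_diff atLeastAtMost_iff)
   also have "(\<Oplus>i\<in>(\<lambda>j. n - j) ` {1..m}. e' i \<otimes> x [^] i) = (\<Oplus>j\<in>{1..m}. e' (n - j) \<otimes> x [^] (n - j))"
    using e'c x nm(3) by (intro finsum_reindex) (auto simp: inj_on_def)
   also have "\<dots> = (\<Oplus>j\<in>{1..m}. e j \<otimes> x [^] (n - j))" using ec x nm(3) by (intro finsum_cong') (auto simp: e'_def)
   finally show ?thesis ..
  qed
  have "\<one> = (\<Oplus>i\<in>insert n {..<n}. a i \<otimes> x [^] i)" unfolding a(2)[symmetric] by (rule arg_cong[where f = "\<lambda>A. finsum R _ A"]) auto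
  also have "\<dots> = a n \<otimes> x [^] n \<oplus> (\<Oplus>i\<in>{..<n}. a i \<otimes> x [^] i)" using ac x by simp
  also have "\<dots> = (\<Oplus>i\<in>{..<n}. e' i \<otimes> x [^] i) \<oplus> (\<Oplus>i\<in>{..<n}. a i \<otimes> x [^] i)" by (simp only: top rev)
  also have "\<dots> = (\<Oplus>i\<in>{..<n}. e' i \<otimes> x [^] i \<oplus> a i \<otimes> x [^] i)" using e'c ac x by simp
  also have "\<dots> = (\<Oplus>i\<in>{..<n}. (e' i \<oplus> a i) \<otimes> x [^] i)" using e'c ac x by (intro finsum_cong') (auto simp: l_distr)
  finally have "(\<Oplus>i\<in>{..n - 1}. (e' i \<oplus> a i) \<otimes> x [^] i) = \<one>" using n0 by (metis Suc_pred' lessThan_Suc_atMost)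
  hence "Q x (n - 1)" using Jadd[OF e'J a(1)] unfolding Q_def by (intro exI[of _ "\<lambda>i. e' i \<oplus> a i"]) auto
  thus ?thesis using n0 by (intro exI[of _ "n - 1"]) auto
 qed
 have "x : V \<or> inv x : V" if x: "x : carrier R" "x ~= \<zero>" for x
 proof (rule ccontr)
  assume no: "\<not> ?thesis"
  have ix: "inv x : carrier R" "inv x ~= \<zero>" "inv (inv x) = x" using x field_inv_inv by auto
  define n m where "n = (LEAST n. Q x n)" and "m = (LEAST m. Q (inv x) m)"
  have nm: "Q x n" "Q (inv x) m" using Q[of x] Q[of "inv x"] no x LeastI_ex unfolding n_def m_def by auto
  have least: "\<not> Q x n'" if "n' < n" for n' using that not_less_Least unfolding n_def by auto
  have least': "\<not> Q (inv x) n'" if "n' < m" for n' using that not_less_Least unfolding m_def by auto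
  show False
  proof (cases "m \<le> n")
   case True
   thus False using reduce[OF x nm] least by auto
  next
   case False
   thus False using reduce[OF ix(1,2), of m n] nm least' ix(3) by auto
  qed
 qed
 thus ?thesis using Vs by auto
qed

section \<open>Extending a complete valuation\<close>

locale valuation_ring_of = field R for R (structure) + fixes V :: "'a set"
 assumes V_subring: "subring V R" and V_total: "[|x : carrier R; x ~= \<zero>|] ==> x : V \<or> inv x : V"
begin

lemmas Vc = subringE[OF V_subring]

lemma V_carrier: "x : V ==> x : carrier R" using Vc(1) by auto

lemma V_pow: "x : V ==> x [^] (i::nat) : V" by (induct i) (auto intro: Vc)

definition val_units where "val_units = {x : carrier R. x ~= \<zero> \<and> x : V \<and> inv x : V}"

lemma units_closed: "x : val_units ==> x : carrier R \<and> x ~= \<zero> \<and> x : V \<and> inv x : V" by (simp add: val_units_def)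

lemma units_mult: "x : val_units ==> y : val_units ==> x \<otimes> y : val_units"
 using Vc(6) field_inv_mult[of x y] integral_iff[of x y] by (auto simp: val_units_def)

lemma units_inv: "x : val_units ==> inv x : val_units" using field_inv_inv[of x] by (auto simp: val_units_def)

lemma units_one: "\<one> : val_units" using Vc(3) by (simp add: val_units_def)

lemma units_pow: "x : val_units ==> x [^] (i::nat) : val_units" by (induct i) (auto simp: units_one units_mult)

text \<open>One of the two quotients of the summands lies in \<open>V\<close>. If
  \<open>x' / y'\<close> does and \<open>x' + y'\<close> is a unit, then
  \<open>(x' / y' + 1) / (x' + y')\<close>, the inverse of \<open>y'\<close>, lies in
  \<open>V\<close>, and \<open>y'\<close> would be a unit.\<close>

lemma nonunits_sum:
 assumes "finite J" "!!j. j : J ==> f j : V - val_units"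
 shows "(\<Oplus>j\<in>J. f j) : V - val_units" using assms
proof (induct J)
 case empty
 thus ?case using Vc(2) by (simp add: val_units_def)
next
 case (insert j J)
 let ?x = "f j" and ?y = "\<Oplus>j\<in>J. f j"
 have xy: "?x : V - val_units" "?y : V - val_units" using insert by auto
 hence c: "?x : carrier R" "?y : carrier R" using V_carrier by auto
 have *: "y' = \<zero>" if x': "x' : V" "x' \<oplus> y' : val_units" and y': "y' : V - val_units" "y' ~= \<zero> ==> x' \<otimes> inv y' : V" for x' y'
 proof (rule ccontr)
  assume n: "y' ~= \<zero>"
  have c': "x' : carrier R" "y' : carrier R" using x' y' V_carrier by auto
  have u: "inv (x' \<oplus> y') : V" "x' \<oplus> y' ~= \<zero>" using x'(2) by (auto simp: val_units_def)
  have "(x' \<otimes> inv y' \<oplus> \<one>) \<otimes> inv (x' \<oplus> y') = inv y'"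
  proof -
   have "x' \<otimes> inv y' \<oplus> \<one> = inv y' \<otimes> (x' \<oplus> y')" using c' n by (simp add: r_distr m_comm)
   thus ?thesis using c' n u by (simp add: m_assoc)
  qed
  moreover have "(x' \<otimes> inv y' \<oplus> \<one>) \<otimes> inv (x' \<oplus> y') : V" using u y'(2)[OF n] Vc by auto
  ultimately have "y' : val_units" using y' n c' by (simp add: val_units_def)
  thus False using y' by simp
 qed
 have "?x \<oplus> ?y \<notin> val_units"
 proof
  assume u: "?x \<oplus> ?y : val_units"
  show False
  proof (cases "?x = \<zero> \<or> ?y = \<zero>")
   case True
   thus False using u xy c by auto
  next
   case False
   have "?x \<otimes> inv ?y : V \<or> ?y \<otimes> inv ?x : V"
    using V_total[of "?x \<otimes> inv ?y"] field_inv_mult[of ?x "inv ?y"] field_inv_inv[of ?y] c False integral_iff by (auto simp: m_comm)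
   thus False using *[of ?x ?y] *[of ?y ?x] u xy c by (auto simp: a_comm)
  qed
 qed
 moreover have "?x \<oplus> ?y : V" using xy Vc(7) by auto
 moreover have "(\<Oplus>j\<in>insert j J. f j) = ?x \<oplus> ?y" using insert V_carrier by simp
 ultimately show ?case by simp
qed

lemma ex_dominant:
 assumes "finite J" "J ~= {}" "!!j. j : J ==> f j : carrier R \<and> f j ~= \<zero>"
 shows "\<exists>j0\<in>J. \<forall>j\<in>J. f j \<otimes> inv (f j0) : V" using assms
proof (induct J rule: finite_ne_induct)
 case (singleton x)
 thus ?case using Vc(3) by simp
next
 case (insert i J)
 then obtain j0 where j0: "j0 : J" "!!j. j : J ==> f j \<otimes> inv (f j0) : V" by auto
 have fi: "f i : carrier R" "f i ~= \<zero>" "f j0 : carrier R" "f j0 ~= \<zero>" using insert(5) j0(1) by auto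
 show ?case
 proof (cases "f i \<otimes> inv (f j0) : V")
  case True
  thus ?thesis using j0 by auto
 next
  case False
  have "inv (f i \<otimes> inv (f j0)) = f j0 \<otimes> inv (f i)"
   using field_inv_mult[of "f i" "inv (f j0)"] field_inv_inv[of "f j0"] fi by (simp add: m_comm)
  hence k: "f j0 \<otimes> inv (f i) : V" using V_total[of "f i \<otimes> inv (f j0)"] False fi integral_iff by auto
  have "f j \<otimes> inv (f i) : V" if j: "j : insert i J" for j
  proof (cases "j = i")
   case True
   thus ?thesis using fi Vc(3) by simp
  next
   case False
   hence jJ: "j : J" using j by simp
   have fj: "f j : carrier R" using insert(5) j by simp
   have "f j \<otimes> inv (f i) = (f j \<otimes> inv (f j0)) \<otimes> (f j0 \<otimes> inv (f i))" using fj fi m_assoc field_inv_cancel(2)[of "f j0" "inv (f i)"] by simp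
   thus ?thesis using Vc(6)[OF j0(2)[OF jJ] k] by simp
  qed
  thus ?thesis by blast
 qed
qed

text \<open>After division by a dominant term the remaining terms sum to minus one, a unit; if all
  of them were nonunits, so would be their sum.\<close>

lemma two_dominant:
 assumes J: "finite J" and f: "!!j. j : J ==> f j : carrier R" and s: "(\<Oplus>j\<in>J. f j) = \<zero>" and nz: "\<exists>j\<in>J. f j ~= \<zero>"
 shows "\<exists>i\<in>J. \<exists>j\<in>J. i ~= j \<and> f i ~= \<zero> \<and> f j ~= \<zero> \<and> f i \<otimes> inv (f j) : val_units"
proof (rule ccontr)
 assume no: "\<not> ?thesis"
 let ?J = "{j\<in>J. f j ~= \<zero>}"
 obtain j where j: "j : ?J" "!!i. i : ?J ==> f i \<otimes> inv (f j) : V"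
 proof -
  have "finite ?J" "?J ~= {}" "!!j. j : ?J ==> f j : carrier R \<and> f j ~= \<zero>" using J nz f by auto
  from ex_dominant[of ?J f, OF this] that show ?thesis by blast
 qed
 have fj: "f j : carrier R" "f j ~= \<zero>" using j(1) f by auto
 have "(\<Oplus>i\<in>J - {j}. f i \<otimes> inv (f j)) : V - val_units"
 proof (rule nonunits_sum)
  fix i assume i: "i : J - {j}"
  show "f i \<otimes> inv (f j) : V - val_units"
  proof (cases "f i = \<zero>")
   case True
   thus ?thesis using fj Vc(2) by (simp add: val_units_def)
  next
   case False
   thus ?thesis using no i j by auto
  qed
 qed (use J in simp)
 moreover have "(\<Oplus>i\<in>J - {j}. f i \<otimes> inv (f j)) = \<ominus> \<one>"
 proof -
  have "\<zero> = (\<Oplus>i\<in>insert j (J - {j}). f i) \<otimes> inv (f j)" using s j fj by (simp add: insert_absorb)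
  also have "\<dots> = (\<Oplus>i\<in>insert j (J - {j}). f i \<otimes> inv (f j))" using J f j by (intro finsum_ldistr) auto
  also have "\<dots> = f j \<otimes> inv (f j) \<oplus> (\<Oplus>i\<in>J - {j}. f i \<otimes> inv (f j))" using J f fj by (intro finsum_insert) auto
  finally have "\<one> \<oplus> (\<Oplus>i\<in>J - {j}. f i \<otimes> inv (f j)) = \<zero>" using fj by simp
  moreover have c: "(\<Oplus>i\<in>J - {j}. f i \<otimes> inv (f j)) : carrier R" using f fj by simp
  ultimately have "(\<Oplus>i\<in>J - {j}. f i \<otimes> inv (f j)) \<oplus> \<one> = \<zero>" using a_comm[OF c one_closed] by simp
  from minus_equality[OF this one_closed c] show ?thesis by simp
 qed
 moreover have "\<ominus> \<one> : val_units" using l_minus minus_minus[of \<one>] one_closed minus_zero one_not_zero Vc val_units_def by simp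
 ultimately show False by simp
qed

end

lemma (in ring) add_minus_add: "[|a : carrier R; b : carrier R; c : carrier R|] ==> (a \<oplus> b) \<ominus> (a \<oplus> c) = b \<ominus> c" by algebra

lemma (in ring) add_minus_minus: "[|a : carrier R; b : carrier R; c : carrier R|] ==> (a \<oplus> b) \<ominus> (b \<ominus> c) = a \<oplus> c" by algebra

text \<open>The field is \<open>L(\<zeta>)\<close> for a complete field \<open>L\<close>, with
  powers of a root of unity as a basis. The valuation is given on \<open>L\<close> only; its
  extension is constructed.\<close>

locale complete_extension = field R for R (structure) +
 fixes L :: "'a set" and v :: "'a \<Rightarrow> int" and d :: nat and \<zeta> :: 'a and q :: nat
 assumes L: "subfield L R" and v_valuation: "valuation (R\<lparr>carrier := L\<rparr>) v" and v_unif: "\<exists>t\<in>L - {\<zero>}. v t = 1"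
  and complete: "[|!!i::nat. s i : L; !!n. \<exists>N. \<forall>i\<ge>N. \<forall>j\<ge>N. val_ge R v n (s i \<ominus> s j)|] ==> \<exists>l\<in>L. \<forall>n. \<exists>N. \<forall>i\<ge>N. val_ge R v n (s i \<ominus> l)"
  and zeta: "\<zeta> : carrier R" "\<zeta> [^] q = \<one>" "q > 0" and d0: "d > 0"
  and spans: "x : carrier R ==> \<exists>a. (\<forall>j<d. a j : L) \<and> x = (\<Oplus>j\<in>{..<d}. a j \<otimes> \<zeta> [^] j)" and indep: "lin_indep L {..<d} (\<lambda>j. \<zeta> [^] j)"
begin

lemmas Lc = subfield_closed[OF L]

lemma zpow: "\<zeta> [^] (i::nat) : carrier R" using zeta by simp

lemma v_mult: "[|x : L; y : L; x ~= \<zero>; y ~= \<zero>|] ==> v (x \<otimes> y) = v x + v y" using valuation.v_mult[OF v_valuation, of x y] by simp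

lemma L_inv: "x : L ==> x ~= \<zero> ==> inv x : L" using Lc by auto

lemma v_one: "v \<one> = 0" using v_mult[of \<one> \<one>] Lc by simp

lemma v_inv: "x : L ==> x ~= \<zero> ==> v (inv x) = - v x" using v_mult[of x "inv x"] L_inv Lc v_one by simp

lemma v_pow: "x : L ==> x ~= \<zero> ==> v (x [^] (i::nat)) = int i * v x"
proof (induct i)
 case (Suc i)
 thus ?case using v_mult[of "x [^] i" x] Lc pow_nonzero[of x i] by (simp add: algebra_simps)
qed (simp add: v_one)

lemma dimension_ext: "dimension d L (carrier R)"
proof -
 let ?U = "map (\<lambda>j. \<zeta> [^] j) [0..<d]"
 have "independent L ?U" using lin_indep_imp_independent[OF L _ indep] zpow by simp
 hence "dimension (length ?U) L (Span L ?U)" by blast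
 moreover have "Span L ?U = carrier R" using Span_in_carrier[of L ?U] Lc(1) zpow spans Span_map[OF L, of d "\<lambda>j. \<zeta> [^] j"] by auto
 ultimately show ?thesis by simp
qed

text \<open>Excluding the inverse of a uniformizer guarantees that the ring meets \<open>L\<close>
  in the valuation ring of \<open>v\<close> and not in more.\<close>

definition ring_V where "ring_V = (SOME V. subring V R \<and> {x : L. val_ge R v 0 x} \<subseteq> V \<and> (\<exists>t\<in>L. t ~= \<zero> \<and> v t = 1 \<and> inv t \<notin> V) \<and>
  (\<forall>x\<in>carrier R. x ~= \<zero> --> x : V \<or> inv x : V))"

lemma ring_V: "subring ring_V R \<and> {x : L. val_ge R v 0 x} \<subseteq> ring_V \<and>
  (\<exists>t\<in>L. t ~= \<zero> \<and> v t = 1 \<and> inv t \<notin> ring_V) \<and> (\<forall>x\<in>carrier R. x ~= \<zero> --> x : ring_V \<or> inv x : ring_V)"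
proof -
 let ?D = "{x : L. val_ge R v 0 x}"
 interpret F: valuation "R\<lparr>carrier := L\<rparr>" v by (rule v_valuation)
 have vg: "F.vge = val_ge R v" by (simp add: val_ge_def fun_eq_iff)
 obtain t where t: "t : L" "t ~= \<zero>" "v t = 1" using v_unif by auto
 have um: "val_ge R v 0 (\<ominus> x)" if x: "x : L" "val_ge R v 0 x" for x
 proof -
  have n1: "\<ominus> \<one> : L" "\<ominus> \<one> ~= \<zero>" using Lc by auto
  have "v (\<ominus> \<one> \<otimes> \<ominus> \<one>) = v (\<ominus> \<one>) + v (\<ominus> \<one>)" using v_mult[OF n1(1,1) n1(2,2)] .
  hence "v (\<ominus> \<one>) = 0" using v_one by (simp add: l_minus)
  moreover have "\<ominus> x = \<ominus> \<one> \<otimes> x" using x Lc by (simp add: l_minus)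
  ultimately show ?thesis using x v_mult[OF n1(1) x(1) n1(2)] by (cases "x = \<zero>") (auto simp: val_ge_def)
 qed
 have sD: "subring ?D R"
 proof (rule subringI)
  show "?D \<subseteq> carrier R" using Lc by auto
  show "\<one> : ?D" using Lc v_one by (simp add: val_ge_def)
  show "\<ominus> h : ?D" if "h : ?D" for h using that um Lc by auto
  show "h1 \<otimes> h2 : ?D" if "h1 : ?D" "h2 : ?D" for h1 h2 using that F.vge_mult[of h1 h2 0 0] Lc unfolding vg by auto
  show "h1 \<oplus> h2 : ?D" if "h1 : ?D" "h2 : ?D" for h1 h2 using that F.vge_add[of h1 h2 0] Lc unfolding vg by auto
 qed
 have tD: "t : ?D" using t by (simp add: val_ge_def)
 have itD: "inv t \<notin> ?D" using t v_inv[OF t(1,2)] Lc(2) by (auto simp: val_ge_def)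
 obtain V where "subring V R \<and> ?D \<subseteq> V \<and> inv t \<notin> V \<and> (\<forall>x\<in>carrier R. x ~= \<zero> --> x : V \<or> inv x : V)"
  using exists_valuation_ring[OF sD tD t(2) itD] by auto
 hence "\<exists>V. subring V R \<and> ?D \<subseteq> V \<and> (\<exists>t\<in>L. t ~= \<zero> \<and> v t = 1 \<and> inv t \<notin> V) \<and> (\<forall>x\<in>carrier R. x ~= \<zero> --> x : V \<or> inv x : V)" using t by auto
 from someI_ex[OF this] show ?thesis unfolding ring_V_def .
qed

lemma ring_V_subring: "subring ring_V R" using ring_V by simp

lemma ring_V_total: "[|x : carrier R; x ~= \<zero>|] ==> x : ring_V \<or> inv x : ring_V"
 by (rule ring_V[THEN conjunct2, THEN conjunct2, THEN conjunct2, rule_format])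

sublocale V: valuation_ring_of R ring_V
 by (rule valuation_ring_of.intro[OF field_axioms valuation_ring_of_axioms.intro[OF ring_V_subring ring_V_total]])

lemma V_L_iff: assumes "x : L" "x ~= \<zero>" shows "x : ring_V \<longleftrightarrow> 0 \<le> v x"
proof
 assume x: "x : ring_V"
 show "0 \<le> v x"
 proof (rule ccontr)
  assume n: "\<not> 0 \<le> v x"
  obtain t where t: "t : L" "t ~= \<zero>" "v t = 1" "inv t \<notin> ring_V" using ring_V by auto
  have c: "x : carrier R" "t : carrier R" "inv x : L" "inv t : L" "inv x ~= \<zero>" "inv t ~= \<zero>" using assms t Lc by auto
  hence "v (inv x \<otimes> inv t) = - v x - 1" using v_mult[of "inv x" "inv t"] v_inv assms t by simp
  hence "inv x \<otimes> inv t : ring_V" using ring_V n Lc(6)[OF c(3,4)] by (auto simp: val_ge_def)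
  hence "x \<otimes> (inv x \<otimes> inv t) : ring_V" using x V.Vc(6) by simp
  thus False using field_inv_cancel(1)[of x "inv t"] c assms t by simp
 qed
qed (use ring_V assms in \<open>auto simp: val_ge_def\<close>)

lemma units_L: assumes "x : L" "x ~= \<zero>" shows "x : V.val_units \<longleftrightarrow> v x = 0"
 using V_L_iff[OF assms] V_L_iff[OF L_inv[OF assms]] v_inv[OF assms] assms Lc by (auto simp: V.val_units_def)

text \<open>Every nonzero element has a power with exponent between 1 and \<open>d\<close> that
  equals an element of \<open>L\<close> up to units. The factorial makes the exponent uniform and
  keeps the values of \<open>w\<close> integral.\<close>

definition e where "e = (fact d :: nat)"

lemma e0: "e > 0" by (simp add: e_def)

text \<open>A vanishing combination of the powers of \<open>x\<close> has two terms whose quotient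
  is a unit, which compares a power of \<open>x\<close> with an element of \<open>F\<close>. The
  fields are left general because the lemma is applied to \<open>k1\<close> over \<open>k0\<close>
  as well as over \<open>L\<close>.\<close>

lemma power_in_subfield:
 assumes F: "subfield F R" and dim: "dimension d F E" and x: "x : carrier R" "x ~= \<zero>" "!!i::nat. x [^] i : E"
 shows "\<exists>i a. 0 < i \<and> i \<le> d \<and> a : F \<and> a ~= \<zero> \<and> x [^] (i::nat) \<otimes> inv a : V.val_units"
proof -
 note Fc = subfield_closed[OF F]
 have "\<not> lin_indep F {..d} (\<lambda>i. x [^] i)" using lin_indep_card_le_dimension[OF F dim, of "{..d}" "\<lambda>i. x [^] i"] x by auto
 then obtain c where c: "!!i. i \<le> d ==> c i : F" "(\<Oplus>i\<in>{..d}. c i \<otimes> x [^] i) = \<zero>" "\<exists>i\<le>d. c i ~= \<zero>" unfolding lin_indep_def by auto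
 have px: "x [^] (i::nat) : carrier R" "x [^] (i::nat) ~= \<zero>" for i using x pow_nonzero by auto
 have cc: "c i : carrier R" if "i \<le> d" for i using c(1)[OF that] Fc by auto
 have "\<exists>i\<in>{..d}. \<exists>j\<in>{..d}. i ~= j \<and> c i \<otimes> x [^] i ~= \<zero> \<and> c j \<otimes> x [^] j ~= \<zero> \<and> (c i \<otimes> x [^] i) \<otimes> inv (c j \<otimes> x [^] j) : V.val_units"
  by (rule V.two_dominant) (use c cc px integral_iff in auto)
 then obtain i0 j0 where ij0: "i0 \<le> d" "j0 \<le> d" "i0 ~= j0" "c i0 \<otimes> x [^] i0 ~= \<zero>" "c j0 \<otimes> x [^] j0 ~= \<zero>"
   "(c i0 \<otimes> x [^] i0) \<otimes> inv (c j0 \<otimes> x [^] j0) : V.val_units" by blast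
 have inv': "(c j0 \<otimes> x [^] j0) \<otimes> inv (c i0 \<otimes> x [^] i0) : V.val_units"
  using V.units_inv[OF ij0(6)] field_inv_mult[of "c i0 \<otimes> x [^] i0" "inv (c j0 \<otimes> x [^] j0)"] field_inv_inv[of "c j0 \<otimes> x [^] j0"] ij0 cc px by (simp add: m_comm)
 have "\<exists>i j. i \<le> d \<and> j \<le> d \<and> j < i \<and> c i \<otimes> x [^] i ~= \<zero> \<and> c j \<otimes> x [^] j ~= \<zero> \<and> (c i \<otimes> x [^] i) \<otimes> inv (c j \<otimes> x [^] j) : V.val_units"
  using ij0 inv' by (metis nat_neq_iff)
 then obtain i j where ij: "i \<le> d" "j \<le> d" "j < i" "c i \<otimes> x [^] i ~= \<zero>" "c j \<otimes> x [^] j ~= \<zero>"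
   "(c i \<otimes> x [^] i) \<otimes> inv (c j \<otimes> x [^] j) : V.val_units" by blast
 have cn: "c i ~= \<zero>" "c j ~= \<zero>" using ij px by auto
 define a where "a = c j \<otimes> inv (c i)"
 have aL: "a : F" using c(1) ij cn Fc(9) Fc(6) by (simp add: a_def)
 have a0: "a ~= \<zero>" using cn ij cc integral_iff by (simp add: a_def)
 have "(c i \<otimes> x [^] i) \<otimes> inv (c j \<otimes> x [^] j) = x [^] (i - j) \<otimes> inv a"
 proof -
  have ic: "inv (c i) : carrier R" "inv (c j) : carrier R" "inv (x [^] j) : carrier R" using cc ij cn px by auto
  have "inv a = inv (c j) \<otimes> c i" using field_inv_mult[of "c j" "inv (c i)"] field_inv_inv[of "c i"] cc ij cn by (simp add: a_def)
  moreover have "inv (c j \<otimes> x [^] j) = inv (c j) \<otimes> inv (x [^] j)" using field_inv_mult cc ij cn px by simp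
  moreover have "x [^] i = x [^] (i - j) \<otimes> x [^] j" using ij x by (simp add: nat_pow_mult)
  moreover have "(c i \<otimes> (x [^] (i - j) \<otimes> x [^] j)) \<otimes> (inv (c j) \<otimes> inv (x [^] j)) =
   x [^] (i - j) \<otimes> (inv (c j) \<otimes> c i) \<otimes> (x [^] j \<otimes> inv (x [^] j))" using ic cc[OF ij(1)] px(1)[of "i - j"] px(1)[of j] by algebra
  ultimately show ?thesis using px[of j] px(1)[of "i - j"] ic cc[OF ij(1)] by simp
 qed
 hence "x [^] (i - j) \<otimes> inv a : V.val_units" using ij(6) by simp
 thus ?thesis using aL a0 ij by (intro exI[of _ "i - j"]) auto
qed

lemma pow_inv_comm: "[|a : carrier R; a ~= \<zero>|] ==> (inv a) [^] (i::nat) = inv (a [^] i)"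
proof (induct i)
 case (Suc i)
 thus ?case using field_inv_mult[of "a [^] i" a] pow_nonzero[of a i] by simp
qed simp

lemma e_power_in_L:
 assumes x: "x : carrier R" "x ~= \<zero>"
 shows "\<exists>a\<in>L. a ~= \<zero> \<and> x [^] e \<otimes> inv a : V.val_units"
proof -
 obtain i a where ia: "0 < i" "i \<le> d" "a : L" "a ~= \<zero>" "x [^] (i::nat) \<otimes> inv a : V.val_units"
  using power_in_subfield[OF L dimension_ext x] x by auto
 have "i dvd e" using ia by (simp add: e_def dvd_fact)
 then obtain k where k: "e = i * k" by auto
 have ac: "a : carrier R" "inv a : carrier R" using ia Lc by auto
 have "(x [^] i \<otimes> inv a) [^] k = x [^] e \<otimes> inv (a [^] k)"
  using x ac pow_inv_comm[OF ac(1) ia(4)] by (simp add: nat_pow_distrib nat_pow_pow k)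
 hence "x [^] e \<otimes> inv (a [^] k) : V.val_units" using V.units_pow[OF ia(5), of k] by simp
 thus ?thesis using Lc(10)[OF ia(3)] pow_nonzero[OF ac(1) ia(4)] by auto
qed

text \<open>The extension of \<open>v\<close> scaled by \<open>e\<close>: on \<open>L\<close> it is
  \<open>e\<close> times \<open>v\<close>.\<close>

definition w where "w x = v (SOME a. a : L \<and> a ~= \<zero> \<and> x [^] e \<otimes> inv a : V.val_units)"

lemma w_eq:
 assumes x: "x : carrier R" and a: "a : L" "a ~= \<zero>" "x [^] e \<otimes> inv a : V.val_units"
 shows "w x = v a"
proof -
 define b where "b = (SOME a. a : L \<and> a ~= \<zero> \<and> x [^] e \<otimes> inv a : V.val_units)"
 have b: "b : L" "b ~= \<zero>" "x [^] e \<otimes> inv b : V.val_units"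
  using someI[of "\<lambda>a. a : L \<and> a ~= \<zero> \<and> x [^] e \<otimes> inv a : V.val_units" a] a unfolding b_def by auto
 have c: "a : carrier R" "b : carrier R" "inv a : carrier R" "inv b : carrier R" "x [^] e : carrier R" using a b Lc x by auto
 have xn: "x [^] e ~= \<zero>" using a(3) c by (auto simp: V.val_units_def)
 have "(x [^] e \<otimes> inv a) \<otimes> inv (x [^] e \<otimes> inv b) = b \<otimes> inv a"
 proof -
  have "inv (x [^] e \<otimes> inv b) = inv (x [^] e) \<otimes> b" using field_inv_mult[of "x [^] e" "inv b"] field_inv_inv[of b] c b xn by simp
  moreover have "(x [^] e \<otimes> inv a) \<otimes> (inv (x [^] e) \<otimes> b) = (x [^] e \<otimes> inv (x [^] e)) \<otimes> (b \<otimes> inv a)"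
   using c inv_closed[OF c(5) xn] by algebra
  ultimately show ?thesis using c xn by simp
 qed
 hence "b \<otimes> inv a : V.val_units" using V.units_mult[OF a(3) V.units_inv[OF b(3)]] by simp
 moreover have "b \<otimes> inv a : L" "b \<otimes> inv a ~= \<zero>" using a b Lc integral_iff by auto
 ultimately have "v (b \<otimes> inv a) = 0" using units_L by simp
 hence "v b = v a" using v_mult[of b "inv a"] v_inv[of a] L_inv[of a] a b c by simp
 thus ?thesis by (simp add: w_def b_def)
qed

lemma w_L: "a : L ==> a ~= \<zero> ==> w a = int e * v a" using w_eq[of a "a [^] e"] Lc pow_nonzero[of a e] V.units_one v_pow[of a e] by simp

lemma w_mult:
 assumes x: "x : carrier R" "x ~= \<zero>" and y: "y : carrier R" "y ~= \<zero>"
 shows "w (x \<otimes> y) = w x + w y"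
proof -
 obtain a where a: "a : L" "a ~= \<zero>" "x [^] e \<otimes> inv a : V.val_units" using e_power_in_L[OF x] by auto
 obtain b where b: "b : L" "b ~= \<zero>" "y [^] e \<otimes> inv b : V.val_units" using e_power_in_L[OF y] by auto
 have c: "a : carrier R" "b : carrier R" "inv a : carrier R" "inv b : carrier R" using a b Lc by auto
 have "(x \<otimes> y) [^] e \<otimes> inv (a \<otimes> b) = (x [^] e \<otimes> inv a) \<otimes> (y [^] e \<otimes> inv b)"
 proof -
  have "(x \<otimes> y) [^] e \<otimes> inv (a \<otimes> b) = (x [^] e \<otimes> y [^] e) \<otimes> (inv a \<otimes> inv b)"
   using x y c a b field_inv_mult[of a b] by (simp add: nat_pow_distrib)
  thus ?thesis using c nat_pow_closed[OF x(1), of e] nat_pow_closed[OF y(1), of e] by algebra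
 qed
 hence "(x \<otimes> y) [^] e \<otimes> inv (a \<otimes> b) : V.val_units" using V.units_mult[OF a(3) b(3)] by simp
 hence "w (x \<otimes> y) = v (a \<otimes> b)" using x y a b Lc integral_iff by (intro w_eq) auto
 thus ?thesis using w_eq[OF x(1) a] w_eq[OF y(1) b] v_mult[of a b] a b by simp
qed

lemma w_one: "w \<one> = 0" using w_mult[of \<one> \<one>] by simp

lemma w_inv: "x : carrier R ==> x ~= \<zero> ==> w (inv x) = - w x" using w_mult[of x "inv x"] w_one by simp

lemma w_V: assumes x: "x : carrier R" "x ~= \<zero>" shows "x : ring_V \<longleftrightarrow> 0 \<le> w x"
proof -
 have pos: "0 \<le> w y" if y: "y : carrier R" "y ~= \<zero>" "y : ring_V" for y
 proof -
  obtain a where a: "a : L" "a ~= \<zero>" "y [^] e \<otimes> inv a : V.val_units" using e_power_in_L[OF y(1,2)] by auto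
  have c: "a : carrier R" "inv a : carrier R" "y [^] e : carrier R" "y [^] e ~= \<zero>" using a Lc y pow_nonzero by auto
  have "inv (y [^] e \<otimes> inv a) \<otimes> y [^] e = a"
  using field_inv_mult[of "y [^] e" "inv a"] field_inv_inv[of a] c a m_comm[of _ a] m_assoc by simp
  hence "a : ring_V" using V.units_closed[OF a(3)] V.V_pow[OF y(3), of e] V.Vc(6) by metis
  thus ?thesis using V_L_iff[OF a(1,2)] w_eq[OF y(1) a] by simp
 qed
 show ?thesis
 proof
  assume w0: "0 \<le> w x"
  show "x : ring_V"
  proof (rule ccontr)
   assume n: "x \<notin> ring_V"
   hence i: "inv x : ring_V" using V.V_total[OF x] by simp
   hence "0 \<le> w (inv x)" using x by (intro pos) auto
   hence "w x = 0" using w_inv[OF x] w0 by simp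
   obtain a where a: "a : L" "a ~= \<zero>" "x [^] e \<otimes> inv a : V.val_units" using e_power_in_L[OF x] by auto
   have c: "a : carrier R" "inv a : carrier R" using a Lc by auto
   have "v a = 0" using w_eq[OF x(1) a] \<open>w x = 0\<close> by simp
   hence "a : ring_V" using V_L_iff[OF a(1,2)] by simp
   hence "(x [^] e \<otimes> inv a) \<otimes> a : ring_V" using V.units_closed[OF a(3)] V.Vc(6) by simp
   hence xe: "x [^] e : ring_V" using c a x by (simp add: m_assoc)
   \<comment> \<open>An instance of integral closedness: \<open>x\<close> is \<open>x [^] e\<close>
     times a power of \<open>inv x\<close>, and both factors are in the ring.\<close>
   have "x [^] e = x [^] (e - 1) \<otimes> x" using e0 nat_pow_Suc[of x "e - 1"] by simp
   hence "(inv x) [^] (e - 1) \<otimes> x [^] e = x" using x pow_inv_comm[OF x] field_inv_cancel(2)[of "x [^] (e - 1)" x] pow_nonzero[OF x] by simp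
   moreover have "(inv x) [^] (e - 1) \<otimes> x [^] e : ring_V" using V.V_pow[OF i] xe V.Vc(6) by simp
   ultimately show False using n by simp
  qed
 qed (use pos x in blast)
qed

sublocale W: valuation R w
proof
 show "w (x \<otimes> y) = w x + w y" if "x : carrier R - {\<zero>}" "y : carrier R - {\<zero>}" for x y using that w_mult by auto
 \<comment> \<open>Dividing by the summand of smaller value reduces the inequality to the ring being
   closed under adding 1.\<close>
 have *: "w y \<le> w (x \<oplus> y)" if xy: "x : carrier R" "x ~= \<zero>" "y : carrier R" "y ~= \<zero>" "x \<oplus> y ~= \<zero>" "w y \<le> w x" for x y
 proof -
  have c: "x \<otimes> inv y : carrier R" "x \<otimes> inv y ~= \<zero>" using xy integral_iff by auto
  have "0 \<le> w (x \<otimes> inv y)" using xy w_mult[of x "inv y"] w_inv[of y] by simp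
  hence "x \<otimes> inv y \<oplus> \<one> : ring_V" using w_V[OF c] V.Vc by auto
  moreover have eq: "(x \<otimes> inv y \<oplus> \<one>) \<otimes> y = x \<oplus> y" using xy by (simp add: l_distr m_assoc)
  moreover have n: "x \<otimes> inv y \<oplus> \<one> ~= \<zero>" using eq xy by auto
  ultimately have "0 \<le> w (x \<otimes> inv y \<oplus> \<one>)" using w_V[of "x \<otimes> inv y \<oplus> \<one>"] c by simp
  thus ?thesis using eq w_mult[OF _ n xy(3,4)] c by simp
 qed
 show "min (w x) (w y) \<le> w (x \<oplus> y)" if "x : carrier R - {\<zero>}" "y : carrier R - {\<zero>}" "x \<oplus> y ~= \<zero>" for x y
  using that *[of x y] *[of y x] by (cases "w y \<le> w x") (auto simp: a_comm)
qed

lemma w_root_of_unity: assumes "z : carrier R" "z [^] (i::nat) = \<one>" "i > 0" shows "z ~= \<zero>" "w z = 0"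
proof -
 show z0: "z ~= \<zero>" using assms by (auto simp: nat_pow_zero)
 have "int i * w z = w \<one>" using W.v_pow[OF assms(1) z0, of i] assms by simp
 thus "w z = 0" using assms by simp
qed

text \<open>Equivalence of norms over a complete field, by induction on the number of basis vectors.
  If no constant \<open>D\<close> worked, scaling would give sums of \<open>\<zeta> [^] k\<close>
  and lower terms of arbitrarily large value. By induction their coefficients are Cauchy, and the
  limit is a nontrivial vanishing combination.\<close>

lemma norm_equivalence_aux: "k \<le> d ==> \<exists>D\<ge>0. \<forall>a N. (\<forall>j<k. a j : L) --> W.vge N (\<Oplus>j\<in>{..<k}. a j \<otimes> \<zeta> [^] j) -->
  (\<forall>i<k. a i ~= \<zero> --> N - D \<le> int e * v (a i))"
proof (induct k)
 case 0
 thus ?case by auto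
next
 case (Suc k)
 let ?s = "\<lambda>k a. (\<Oplus>j\<in>{..<k::nat}. a j \<otimes> \<zeta> [^] j)"
 obtain D where D: "D \<ge> 0" "!!a N i. [|\<forall>j<k. a j : L; W.vge N (?s k a); i < k; a i ~= \<zero>|] ==> N - D \<le> int e * v (a i)" using Suc by auto
 have wz: "\<zeta> [^] (j::nat) ~= \<zero>" "w (\<zeta> [^] (j::nat)) = 0" for j
 proof -
  have "(\<zeta> [^] j) [^] q = (\<zeta> [^] q) [^] j" using zeta(1) by (simp add: nat_pow_pow mult.commute)
  hence "(\<zeta> [^] j) [^] q = \<one>" using zeta(2) by simp
  thus "\<zeta> [^] (j::nat) ~= \<zero>" "w (\<zeta> [^] (j::nat)) = 0" using w_root_of_unity[OF zpow _ zeta(3)] by auto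
 qed
 have sc: "?s k a : carrier R" if "!!j. j < k ==> a j : L" for a k using that Lc zpow by simp
 have sS: "?s (Suc k) a = a k \<otimes> \<zeta> [^] k \<oplus> ?s k a" if "!!j. j < Suc k ==> a j : L" for a k using that Lc zpow unfolding lessThan_Suc by simp
 define P where "P = (\<lambda>D a N i. (\<forall>j<Suc k. a j : L) --> W.vge N (?s (Suc k) a) --> i < Suc k --> a i ~= \<zero> --> N - D \<le> int e * v (a i))"
 have "\<exists>D\<ge>0. \<forall>a N i. P D a N i"
 proof (rule ccontr)
  assume no: "\<not> ?thesis"
  have "\<exists>b. (\<forall>j<k. b j : L) \<and> W.vge (int M) (\<zeta> [^] k \<oplus> ?s k b)" for M
  proof -
   obtain a N i where a: "!!j. j < Suc k ==> a j : L" "W.vge N (?s (Suc k) a)" "i < Suc k" "a i ~= \<zero>" "\<not> N - (int M + D) \<le> int e * v (a i)"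
   proof -
    have "int M + D \<ge> 0" using D(1) by simp
    then obtain a N i where "\<not> P (int M + D) a N i" using no by auto
    thus ?thesis using that unfolding P_def by auto
   qed
   have ss: "?s (Suc k) a = a k \<otimes> \<zeta> [^] k \<oplus> ?s k a" by (rule sS) (rule a(1))
   have sck: "?s k a : carrier R" "?s (Suc k) a : carrier R" by (rule sc, use a(1) in simp)+
   have ak: "a k : L" "a k : carrier R" using a(1) Lc by auto
   show ?thesis
   \<comment> \<open>If the top term had value at least \<open>N - M\<close>, the lower part would
     too, and no coefficient could be as bad as \<open>a i\<close>. So the value of the top term is
     smaller, and its coefficient can be divided out.\<close>
   proof (cases "W.vge (N - int M) (a k \<otimes> \<zeta> [^] k)")
    case True
    have "W.vge (N - int M) (?s (Suc k) a \<ominus> a k \<otimes> \<zeta> [^] k)"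
     using True sc[of "Suc k" a] a(1) ak zpow W.vge_mono[OF a(2), of "N - int M"] by (intro W.vge_minus) auto
    moreover have "?s (Suc k) a \<ominus> a k \<otimes> \<zeta> [^] k = ?s k a"
     unfolding ss using sck(1) ak zpow[of k] by (simp add: a_minus_def a_comm[of "a k \<otimes> \<zeta> [^] k"] a_assoc r_neg)
    ultimately have vk: "W.vge (N - int M) (?s k a)" by simp
    show ?thesis
    proof (cases "i < k")
     case True
     thus ?thesis using D(2)[of a "N - int M" i] a vk by auto
    next
     case False
     hence i: "i = k" using a(3) by simp
     have "w (a k \<otimes> \<zeta> [^] k) = int e * v (a k)" using w_mult[of "a k" "\<zeta> [^] k"] w_L[OF ak(1)] wz zpow ak a(4) i by simp
     moreover have "a k \<otimes> \<zeta> [^] k ~= \<zero>" using a(4) i ak wz zpow integral_iff by auto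
     ultimately show ?thesis using True a(5) i D(1) by (auto simp: W.vge_nonzero)
    qed
   next
    case False
    hence akn: "a k ~= \<zero>" using zpow by auto
    hence "a k \<otimes> \<zeta> [^] k ~= \<zero>" "w (a k \<otimes> \<zeta> [^] k) = int e * v (a k)"
     using w_mult[of "a k" "\<zeta> [^] k"] w_L[OF ak(1)] wz zpow ak integral_iff by auto
    hence less: "int e * v (a k) < N - int M" using False by (simp add: W.vge_nonzero)
    have ik: "inv (a k) : L" "inv (a k) : carrier R" "inv (a k) ~= \<zero>" "w (inv (a k)) = - (int e * v (a k))"
     using L_inv[OF ak(1) akn] w_inv[OF ak(2) akn] w_L[OF ak(1) akn] ak akn by auto
    define b where "b = (\<lambda>j. inv (a k) \<otimes> a j)"
    have bL: "b j : L" if "j < k" for j using that a(1) ik(1) Lc(6) by (simp add: b_def)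
    have "?s k b = inv (a k) \<otimes> ?s k a"
    proof -
     have "inv (a k) \<otimes> ?s k a = (\<Oplus>j\<in>{..<k}. inv (a k) \<otimes> (a j \<otimes> \<zeta> [^] j))" using a(1) Lc(2) zpow ik by (intro finsum_rdistr) auto
     also have "\<dots> = ?s k b" using a(1) Lc(2) zpow ik by (intro finsum_cong') (auto simp: b_def m_assoc)
     finally show ?thesis ..
    qed
    hence "\<zeta> [^] k \<oplus> ?s k b = inv (a k) \<otimes> ?s (Suc k) a"
     unfolding ss using ak akn zpow sck(1) field_inv_cancel(2)[of "a k" "\<zeta> [^] k"] by (simp add: r_distr)
    moreover have "W.vge (w (inv (a k)) + N) (inv (a k) \<otimes> ?s (Suc k) a)" by (rule W.vge_mult[OF ik(2) sck(2) W.vge_self a(2)])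
    ultimately have "W.vge (int M) (\<zeta> [^] k \<oplus> ?s k b)" using less ik(4) by (auto elim: W.vge_mono)
    thus ?thesis using bL by auto
   qed
  qed
  then obtain b where b: "!!M j. j < k ==> b M j : L" "!!M. W.vge (int M) (\<zeta> [^] k \<oplus> ?s k (b M))" by metis
  have scb: "?s k (b M) : carrier R" for M using sc b(1) by simp
  have diff: "?s k (\<lambda>j. x j \<ominus> y j) = ?s k x \<ominus> ?s k y" if "!!j. j < k ==> x j : L" "!!j. j < k ==> y j : L" for x y
  proof -
   have "?s k (\<lambda>j. x j \<ominus> y j) \<oplus> ?s k y = (\<Oplus>j\<in>{..<k}. (x j \<ominus> y j) \<otimes> \<zeta> [^] j \<oplus> y j \<otimes> \<zeta> [^] j)" using that Lc zpow by simp
   also have "\<dots> = ?s k x"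
   proof (intro finsum_cong' refl)
    fix j assume "j : {..<k}"
    hence "x j : carrier R" "y j : carrier R" using that Lc by auto
    thus "(x j \<ominus> y j) \<otimes> \<zeta> [^] j \<oplus> y j \<otimes> \<zeta> [^] j = x j \<otimes> \<zeta> [^] j" using zpow[of j] by algebra
   qed (use that Lc zpow in auto)
   finally have "?s k x \<ominus> ?s k y = (?s k (\<lambda>j. x j \<ominus> y j) \<oplus> ?s k y) \<ominus> ?s k y" by simp
   thus ?thesis using sc[of k y] sc[of k "\<lambda>j. x j \<ominus> y j"] that Lc(8) by (simp add: a_minus_def a_assoc r_neg)
  qed
  have cauchy: "val_ge R v n (b i j \<ominus> b i' j)" if j: "j < k" and i: "i \<ge> T" "i' \<ge> T" and T: "int T - D \<ge> int e * n" for n i i' j T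
  proof (cases "b i j \<ominus> b i' j = \<zero>")
   case False
   have "W.vge (int T) ((\<zeta> [^] k \<oplus> ?s k (b i)) \<ominus> (\<zeta> [^] k \<oplus> ?s k (b i')))"
    using W.vge_mono[OF b(2)[of i], of "int T"] W.vge_mono[OF b(2)[of i'], of "int T"] i scb zpow by (intro W.vge_minus) auto
   moreover have "(\<zeta> [^] k \<oplus> ?s k (b i)) \<ominus> (\<zeta> [^] k \<oplus> ?s k (b i')) = ?s k (b i) \<ominus> ?s k (b i')" by (rule add_minus_add[OF zpow scb scb])
   ultimately have "W.vge (int T) (?s k (\<lambda>j. b i j \<ominus> b i' j))" using diff[of "b i" "b i'"] b(1) by simp
   hence "int T - D \<le> int e * v (b i j \<ominus> b i' j)" using D(2)[of "\<lambda>j. b i j \<ominus> b i' j" "int T" j] b(1) Lc(8) j False by auto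
   hence "int e * n \<le> int e * v (b i j \<ominus> b i' j)" using T by simp
   hence "n \<le> v (b i j \<ominus> b i' j)" using e0 by simp
   thus ?thesis by (simp add: val_ge_def)
  qed (simp add: val_ge_def)
  have "\<exists>l\<in>L. \<forall>n. \<exists>N. \<forall>i\<ge>N. val_ge R v n (b i j \<ominus> l)" if j: "j < k" for j
  proof (rule complete)
   show "b i j : L" for i using b(1) j by simp
   show "\<exists>N. \<forall>i\<ge>N. \<forall>i'\<ge>N. val_ge R v n (b i j \<ominus> b i' j)" for n
   proof (intro exI allI impI)
    fix i i' assume "i \<ge> nat (int e * n + D)" "i' \<ge> nat (int e * n + D)"
    thus "val_ge R v n (b i j \<ominus> b i' j)" by (rule cauchy[OF j]) auto
   qed
  qed
  then obtain l where l: "!!j. j < k ==> l j : L" "!!j n. j < k ==> \<exists>N. \<forall>i\<ge>N. val_ge R v n (b i j \<ominus> l j)" by metis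
  define x where "x = \<zeta> [^] k \<oplus> ?s k l"
  \<comment> \<open>All \<open>l j\<close> are approximated at once by \<open>b M j\<close>, with
    \<open>M\<close> beyond the sum of the finitely many thresholds.\<close>
  have xT: "W.vge (int T) x" for T
  proof -
   have "\<forall>j. \<exists>N. j < k --> (\<forall>i\<ge>N. val_ge R v (int T) (b i j \<ominus> l j))" using l(2) by simp
   then obtain N where N: "!!j i. j < k ==> i \<ge> N j ==> val_ge R v (int T) (b i j \<ominus> l j)" by metis
   define M where "M = T + (\<Sum>j<k. N j)"
   have MN: "M \<ge> N j" if "j < k" for j using member_le_sum[of j "{..<k}" N] that by (simp add: M_def)
   have "W.vge (int T) (?s k (\<lambda>j. b M j \<ominus> l j))"
   proof (rule W.vge_finsum)
    fix j assume j: "j : {..<k}"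
    have dL: "b M j \<ominus> l j : L" using b(1) l(1) j Lc(8) by simp
    show "(b M j \<ominus> l j) \<otimes> \<zeta> [^] j : carrier R" using dL Lc zpow by simp
    show "W.vge (int T) ((b M j \<ominus> l j) \<otimes> \<zeta> [^] j)"
    proof (cases "b M j \<ominus> l j = \<zero>")
     case False
     have "int T \<le> v (b M j \<ominus> l j)" using N[of j M] MN[of j] j False by (simp add: val_ge_def)
     moreover have "v (b M j \<ominus> l j) * 1 \<le> v (b M j \<ominus> l j) * int e" using e0 calculation by (intro mult_left_mono) auto
     ultimately have "int T \<le> w (b M j \<ominus> l j)" using w_L[OF dL False] by (simp add: mult.commute)
     thus ?thesis using w_mult[of "b M j \<ominus> l j" "\<zeta> [^] j"] dL False Lc(2) wz zpow integral_iff by (simp add: W.vge_nonzero)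
    qed (use zpow in simp)
   qed simp
   moreover have "W.vge (int T) (\<zeta> [^] k \<oplus> ?s k (b M))" by (rule W.vge_mono[OF b(2)[of M]]) (simp add: M_def sum_nonneg)
   ultimately have "W.vge (int T) ((\<zeta> [^] k \<oplus> ?s k (b M)) \<ominus> ?s k (\<lambda>j. b M j \<ominus> l j))"
    using scb[of M] zpow sc[of k "\<lambda>j. b M j \<ominus> l j"] b(1) l(1) Lc(8) by (intro W.vge_minus) auto
   moreover have "(\<zeta> [^] k \<oplus> ?s k (b M)) \<ominus> (?s k (b M) \<ominus> ?s k l) = x" unfolding x_def by (rule add_minus_minus[OF zpow scb sc]) (rule l(1))
   ultimately show ?thesis using diff[of "b M" l] b(1) l(1) by simp
  qed
  have x0: "x = \<zero>"
  proof (rule ccontr)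
   assume "x ~= \<zero>"
   hence "int (nat (w x) + 1) \<le> w x" using xT[of "nat (w x) + 1"] by (simp add: W.vge_nonzero)
   thus False by linarith
  qed
  define c where "c = (\<lambda>j. if j < k then l j else if j = k then \<one> else \<zero>)"
  have cL: "c j : L" for j using l(1) Lc by (simp add: c_def)
  have "(\<Oplus>j\<in>{..<d}. c j \<otimes> \<zeta> [^] j) = (\<Oplus>j\<in>{..<Suc k}. c j \<otimes> \<zeta> [^] j)" using Suc(2) cL Lc(2) zpow
   by (intro add.finprod_mono_neutral_cong_left[symmetric, where g = "\<lambda>j. c j \<otimes> \<zeta> [^] j"]) (auto simp: c_def)
  also have "\<dots> = c k \<otimes> \<zeta> [^] k \<oplus> ?s k c" by (rule sS) (rule cL)
  also have "?s k c = ?s k l" using l(1) Lc(2) zpow by (intro finsum_cong') (auto simp: c_def)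
  also have "c k \<otimes> \<zeta> [^] k \<oplus> ?s k l = x" using zpow by (simp add: c_def x_def)
  finally have "(\<Oplus>j\<in>{..<d}. c j \<otimes> \<zeta> [^] j) = \<zero>" using x0 by simp
  hence "c k = \<zero>" using indep cL Suc(2) unfolding lin_indep_def by auto
  thus False by (simp add: c_def)
 qed
 then obtain D where "D \<ge> 0" "!!a N i. P D a N i" by blast
 thus ?case unfolding P_def by auto
qed

text \<open>An automorphism over \<open>L\<close> keeps the coordinates and maps the basis of roots
  of unity to elements of value 0. By equivalence of norms, a high power of an element of positive
  value has coordinates of positive value, so positivity is preserved. Hence units go to units, and
  comparison with \<open>L\<close> gives all other values.\<close>

lemma w_automorphism:
 assumes g: "g : ring_hom R R" "!!a. a : L ==> g a = a" and h: "h : ring_hom R R" "!!a. a : L ==> h a = a"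
  and hg: "!!x. x : carrier R ==> h (g x) = x" and gh: "!!x. x : carrier R ==> g (h x) = x" and x: "x : carrier R" "x ~= \<zero>"
 shows "w (g x) = w x"
proof -
 obtain D where D: "D \<ge> 0" "!!a N i. [|\<forall>j<d. a j : L; W.vge N (\<Oplus>j\<in>{..<d}. a j \<otimes> \<zeta> [^] j); i < d; a i ~= \<zero>|] ==> N - D \<le> int e * v (a i)"
  using norm_equivalence_aux[of d] by auto
 have pow: "f (y [^] (i::nat)) = f y [^] i" if f: "f : ring_hom R R" and y: "y : carrier R" for f y i
  using ring_hom_one[OF f] ring_hom_mult[OF f] y by (induct i) auto
 have nz: "f y ~= \<zero>" if f: "f : ring_hom R R" and f': "!!x. x : carrier R ==> f' (f x) = x"
   "!!a. a : L ==> f' a = a" and y: "y : carrier R" "y ~= \<zero>" for f f' y using f'(1)[OF y(1)] f'(2)[OF Lc(3)] y by auto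
 have pos: "0 < w (f y)" if f: "f : ring_hom R R" "!!a. a : L ==> f a = a" "f y ~= \<zero>" and y: "y : carrier R" "y ~= \<zero>" "0 < w y" for f y
 proof -
  have fc: "f z : carrier R" if "z : carrier R" for z using ring_hom_closed[OF f(1)] that .
  \<comment> \<open>Exceeds the loss \<open>D\<close>, so that the estimate \<open>int N - D\<close>
    stays positive.\<close>
  define N where "N = nat D + 1"
  have yN: "y [^] N : carrier R" using y by simp
  obtain a where a: "!!j. j < d ==> a j : L" "y [^] N = (\<Oplus>j\<in>{..<d}. a j \<otimes> \<zeta> [^] j)" using spans[OF yN] by auto
  have ac: "a j : carrier R" if "j < d" for j using a(1) Lc that by auto
  have "w (y [^] N) = int N * w y" by (rule W.v_pow) (use y in auto)
  moreover have "int N * 1 \<le> int N * w y" using y(3) by (intro mult_left_mono) auto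
  ultimately have "W.vge (int N) (y [^] N)" by (simp add: val_ge_def)
  hence av: "int N - D \<le> int e * v (a j)" if "j < d" "a j ~= \<zero>" for j using D(2)[of a] a that by auto
  have fz: "f \<zeta> : carrier R" using fc zeta by simp
  have fzq: "(f \<zeta> [^] (j::nat)) [^] q = \<one>" for j
  proof -
   have "(f \<zeta> [^] j) [^] q = (f \<zeta> [^] q) [^] j" using fz by (simp add: nat_pow_pow mult.commute)
   also have "f \<zeta> [^] q = \<one>" using pow[OF f(1) zeta(1), of q] zeta(2) ring_hom_one[OF f(1)] by simp
   finally show ?thesis by simp
  qed
  have fz0: "f \<zeta> [^] (j::nat) ~= \<zero>" "w (f \<zeta> [^] (j::nat)) = 0" "f \<zeta> [^] (j::nat) : carrier R" for j
   using w_root_of_unity[OF _ fzq zeta(3)] fz by auto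
  have "f (y [^] N) = (\<Oplus>j\<in>{..<d}. f (a j \<otimes> \<zeta> [^] j))"
  proof -
   interpret H: ring_hom_ring R R f using f(1) ring_axioms by (simp add: ring_hom_ring_def ring_hom_ring_axioms_def)
   show ?thesis unfolding a(2) using ac zpow by (simp add: comp_def)
  qed
  also have "\<dots> = (\<Oplus>j\<in>{..<d}. a j \<otimes> f \<zeta> [^] j)"
   using ac zpow f(2) a(1) ring_hom_mult[OF f(1)] pow[OF f(1) zeta(1)] fz0(3) by (intro finsum_cong') auto
  finally have fN: "f (y [^] N) = (\<Oplus>j\<in>{..<d}. a j \<otimes> f \<zeta> [^] j)" .
  have "W.vge (int N - D) (f (y [^] N))" unfolding fN
  proof (rule W.vge_finsum)
   fix j assume j: "j : {..<d}"
   show "W.vge (int N - D) (a j \<otimes> f \<zeta> [^] j)"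
   proof (cases "a j = \<zero>")
    case False
    hence "w (a j \<otimes> f \<zeta> [^] j) = int e * v (a j)" using w_mult[of "a j" "f \<zeta> [^] j"] w_L[OF a(1)] fz0 ac j by simp
    thus ?thesis using av[of j] j False by (simp add: val_ge_def)
   qed (use fz0 in simp)
  qed (use ac fz0 in auto)
  moreover have "f (y [^] N) = f y [^] N" by (rule pow[OF f(1) y(1)])
  moreover have "f y [^] N ~= \<zero>" "w (f y [^] N) = int N * w (f y)" using W.v_pow pow_nonzero fc[OF y(1)] f(3) by auto
  ultimately have "int N - D \<le> int N * w (f y)" by (simp add: W.vge_nonzero)
  moreover have "int N - D > 0" by (simp add: N_def)
  ultimately have "0 < int N * w (f y)" by linarith
  thus ?thesis by (simp add: zero_less_mult_iff)
 qed
 have gc: "g y : carrier R" if "y : carrier R" for y using ring_hom_closed[OF g(1) that] .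
 have zero: "w (g u) = 0" if u: "u : carrier R" "u ~= \<zero>" "w u = 0" for u
 proof (rule ccontr)
  assume n: "w (g u) ~= 0"
  have gu: "g u ~= \<zero>" by (rule nz[OF g(1) hg h(2) u(1,2)])
  have hgi: "h (inv (g u)) = inv u"
  proof -
   have "h (g u \<otimes> inv (g u)) = h (g u) \<otimes> h (inv (g u))" by (rule ring_hom_mult[OF h(1)]) (use gc[OF u(1)] gu in auto)
   hence "h (g u \<otimes> inv (g u)) = u \<otimes> h (inv (g u))" unfolding hg[OF u(1)] .
   hence "u \<otimes> h (inv (g u)) = \<one>" using gc[OF u(1)] gu ring_hom_one[OF h(1)] by simp
   thus ?thesis using comm_inv_char[of u "h (inv (g u))"] u ring_hom_closed[OF h(1)] gc[OF u(1)] gu by simp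
  qed
  show False
  proof (cases "0 < w (g u)")
   case True
   thus False using pos[OF h, of "g u"] hg[OF u(1)] u gu gc by simp
  next
   case False
   hence "0 < w (inv (g u))" using n w_inv[OF gc[OF u(1)] gu] by simp
   hence "0 < w (h (inv (g u)))" using hgi u gu gc[OF u(1)] by (intro pos[OF h]) auto
   thus False using hgi w_inv[OF u(1,2)] u(3) by simp
  qed
 qed
 obtain a where a: "a : L" "a ~= \<zero>" "x [^] e \<otimes> inv a : V.val_units" using e_power_in_L[OF x] by auto
 have ac: "a : carrier R" "inv a : carrier R" "inv a : L" "inv a ~= \<zero>" using a Lc by auto
 \<comment> \<open>The power \<open>x [^] e\<close> is the unit \<open>?u\<close> times an element
   of \<open>L\<close>, which \<open>g\<close> fixes.\<close>
 let ?u = "x [^] e \<otimes> inv a"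
 have u: "?u : carrier R" "?u ~= \<zero>" "w ?u = 0"
 using V.units_closed[OF a(3)] x pow_nonzero[OF x] ac w_mult W.v_pow[OF x, of e] w_eq[OF x(1) a] w_inv[OF ac(1) a(2)] w_L[OF a(1,2)] by auto
 have "g ?u = g x [^] e \<otimes> inv a" using ring_hom_mult[OF g(1)] pow[OF g(1) x(1)] g(2)[OF ac(3)] x ac by simp
 hence gu: "w (g x [^] e \<otimes> inv a) = 0" using zero[OF u] by simp
 have gx: "g x : carrier R" "g x ~= \<zero>" using gc x nz[OF g(1) hg h(2) x] by auto
 have c: "g x [^] e \<otimes> inv a : carrier R" "g x [^] e \<otimes> inv a ~= \<zero>" using gx ac pow_nonzero[OF gx] integral_iff by auto
 have "g x [^] e \<otimes> inv a : V.val_units" using w_V[OF c] w_V[of "inv (g x [^] e \<otimes> inv a)"] w_inv[OF c] gu c by (simp add: V.val_units_def)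
 thus ?thesis using w_eq[OF gx(1) a(1,2)] w_eq[OF x(1) a] by simp
qed

end

section \<open>Descent from a cyclotomic extension\<close>

lemma (in field) order_of_root:
 fixes m :: nat
 assumes x: "x : carrier R" "x [^] m = \<one>" and m: "m > 0"
 shows "\<exists>r. r dvd m \<and> (\<forall>i::nat. x [^] i = \<one> \<longleftrightarrow> r dvd i)"
proof -
 define r where "r = (LEAST r. r > 0 \<and> x [^] (r::nat) = \<one>)"
 have r: "r > 0" "x [^] r = \<one>" using LeastI[of "\<lambda>r. r > 0 \<and> x [^] (r::nat) = \<one>" m] x m by (auto simp: r_def)
 have min: "\<not> (i > 0 \<and> x [^] i = \<one>)" if "i < r" for i :: nat
  using not_less_Least[of i "\<lambda>r. r > 0 \<and> x [^] (r::nat) = \<one>"] that by (auto simp: r_def)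
 have "x [^] i = \<one> \<longleftrightarrow> r dvd i" for i :: nat
 proof
  assume i: "x [^] i = \<one>"
  have "x [^] (r * (i div r) + i mod r) = (x [^] r) [^] (i div r) \<otimes> x [^] (i mod r)" using x by (simp add: nat_pow_mult nat_pow_pow)
  hence "x [^] (i mod r) = \<one>" using i r x by simp
  hence "i mod r = 0" using min[of "i mod r"] r by auto
  thus "r dvd i" by auto
 qed (use r x pow_dvd_eq_one in blast)
 thus ?thesis using x by auto
qed

text \<open>Take an element of largest order \<open>r\<close>. Orders are powers of
  \<open>p\<close>, hence comparable, so every other root has order dividing \<open>r\<close> and is
  among the \<open>r\<close> zeros of \<open>X ^ r - 1\<close>.\<close>

lemma (in field) prime_power_roots_of_unity:
 fixes p \<mu> :: nat
 assumes K: "subfield K R" and p: "prime p"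
 shows "\<exists>\<zeta>\<in>K. \<exists>r. r dvd p ^ \<mu> \<and> (\<forall>i::nat. \<zeta> [^] i = \<one> \<longleftrightarrow> r dvd i) \<and> (\<forall>x\<in>K. x [^] (p ^ \<mu>) = \<one> --> (\<exists>i::nat. x = \<zeta> [^] i))"
proof -
 note Kc = subfield_closed[OF K]
 let ?m = "p ^ \<mu>"
 have m0: "?m > 0" using p prime_gt_0_nat by simp
 define P where "P = (\<lambda>r. r dvd ?m \<and> (\<exists>x\<in>K. \<forall>i::nat. x [^] i = \<one> \<longleftrightarrow> r dvd i))"
 have P1: "P 1" unfolding P_def using Kc by (intro conjI bexI[of _ \<one>]) auto
 have bd: "r < Suc ?m" if "P r" for r using that m0 dvd_imp_le by (auto simp: P_def less_Suc_eq_le)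
 obtain r where r: "P r" "!!r'. P r' ==> r' \<le> r" using ex_has_greatest_nat[of P 1 "\<lambda>r. r" "Suc ?m"] P1 bd by auto
 obtain z where z: "z : K" "!!i::nat. z [^] i = \<one> \<longleftrightarrow> r dvd i" and rm: "r dvd ?m" using r(1) by (auto simp: P_def)
 have r0: "r > 0" using rm m0 by (auto intro: gr0I)
 have z0: "z : carrier R" "z ~= \<zero>" using z(1) Kc(2) z(2)[of r] r0 nat_pow_zero[of r] by auto
 have "\<exists>i::nat. x = z [^] i" if x: "x : K" "x [^] ?m = \<one>" for x
 proof -
  have xc: "x : carrier R" using x Kc by auto
  obtain r' where r': "r' dvd ?m" "!!i::nat. x [^] i = \<one> \<longleftrightarrow> r' dvd i" using order_of_root[OF xc x(2) m0] by auto
  hence "P r'" using x(1) by (auto simp: P_def)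
  hence le: "r' \<le> r" using r(2) by simp
  obtain i where i: "r = p ^ i" using rm divides_primepow_nat[OF p, of r \<mu>] by auto
  obtain j where j: "r' = p ^ j" using r'(1) divides_primepow_nat[OF p, of r' \<mu>] by auto
  have "r' dvd r" using le i j p by (auto simp: le_imp_power_dvd prime_nat_iff)
  hence "x [^] r = \<one>" using r'(2) by simp
  thus ?thesis by (rule pow_eq_one_imp[OF z0 z(2) r0 xc])
 qed
 thus ?thesis using z rm by auto
qed

text \<open>\<open>C\<close> contains the exponents of the conjugates of \<open>\<zeta>\<close> over
  the fixed field \<open>k0\<close> of \<open>G\<close>, and \<open>kk i\<close> the coordinates of
  \<open>\<zeta> [^] i\<close>. The same coordinates serve all conjugates, which makes lifts
  multiplicative. The bounds on \<open>d\<close> say that \<open>\<zeta>\<close> is not in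
  \<open>k0\<close> and that the degree is prime to \<open>p\<close>.\<close>

locale cyclotomic = complete_extension R L v d \<zeta> p + A: ab_ram_aut "R\<lparr>carrier := L\<rparr>" G v
 for R :: "('a, 'b) ring_scheme" (structure) and L v d \<zeta> p and G :: "('a \<Rightarrow> 'a) set" +
 fixes k :: nat and C :: "nat set" and kk :: "nat \<Rightarrow> nat \<Rightarrow> 'a"
 assumes p: "prime p" and card_G: "card G = p ^ k" and k: "k > 0" and zeta_ord: "!!i::nat. \<zeta> [^] i = \<one> \<longleftrightarrow> p dvd i" and d: "1 < d" "d < p"
  and C: "C \<subseteq> {..<p}" "card C = d" "1 : C" and kk: "!!i j. kk i j : A.K"
  and rel: "!!c i. c : C ==> \<zeta> [^] (c * i) = (\<Oplus>j\<in>{..<d}. kk i j \<otimes> \<zeta> [^] (c * j))" and vp: "val_ge R v 1 ([p] \<cdot> \<one>)"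
begin

abbreviation k0 where "k0 \<equiv> A.K"

lemma k0_L: "x : k0 ==> x : L" by (simp add: fixed_field_def)

lemma k0_subfield: "subfield k0 R"
proof -
 have sub: "k0 \<subseteq> L" using k0_L by auto
 have "field (R\<lparr>carrier := L, carrier := k0\<rparr>)" using A.subfield_iff(2)[OF A.fixed_subfield] by simp
 hence "field (R\<lparr>carrier := k0\<rparr>)" by simp
 moreover have "k0 \<subseteq> carrier R" using sub Lc by auto
 ultimately show ?thesis using subfield_iff(1) by simp
qed

lemmas k0c = subfield_closed[OF k0_subfield]

lemma p1: "p > 0" "p > 1" using p prime_gt_0_nat prime_gt_1_nat by auto

lemma zeta_powers: "\<zeta> [^] i = \<zeta> [^] j \<longleftrightarrow> [i = j] (mod p)"
proof -
 have "\<zeta> ~= \<zero>" using zeta(2) p1 by (auto simp: nat_pow_zero)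
 thus ?thesis using pow_eq_pow_cong[OF zeta(1) _ zeta_ord] by simp
qed

lemma G_closed: "[|\<rho> : G; a : L|] ==> \<rho> a : L" using A.aut_closed by simp

definition co :: "'a \<Rightarrow> nat \<Rightarrow> 'a" where "co x = (SOME a. (\<forall>j<d. a j : L) \<and> x = (\<Oplus>j\<in>{..<d}. a j \<otimes> \<zeta> [^] j))"

lemma co: "x : carrier R ==> j < d ==> co x j : L" "x : carrier R ==> x = (\<Oplus>j\<in>{..<d}. co x j \<otimes> \<zeta> [^] j)"
 using someI_ex[OF spans[of x]] by (auto simp: co_def)

lemma co_unique:
 assumes a: "!!j. j < d ==> a j : L" and x: "x = (\<Oplus>j\<in>{..<d}. a j \<otimes> \<zeta> [^] j)" and j: "j < d"
 shows "co x j = a j"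
proof -
 have xc: "x : carrier R" unfolding x using a Lc zpow by simp
 note cx = co[OF xc]
 have "(\<Oplus>j\<in>{..<d}. (co x j \<ominus> a j) \<otimes> \<zeta> [^] j) \<oplus> x = x"
 proof -
  have "(\<Oplus>j\<in>{..<d}. (co x j \<ominus> a j) \<otimes> \<zeta> [^] j) \<oplus> x = (\<Oplus>j\<in>{..<d}. (co x j \<ominus> a j) \<otimes> \<zeta> [^] j \<oplus> a j \<otimes> \<zeta> [^] j)" using a cx(1) Lc zpow x by simp
  also have "\<dots> = (\<Oplus>j\<in>{..<d}. co x j \<otimes> \<zeta> [^] j)"
  proof (intro finsum_cong' refl)
   fix j assume "j : {..<d}"
   hence "co x j : carrier R" "a j : carrier R" using a cx(1) Lc by auto
   thus "(co x j \<ominus> a j) \<otimes> \<zeta> [^] j \<oplus> a j \<otimes> \<zeta> [^] j = co x j \<otimes> \<zeta> [^] j" using zpow[of j] by algebra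
  qed (use cx(1) Lc zpow in auto)
  finally show ?thesis using cx(2) by simp
 qed
 moreover have "(\<Oplus>j\<in>{..<d}. (co x j \<ominus> a j) \<otimes> \<zeta> [^] j) : carrier R" using a cx(1) Lc zpow by simp
 ultimately have "(\<Oplus>j\<in>{..<d}. (co x j \<ominus> a j) \<otimes> \<zeta> [^] j) = \<zero>" using xc by simp
 hence "co x j \<ominus> a j = \<zero>" using indep[unfolded lin_indep_def, rule_format, of "\<lambda>j. co x j \<ominus> a j" j] a cx(1) Lc(8) j by auto
 thus ?thesis using a cx(1) j Lc by auto
qed

lemma co_add: assumes "x : carrier R" "y : carrier R" "j < d" shows "co (x \<oplus> y) j = co x j \<oplus> co y j"
proof (rule co_unique)
 have "x \<oplus> y = (\<Oplus>j\<in>{..<d}. co x j \<otimes> \<zeta> [^] j \<oplus> co y j \<otimes> \<zeta> [^] j)" using co[OF assms(1)] co[OF assms(2)] Lc(2) zpow by simp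
 also have "\<dots> = (\<Oplus>j\<in>{..<d}. (co x j \<oplus> co y j) \<otimes> \<zeta> [^] j)"
  using co(1)[OF assms(1)] co(1)[OF assms(2)] Lc zpow by (intro finsum_cong') (auto simp: l_distr)
 finally show "x \<oplus> y = (\<Oplus>j\<in>{..<d}. (co x j \<oplus> co y j) \<otimes> \<zeta> [^] j)" .
qed (use co(1)[OF assms(1)] co(1)[OF assms(2)] Lc assms in auto)

lemma co_smult: assumes "a : L" "x : carrier R" "j < d" shows "co (a \<otimes> x) j = a \<otimes> co x j"
proof (rule co_unique)
 have ac: "a : carrier R" using assms Lc by auto
 have "a \<otimes> x = (\<Oplus>j\<in>{..<d}. a \<otimes> (co x j \<otimes> \<zeta> [^] j))"
  using co(1)[OF assms(2)] Lc(2) zpow ac by (subst co(2)[OF assms(2)], intro finsum_rdistr) auto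
 also have "\<dots> = (\<Oplus>j\<in>{..<d}. (a \<otimes> co x j) \<otimes> \<zeta> [^] j)" using co(1)[OF assms(2)] Lc(2) zpow ac by (intro finsum_cong') (auto simp: m_assoc)
 finally show "a \<otimes> x = (\<Oplus>j\<in>{..<d}. (a \<otimes> co x j) \<otimes> \<zeta> [^] j)" .
qed (use co(1)[OF assms(2)] Lc assms in auto)

lemma co_zeta: "j < d ==> co (\<zeta> [^] i) j = kk i j" by (rule co_unique) (use rel[OF C(3), of i] kk k0_L in auto)

text \<open>Automorphisms of \<open>L(\<zeta>)\<close> over \<open>k0\<close>, described by their
  action on \<open>L\<close> and on \<open>\<zeta>\<close>; as both kinds of action commute, the
  group is abelian.\<close>

definition \<Gamma> :: "('a \<Rightarrow> 'a) set" where "\<Gamma> = {g : ring_hom R R \<inter> extensional (carrier R). (\<exists>\<rho>\<in>G. \<forall>a\<in>L. g a = \<rho> a) \<and> (\<exists>i::nat. g \<zeta> = \<zeta> [^] i)}"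

lemma hom_pow: "g : ring_hom R R ==> x : carrier R ==> g (x [^] (i::nat)) = g x [^] i" by (induct i) (auto simp: ring_hom_one ring_hom_mult)

text \<open>Reduces an additive claim to monomials. The set \<open>T\<close> records where the
  coordinates lie: in \<open>L\<close>, in \<open>k0\<close> or in a submodule.\<close>

lemma co_induct:
 assumes x: "x : carrier R" "!!j. j < d ==> co x j : T" and P: "P \<zero>" "!!a i::nat. [|a : T; a : L|] ==> P (a \<otimes> \<zeta> [^] i)"
  "!!x y. [|x : carrier R; y : carrier R; P x; P y|] ==> P (x \<oplus> y)"
 shows "P x"
proof -
 have c: "co x j \<otimes> \<zeta> [^] j : carrier R" if "j < d" for j using co(1)[OF x(1) that] Lc(2) zpow by simp
 have "k \<le> d ==> P (\<Oplus>j\<in>{..<k}. co x j \<otimes> \<zeta> [^] j)" for k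
 proof (induct k)
  case (Suc k)
  have s: "(\<Oplus>j\<in>{..<Suc k}. co x j \<otimes> \<zeta> [^] j) = co x k \<otimes> \<zeta> [^] k \<oplus> (\<Oplus>j\<in>{..<k}. co x j \<otimes> \<zeta> [^] j)"
   unfolding lessThan_Suc using c Suc(2) by (intro finsum_insert) auto
  have "(\<Oplus>j\<in>{..<k}. co x j \<otimes> \<zeta> [^] j) : carrier R" using c Suc(2) by (intro finsum_closed) auto
  thus ?case unfolding s using P(2,3) c Suc x(2) co(1)[OF x(1)] by simp
 qed (use P(1) in simp)
 thus ?thesis using co(2)[OF x(1)] by (metis order_refl)
qed

lemma \<Gamma>_eqI:
 assumes "g : \<Gamma>" "h : \<Gamma>" "!!a. a : L ==> g a = h a" "g \<zeta> = h \<zeta>"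
 shows "g = h"
proof -
 have r: "g : ring_hom R R" "h : ring_hom R R" using assms by (auto simp: \<Gamma>_def)
 have "g x = h x" if x: "x : carrier R" for x
 proof (rule co_induct[where T = L, OF x])
  show "g \<zero> = h \<zero>" using assms(3) Lc by simp
  show "g (a \<otimes> \<zeta> [^] i) = h (a \<otimes> \<zeta> [^] i)" if "a : L" for a and i :: nat
   using that assms(3,4) r Lc(2) zeta(1) by (simp add: ring_hom_mult hom_pow)
 qed (use r co(1)[OF x] in \<open>auto simp: ring_hom_add\<close>)
 thus ?thesis using assms(1,2) by (auto simp: \<Gamma>_def intro: extensionalityI)
qed

lemma \<Gamma>_finite: "finite \<Gamma>"
proof -
 let ?f = "\<lambda>g. (restrict g L, g \<zeta>)"
 have "inj_on ?f \<Gamma>"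
 proof (rule inj_onI)
  fix g h assume gh: "g : \<Gamma>" "h : \<Gamma>" "?f g = ?f h"
  hence "restrict g L a = restrict h L a" for a by simp
  hence "g a = h a" if "a : L" for a using that by (metis restrict_apply')
  thus "g = h" using gh by (intro \<Gamma>_eqI) auto
 qed
 moreover have "?f ` \<Gamma> \<subseteq> G \<times> (\<lambda>i. \<zeta> [^] i) ` {..<p}"
 proof
  fix y assume "y : ?f ` \<Gamma>"
  then obtain g where g: "g : \<Gamma>" "y = ?f g" by blast
  then obtain \<rho> i where s: "\<rho> : G" "!!a. a : L ==> g a = \<rho> a" "g \<zeta> = \<zeta> [^] (i::nat)" by (auto simp: \<Gamma>_def)
  have "restrict g L = \<rho>" using s A.aut_ext[OF s(1)] by (auto simp: extensional_def)
  moreover have "\<zeta> [^] i = \<zeta> [^] (i mod p)" using zeta_powers by simp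
  ultimately show "y : G \<times> (\<lambda>i. \<zeta> [^] i) ` {..<p}" using g(2) s p1 by simp
 qed
 ultimately show ?thesis using A.finite_G by (meson finite_SigmaI finite_imageI finite_imageD finite_lessThan finite_subset)
qed

sublocale \<Gamma>: ab_aut_group R \<Gamma>
proof unfold_locales
 show "finite \<Gamma>" by (rule \<Gamma>_finite)
 show "g : ring_hom R R" "g : extensional (carrier R)" if "g : \<Gamma>" for g using that by (auto simp: \<Gamma>_def)
 show "(\<lambda>x\<in>carrier R. x) : \<Gamma>"
 proof -
  have "(\<lambda>x\<in>carrier R. x) : ring_hom R R" by (intro ring_hom_memI) auto
  moreover have "\<exists>\<rho>\<in>G. \<forall>a\<in>L. (\<lambda>x\<in>carrier R. x) a = \<rho> a" using A.aut_id Lc(2) by (intro bexI[of _ "\<lambda>x\<in>L. x"]) auto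
  moreover have "\<exists>i::nat. (\<lambda>x\<in>carrier R. x) \<zeta> = \<zeta> [^] i" using zeta(1) by (intro exI[of _ 1]) simp
  ultimately show ?thesis by (simp add: \<Gamma>_def)
 qed
 fix g h assume g: "g : \<Gamma>" and h: "h : \<Gamma>"
 obtain \<rho> i where s: "\<rho> : G" "!!a. a : L ==> g a = \<rho> a" "g \<zeta> = \<zeta> [^] (i::nat)" using g by (auto simp: \<Gamma>_def)
 obtain \<tau> j where t: "\<tau> : G" "!!a. a : L ==> h a = \<tau> a" "h \<zeta> = \<zeta> [^] (j::nat)" using h by (auto simp: \<Gamma>_def)
 have gr: "g : ring_hom R R" "h : ring_hom R R" using g h by (auto simp: \<Gamma>_def)
 have comp: "compose (carrier R) g h : \<Gamma>"
  if gr: "g : ring_hom R R" "h : ring_hom R R" and s: "\<rho> : G" "!!a. a : L ==> g a = \<rho> a" "g \<zeta> = \<zeta> [^] (i::nat)"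
   and t: "\<tau> : G" "!!a. a : L ==> h a = \<tau> a" "h \<zeta> = \<zeta> [^] (j::nat)" for g h \<rho> \<tau> i j
 proof -
  have "compose (carrier R) g h : ring_hom R R"
   using gr by (intro ring_hom_memI) (auto simp: compose_def ring_hom_closed ring_hom_mult ring_hom_add ring_hom_one)
  moreover have "compose (carrier R) g h a = compose L \<rho> \<tau> a" if "a : L" for a
   using that Lc(2) s(2) t(2) G_closed[OF t(1)] by (simp add: compose_def)
  moreover have "compose L \<rho> \<tau> : G" using A.aut_comp[OF s(1) t(1)] by simp
  moreover have "compose (carrier R) g h \<zeta> = \<zeta> [^] (i * j)"
   using zeta(1) s(3) t(3) hom_pow[OF gr(1) zeta(1), of j] by (simp add: compose_def nat_pow_pow)
  ultimately show ?thesis by (auto simp: \<Gamma>_def)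
 qed
 show "compose (carrier R) g h : \<Gamma>" by (rule comp[OF gr s t])
 fix x assume x: "x : carrier R"
 have "compose (carrier R) g h = compose (carrier R) h g"
 proof (rule \<Gamma>_eqI)
  show "compose (carrier R) g h : \<Gamma>" by (rule comp[OF gr s t])
  show "compose (carrier R) h g : \<Gamma>" by (rule comp[OF gr(2,1) t s])
  show "compose (carrier R) g h a = compose (carrier R) h g a" if "a : L" for a
   using that s(2) t(2) G_closed[OF t(1)] G_closed[OF s(1)] A.aut_commute[OF s(1) t(1), of a] by (simp add: compose_def)
  show "compose (carrier R) g h \<zeta> = compose (carrier R) h g \<zeta>"
   using s(3) t(3) hom_pow[OF gr(1) zeta(1), of j] hom_pow[OF gr(2) zeta(1), of i] by (simp add: compose_def nat_pow_pow mult.commute)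
 qed
 hence "compose (carrier R) g h x = compose (carrier R) h g x" by simp
 thus "g (h x) = h (g x)" using x by (simp add: compose_def)
qed

definition lift :: "('a \<Rightarrow> 'a) \<Rightarrow> nat \<Rightarrow> 'a \<Rightarrow> 'a" where "lift \<rho> c = (\<lambda>x\<in>carrier R. \<Oplus>j\<in>{..<d}. \<rho> (co x j) \<otimes> \<zeta> [^] (c * j))"

text \<open>Multiplicativity reduces to monomials, where it holds because a power of
  \<open>\<zeta>\<close> and its conjugate have the same coordinates over \<open>k0\<close>.\<close>

lemma lift:
 assumes s: "\<rho> : G" and c: "c : C"
 shows "lift \<rho> c : \<Gamma>" "a : L ==> lift \<rho> c a = \<rho> a" "lift \<rho> c \<zeta> = \<zeta> [^] c"
proof -
 let ?g = "lift \<rho> c"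
 have sc: "\<rho> a : L" "\<rho> a : carrier R" if "a : L" for a using G_closed[OF s that] Lc by auto
 have tc: "\<rho> (co x j) \<otimes> \<zeta> [^] (c * j) : carrier R" if "x : carrier R" "j < d" for x j using sc(2)[OF co(1)[OF that]] zpow by simp
 have cl: "?g x : carrier R" if "x : carrier R" for x using that tc by (auto simp: lift_def)
 have sadd: "\<rho> (a \<oplus> b) = \<rho> a \<oplus> \<rho> b" "\<rho> (a \<otimes> b) = \<rho> a \<otimes> \<rho> b" if "a : L" "b : L" for a b
  using A.aut_add[OF s, of a b] A.aut_mult[OF s, of a b] that by auto
 have add: "?g (x \<oplus> y) = ?g x \<oplus> ?g y" if xy: "x : carrier R" "y : carrier R" for x y
 proof -
  have "?g (x \<oplus> y) = (\<Oplus>j\<in>{..<d}. \<rho> (co (x \<oplus> y) j) \<otimes> \<zeta> [^] (c * j))" using xy by (simp add: lift_def)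
  also have "\<dots> = (\<Oplus>j\<in>{..<d}. \<rho> (co x j) \<otimes> \<zeta> [^] (c * j) \<oplus> \<rho> (co y j) \<otimes> \<zeta> [^] (c * j))"
  proof (intro finsum_cong' refl)
   fix j assume j: "j : {..<d}"
   have l: "co x j : L" "co y j : L" using co(1) xy j by auto
   show "\<rho> (co (x \<oplus> y) j) \<otimes> \<zeta> [^] (c * j) = \<rho> (co x j) \<otimes> \<zeta> [^] (c * j) \<oplus> \<rho> (co y j) \<otimes> \<zeta> [^] (c * j)"
    using co_add[OF xy, of j] j sadd(1)[OF l] sc(2)[OF l(1)] sc(2)[OF l(2)] zpow by (simp add: l_distr)
  qed (use tc xy in auto)
  also have "\<dots> = (\<Oplus>j\<in>{..<d}. \<rho> (co x j) \<otimes> \<zeta> [^] (c * j)) \<oplus> (\<Oplus>j\<in>{..<d}. \<rho> (co y j) \<otimes> \<zeta> [^] (c * j))" using tc xy by simp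
  finally show ?thesis using xy by (simp add: lift_def)
 qed
 have mon: "?g (a \<otimes> \<zeta> [^] i) = \<rho> a \<otimes> \<zeta> [^] (c * i)" if a: "a : L" for a i
 proof -
  have ac: "a : carrier R" using a Lc by auto
  have "?g (a \<otimes> \<zeta> [^] i) = (\<Oplus>j\<in>{..<d}. \<rho> (co (a \<otimes> \<zeta> [^] i) j) \<otimes> \<zeta> [^] (c * j))" using ac zpow by (simp add: lift_def)
  also have "\<dots> = (\<Oplus>j\<in>{..<d}. \<rho> a \<otimes> (kk i j \<otimes> \<zeta> [^] (c * j)))"
  proof (intro finsum_cong' refl)
   fix j assume j: "j : {..<d}"
   have "co (a \<otimes> \<zeta> [^] i) j = a \<otimes> kk i j" using co_smult[OF a zpow] co_zeta j by simp
   hence "\<rho> (co (a \<otimes> \<zeta> [^] i) j) = \<rho> a \<otimes> kk i j" using sadd(2)[OF a k0_L[OF kk]] A.aut_fix[OF s kk] by simp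
   thus "\<rho> (co (a \<otimes> \<zeta> [^] i) j) \<otimes> \<zeta> [^] (c * j) = \<rho> a \<otimes> (kk i j \<otimes> \<zeta> [^] (c * j))"
    using sc(2)[OF a] k0c(2)[OF kk] zpow by (simp add: m_assoc)
  qed (use sc(2)[OF a] k0c(2)[OF kk] zpow in auto)
  also have "\<dots> = \<rho> a \<otimes> (\<Oplus>j\<in>{..<d}. kk i j \<otimes> \<zeta> [^] (c * j))" using sc(2)[OF a] k0c(2)[OF kk] zpow by (intro finsum_rdistr[symmetric]) auto
  finally show ?thesis by (simp only: rel[OF c, of i, symmetric])
 qed
 have z0: "?g \<zero> = \<zero>" using mon[OF Lc(3), of 0] A.aut_zero[OF s] Lc(2) by simp
 have mult: "?g (x \<otimes> y) = ?g x \<otimes> ?g y" if xy: "x : carrier R" "y : carrier R" for x y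
 proof (rule co_induct[where T = L, OF xy(1)])
  fix a and i :: nat assume a: "a : L"
  have ac: "a : carrier R" using a Lc(2) by simp
  show "?g (a \<otimes> \<zeta> [^] i \<otimes> y) = ?g (a \<otimes> \<zeta> [^] i) \<otimes> ?g y"
  proof (rule co_induct[where T = L, OF xy(2)])
   fix b and j :: nat assume b: "b : L"
   have bc: "b : carrier R" using b Lc(2) by simp
   have "a \<otimes> \<zeta> [^] i \<otimes> (b \<otimes> \<zeta> [^] j) = a \<otimes> b \<otimes> \<zeta> [^] (i + j)" using ac bc zeta(1) by (simp add: m_ac flip: nat_pow_mult)
   hence "?g (a \<otimes> \<zeta> [^] i \<otimes> (b \<otimes> \<zeta> [^] j)) = \<rho> a \<otimes> \<rho> b \<otimes> (\<zeta> [^] (c * i) \<otimes> \<zeta> [^] (c * j))"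
    using mon[of "a \<otimes> b" "i + j"] a b Lc sadd(2) zeta(1) by (simp add: distrib_left nat_pow_mult)
   thus "?g (a \<otimes> \<zeta> [^] i \<otimes> (b \<otimes> \<zeta> [^] j)) = ?g (a \<otimes> \<zeta> [^] i) \<otimes> ?g (b \<otimes> \<zeta> [^] j)"
    using mon[OF a] mon[OF b] sc(2)[OF a] sc(2)[OF b] zeta(1) by (simp add: m_ac)
  qed (use ac zpow z0 cl add co(1)[OF xy(2)] in \<open>auto simp: r_distr\<close>)
 qed (use xy z0 cl add co(1)[OF xy(1)] in \<open>auto simp: l_distr\<close>)
 have sone: "\<rho> \<one> = \<one>" using A.aut_one[OF s] by simp
 show a: "?g a = \<rho> a" if "a : L" for a using mon[OF that, of 0] that Lc(2) sc(2) by simp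
 show z: "?g \<zeta> = \<zeta> [^] c" using mon[of \<one> 1] Lc(4) zeta(1) sone by simp
 have "?g : ring_hom R R" using cl add mult a[OF Lc(4)] sone by (intro ring_hom_memI) auto
 thus "?g : \<Gamma>" using a z s by (auto simp: \<Gamma>_def lift_def)
qed

section \<open>The subgroups fixing the root of unity and fixing the original field\<close>

definition G' where "G' = {g : \<Gamma>. g \<zeta> = \<zeta>}"
definition \<Delta> where "\<Delta> = {g : \<Gamma>. \<forall>a\<in>L. g a = a}"

lemma G'_sub: "G' \<subseteq> \<Gamma>" and \<Delta>_sub: "\<Delta> \<subseteq> \<Gamma>" by (auto simp: G'_def \<Delta>_def)

sublocale G': ab_aut_group R G'
proof -
 have "aut_group R G'"
 proof (rule \<Gamma>.subgroup_aut[OF G'_sub])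
  show "(\<lambda>x\<in>carrier R. x) : G'" unfolding G'_def by (intro CollectI conjI \<Gamma>.aut_id) (rule restrict_apply'[OF zeta(1)])
  show "compose (carrier R) g h : G'" if "g : G'" "h : G'" for g h
   using that unfolding G'_def by (intro CollectI conjI \<Gamma>.aut_comp) (auto simp: compose_eq[OF zeta(1)])
 qed
 then interpret aut_group R G' .
 show "ab_aut_group R G'" using G'_sub \<Gamma>.aut_commute by unfold_locales blast
qed

sublocale \<Delta>: aut_group R \<Delta>
proof (rule \<Gamma>.subgroup_aut[OF \<Delta>_sub])
 show "(\<lambda>x\<in>carrier R. x) : \<Delta>" unfolding \<Delta>_def by (intro CollectI conjI ballI \<Gamma>.aut_id) (rule restrict_apply'[OF Lc(2)])
 show "compose (carrier R) g h : \<Delta>" if "g : \<Delta>" "h : \<Delta>" for g h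
  using that unfolding \<Delta>_def by (intro CollectI conjI \<Gamma>.aut_comp) (auto simp: compose_eq[OF Lc(2)])
qed

abbreviation k1 where "k1 \<equiv> fixed_field R G'"

text \<open>If \<open>x\<close> is fixed by all lifts of the identity, the polynomial formed by its
  coordinates, minus the constant \<open>x\<close>, vanishes at the \<open>d\<close> conjugates of
  \<open>\<zeta>\<close>. Its degree is below \<open>d\<close>, so its constant term is zero and
  \<open>x\<close> equals a coordinate.\<close>

lemma fixed_\<Delta>: "fixed_field R \<Delta> = L"
proof
 show "L \<subseteq> fixed_field R \<Delta>" using Lc(2) by (auto simp: fixed_field_def \<Delta>_def)
 show "fixed_field R \<Delta> \<subseteq> L"
 proof
  fix x assume x: "x : fixed_field R \<Delta>"
  hence xc: "x : carrier R" by (simp add: fixed_field_def)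
  have id: "(\<lambda>a\<in>L. a) : G" using A.aut_id by simp
  have cc: "co x j : carrier R" if "j < d" for j using co(1)[OF xc that] Lc by auto
  define a where "a = (\<lambda>j. if j = 0 then co x 0 \<ominus> x else co x j)"
  have ac: "a j : carrier R" if "j < d" for j using cc that xc by (simp add: a_def)
  have ins: "{..<d} = insert 0 {0<..<d}" using d by auto
  have root: "(\<Oplus>j\<in>{..<d}. a j \<otimes> (\<zeta> [^] c) [^] j) = \<zero>" if c: "c : C" for c
  proof -
   have zc: "\<zeta> [^] c : carrier R" by (rule zpow)
   have T: "(\<Oplus>j\<in>{0<..<d}. co x j \<otimes> (\<zeta> [^] c) [^] j) : carrier R" using cc zc by simp
   have "lift (\<lambda>a\<in>L. a) c : \<Delta>" using lift[OF id c] by (simp add: \<Delta>_def)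
   hence "lift (\<lambda>a\<in>L. a) c x = x" using x by (simp add: fixed_field_def)
   moreover have "lift (\<lambda>a\<in>L. a) c x = (\<Oplus>j\<in>{..<d}. co x j \<otimes> (\<zeta> [^] c) [^] j)"
    unfolding lift_def using xc co(1)[OF xc] cc zeta(1) by (simp add: nat_pow_pow, intro finsum_cong') auto
   ultimately have "x = (\<Oplus>j\<in>insert 0 {0<..<d}. co x j \<otimes> (\<zeta> [^] c) [^] j)" using ins by simp
   also have "\<dots> = co x 0 \<oplus> (\<Oplus>j\<in>{0<..<d}. co x j \<otimes> (\<zeta> [^] c) [^] j)" using cc zc d by simp
   finally have e: "x = co x 0 \<oplus> (\<Oplus>j\<in>{0<..<d}. co x j \<otimes> (\<zeta> [^] c) [^] j)" .
   have "(\<Oplus>j\<in>insert 0 {0<..<d}. a j \<otimes> (\<zeta> [^] c) [^] j) = (co x 0 \<ominus> x) \<oplus> (\<Oplus>j\<in>{0<..<d}. a j \<otimes> (\<zeta> [^] c) [^] j)"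
    using zc d cc xc by (subst finsum_insert) (auto simp: a_def)
   also have "(\<Oplus>j\<in>{0<..<d}. a j \<otimes> (\<zeta> [^] c) [^] j) = (\<Oplus>j\<in>{0<..<d}. co x j \<otimes> (\<zeta> [^] c) [^] j)"
    using cc zc by (intro finsum_cong') (auto simp: a_def)
   also have "(co x 0 \<ominus> x) \<oplus> (\<Oplus>j\<in>{0<..<d}. co x j \<otimes> (\<zeta> [^] c) [^] j) = (co x 0 \<oplus> (\<Oplus>j\<in>{0<..<d}. co x j \<otimes> (\<zeta> [^] c) [^] j)) \<ominus> x"
    using cc[of 0] d xc T by (simp add: a_minus_def a_ac)
   also have "\<dots> = \<zero>" unfolding e[symmetric] using xc by simp
   finally show ?thesis using ins by simp
  qed
  let ?S = "(\<lambda>c. \<zeta> [^] c) ` C"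
  have "inj_on (\<lambda>c. \<zeta> [^] c) C" using zeta_powers C(1) cong_less_modulus_unique_nat by (auto simp: inj_on_def subset_iff)
  hence card: "card ?S = d" using C(2) by (simp add: card_image)
  have "a j = \<zero>" if "j < d" for j by (rule few_roots_coeffs[of d a ?S]) (use ac card root zpow that in auto)
  hence "a 0 = \<zero>" using d by simp
  hence "co x 0 = x" using cc[of 0] d xc by (simp add: a_def)
  thus "x : L" using co(1)[OF xc, of 0] d by simp
 qed
qed

lemma k1_iff: "x : carrier R ==> x : k1 \<longleftrightarrow> (\<forall>j<d. co x j : k0)"
proof -
 assume x: "x : carrier R"
 note cx = co[OF x]
 have lx: "lift \<rho> 1 x = (\<Oplus>j\<in>{..<d}. \<rho> (co x j) \<otimes> \<zeta> [^] j)" for \<rho> using x by (simp add: lift_def)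
 have lG: "lift \<rho> 1 : G'" if "\<rho> : G" for \<rho> using lift[OF that C(3)] zeta(1) by (simp add: G'_def)
 show ?thesis
 proof
  assume "x : k1"
  hence f: "lift \<rho> 1 x = x" if "\<rho> : G" for \<rho> using lG[OF that] by (simp add: fixed_field_def)
  have "\<rho> (co x j) = co x j" if "\<rho> : G" "j < d" for \<rho> j
  proof -
   have "co (lift \<rho> 1 x) j = \<rho> (co x j)" by (rule co_unique[OF _ lx]) (use that G_closed[OF that(1) cx(1)] in auto)
   thus ?thesis using f that by simp
  qed
  thus "\<forall>j<d. co x j : k0" using cx(1) by (simp add: fixed_field_def)
 next
  assume k: "\<forall>j<d. co x j : k0"
  have "g x = x" if g: "g : G'" for g
  proof -
   have gG: "g : \<Gamma>" "g \<zeta> = \<zeta>" using g by (auto simp: G'_def)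
   have h: "g : ring_hom R R" using gG by (simp add: \<Gamma>_def)
   obtain \<rho> where s: "\<rho> : G" "!!a. a : L ==> g a = \<rho> a" using gG by (auto simp: \<Gamma>_def)
   show ?thesis
   proof (rule co_induct[where T = k0, OF x])
    show "g (a \<otimes> \<zeta> [^] i) = a \<otimes> \<zeta> [^] i" if "a : k0" "a : L" for a and i :: nat
     using that s A.aut_fix[OF s(1)] gG(2) h Lc(2) zeta(1) by (simp add: ring_hom_mult hom_pow)
   qed (use k h s(2) Lc A.aut_zero[OF s(1)] in \<open>auto simp: ring_hom_add\<close>)
  qed
  thus "x : k1" using x by (simp add: fixed_field_def)
 qed
qed

lemma zeta_k1: "\<zeta> : k1" using zeta(1) by (simp add: fixed_field_def G'_def)

lemma L_k1: "x : L ==> x : k1 ==> x : k0"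
proof -
 assume x: "x : L" "x : k1"
 have "\<rho> x = x" if r: "\<rho> : G" for \<rho>
 proof -
  have "lift \<rho> 1 : G'" using lift[OF r C(3)] zeta(1) by (simp add: G'_def)
  hence "lift \<rho> 1 x = x" using x by (simp add: fixed_field_def)
  thus ?thesis using lift(2)[OF r C(3) x(1)] by simp
 qed
 thus ?thesis using x by (simp add: fixed_field_def)
qed

lemma card_G': "card G' = card G"
proof -
 have "bij_betw (\<lambda>\<rho>. lift \<rho> 1) G G'"
 proof (intro bij_betw_imageI inj_onI)
  fix \<rho> \<rho>' assume r: "\<rho> : G" "\<rho>' : G" "lift \<rho> 1 = lift \<rho>' 1"
  hence "\<rho> a = \<rho>' a" if "a : L" for a using lift(2)[OF r(1) C(3) that] lift(2)[OF r(2) C(3) that] by simp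
  thus "\<rho> = \<rho>'" using A.aut_eqI[OF r(1,2)] by simp
 next
  show "(\<lambda>\<rho>. lift \<rho> 1) ` G = G'"
  proof
   show "(\<lambda>\<rho>. lift \<rho> 1) ` G \<subseteq> G'" using lift[OF _ C(3)] zeta(1) by (auto simp: G'_def)
   show "G' \<subseteq> (\<lambda>\<rho>. lift \<rho> 1) ` G"
   proof
    fix g assume g: "g : G'"
    hence gG: "g : \<Gamma>" "g \<zeta> = \<zeta>" by (auto simp: G'_def)
    obtain \<rho> where s: "\<rho> : G" "!!a. a : L ==> g a = \<rho> a" using gG by (auto simp: \<Gamma>_def)
    have "g = lift \<rho> 1" using s lift[OF s(1) C(3)] gG zeta(1) by (intro \<Gamma>_eqI) auto
    thus "g : (\<lambda>\<rho>. lift \<rho> 1) ` G" using s(1) by simp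
   qed
  qed
 qed
 thus ?thesis using bij_betw_same_card by metis
qed

lemma dimension_k1: "dimension d k0 k1"
proof -
 let ?U = "map (\<lambda>j. \<zeta> [^] j) [0..<d]"
 have "lin_indep k0 {..<d} (\<lambda>j. \<zeta> [^] j)" using indep k0_L unfolding lin_indep_def by simp
 hence "independent k0 ?U" using lin_indep_imp_independent[OF k0_subfield] zpow by simp
 hence "dimension (length ?U) k0 (Span k0 ?U)" by blast
 moreover have "x : Span k0 ?U \<longleftrightarrow> x : k1" for x
 proof -
  have "x : Span k0 ?U \<longleftrightarrow> (\<exists>c. (\<forall>i<d. c i : k0) \<and> x = (\<Oplus>i\<in>{..<d}. c i \<otimes> \<zeta> [^] i))" by (rule Span_map[OF k0_subfield]) (rule zpow)
  also have "\<dots> \<longleftrightarrow> x : k1"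
  proof
   assume "\<exists>c. (\<forall>i<d. c i : k0) \<and> x = (\<Oplus>i\<in>{..<d}. c i \<otimes> \<zeta> [^] i)"
   then obtain c where c: "!!i. i < d ==> c i : k0" "x = (\<Oplus>i\<in>{..<d}. c i \<otimes> \<zeta> [^] i)" by blast
   have "x : carrier R" unfolding c(2) using c(1) k0c(2) zpow by simp
   moreover have "co x j = c j" if "j < d" for j by (rule co_unique[OF _ c(2) that]) (use c(1) k0_L in auto)
   ultimately show "x : k1" using k1_iff c(1) by simp
  next
   assume x: "x : k1"
   hence xc: "x : carrier R" by (simp add: fixed_field_def)
   show "\<exists>c. (\<forall>i<d. c i : k0) \<and> x = (\<Oplus>i\<in>{..<d}. c i \<otimes> \<zeta> [^] i)" using k1_iff[OF xc] x co(2)[OF xc] by auto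
  qed
  finally show ?thesis .
 qed
 hence "Span k0 ?U = k1" by blast
 ultimately show ?thesis by simp
qed

lemma coprime_index: "0 < i ==> i \<le> d ==> coprime i (card G)"
proof -
 assume i: "0 < i" "i \<le> d"
 hence "\<not> p dvd i" using d by (auto dest: dvd_imp_le)
 hence "coprime p i" using p by (simp add: prime_imp_coprime)
 thus ?thesis using card_G by (simp add: coprime_commute)
qed

text \<open>Some power of \<open>x\<close> with exponent \<open>i \<le> d\<close> equals an element
  of \<open>k0\<close> up to units, and values on \<open>k0\<close> are multiples of
  \<open>card G\<close>. The factor \<open>i\<close> is harmless, being below
  \<open>p\<close>.\<close>

lemma w_k1: assumes x: "x : k1" "x ~= \<zero>" shows "\<exists>i. 0 < i \<and> i \<le> d \<and> int (e * card G) dvd int i * w x"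
proof -
 have xc: "x : carrier R" using x by (simp add: fixed_field_def)
 obtain i a where ia: "0 < i" "i \<le> d" "a : k0" "a ~= \<zero>" "x [^] (i::nat) \<otimes> inv a : V.val_units"
  using power_in_subfield[OF k0_subfield dimension_k1 xc x(2)] G'.Kc(10)[OF x(1)] by auto
 have aL: "a : L" "a : carrier R" using ia k0_L k0c by auto
 have u: "x [^] i \<otimes> inv a : carrier R" "x [^] i \<otimes> inv a ~= \<zero>" "x [^] i \<otimes> inv a : ring_V" "inv (x [^] i \<otimes> inv a) : ring_V"
  using V.units_closed[OF ia(5)] by auto
 have "w (x [^] i \<otimes> inv a) = 0" using w_V[OF u(1,2)] w_V[of "inv (x [^] i \<otimes> inv a)"] u w_inv[OF u(1,2)] by simp
 moreover have "w (x [^] i \<otimes> inv a) = int i * w x - int e * v a"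
  using w_mult[of "x [^] i" "inv a"] W.v_pow[OF xc x(2)] w_inv[of a] w_L[OF aL(1) ia(4)] aL ia(4) xc pow_nonzero[OF xc x(2)] by simp
 moreover have "int (card G) dvd v a" using A.v_K[of a] ia by simp
 ultimately have "int i * w x = int e * v a" "int e * int (card G) dvd int e * v a" by auto
 thus ?thesis using ia by (intro exI[of _ i]) simp
qed

lemma w_k1_unif:
 assumes x: "x : k1" "x ~= \<zero>" and j: "w x = int e * j"
 shows "int (card G) dvd j"
proof -
 obtain i where i: "0 < i" "i \<le> d" "int (e * card G) dvd int i * w x" using w_k1[OF x] by auto
 have "int e * int (card G) dvd int e * (int i * j)" using i(3) j by simp
 hence "int (card G) dvd int i * j" using e0 by simp
 moreover have "coprime (int (card G)) (int i)" using coprime_index[OF i(1,2)] by (simp add: coprime_commute)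
 ultimately show ?thesis by (simp add: coprime_dvd_mult_right_iff)
qed

text \<open>For a submodule \<open>N\<close>, the module it generates over \<open>k1\<close>, that
  is, \<open>N\<close> tensored with \<open>k1\<close> over \<open>k0\<close>.\<close>

definition extend :: "'a set \<Rightarrow> 'a set" where "extend N = {x : carrier R. \<forall>j<d. co x j : N}"

context
 fixes N assumes N: "A.submodule N"
begin

lemma N_props: "x : N ==> x : L" "x : N ==> x : carrier R" "\<zero> : N" "x : N ==> y : N ==> x \<oplus> y : N"
  "c : k0 ==> x : N ==> c \<otimes> x : N" "\<rho> : G ==> x : N ==> \<rho> x : N" using A.submoduleD[OF N] Lc(2) by auto

lemma extend_add: "x : extend N ==> y : extend N ==> x \<oplus> y : extend N" using co_add N_props(4) by (simp add: extend_def)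

lemma extend_zero: "\<zero> : extend N" using co_smult[of \<zero> \<zero>] Lc(3) co(1)[of \<zero>] Lc(2) N_props(3) by (simp add: extend_def)

lemma extend_mono: "a : N ==> a \<otimes> \<zeta> [^] (i::nat) : extend N"
proof -
 assume a: "a : N"
 have "co (a \<otimes> \<zeta> [^] i) j = kk i j \<otimes> a" if "j < d" for j
  using co_smult[OF N_props(1)[OF a] zpow that] co_zeta[OF that] N_props(2)[OF a] k0c(2)[OF kk] by (simp add: m_comm)
 thus ?thesis using N_props(2,5) a kk zpow by (simp add: extend_def)
qed

lemma N_extend: "a : N ==> a : extend N" using extend_mono[of a 0] N_props(2) by simp

lemma extend_submodule: "G'.submodule (extend N)"
proof -
 have ex: "x = (\<Oplus>j\<in>{..<d}. co x j \<otimes> \<zeta> [^] j)" "!!j. j < d ==> co x j : N" "x : carrier R" if "x : extend N" for x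
  using that co(2)[of x] by (auto simp: extend_def)
 have cl: "extend N \<subseteq> carrier R" by (auto simp: extend_def)
 have k0m: "c \<otimes> x : extend N" if "c : k0" "x : extend N" for c x
  using that co_smult[OF k0_L[OF that(1)] ex(3)[OF that(2)]] N_props(5) k0c(2) by (simp add: extend_def)
 have zm: "\<zeta> [^] (i::nat) \<otimes> x : extend N" if x: "x : extend N" for x i
 proof (rule co_induct[where T = N, OF ex(3)[OF x] ex(2)[OF x]])
  show "\<zeta> [^] i \<otimes> (a \<otimes> \<zeta> [^] j) : extend N" if "a : N" for a and j :: nat
   using extend_mono[OF that, of "i + j"] N_props(2)[OF that] zeta(1) by (simp add: m_lcomm nat_pow_mult)
 qed (use zpow extend_add extend_zero in \<open>auto simp: r_distr\<close>)
 show ?thesis unfolding G'.submodule_def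
 proof (intro conjI ballI)
  fix c x assume c: "c : k1" and x: "x : extend N"
  have cc: "c : carrier R" using c by (simp add: fixed_field_def)
  have ck: "co c j : k0" if "j < d" for j using k1_iff[OF cc] c that by auto
  show "c \<otimes> x : extend N"
  proof (rule co_induct[where T = k0, OF cc ck])
   show "a \<otimes> \<zeta> [^] j \<otimes> x : extend N" if "a : k0" for a and j :: nat
    using k0m[OF that zm[OF x]] k0c(2)[OF that] ex(3)[OF x] zpow by (simp add: m_assoc)
  qed (use ex(3)[OF x] extend_add extend_zero in \<open>auto simp: l_distr\<close>)
 next
  fix g x assume g: "g : G'" and x: "x : extend N"
  have g': "g : \<Gamma>" "g \<zeta> = \<zeta>" using g by (auto simp: G'_def)
  hence h: "g : ring_hom R R" by (simp add: \<Gamma>_def)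
  note gG = g' h
  obtain \<rho> where s: "\<rho> : G" "!!a. a : L ==> g a = \<rho> a" using gG by (auto simp: \<Gamma>_def)
  show "g x : extend N"
  proof (rule co_induct[where T = N, OF ex(3)[OF x] ex(2)[OF x]])
   show "g (a \<otimes> \<zeta> [^] j) : extend N" if "a : N" for a and j :: nat
    using extend_mono[OF N_props(6)[OF s(1) that]] s(2)[OF N_props(1)[OF that]] gG N_props(2)[OF that] zeta(1)
    by (simp add: ring_hom_mult hom_pow)
  qed (use gG extend_add extend_zero \<Gamma>.aut_zero in \<open>auto simp: ring_hom_add\<close>)
 qed (use cl extend_zero extend_add in auto)
qed

text \<open>On a monomial \<open>a \<otimes> \<zeta> [^] j\<close> the trace over \<open>L\<close>
  is \<open>a\<close> times the trace of \<open>\<zeta> [^] j\<close>, which lies in both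
  \<open>L\<close> and \<open>k1\<close>, hence in \<open>k0\<close>.\<close>

lemma trace_extend: assumes x: "x : extend N" shows "\<Delta>.tr x : N"
proof -
 have xc: "x : carrier R" and cN: "!!j. j < d ==> co x j : N" using x by (auto simp: extend_def)
 have tz: "\<Delta>.tr (\<zeta> [^] j) : k0" for j :: nat
 proof (rule L_k1)
  show "\<Delta>.tr (\<zeta> [^] j) : L" using \<Delta>.tr_fixed[OF zpow] fixed_\<Delta> by simp
  have "g \<zeta> : k1" if g: "g : \<Delta>" for g using g \<Delta>_def \<Gamma>_def G'.Kc(10)[OF zeta_k1] by auto
  hence "g (\<zeta> [^] j) : k1" if "g : \<Delta>" for g using \<Delta>.aut_pow[OF that zeta(1)] that G'.Kc(10) by simp
  thus "\<Delta>.tr (\<zeta> [^] j) : k1" unfolding \<Delta>.tr_def by (intro subfield_finsum_closed[OF G'.fixed_subfield])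
 qed
 show ?thesis
 proof (rule co_induct[where T = N, OF xc cN])
  show "\<Delta>.tr (a \<otimes> \<zeta> [^] j) : N" if "a : N" for a and j :: nat
   using \<Delta>.tr_smult[of a "\<zeta> [^] j"] N_props(1,2)[OF that] N_props(5)[OF tz that] fixed_\<Delta> zpow
    m_comm[of a "\<Delta>.tr (\<zeta> [^] j)"] k0c(2)[OF tz] by simp
 qed (use N_props \<Delta>.tr_add \<Delta>.tr_smult[of \<zero> \<zero>] fixed_\<Delta> Lc in auto)
qed

text \<open>An automorphism \<open>g\<close> over \<open>L\<close> that moves \<open>\<zeta>\<close>
  replaces the unit root hypothesis. It preserves \<open>w\<close>, so the quotient \<open>q\<close>
  of \<open>g y\<close> by a suitable power of \<open>y\<close> lies in the fixed field of
  \<open>eigen y\<close> and has value \<open>(1 - ct) * w y\<close> with \<open>1 - ct\<close>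
  prime to \<open>p\<close>. Together with \<open>y [^] r\<close> this realizes the value of
  \<open>y\<close> there.\<close>

theorem extend_unit:
 assumes "N ~= {\<zero>}"
 shows "\<exists>y\<in>extend N. y ~= \<zero> \<and> w y = 0"
proof -
 have "subfield k1 R" by (rule G'.fixed_subfield)
 define m where "m = card G"
 have m: "m = p ^ k" "m > 0" using card_G p1 by (auto simp: m_def)
 obtain z r where z: "z : k1" "r dvd m" "!!i::nat. z [^] i = \<one> \<longleftrightarrow> r dvd i" "!!x. x : k1 ==> x [^] m = \<one> ==> \<exists>i::nat. x = z [^] i"
  using prime_power_roots_of_unity[OF G'.fixed_subfield p, of k] unfolding m(1) by auto
 have "p dvd m" using m(1) k by simp
 hence "\<zeta> [^] m = \<one>" using zeta_ord by simp
 then obtain b :: nat where b: "\<zeta> = z [^] b" using z(4)[OF zeta_k1] by auto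
 have zc: "z : carrier R" using z(1) by (simp add: fixed_field_def)
 have pr: "p dvd r"
 proof (rule ccontr)
  assume n: "\<not> p dvd r"
  have "\<zeta> [^] r = (z [^] r) [^] b" unfolding b using zc by (simp add: nat_pow_pow mult.commute)
  also have "\<dots> = \<one>" using z(3)[of r] by simp
  finally show False using zeta_ord n by simp
 qed
 \<comment> \<open>Follows from \<open>1 < d < p\<close>, and settles the condition at 2.\<close>
 have p2: "p ~= 2" using d by auto
 interpret D: kummer_data R G' p r m z
 proof unfold_locales
  show "(g [^]\<^bsub>galois_group R k1\<^esub> m) x = x" if "g : G'" "x : carrier R" for g x
   using G'.GG.pow_order_eq_1[of g] that card_G' by (simp add: order_def m_def)
 qed (use p m z pr p2 in auto)
 have "extend N ~= {\<zero>}" using assms N_props(3) N_extend by auto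
 then obtain y where y: "y : extend N" "y ~= \<zero>" and ye: "!!e. e : fixed_field R (D.eigen y) ==> y \<otimes> e : extend N"
  using D.submodule_contains_eigenspace[OF extend_submodule] by metis
 have yc: "y : carrier R" using y by (simp add: extend_def)
 interpret Y: aut_group R "D.eigen y" by (rule D.eigen_aut_group[OF yc])
 let ?E = "fixed_field R (D.eigen y)"
 have "\<exists>c\<in>C. c ~= 1" using card_mono[of "{1}" C] C(2) d by auto
 then obtain c where c: "c : C" "c ~= 1" by blast
 define g where "g = lift (\<lambda>a\<in>L. a) c"
 have "(\<lambda>a\<in>L. a) : G" using A.aut_id by simp
 note gl = lift[OF this c(1), folded g_def]
 have g\<Delta>: "g : \<Delta>" using gl by (simp add: \<Delta>_def)
 have cp: "c < p" "c ~= 0"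
 proof -
  show "c < p" using c C(1) by auto
  show "c ~= 0"
  proof
   assume "c = 0"
   hence "g \<zeta> = g \<one>" using gl(3) \<Gamma>.aut_one[OF gl(1)] by simp
   hence "\<zeta> = \<one>" using \<Gamma>.aut_inj[OF gl(1)] zeta(1) by (auto dest: inj_onD)
   thus False using zeta_ord[of 1] p1 by simp
  qed
 qed
 have gk1: "g x : k1" if "x : k1" for x using \<Gamma>.fixed_field_stable[OF G'_sub gl(1) that] .
 have "(g z) [^] m = \<one>" using \<Gamma>.aut_pow[OF gl(1) zc, of m] z(3)[of m] z(2) \<Gamma>.aut_one[OF gl(1)] by simp
 \<comment> \<open>The action of \<open>g\<close> on the generator \<open>z\<close> of the larger
   group of roots of unity refines that on \<open>\<zeta>\<close>, so \<open>ct\<close> is congruent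
   to \<open>c\<close> modulo \<open>p\<close>.\<close>
 then obtain ct :: nat where ct: "g z = z [^] ct" using z(4)[OF gk1[OF z(1)]] by auto
 have ctc: "[ct = c] (mod p)" by (metis \<Gamma>.aut_pow[OF gl(1) zc, of b] b ct zc nat_pow_pow mult.commute gl(3) zeta_powers cong_sym)
 have gyc: "g y : carrier R" "g y ~= \<zero>" "w (g y) = w y"
 proof -
  show "g y : carrier R" "g y ~= \<zero>" using \<Gamma>.aut_closed[OF gl(1) yc] \<Gamma>.aut_nonzero[OF gl(1) yc y(2)] by auto
  obtain g' where g': "g' : \<Delta>" "!!x. x : carrier R ==> g (g' x) = x" "!!x. x : carrier R ==> g' (g x) = x" using \<Delta>.aut_inverse[OF g\<Delta>] by auto
  show "w (g y) = w y" by (rule w_automorphism[of g g']) (use g\<Delta> g' yc y(2) \<Delta>.aut_hom in \<open>auto simp: \<Delta>_def\<close>)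
 qed
 define q where "q = g y \<otimes> inv (y [^] ct)"
 have yct: "y [^] (i::nat) : carrier R" "y [^] (i::nat) ~= \<zero>" for i using yc y pow_nonzero by auto
 have qc: "q : carrier R" "q ~= \<zero>" using gyc yct integral_iff by (auto simp: q_def)
 have qE: "q : ?E"
 proof -
  \<comment> \<open>An \<open>h\<close> that multiplies \<open>y\<close> by \<open>z [^] i\<close>
    multiplies both \<open>g y\<close> and \<open>y [^] ct\<close> by \<open>z [^] (ct * i)\<close>,
    since it commutes with \<open>g\<close>.\<close>
  have "h q = q" if h: "h : D.eigen y" for h
  proof -
   obtain i :: nat where hi: "h : G'" "h y = z [^] i \<otimes> y" using h by (auto simp: D.eigen_def)
   have zi: "z [^] i : k1" "z [^] i : carrier R" by auto
   have zct: "z [^] (ct * i) : carrier R" "z [^] (ct * i) ~= \<zero>" by auto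
   have "g (z [^] i) = z [^] (ct * i)" using \<Gamma>.aut_pow[OF gl(1) zc, of i] ct by (simp add: nat_pow_pow)
   hence 1: "h (g y) = z [^] (ct * i) \<otimes> g y" using \<Gamma>.aut_commute[OF _ gl(1) yc, of h] hi G'_sub \<Gamma>.aut_mult[OF gl(1) zi(2) yc] by auto
   have 2: "h (y [^] ct) = z [^] (ct * i) \<otimes> y [^] ct"
    using G'.aut_pow[OF hi(1) yc, of ct] hi(2) yc by (simp add: nat_pow_distrib nat_pow_pow mult.commute)
   have "q \<otimes> y [^] ct = g y" using gyc yct[of ct] by (simp add: q_def m_assoc)
   hence "h q \<otimes> h (y [^] ct) = h (g y)" using G'.aut_mult[OF hi(1) qc(1) yct(1)[of ct]] by simp
   hence "h q \<otimes> (z [^] (ct * i) \<otimes> y [^] ct) = z [^] (ct * i) \<otimes> (q \<otimes> y [^] ct)" using 1 2 \<open>q \<otimes> y [^] ct = g y\<close> by simp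
   also have "\<dots> = q \<otimes> (z [^] (ct * i) \<otimes> y [^] ct)" using qc yct by (intro m_lcomm) auto
   finally show "h q = q"
    using m_rcancel[of "z [^] (ct * i) \<otimes> y [^] ct" "h q" q] yct[of ct] qc integral_iff G'.aut_closed[OF hi(1) qc(1)] by auto
  qed
  thus ?thesis using qc by (simp add: fixed_field_def)
 qed
 have yE: "y [^] r : ?E"
 proof -
  have "h (y [^] r) = y [^] r" if h: "h : D.eigen y" for h
  proof -
   obtain i :: nat where hi: "h : G'" "h y = z [^] i \<otimes> y" using h by (auto simp: D.eigen_def)
   have "h (y [^] r) = (z [^] i) [^] r \<otimes> y [^] r" using G'.aut_pow[OF hi(1) yc] hi(2) yc by (simp add: nat_pow_distrib)
   also have "(z [^] i) [^] r = \<one>" using z(3)[of "i * r"] by (simp add: nat_pow_pow)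
   finally show ?thesis using yct by simp
  qed
  thus ?thesis using yct by (simp add: fixed_field_def)
 qed
 have wq: "w q = (1 - int ct) * w y" using gyc yct[of ct] w_mult[of "g y" "inv (y [^] ct)"] w_inv[of "y [^] ct"] W.v_pow[OF yc y(2), of ct]
  by (simp add: q_def algebra_simps)
 have "coprime (1 - int ct) (int r)"
 proof -
  have "\<not> int p dvd int ct - 1"
  proof
   assume "int p dvd int ct - 1"
   hence "[int ct = int 1] (mod int p)" by (simp add: cong_iff_dvd_diff)
   hence "[ct = 1] (mod p)" using cong_int_iff by blast
   hence "[c = 1] (mod p)" using ctc cong_sym cong_trans by blast
   thus False using cp c(2) cong_less_modulus_unique_nat by simp
  qed
  hence "coprime (int p) (int ct - 1)" using p by (intro prime_imp_coprime) auto
  hence "coprime (int p ^ k) (int ct - 1)" by simp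
  moreover have "int r dvd int p ^ k" using z(2) m(1) by (metis of_nat_dvd_iff of_nat_power)
  ultimately have "coprime (int r) (int ct - 1)" using coprime_divisors dvd_refl by blast
  hence "coprime (int r) (- (int ct - 1))" by (simp only: coprime_minus_right_iff)
  thus ?thesis by (simp add: coprime_commute)
 qed
 \<comment> \<open>Bezout: \<open>w y\<close> is an integer combination of
   \<open>(1 - ct) * w y\<close> and \<open>r * w y\<close>, both values of elements of the fixed
   field.\<close>
 then obtain s t where st: "s * (1 - int ct) + t * int r = 1" using bezout_int[of "1 - int ct" "int r"] by auto
 obtain e1 where e1: "e1 : ?E - {\<zero>}" "w e1 = s * w q" using W.subfield_powers[OF _ Y.fixed_subfield, of q s] qE qc by auto
 obtain e2 where e2: "e2 : ?E - {\<zero>}" "w e2 = t * w (y [^] r)" using W.subfield_powers[OF _ Y.fixed_subfield, of "y [^] r" t] yE yct by auto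
 have e1c: "e1 : carrier R" and e2c: "e2 : carrier R" using e1 e2 Y.Kc by auto
 define e' where "e' = e1 \<otimes> e2"
 have e': "e' : ?E" "e' ~= \<zero>" "e' : carrier R" using e1 e2 e1c e2c Y.Kc(6) integral_iff by (auto simp: e'_def)
 have "w e' = s * ((1 - int ct) * w y) + t * (int r * w y)"
  using w_mult[of e1 e2] e1 e2 e1c e2c wq W.v_pow[OF yc y(2), of r] by (simp add: e'_def)
 also have "\<dots> = (s * (1 - int ct) + t * int r) * w y" by (simp add: algebra_simps)
 finally have we: "w e' = w y" using st by simp
 have "inv e' : ?E" using e' Y.Kc(9) by simp
 hence "y \<otimes> inv e' : extend N" by (rule ye)
 moreover have "y \<otimes> inv e' ~= \<zero>" "w (y \<otimes> inv e') = 0" using e' yc y we w_mult[of y "inv e'"] w_inv[of e'] integral_iff by auto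
 ultimately show ?thesis by blast
qed

text \<open>The unit of \<open>extend N\<close> is divided by its leading coefficient in
  \<open>k1\<close>, so that it becomes 1 plus a term of positive value. Its trace lies in
  \<open>N\<close> and is \<open>d\<close> plus a term of positive value, and \<open>d\<close> is a
  unit, being prime to the residue characteristic.\<close>

theorem unit_in_submodule:
 assumes "N ~= {\<zero>}"
 shows "\<exists>x\<in>N. x ~= \<zero> \<and> v x = 0"
proof -
 obtain y where y: "y : extend N" "y ~= \<zero>" "w y = 0" using extend_unit[OF assms] by auto
 have yc: "y : carrier R" using y by (simp add: extend_def)
 note exm = G'.submoduleD[OF extend_submodule]
 obtain u where u: "u : L" "u ~= \<zero>" "v u = 1" using v_unif by auto
 have uc: "u [^] (j::nat) : carrier R" "u [^] (j::nat) ~= \<zero>" "w (u [^] (j::nat)) = int e * int j" for j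
 using u Lc pow_nonzero W.v_pow[of u j] w_L[OF u(1,2)] by auto
 let ?n = "card G"
 \<comment> \<open>Powers of a uniformizer of \<open>L\<close> with exponents below
   \<open>card G\<close> have values in different classes modulo those of \<open>k1\<close>, so they
   form a basis over \<open>k1\<close> in which no cancellation occurs.\<close>
 have dist: "w (c i \<otimes> u [^] i) ~= w (c j \<otimes> u [^] j)"
  if c: "c i : k1" "c j : k1" "c i ~= \<zero>" "c j ~= \<zero>" and ij: "i < ?n" "j < ?n" "i ~= j" for c i j
 proof
  assume eq: "w (c i \<otimes> u [^] i) = w (c j \<otimes> u [^] j)"
  have cc: "c i : carrier R" "c j : carrier R" using c G'.Kc by auto
  have "w (c i \<otimes> inv (c j)) = int e * (int j - int i)"
   using eq w_mult[of "c i" "u [^] i"] w_mult[of "c j" "u [^] j"] w_mult[of "c i" "inv (c j)"] w_inv[of "c j"] cc c uc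
   by (simp add: algebra_simps)
  moreover have "c i \<otimes> inv (c j) : k1" "c i \<otimes> inv (c j) ~= \<zero>" using c cc G'.Kc(6,9) integral_iff by auto
  ultimately have "int ?n dvd int j - int i" using w_k1_unif by simp
  hence "[j = i] (mod ?n)" by (simp add: cong_iff_dvd_diff flip: cong_int_iff)
  thus False using ij cong_less_modulus_unique_nat by auto
 qed
 have dom: "\<exists>j0\<in>{..<?n}. c j0 \<otimes> u [^] j0 ~= \<zero> \<and> x ~= \<zero> \<and> w x = w (c j0 \<otimes> u [^] j0) \<and> W.vge (w (c j0 \<otimes> u [^] j0) + 1) (x \<ominus> c j0 \<otimes> u [^] j0)"
  if c: "!!j. j < ?n ==> c j : k1" "\<exists>j<?n. c j ~= \<zero>" and x: "x = (\<Oplus>j\<in>{..<?n}. c j \<otimes> u [^] j)" for c x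
 proof -
  have cc: "c j : carrier R" if "j < ?n" for j using c(1)[OF that] G'.Kc by auto
  have z: "c j \<otimes> u [^] j ~= \<zero> \<longleftrightarrow> c j ~= \<zero>" if "j < ?n" for j using cc[OF that] uc integral_iff by auto
  have "\<exists>j0\<in>{..<?n}. c j0 \<otimes> u [^] j0 ~= \<zero> \<and> (\<Oplus>j\<in>{..<?n}. c j \<otimes> u [^] j) ~= \<zero> \<and> w (\<Oplus>j\<in>{..<?n}. c j \<otimes> u [^] j) = w (c j0 \<otimes> u [^] j0) \<and>
   (\<forall>j\<in>{..<?n}. W.vge (w (c j0 \<otimes> u [^] j0)) (c j \<otimes> u [^] j)) \<and>
   W.vge (w (c j0 \<otimes> u [^] j0) + 1) ((\<Oplus>j\<in>{..<?n}. c j \<otimes> u [^] j) \<ominus> c j0 \<otimes> u [^] j0)"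
   by (rule W.distinct_valuations) (use cc uc c z dist in auto)
  thus ?thesis unfolding x by auto
 qed
 have li: "lin_indep k1 {..<?n} (\<lambda>j. u [^] j)" unfolding lin_indep_def
 proof (intro allI impI ballI, rule ccontr)
  fix c j assume c: "\<forall>j\<in>{..<?n}. c j : k1" "(\<Oplus>j\<in>{..<?n}. c j \<otimes> u [^] j) = \<zero>" "j : {..<?n}" "c j ~= \<zero>"
  hence "!!j. j < ?n ==> c j : k1" "\<exists>j<?n. c j ~= \<zero>" by auto
  from dom[OF this c(2)[symmetric]] show False by blast
 qed
 obtain c where c: "!!j. j : {..<?n} ==> c j : k1" "y = (\<Oplus>j\<in>{..<?n}. c j \<otimes> u [^] j)"
  using lin_indep_spans[OF G'.fixed_subfield G'.artin_dimension, of "{..<?n}" "\<lambda>j. u [^] j" y] li uc yc card_G' by auto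
 have cc: "c j : carrier R" if "j < ?n" for j using c(1) that G'.Kc by auto
 have "\<exists>j<?n. c j ~= \<zero>"
 proof (rule ccontr)
  assume "\<not> ?thesis"
  hence "y = (\<Oplus>j\<in>{..<?n}. \<zero>)" unfolding c(2) using uc by (intro finsum_cong') auto
  thus False using y(2) by simp
 qed
 then obtain j0 where j0: "j0 < ?n" "c j0 \<otimes> u [^] j0 ~= \<zero>" "w y = w (c j0 \<otimes> u [^] j0)"
   "W.vge (w (c j0 \<otimes> u [^] j0) + 1) (y \<ominus> c j0 \<otimes> u [^] j0)" using dom[of c y] c by auto
 have cj: "c j0 ~= \<zero>" "c j0 : k1" using j0 uc c(1) by auto
 have "w (c j0) = int e * (- int j0)" using w_mult[of "c j0" "u [^] j0"] cc j0 cj uc y(3) by simp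
 hence "int ?n dvd - int j0" using w_k1_unif[OF cj(2,1)] by blast
 \<comment> \<open>Value 0 forces the leading exponent to be 0, so the leading term lies in
   \<open>k1\<close>.\<close>
 hence j00: "j0 = 0" using j0(1) by auto
 define b where "b = c 0"
 have b: "b : k1" "b ~= \<zero>" "b : carrier R" "w b = 0" "W.vge 1 (y \<ominus> b)" using cj j00 cc j0 y(3) by (auto simp: b_def)
 have ib: "inv b : k1" "inv b : carrier R" "w (inv b) = 0" using G'.Kc(9) b w_inv[of b] by auto
 define y2 where "y2 = inv b \<otimes> y"
 define z where "z = inv b \<otimes> (y \<ominus> b)"
 have zc: "z : carrier R" using b yc by (simp add: z_def)
 have "W.vge (w (inv b) + 1) z" unfolding z_def by (rule W.vge_mult[OF ib(2) _ W.vge_self b(5)]) (use b yc in simp)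
 hence zv: "W.vge 1 z" using ib by simp
 have y2: "y2 : extend N" unfolding y2_def by (rule exm(5)[OF ib(1) y(1)])
 have "y2 = \<one> \<oplus> z"
 proof -
  have "y = b \<oplus> (y \<ominus> b)" using b yc by (simp add: a_minus_def a_lcomm[of b y] r_neg)
  hence "y2 = inv b \<otimes> (b \<oplus> (y \<ominus> b))" by (simp add: y2_def)
  also have "\<dots> = inv b \<otimes> b \<oplus> z" unfolding z_def using b yc by (intro r_distr) auto
  finally show ?thesis using b by simp
 qed
 hence t: "\<Delta>.tr y2 = \<Delta>.tr \<one> \<oplus> \<Delta>.tr z" using \<Delta>.tr_add zc by simp
 have tz: "W.vge 1 (\<Delta>.tr z)" unfolding \<Delta>.tr_def
 proof (rule W.vge_finsum)
  fix g assume g: "g : \<Delta>"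
  show "W.vge 1 (g z)"
  proof (cases "z = \<zero>")
   case False
   obtain g' where g': "g' : \<Delta>" "!!x. x : carrier R ==> g (g' x) = x" "!!x. x : carrier R ==> g' (g x) = x" using \<Delta>.aut_inverse[OF g] by auto
   have "w (g z) = w z" by (rule w_automorphism[of g g']) (use g g' zc False \<Delta>.aut_hom in \<open>auto simp: \<Delta>_def\<close>)
   thus ?thesis using zv False \<Delta>.aut_nonzero[OF g zc False] by (simp add: W.vge_nonzero)
  qed (use g in simp)
 qed (use \<Delta>.finite_G zc in auto)
 have card\<Delta>: "card \<Delta> = d" using dimension_is_inj[OF L _ dimension_ext] \<Delta>.artin_dimension unfolding fixed_\<Delta> by simp
 have t1: "\<Delta>.tr \<one> = [d] \<cdot> \<one>"
 proof -
  have "\<Delta>.tr \<one> = (\<Oplus>g\<in>\<Delta>. \<one>)" unfolding \<Delta>.tr_def by (intro finsum_cong') auto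
  also have "\<dots> = [card \<Delta>] \<cdot> \<one>" using add.finprod_const[of \<one> \<Delta>] by simp
  finally show ?thesis using card\<Delta> by simp
 qed
 have natV: "[(i::nat)] \<cdot> \<one> : ring_V" for i by (induct i) (use V.Vc in auto)
 have natc: "[(i::nat)] \<cdot> \<one> : carrier R" for i by simp
 have natmult: "[(i * j)] \<cdot> \<one> = [i] \<cdot> \<one> \<otimes> [j] \<cdot> \<one>" for i j :: nat
  using add_pow_ldistr[of \<one> "[j] \<cdot> \<one>" i] add.nat_pow_pow[of \<one> i j] by (simp add: mult.commute[of i j])
 have "\<not> p dvd d" using d by auto
 hence "coprime d p" using p prime_imp_coprime[of p d] by (simp add: coprime_commute)
 then obtain x where "[d * x = Suc 0] (mod p)" using cong_solve_coprime_nat by auto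
 moreover have "Suc 0 \<le> d * x" using calculation p1 by (cases "d * x") (auto simp: cong_def)
 ultimately have "p dvd d * x - Suc 0" by (simp add: cong_altdef_nat)
 \<comment> \<open>An inverse of \<open>d\<close> modulo \<open>p\<close>, written with natural
   numbers: the product of \<open>d\<close> and \<open>x\<close> is 1 plus an element of positive
   value.\<close>
 then obtain l where l: "d * x = p * l + 1" using \<open>Suc 0 \<le> d * x\<close> by (metis dvdE add.commute le_add_diff_inverse One_nat_def)
 have pV: "W.vge 1 ([p] \<cdot> \<one>)"
 proof (cases "[p] \<cdot> \<one> = \<zero>")
  case False
  have pL: "[(i::nat)] \<cdot> \<one> : L" for i by (induct i) (use Lc in auto)
  have "1 \<le> v ([p] \<cdot> \<one>)" using vp False by (simp add: val_ge_def)
  hence "int e * 1 \<le> int e * v ([p] \<cdot> \<one>)" by (intro mult_left_mono) auto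
  hence "1 \<le> w ([p] \<cdot> \<one>)" using w_L[OF pL False] e0 by linarith
  thus ?thesis by (simp add: val_ge_def)
 qed simp
 have prod: "[d] \<cdot> \<one> \<otimes> [x] \<cdot> \<one> = \<one> \<oplus> [p] \<cdot> \<one> \<otimes> [l] \<cdot> \<one>"
 proof -
  have "[(d * x)] \<cdot> \<one> = [(p * l)] \<cdot> \<one> \<oplus> \<one>" unfolding l by simp
  thus ?thesis using natmult by (simp add: a_comm)
 qed
 have lge: "W.vge 0 ([(i::nat)] \<cdot> \<one>)" for i using w_V[OF natc, of i] natV by (cases "[i] \<cdot> \<one> = \<zero>") (auto simp: val_ge_def)
 have "W.vge (1 + 0) ([p] \<cdot> \<one> \<otimes> [l] \<cdot> \<one>)" by (rule W.vge_mult[OF natc natc pV lge])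
 hence "W.vge (w \<one> + 1) ([p] \<cdot> \<one> \<otimes> [l] \<cdot> \<one>)" by simp
 hence u1: "\<one> \<oplus> [p] \<cdot> \<one> \<otimes> [l] \<cdot> \<one> ~= \<zero>" "w (\<one> \<oplus> [p] \<cdot> \<one> \<otimes> [l] \<cdot> \<one>) = 0" using W.v_add_strict[of \<one> "[p] \<cdot> \<one> \<otimes> [l] \<cdot> \<one>"] by auto
 have dn: "[d] \<cdot> \<one> ~= \<zero>" "[x] \<cdot> \<one> ~= \<zero>" using prod u1(1) by auto
 have "w ([d] \<cdot> \<one>) + w ([x] \<cdot> \<one>) = 0" using w_mult[OF natc dn(1) natc dn(2)] prod u1(2) by simp
 hence wd: "w ([d] \<cdot> \<one>) = 0" using lge[of d] lge[of x] dn by (simp add: W.vge_nonzero)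
 have "\<Delta>.tr y2 ~= \<zero> \<and> w (\<Delta>.tr y2) = 0" using W.v_add_strict[of "[d] \<cdot> \<one>" "\<Delta>.tr z"] \<Delta>.tr_closed[OF zc] dn(1) wd tz unfolding t t1 by simp
 moreover have tN: "\<Delta>.tr y2 : N" by (rule trace_extend[OF y2])
 ultimately have "v (\<Delta>.tr y2) = 0" using w_L[OF N_props(1)[OF tN]] e0 by simp
 thus ?thesis using tN \<open>\<Delta>.tr y2 ~= \<zero> \<and> w (\<Delta>.tr y2) = 0\<close> by auto
qed

end

end

section \<open>Adjoining a root of unity inside an algebraic closure\<close>

lemma (in field) simple_extension_expand:
 assumes K: "subfield K R" and s: "s : carrier R" "(algebraic over K) s"
 shows "x : simple_extension K s \<longleftrightarrow> (\<exists>c. (\<forall>j<degree (Irr K s). c j : K) \<and> x = (\<Oplus>j\<in>{..<degree (Irr K s)}. c j \<otimes> s [^] j))"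
  "lin_indep K {..<degree (Irr K s)} (\<lambda>j. s [^] j)"
proof -
 let ?d = "degree (Irr K s)" and ?U = "map (\<lambda>j. s [^] j) [0..<degree (Irr K s)]"
 have c: "set ?U \<subseteq> carrier R" "set (exp_base s ?d) \<subseteq> carrier R" using s exp_base_closed by auto
 have set: "set (exp_base s ?d) = set ?U" by (simp add: exp_base_def)
 have "Span K ?U = simple_extension K s" using Span_same_set[OF K c(1), of "exp_base s ?d"] set Span_exp_base[OF K s] by simp
 thus "x : simple_extension K s \<longleftrightarrow> (\<exists>c. (\<forall>j<?d. c j : K) \<and> x = (\<Oplus>j\<in>{..<?d}. c j \<otimes> s [^] j))"
  using Span_map[OF K, of ?d "\<lambda>j. s [^] j" x] s by simp
 have "independent K ?U" using independent_same_set[OF K set _ exp_base_independent[OF K s]] by (simp add: exp_base_def)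
 thus "lin_indep K {..<?d} (\<lambda>j. s [^] j)" by (intro independent_imp_lin_indep[OF K]) (use s in auto)
qed

text \<open>The degree of \<open>L(s)\<close> over \<open>K\<close> is divisible by both
  \<open>n\<close> and the degree of \<open>s\<close> over \<open>K\<close>, so coprimality leaves
  no room for the latter to drop over \<open>L\<close>.\<close>

lemma (in field) coprime_degree_Irr:
 assumes K: "subfield K R" and L: "subfield L R" and KL: "K \<subseteq> L" and dim: "dimension n K L" and n: "n > 0"
  and s: "s : carrier R" "(algebraic over K) s" and cop: "coprime n (degree (Irr K s))"
 shows "degree (Irr L s) = degree (Irr K s)"
proof -
 have algL: "(algebraic over L) s" using algebraic_mono[OF KL s(2)] .
 let ?d = "degree (Irr K s)" and ?e = "degree (Irr L s)" and ?K = "simple_extension K s" and ?L = "simple_extension L s"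
 have sub: "subfield ?K R" "subfield ?L R" using simple_extension_is_subfield K L s algL by auto
 have Lc: "carrier (K[X]) \<subseteq> carrier (L[X])" using KL by (auto simp: univ_poly_carrier[symmetric] polynomial_def subset_iff)
 note I = IrrE[OF K s]
 have "?e \<le> ?d"
 proof (rule pdivides_imp_degree_le[OF subfieldE(1)[OF L]])
  show "Irr L s : carrier (L[X])" using IrrE(1)[OF L s(1) algL] .
  show "Irr K s : carrier (L[X])" using I(1) Lc by auto
  show "Irr K s ~= []" using pirreducible_degree[OF K I(1,2)] by auto
  show "Irr L s pdivides Irr K s" using Irr_minimal[OF L s(1) algL] I(1,4) Lc by auto
 qed
 have e0: "?e > 0" using pirreducible_degree[OF L IrrE(1,2)[OF L s(1) algL]] by simp
 have dimL: "dimension (n * ?e) K ?L" by (rule telescopic_base[OF K L dim dimension_simple_extension[OF L s(1) algL]])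
 obtain Us where Us: "set Us \<subseteq> carrier R" "Span K Us = ?L" using exists_base[OF K dimL] by blast
 have Kc: "K \<subseteq> carrier R" "L \<subseteq> carrier R" using K L subfield_closed(1) by auto
 have KK: "K \<subseteq> ?K" "?K \<subseteq> ?L" using simple_extension_incl[OF Kc(1) s(1)] mono_simple_extension[OF KL] by auto
 have "Span ?K Us = ?L"
 proof
  show "?L \<subseteq> Span ?K Us" unfolding Us(2)[symmetric] Span_eq_combine_set[OF K Us(1)] Span_eq_combine_set[OF sub(1) Us(1)]
   using KK(1) by blast
  have "set Us \<subseteq> ?L" using Span_base_incl[OF K Us(1)] Us(2) by simp
  moreover have "subalgebra ?K ?L R"
  proof (intro subalgebra.intro subalgebra_axioms.intro)
   show "subgroup ?L (add_monoid R)" using subring.axioms(1)[OF subfieldE(1)[OF sub(2)]] .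
  qed (use KK subfield_closed(6)[OF sub(2)] in auto)
  ultimately show "Span ?K Us \<subseteq> ?L" by (rule subalgebra_Span_incl[OF sub(1), rotated])
 qed
 then obtain f where f: "dimension f ?K ?L" using Span_finite_dimension[OF sub(1) Us(1)] by auto
 have "dimension (?d * f) K ?L" by (rule telescopic_base[OF K sub(1) dimension_simple_extension[OF K s] f])
 hence eq: "?d * f = n * ?e" using dimension_is_inj[OF K _ dimL] by blast
 hence "n dvd f" using cop by (metis coprime_dvd_mult_right_iff dvd_triv_left)
 moreover have "f ~= 0"
 proof
  assume "f = 0"
  hence "n * ?e = 0" using eq by (metis mult_0_right)
  thus False using n e0 by (metis mult_is_0 less_numeral_extra(3))
 qed
 ultimately have "n \<le> f" by (auto intro: dvd_imp_le)
 hence "?d * n \<le> ?d * f" by (intro mult_le_mono2)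
 hence "n * ?d \<le> n * ?e" unfolding eq by (simp only: mult.commute)
 hence "?d \<le> ?e" using n mult_le_cancel1 by blast
 thus ?thesis using \<open>?e \<le> ?d\<close> by simp
qed

lemma (in field) finsum_subfield:
 assumes S: "subfield S R" and A: "finite A" "!!a. a : A ==> h a : S"
 shows "(\<Oplus>\<^bsub>R\<lparr>carrier := S\<rparr>\<^esub>a\<in>A. h a) = (\<Oplus>a\<in>A. h a)"
proof -
 interpret F: field "R\<lparr>carrier := S\<rparr>" using subfield_iff(2)[OF S] .
 show ?thesis using A
 proof (induct A)
  case (insert a A)
  have "(\<Oplus>\<^bsub>R\<lparr>carrier := S\<rparr>\<^esub>a\<in>insert a A. h a) = h a \<oplus> (\<Oplus>\<^bsub>R\<lparr>carrier := S\<rparr>\<^esub>a\<in>A. h a)"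
   using F.finsum_insert[OF insert(1,2), of h] insert(4) by auto
  moreover have "(\<Oplus>a\<in>insert a A. h a) = h a \<oplus> (\<Oplus>a\<in>A. h a)" using insert subfield_closed(2)[OF S] by (intro finsum_insert) auto
  ultimately show ?case using insert by simp
 qed (use F.finsum_empty in simp)
qed

lemma (in field) minus_subfield:
 assumes S: "subfield S R" and x: "x : S" "y : S"
 shows "x \<ominus>\<^bsub>R\<lparr>carrier := S\<rparr>\<^esub> y = x \<ominus> y"
proof -
 interpret F: field "R\<lparr>carrier := S\<rparr>" using subfield_iff(2)[OF S] .
 note Sc = subfield_closed[OF S]
 have "\<ominus>\<^bsub>R\<lparr>carrier := S\<rparr>\<^esub> y = \<ominus> y" using F.minus_equality[of "\<ominus> y" y] x Sc l_neg[of y] by simp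
 thus ?thesis by (simp add: a_minus_def)
qed

text \<open>A zero of \<open>1 + X + ... + X ^ (p - 1)\<close>. As \<open>p\<close> is nonzero in
  the field, 1 is not a zero, so the order is exactly \<open>p\<close>; the polynomial also bounds
  the degree over \<open>K\<close>.\<close>

lemma (in field) prime_root_of_unity:
 assumes p: "prime p" and char: "[p] \<cdot> \<one> ~= \<zero>" and K: "subfield K R" and splitted: "!!P. P : carrier (poly_ring R) ==> splitted P"
 obtains \<zeta> \<Phi> where "\<zeta> : carrier R" "!!i::nat. \<zeta> [^] i = \<one> \<longleftrightarrow> p dvd i" "\<Phi> : carrier (K[X])" "\<Phi> ~= []" "degree \<Phi> = p - 1" "eval \<Phi> \<zeta> = \<zero>"
proof -
 have p1: "p > 1" "p > 0" using p prime_gt_1_nat prime_gt_0_nat by auto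
 obtain \<Phi> where \<Phi>: "\<Phi> : carrier (K[X])" "\<Phi> ~= []" "degree \<Phi> = p - 1" and ev\<Phi>: "!!x. x : carrier R ==> eval \<Phi> x = x [^] (p - 1) \<ominus>
   (\<Oplus>j\<in>{..<p - 1}. (\<ominus> \<one>) \<otimes> x [^] j)" using monic_polynomial[OF K, of "p - 1" "\<lambda>j. \<ominus> \<one>"] subfield_closed(4,7)[OF K] by auto
 have ev\<Phi>': "eval \<Phi> x = (\<Oplus>j\<in>{..<p}. x [^] j)" if x: "x : carrier R" for x
 proof -
  have "(\<Oplus>j\<in>{..<p - 1}. (\<ominus> \<one>) \<otimes> x [^] j) = (\<ominus> \<one>) \<otimes> (\<Oplus>j\<in>{..<p - 1}. x [^] j)" using x by (intro finsum_rdistr[symmetric]) auto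
  moreover have c: "(\<Oplus>j\<in>{..<p - 1}. x [^] j) : carrier R" using x by (intro finsum_closed) auto
  ultimately have "eval \<Phi> x = x [^] (p - 1) \<oplus> (\<Oplus>j\<in>{..<p - 1}. x [^] j)" using ev\<Phi>[OF x] x by (simp add: l_minus a_minus_def)
  also have "\<dots> = (\<Oplus>j\<in>insert (p - 1) {..<p - 1}. x [^] j)" using x by (intro finsum_insert[symmetric]) auto
  also have "insert (p - 1) {..<p - 1} = {..<p}" using p1 by auto
  finally show ?thesis .
 qed
 have \<Phi>R: "\<Phi> : carrier (poly_ring R)" using \<Phi>(1) carrier_polynomial_shell[OF subfieldE(1)[OF K]] by auto
 have "splitted \<Phi>" by (rule splitted[OF \<Phi>R])
 hence "roots \<Phi> ~= {#}" using \<Phi>(3) p1 unfolding splitted_def by auto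
 then obtain \<zeta> where "\<zeta> \<in># roots \<Phi>" by auto
 hence z: "\<zeta> : carrier R" "eval \<Phi> \<zeta> = \<zero>" using roots_mem_iff_is_root[OF \<Phi>R] unfolding is_root_def by auto
 have zsum: "(\<Oplus>j\<in>{..<p}. \<zeta> [^] j) = \<zero>" using z ev\<Phi>' by simp
 \<comment> \<open>The factorization of \<open>X ^ n - 1\<close>, arranged so that no subtraction
   occurs.\<close>
 have tel: "(\<Oplus>j\<in>{..<n}. \<zeta> [^] j) \<otimes> \<zeta> \<oplus> \<one> = (\<Oplus>j\<in>{..<n}. \<zeta> [^] j) \<oplus> \<zeta> [^] n" for n :: nat
 proof (induct n)
  case (Suc n)
  let ?S = "\<Oplus>j\<in>{..<n}. \<zeta> [^] j" and ?z = "\<zeta> [^] n"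
  have c: "?S : carrier R" "?z : carrier R" using z by (auto intro!: finsum_closed)
  have s: "(\<Oplus>j\<in>{..<Suc n}. \<zeta> [^] j) = ?z \<oplus> ?S" unfolding lessThan_Suc using z by (intro finsum_insert) auto
  have "(?z \<oplus> ?S) \<otimes> \<zeta> \<oplus> \<one> = ?z \<otimes> \<zeta> \<oplus> (?S \<otimes> \<zeta> \<oplus> \<one>)" using c z by (simp add: l_distr a_assoc)
  also have "\<dots> = (?z \<oplus> ?S) \<oplus> ?z \<otimes> \<zeta>" unfolding Suc using c z by (simp add: a_ac)
  finally show ?case unfolding s by simp
 qed (use z in simp)
 have zp: "\<zeta> [^] p = \<one>" using tel[of p] zsum z by simp
 have z1: "\<zeta> ~= \<one>"
 proof
  assume "\<zeta> = \<one>"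
  hence "(\<Oplus>j\<in>{..<p}. \<one>) = \<zero>" using zsum by simp
  thus False using add.finprod_const[of "\<one>" "{..<p}"] char by simp
 qed
 have zord: "\<zeta> [^] i = \<one> \<longleftrightarrow> p dvd i" for i :: nat
 proof -
  obtain r where r: "r dvd p" "!!i::nat. \<zeta> [^] i = \<one> \<longleftrightarrow> r dvd i" using order_of_root[OF z(1) zp p1(2)] by blast
  have "r ~= 1" using r(2)[of 1] z1 z(1) by auto
  hence "r = p" using r(1) p by (auto simp: prime_nat_iff)
  thus ?thesis using r(2) by simp
 qed
 show thesis by (rule that[OF z(1) zord \<Phi> z(2)])
qed

text \<open>The expansion of \<open>\<zeta> [^] i\<close> is a polynomial relation over
  \<open>K\<close>, so it persists at every conjugate.\<close>

lemma (in field) conjugate_expand: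
 assumes K: "subfield K R" and z: "\<zeta> : carrier R" and alg: "(algebraic over K) \<zeta>"
  and conj: "!!P a. [|P : carrier (K[X]); eval P \<zeta> = \<zero>; a : C|] ==> eval P (\<zeta> [^] a) = \<zero>"
 defines "d \<equiv> degree (Irr K \<zeta>)"
 shows "\<exists>c. (\<forall>j. c j : K) \<and> (\<forall>a\<in>C. \<zeta> [^] (a * i) = (\<Oplus>j\<in>{..<d}. c j \<otimes> \<zeta> [^] (a * (j::nat))))"
proof -
 note Kc = subfield_closed[OF K]
 have zpow: "\<zeta> [^] (i::nat) : carrier R" for i using z by simp
 show ?thesis
 \<comment> \<open>Below \<open>d\<close> the coordinates form a unit vector. Otherwise
   \<open>X ^ i\<close> minus the expansion is monic of degree \<open>i\<close>, once the
   coefficients are padded with zeros up to \<open>i\<close>.\<close>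
 proof (cases "i < d")
 case True
 let ?c = "\<lambda>j. if j = i then \<one> else \<zero>"
 have "(\<Oplus>j\<in>{..<d}. ?c j \<otimes> \<zeta> [^] (a * j)) = \<zeta> [^] (a * i)" for a
 proof -
  have "(\<Oplus>j\<in>{..<d}. ?c j \<otimes> \<zeta> [^] (a * j)) = (\<Oplus>j\<in>{..<d}. if i = j then \<zeta> [^] (a * j) else \<zero>)" using zpow by (intro finsum_cong') auto
  also have "\<dots> = \<zeta> [^] (a * i)" using add.finprod_singleton[of i "{..<d}" "\<lambda>j. \<zeta> [^] (a * j)"] True zpow by simp
  finally show ?thesis .
 qed
 thus ?thesis using Kc(3,4) by (intro exI[of _ ?c]) auto
next
 case False
 have "\<zeta> [^] i : simple_extension K \<zeta>"
 proof -
  have "subfield (simple_extension K \<zeta>) R" using simple_extension_is_subfield[OF K z] alg by blast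
  thus ?thesis using subfield_closed(10) simple_extension_mem[OF subfieldE(1)[OF K] z] by blast
 qed
 then obtain c where c: "!!j. j < d ==> c j : K" "\<zeta> [^] i = (\<Oplus>j\<in>{..<d}. c j \<otimes> \<zeta> [^] j)"
  using simple_extension_expand(1)[OF K z alg] unfolding d_def by blast
 define c' where "c' = (\<lambda>j. if j < d then c j else \<zero>)"
 have c'K: "c' j : K" "c' j : carrier R" for j using c(1) Kc(2,3) by (auto simp: c'_def)
 have sum: "(\<Oplus>j\<in>{..<i}. c' j \<otimes> x [^] j) = (\<Oplus>j\<in>{..<d}. c' j \<otimes> x [^] j)" if "x : carrier R" for x using that c'K False
  by (intro add.finprod_mono_neutral_cong_left[symmetric, where g = "\<lambda>j. c' j \<otimes> x [^] j"]) (auto simp: c'_def)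
 obtain P where P: "P : carrier (K[X])" "!!x. x : carrier R ==> eval P x = x [^] i \<ominus> (\<Oplus>j\<in>{..<i}. c' j \<otimes> x [^] j)"
  using monic_polynomial[OF K, of i c'] c'K by blast
 have cl: "(\<Oplus>j\<in>{..<d}. c' j \<otimes> x [^] j) : carrier R" if "x : carrier R" for x using that c'K by (intro finsum_closed) auto
 have "(\<Oplus>j\<in>{..<d}. c' j \<otimes> \<zeta> [^] j) = \<zeta> [^] i" unfolding c(2) using c(1) Kc(2) zpow by (intro finsum_cong') (auto simp: c'_def)
 hence "eval P \<zeta> = \<zero>" using P(2)[OF z] sum[OF z] zpow by (simp add: a_minus_def r_neg)
 hence root: "eval P (\<zeta> [^] a) = \<zero>" if "a : C" for a using conj[OF P(1)] that by blast
 have "\<zeta> [^] (a * i) = (\<Oplus>j\<in>{..<d}. c' j \<otimes> \<zeta> [^] (a * j))" if a: "a : C" for a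
 proof -
  have "(\<zeta> [^] a) [^] i \<ominus> (\<Oplus>j\<in>{..<d}. c' j \<otimes> (\<zeta> [^] a) [^] j) = \<zero>" using root[OF a] P(2)[OF zpow[of a]] sum[OF zpow[of a]] by simp
  hence "(\<zeta> [^] a) [^] i = (\<Oplus>j\<in>{..<d}. c' j \<otimes> (\<zeta> [^] a) [^] j)" using r_right_minus_eq[OF _ cl[OF zpow[of a]]] zpow[of a] by simp
  thus ?thesis using z by (simp add: nat_pow_pow)
 qed
 thus ?thesis using c'K(1) by (intro exI[of _ c']) blast
qed
qed

text \<open>A change of ambient structure: sums, powers and differences of the surrounding field are
  those of the subfield generated by \<open>\<zeta>\<close> over \<open>L\<close>.\<close>

lemma (in field) complete_simple_extension:
 assumes L: "subfield L R" and z: "\<zeta> : carrier R" and algL: "(algebraic over L) \<zeta>" and zp: "\<zeta> [^] p = \<one>" "p > 0"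
  and val: "valuation (R\<lparr>carrier := L\<rparr>) w" "\<exists>t\<in>L - {\<zero>}. w t = 1"
  and complete: "!!s. [|!!i::nat. s i : L; !!n. \<exists>N. \<forall>i\<ge>N. \<forall>j\<ge>N. val_ge R w n (s i \<ominus> s j)|] ==> \<exists>l\<in>L. \<forall>n. \<exists>N. \<forall>i\<ge>N. val_ge R w n (s i \<ominus> l)"
 defines "S \<equiv> simple_extension L \<zeta>" and "d \<equiv> degree (Irr L \<zeta>)"
 shows "complete_extension (R\<lparr>carrier := S\<rparr>) L w d \<zeta> p"
proof -
 let ?S = "R\<lparr>carrier := S\<rparr>"
 have S: "subfield S R" unfolding S_def using simple_extension_is_subfield[OF L z] algL by blast
 note Sc = subfield_closed[OF S] and Lc = subfield_closed[OF L]
 interpret SF: field ?S using subfield_iff(2)[OF S] .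
 have LS: "L \<subseteq> S" unfolding S_def by (rule simple_extension_incl[OF Lc(1) z])
 have zS: "\<zeta> : S" unfolding S_def by (rule simple_extension_mem[OF subfieldE(1)[OF L] z])
 have powS: "x [^]\<^bsub>?S\<^esub> (i::nat) = x [^] i" for x i by (rule nat_pow_consistent_field)
 have sumS: "(\<Oplus>\<^bsub>?S\<^esub>a\<in>A. h a) = (\<Oplus>a\<in>A. h a)" if "finite A" "!!a. a : A ==> h a : S" for h and A :: "nat set"
  by (rule finsum_subfield[OF S that])
 have minS: "x \<ominus>\<^bsub>?S\<^esub> y = x \<ominus> y" if "x : S" "y : S" for x y by (rule minus_subfield[OF S that])
 have zSp: "\<zeta> [^] (j::nat) : S" for j using Sc(10)[OF zS] .
 have spanS: "\<exists>a. (\<forall>j<d. a j : L) \<and> x = (\<Oplus>j\<in>{..<d}. a j \<otimes> \<zeta> [^] j)" if "x : S" for x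
  using simple_extension_expand(1)[OF L z algL, of x] that unfolding d_def S_def by blast
 have liS: "lin_indep L {..<d} (\<lambda>j. \<zeta> [^] j)" using simple_extension_expand(2)[OF L z algL] unfolding d_def .
 have vS: "val_ge ?S w n x \<longleftrightarrow> val_ge R w n x" for n x by (simp add: val_ge_def)
 have LsubS: "subfield L ?S" using SF.subfield_iff(1)[of L] subfield_iff(2)[OF L] LS by simp
 show ?thesis
 proof (intro complete_extension.intro SF.field_axioms complete_extension_axioms.intro LsubS)
  show "valuation (?S\<lparr>carrier := L\<rparr>) w" using val(1) by simp
  show "\<exists>t\<in>L - {\<zero>\<^bsub>?S\<^esub>}. w t = 1" using val(2) by simp
  show "\<zeta> : carrier ?S" using zS by simp
  show "\<zeta> [^]\<^bsub>?S\<^esub> p = \<one>\<^bsub>?S\<^esub>" using zp by (simp add: powS)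
  show "0 < p" "0 < d" using zp(2) pirreducible_degree[OF L IrrE(1,2)[OF L z algL]] by (simp_all add: d_def)
  fix x assume x: "x : carrier ?S"
  then obtain a where a: "!!j. j < d ==> a j : L" "x = (\<Oplus>j\<in>{..<d}. a j \<otimes> \<zeta> [^] j)" using spanS by auto
  have "(\<Oplus>\<^bsub>?S\<^esub>j\<in>{..<d}. a j \<otimes>\<^bsub>?S\<^esub> \<zeta> [^]\<^bsub>?S\<^esub> j) = x" unfolding a(2) using sumS[of "{..<d}" "\<lambda>j. a j \<otimes> \<zeta> [^] j"] a(1) LS zSp Sc(6)
   by (simp add: powS subset_iff)
  thus "\<exists>a. (\<forall>j<d. a j : L) \<and> x = (\<Oplus>\<^bsub>?S\<^esub>j\<in>{..<d}. a j \<otimes>\<^bsub>?S\<^esub> \<zeta> [^]\<^bsub>?S\<^esub> j)" using a(1) by (intro exI[of _ a]) simp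
 next
  show "SF.lin_indep L {..<d} (\<lambda>j. \<zeta> [^]\<^bsub>?S\<^esub> j)" unfolding SF.lin_indep_def powS
  proof (intro allI impI)
   fix c assume c: "\<forall>j\<in>{..<d}. c j : L" "(\<Oplus>\<^bsub>?S\<^esub>j\<in>{..<d}. c j \<otimes>\<^bsub>?S\<^esub> \<zeta> [^] j) = \<zero>\<^bsub>?S\<^esub>"
   have t: "c j \<otimes> \<zeta> [^] j : S" if "j : {..<d}" for j using c(1) LS zSp that by (intro Sc(6)) auto
   have "(\<Oplus>j\<in>{..<d}. c j \<otimes> \<zeta> [^] j) = (\<Oplus>\<^bsub>?S\<^esub>j\<in>{..<d}. c j \<otimes> \<zeta> [^] j)" by (rule sumS[OF finite_lessThan t, symmetric])
   hence "(\<Oplus>j\<in>{..<d}. c j \<otimes> \<zeta> [^] j) = \<zero>" using c(2) by simp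
   from liS[unfolded lin_indep_def, THEN spec, of c, THEN mp, OF c(1), THEN mp, OF this]
   show "\<forall>j\<in>{..<d}. c j = \<zero>\<^bsub>?S\<^esub>" by simp
  qed
 next
  fix s :: "nat \<Rightarrow> _" assume s: "!!i. s i : L" "!!n. \<exists>N. \<forall>i\<ge>N. \<forall>j\<ge>N. val_ge ?S w n (s i \<ominus>\<^bsub>?S\<^esub> s j)"
  have eq: "s i \<ominus>\<^bsub>?S\<^esub> y = s i \<ominus> y" if "y : L" for i y using minS subsetD[OF LS] s(1) that by blast
  have "\<exists>l\<in>L. \<forall>n. \<exists>N. \<forall>i\<ge>N. val_ge R w n (s i \<ominus> l)" by (rule complete[OF s(1)]) (use s(2) in \<open>simp add: vS eq[OF s(1)]\<close>)
  thus "\<exists>l\<in>L. \<forall>n. \<exists>N. \<forall>i\<ge>N. val_ge ?S w n (s i \<ominus>\<^bsub>?S\<^esub> l)" using eq by (simp add: vS)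
 qed
qed

context ab_ram_aut
begin

text \<open>An algebraic closure contains only an isomorphic copy of the field, so the group, the
  valuation and the submodules are carried along the embedding \<open>f\<close> with inverse
  \<open>g\<close>.\<close>

lemma transport:
 assumes S: "field S" and f: "f : ring_hom R S" and g: "!!x. x : carrier R ==> g (f x) = x" "!!y. y : carrier S ==> g y : carrier R \<and> f (g y) = y"
 defines "H \<equiv> (\<lambda>\<tau>. \<lambda>y\<in>carrier S. f (\<tau> (g y))) ` G"
 shows "ab_ram_aut S H (v \<circ> g)" "fixed_field S H = f ` K" "card H = card G" "submodule N ==> aut_group.submodule S H (f ` N)"
proof -
 interpret S: field S by (rule S)
 have fc: "f x : carrier S" if "x : carrier R" for x using ring_hom_closed[OF f that] .
 have fz: "f \<zero> = \<zero>\<^bsub>S\<^esub>" using ring_hom_zero[OF f ring_axioms S.ring_axioms] .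
 have fo: "f \<one> = \<one>\<^bsub>S\<^esub>" using ring_hom_one[OF f] .
 have gz: "g \<zero>\<^bsub>S\<^esub> = \<zero>" using g(1)[of \<zero>] fz by simp
 have gc: "g y : carrier R" and fg: "f (g y) = y" if "y : carrier S" for y using g(2)[OF that] by auto
 have gadd: "g (x \<oplus>\<^bsub>S\<^esub> y) = g x \<oplus> g y" if "x : carrier S" "y : carrier S" for x y
  using g(1)[of "g x \<oplus> g y"] ring_hom_add[OF f gc[OF that(1)] gc[OF that(2)]] fg gc that by simp
 have gmult: "g (x \<otimes>\<^bsub>S\<^esub> y) = g x \<otimes> g y" if "x : carrier S" "y : carrier S" for x y
  using g(1)[of "g x \<otimes> g y"] ring_hom_mult[OF f gc[OF that(1)] gc[OF that(2)]] fg gc that by simp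
 have gnz: "g y ~= \<zero>" if "y : carrier S" "y ~= \<zero>\<^bsub>S\<^esub>" for y using fg[OF that(1)] that(2) fz by auto
 have fnz: "f x ~= \<zero>\<^bsub>S\<^esub>" if "x : carrier R" "x ~= \<zero>" for x using g(1)[OF that(1)] that(2) gz by auto
 define h where "h = (\<lambda>\<tau>. \<lambda>y\<in>carrier S. f (\<tau> (g y)))"
 have H: "H = h ` G" by (simp add: H_def h_def)
 have happ: "h \<tau> y = f (\<tau> (g y))" if "y : carrier S" for \<tau> y using that by (simp add: h_def)
 have hcomp: "compose (carrier S) (h \<tau>) (h \<rho>) = h (compose (carrier R) \<tau> \<rho>)" if "\<tau> : G" "\<rho> : G" for \<tau> \<rho>
 proof (rule extensionalityI)
  fix y assume y: "y : carrier S"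
  have "h \<rho> y : carrier S" using happ[OF y] fc gc[OF y] that by simp
  thus "compose (carrier S) (h \<tau>) (h \<rho>) y = h (compose (carrier R) \<tau> \<rho>) y" using y happ gc[OF y] that g(1) by (simp add: compose_eq)
 qed (auto simp: h_def compose_def)
 have ag: "aut_group S H"
 proof
  show "finite H" using finite_G by (simp add: H_def)
  show "(\<lambda>x\<in>carrier S. x) : H"
  proof -
   have "(\<lambda>x\<in>carrier S. x) = h (\<lambda>x\<in>carrier R. x)" by (rule extensionalityI) (auto simp: h_def gc fg)
   thus ?thesis using aut_id unfolding H by blast
  qed
  fix a assume "a : H"
  then obtain \<tau> where t: "\<tau> : G" "a = h \<tau>" by (auto simp: H)
  show "a : extensional (carrier S)" by (simp add: t h_def)
  show "a : ring_hom S S"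
  proof (rule ring_hom_memI)
   fix x y assume xy: "x : carrier S" "y : carrier S"
   note ggx = gc[OF xy(1)] gc[OF xy(2)]
   show "a x : carrier S" using xy happ t fc ggx by simp
   show "a (x \<otimes>\<^bsub>S\<^esub> y) = a x \<otimes>\<^bsub>S\<^esub> a y" using xy happ t gmult ggx ring_hom_mult[OF f] by (simp add: aut_mult)
   show "a (x \<oplus>\<^bsub>S\<^esub> y) = a x \<oplus>\<^bsub>S\<^esub> a y" using xy happ t gadd ggx ring_hom_add[OF f] by (simp add: aut_add)
  next
   show "a \<one>\<^bsub>S\<^esub> = \<one>\<^bsub>S\<^esub>" using happ t fo g(1)[of \<one>] by simp
  qed
  fix b assume "b : H"
  then obtain \<rho> where r: "\<rho> : G" "b = h \<rho>" by (auto simp: H)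
  show "compose (carrier S) a b : H" using hcomp[OF t(1) r(1)] aut_comp[OF t(1) r(1)] t r by (simp add: H)
 qed
 then interpret H: aut_group S H .
 show fixH: "fixed_field S H = f ` K"
 proof
  show "f ` K \<subseteq> fixed_field S H" using fc g(1) happ by (auto simp: fixed_field_def H)
  show "fixed_field S H \<subseteq> f ` K"
  proof
   fix y assume y: "y : fixed_field S H"
   hence yc: "y : carrier S" by (simp add: fixed_field_def)
   have "\<tau> (g y) = g y" if "\<tau> : G" for \<tau>
   proof -
    have "f (\<tau> (g y)) = y" using y that happ[OF yc] by (auto simp: fixed_field_def H)
    thus ?thesis using g(1)[of "\<tau> (g y)"] gc[OF yc] that by simp
   qed
   hence "g y : K" using gc[OF yc] by (simp add: fixed_field_def)
   thus "y : f ` K" using fg[OF yc] by (metis imageI)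
  qed
 qed
 have "inj_on h G"
 proof (rule inj_onI)
  fix \<tau> \<rho> assume t: "\<tau> : G" "\<rho> : G" "h \<tau> = h \<rho>"
  have "\<tau> x = \<rho> x" if x: "x : carrier R" for x
  proof -
   have "h \<tau> (f x) = h \<rho> (f x)" using t by simp
   hence "f (\<tau> x) = f (\<rho> x)" using happ[OF fc[OF x]] g(1)[OF x] by simp
   hence "g (f (\<tau> x)) = g (f (\<rho> x))" by simp
   thus ?thesis using g(1)[of "\<tau> x"] g(1)[of "\<rho> x"] t(1,2) x by simp
  qed
  thus "\<tau> = \<rho>" by (rule aut_eqI[OF t(1,2)])
 qed
 thus card: "card H = card G" by (simp add: H card_image)
 have ab: "ab_aut_group S H"
 proof
  fix a b x assume "a : H" "b : H" and x: "x : carrier S"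
  then obtain \<tau> \<rho> where t: "\<tau> : G" "a = h \<tau>" "\<rho> : G" "b = h \<rho>" by (auto simp: H)
  have c: "f (\<tau> (g x)) : carrier S" "f (\<rho> (g x)) : carrier S" using t fc gc[OF x] by auto
  show "a (b x) = b (a x)" using t happ[OF x] happ[OF c(1)] happ[OF c(2)] g(1) aut_commute[OF t(1,3) gc[OF x]] gc[OF x] by simp
 qed
 show "ab_ram_aut S H (v \<circ> g)"
 proof (intro ab_ram_aut.intro ab ram_aut.intro ag valuation.intro S valuation_axioms.intro ram_aut_axioms.intro)
  fix x y assume xy: "x : carrier S - {\<zero>\<^bsub>S\<^esub>}" "y : carrier S - {\<zero>\<^bsub>S\<^esub>}"
  thus "(v \<circ> g) (x \<otimes>\<^bsub>S\<^esub> y) = (v \<circ> g) x + (v \<circ> g) y" using gmult gnz gc v_mult by auto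
  assume "x \<oplus>\<^bsub>S\<^esub> y ~= \<zero>\<^bsub>S\<^esub>"
  thus "min ((v \<circ> g) x) ((v \<circ> g) y) \<le> (v \<circ> g) (x \<oplus>\<^bsub>S\<^esub> y)" using xy gadd gnz gc v_add[of "g x" "g y"] gnz[of "x \<oplus>\<^bsub>S\<^esub> y"] by auto
 next
  fix x assume "x : fixed_field S H - {\<zero>\<^bsub>S\<^esub>}"
  then obtain x' where "x' : K" "x = f x'" "x' ~= \<zero>" using fixH fz by auto
  thus "int (card H) dvd (v \<circ> g) x" using v_K[of x'] g(1) Kc(2) card by simp
 next
  obtain x where x: "x : K" "x ~= \<zero>" "v x = int n" using v_K_gen by blast
  have xc: "x : carrier R" using x Kc(2) by simp
  show "\<exists>x\<in>fixed_field S H - {\<zero>\<^bsub>S\<^esub>}. (v \<circ> g) x = int (card H)"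
   using x fnz[OF xc x(2)] g(1)[OF xc] fixH card by (intro bexI[of _ "f x"]) auto
 next
  obtain x where x: "x : carrier R" "x ~= \<zero>" "v x = 1" using v_unif by blast
  show "\<exists>x\<in>carrier S - {\<zero>\<^bsub>S\<^esub>}. (v \<circ> g) x = 1" using x fnz[OF x(1,2)] g(1)[OF x(1)] fc by (intro bexI[of _ "f x"]) auto
 qed
 assume N: "submodule N"
 note Nd = submoduleD[OF N]
 show "H.submodule (f ` N)" unfolding H.submodule_def fixH
 proof (intro conjI ballI)
  show "f ` N \<subseteq> carrier S" using Nd(2) fc by auto
  show "\<zero>\<^bsub>S\<^esub> : f ` N" using Nd(3) fz by (metis imageI)
  fix x assume "x : f ` N"
  then obtain x' where x': "x' : N" "x = f x'" by blast
  show "x \<oplus>\<^bsub>S\<^esub> y : f ` N" if y: "y : f ` N" for y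
  proof -
   obtain y' where y': "y' : N" "y = f y'" using y by blast
   show ?thesis using ring_hom_add[OF f Nd(2)[OF x'(1)] Nd(2)[OF y'(1)]] Nd(4)[OF x'(1) y'(1)] x' y' by (metis imageI)
  qed
  show "c \<otimes>\<^bsub>S\<^esub> x : f ` N" if c: "c : f ` K" for c
  proof -
   obtain c' where c': "c' : K" "c = f c'" using c by blast
   show ?thesis using ring_hom_mult[OF f Kc(2)[OF c'(1)] Nd(2)[OF x'(1)]] Nd(5)[OF c'(1) x'(1)] x' c' by (metis imageI)
  qed
  show "a x : f ` N" if a: "a : H" for a
  proof -
   obtain \<tau> where t: "\<tau> : G" "a = h \<tau>" using a by (auto simp: H)
   show ?thesis using happ[OF fc[OF Nd(2)[OF x'(1)]]] g(1)[OF Nd(2)[OF x'(1)]] Nd(6)[OF t(1) x'(1)] t x' by simp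
  qed
 qed
qed

text \<open>A \<open>p\<close>-th root of unity generates an extension of \<open>K\<close> of degree
  \<open>d\<close> with \<open>1 < d < p\<close>. Over the whole field it still has degree
  \<open>d\<close>, since that field has degree a power of \<open>p\<close> over \<open>K\<close>;
  so the descent applies.\<close>

theorem units_without_roots:
 assumes p: "prime p" and card_G: "card G = p ^ k" "k > 0"
  and complete: "!!s. [|!!i::nat. s i : carrier R; !!n. \<exists>N. \<forall>i\<ge>N. \<forall>j\<ge>N. val_ge R v n (s i \<ominus> s j)|]
    ==> \<exists>l\<in>carrier R. \<forall>n. \<exists>N. \<forall>i\<ge>N. val_ge R v n (s i \<ominus> l)" and roots: "!!x. x : K ==> x [^] p = \<one> ==> x = \<one>"
  and char: "[p] \<cdot> \<one> ~= \<zero>" "vge 1 ([p] \<cdot> \<one>)"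
 shows "units_in_submodules"
proof -
 let ?f = "indexed_const :: 'a \<Rightarrow> ('a list \<times> nat) multiset \<Rightarrow> 'a"
 interpret M: algebraic_closure alg_closure "?f ` carrier R" by (rule alg_closureE(1))
 define L where "L = ?f ` carrier R"
 have fM: "?f : ring_hom R alg_closure" by (rule alg_closureE(2))
 have L: "subfield L alg_closure" unfolding L_def by (rule M.subfield_axioms)
 note Lc = M.subfield_closed[OF L]
 let ?L = "alg_closure\<lparr>carrier := L\<rparr>"
 interpret LF: field ?L using M.subfield_iff(2)[OF L] .
 have f: "?f : ring_hom R ?L" using fM by (intro ring_hom_memI) (auto simp: L_def ring_hom_mult ring_hom_add ring_hom_one)
 define g where "g = the_inv_into (carrier R) ?f"
 have g: "g (?f x) = x" if "x : carrier R" for x unfolding g_def by (rule the_inv_into_f_f[OF indexed_const_inj_on that])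
 have g': "g y : carrier R \<and> ?f (g y) = y" if "y : carrier ?L" for y using that g by (auto simp: L_def)
 define H where "H = (\<lambda>\<tau>. \<lambda>y\<in>carrier ?L. ?f (\<tau> (g y))) ` G"
 note T = transport[OF LF.field_axioms f g g', folded H_def]
 define K' where "K' = ?f ` K"
 have fixH: "fixed_field ?L H = K'" using T(2) by (simp add: K'_def)
 interpret H: ab_ram_aut ?L H "v \<circ> g" by (rule T(1))
 have cardH: "card H = p ^ k" using T(3) card_G by simp
 have K'L: "K' \<subseteq> L" using Kc(1) by (auto simp: K'_def L_def)
 have K': "subfield K' alg_closure"
 proof -
  have "field (?L\<lparr>carrier := K'\<rparr>)" using LF.subfield_iff(2)[OF H.fixed_subfield] by (simp add: fixH)
  hence "field (alg_closure\<lparr>carrier := K'\<rparr>)" by simp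
  moreover have "K' \<subseteq> carrier alg_closure" using K'L Lc(1) by auto
  ultimately show ?thesis using M.subfield_iff(1) by blast
 qed
 note Kc' = M.subfield_closed[OF K']
 have fone: "?f \<one> = \<one>\<^bsub>alg_closure\<^esub>" using ring_hom_one[OF fM] .
 have fzero: "?f \<zero> = \<zero>\<^bsub>alg_closure\<^esub>" using ring_hom_zero[OF fM ring_axioms M.ring_axioms] .
 have fnat: "?f ([i] \<cdot> \<one>) = [i] \<cdot>\<^bsub>alg_closure\<^esub> \<one>\<^bsub>alg_closure\<^esub>" for i :: nat by (induct i) (auto simp: fzero fone ring_hom_add[OF fM])
 have fpow: "?f (x [^] (i::nat)) = ?f x [^]\<^bsub>alg_closure\<^esub> i" if "x : carrier R" for x i
  using that by (induct i) (auto simp: fone ring_hom_mult[OF fM])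
 have p1: "p > 1" "p > 0" using p prime_gt_1_nat prime_gt_0_nat by auto
 have charM: "[p] \<cdot>\<^bsub>alg_closure\<^esub> \<one>\<^bsub>alg_closure\<^esub> ~= \<zero>\<^bsub>alg_closure\<^esub>"
 proof
  assume "[p] \<cdot>\<^bsub>alg_closure\<^esub> \<one>\<^bsub>alg_closure\<^esub> = \<zero>\<^bsub>alg_closure\<^esub>"
  hence "?f ([p] \<cdot> \<one>) = ?f \<zero>" using fnat fzero by simp
  hence "g (?f ([p] \<cdot> \<one>)) = g (?f \<zero>)" by simp
  thus False using g[of "[p] \<cdot> \<one>"] g[of \<zero>] char by simp
 qed
 obtain \<zeta> \<Phi> where z0: "\<zeta> : carrier alg_closure" and zord: "!!i::nat. \<zeta> [^]\<^bsub>alg_closure\<^esub> i = \<one>\<^bsub>alg_closure\<^esub> \<longleftrightarrow> p dvd i"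
  and \<Phi>: "\<Phi> : carrier (K'[X]\<^bsub>alg_closure\<^esub>)" "\<Phi> ~= []" "degree \<Phi> = p - 1" and ev: "M.eval \<Phi> \<zeta> = \<zero>\<^bsub>alg_closure\<^esub>"
  using M.prime_root_of_unity[OF p charM K' M.roots_over_carrier] by blast
 note z = z0 ev
 have zp: "\<zeta> [^]\<^bsub>alg_closure\<^esub> p = \<one>\<^bsub>alg_closure\<^esub>" and z1: "\<zeta> ~= \<one>\<^bsub>alg_closure\<^esub>" using zord[of p] zord[of 1] z(1) p1 by auto
 have zK: "\<zeta> \<notin> K'"
 proof
  assume "\<zeta> : K'"
  then obtain x where x: "x : K" "\<zeta> = ?f x" by (auto simp: K'_def)
  have xc: "x : carrier R" using x Kc by auto
  have "?f (x [^] p) = ?f \<one>" using fpow[OF xc] zp x(2) fone by simp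
  hence "g (?f (x [^] p)) = g (?f \<one>)" by simp
  hence "x [^] p = \<one>" using g[of "x [^] p"] g[of \<one>] xc by simp
  hence "x = \<one>" using roots x(1) by simp
  thus False using x(2) fone z1 by simp
 qed
 define C where "C = {i\<in>{..<p}. M.eval (M.Irr K' \<zeta>) (\<zeta> [^]\<^bsub>alg_closure\<^esub> i) = \<zero>\<^bsub>alg_closure\<^esub>}"
 note conj = M.root_of_unity_conjugates[OF K' p1(2) z(1) zord, folded C_def]
 note alg = conj(1)
 define d where "d = degree (M.Irr K' \<zeta>)"
 have zpow: "\<zeta> [^]\<^bsub>alg_closure\<^esub> (i::nat) : carrier alg_closure" for i using z by simp
 have dp: "d \<le> p - 1" unfolding d_def \<Phi>(3)[symmetric]
  by (rule M.pdivides_imp_degree_le[OF subfieldE(1)[OF K'] M.IrrE(1)[OF K' z(1) alg] \<Phi>(1,2) M.Irr_minimal[OF K' z(1) alg \<Phi>(1) z(2)]])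
 have d0: "d > 0" using M.pirreducible_degree[OF K' M.IrrE(1,2)[OF K' z(1) alg]] by (simp add: d_def)
 have d1: "d > 1"
 proof (rule ccontr)
  assume "\<not> ?thesis"
  hence d: "d = 1" using d0 by simp
  have "\<zeta> : M.simple_extension K' \<zeta>" by (rule M.simple_extension_mem[OF subfieldE(1)[OF K'] z(1)])
  then obtain c where "\<forall>j<d. c j : K'" "\<zeta> = (\<Oplus>\<^bsub>alg_closure\<^esub>j\<in>{..<d}. c j \<otimes>\<^bsub>alg_closure\<^esub> \<zeta> [^]\<^bsub>alg_closure\<^esub> j)"
   using M.simple_extension_expand(1)[OF K' z(1) alg] unfolding d_def by blast
  moreover have "{..<d} = {0}" using d by auto
  ultimately have "\<zeta> = c 0" "c 0 : K'" using d Kc'(2) by auto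
  thus False using zK by simp
 qed
 have "ring.dimension ?L (card H) K' L" using H.artin_dimension by (simp add: fixH)
 hence dimL: "M.dimension (card H) K' L" using M.dimension_subring[OF subfieldE(1)[OF L]] by blast
 have "\<not> p dvd d" using d0 dp p1 by (auto dest: dvd_imp_le)
 hence cop: "coprime (card H) d" using prime_imp_coprime[OF p] by (simp add: cardH)
 have dL: "degree (M.Irr L \<zeta>) = d"
  unfolding d_def by (rule M.coprime_degree_Irr[OF K' L K'L dimL _ z(1) alg]) (use cop d_def cardH p1 in auto)
 have algL: "(M.algebraic over L) \<zeta>" using M.algebraic_mono[OF K'L alg] .
 define S where "S = M.simple_extension L \<zeta>"
 have S: "subfield S alg_closure" unfolding S_def using M.simple_extension_is_subfield[OF L z(1)] algL by blast
 note Sc = M.subfield_closed[OF S]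
 have LS: "L \<subseteq> S" unfolding S_def by (rule M.simple_extension_incl[OF Lc(1) z(1)])
 have zS: "\<zeta> : S" unfolding S_def by (rule M.simple_extension_mem[OF subfieldE(1)[OF L] z(1)])
 let ?S = "alg_closure\<lparr>carrier := S\<rparr>"
 interpret SF: field ?S using M.subfield_iff(2)[OF S] .
 have powS: "x [^]\<^bsub>?S\<^esub> (i::nat) = x [^]\<^bsub>alg_closure\<^esub> i" for x i by (rule M.nat_pow_consistent_field)
 have sumS: "(\<Oplus>\<^bsub>?S\<^esub>a\<in>A. h a) = (\<Oplus>\<^bsub>alg_closure\<^esub>a\<in>A. h a)" if "finite A" "!!a. a : A ==> h a : S" for h and A :: "nat set"
  by (rule M.finsum_subfield[OF S that])
 have fminus: "?f (x \<ominus> y) = ?f x \<ominus>\<^bsub>alg_closure\<^esub> ?f y" if "x : carrier R" "y : carrier R" for x y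
 proof -
  interpret fh: ring_hom_ring R alg_closure ?f using fM ring_axioms M.ring_axioms by (simp add: ring_hom_ring_def ring_hom_ring_axioms_def)
  show ?thesis using that by (simp add: a_minus_def)
 qed
 have gminus: "g (x \<ominus>\<^bsub>alg_closure\<^esub> y) = g x \<ominus> g y" if "x : L" "y : L" for x y
  using g[of "g x \<ominus> g y"] fminus[of "g x" "g y"] g'[of x] g'[of y] that by simp
 have gzero: "g z = \<zero> \<longleftrightarrow> z = \<zero>\<^bsub>alg_closure\<^esub>" if "z : L" for z using g[of \<zero>] g'[of z] that fzero by auto
 have vgL: "val_ge R v a (g z) \<longleftrightarrow> val_ge alg_closure (v \<circ> g) a z" if "z : L" for a z using gzero[OF that] by (simp add: val_ge_def)
 have zSp: "\<zeta> [^]\<^bsub>alg_closure\<^esub> (j::nat) : S" for j using Sc(10)[OF zS] .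
 have carr: "?S\<lparr>carrier := L\<rparr> = ?L" by simp
 have CE: "complete_extension ?S L (v \<circ> g) d \<zeta> p" unfolding S_def dL[symmetric]
 proof (rule M.complete_simple_extension[OF L z(1) algL zp p1(2) H.valuation_axioms])
  show "\<exists>t\<in>L - {\<zero>\<^bsub>alg_closure\<^esub>}. (v \<circ> g) t = 1" using H.v_unif by simp
  fix s :: "nat \<Rightarrow> _" assume s: "!!i. s i : L" "!!n. \<exists>N. \<forall>i\<ge>N. \<forall>j\<ge>N. val_ge alg_closure (v \<circ> g) n (s i \<ominus>\<^bsub>alg_closure\<^esub> s j)"
  have eq: "val_ge alg_closure (v \<circ> g) n (s i \<ominus>\<^bsub>alg_closure\<^esub> y) \<longleftrightarrow> val_ge R v n (g (s i) \<ominus> g y)" if "y : L" for n i y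
   using vgL[OF Lc(8)[OF s(1) that], of n i] gminus[OF s(1) that, of i] by simp
  have gs: "g (s i) : carrier R" for i using g'[of "s i"] s(1) by simp
  have "\<exists>N. \<forall>i\<ge>N. \<forall>j\<ge>N. val_ge R v n (g (s i) \<ominus> g (s j))" for n using s(2)[of n] eq[OF s(1)] by simp
  then obtain l where l: "l : carrier R" "\<forall>n. \<exists>N. \<forall>i\<ge>N. val_ge R v n (g (s i) \<ominus> l)" using complete[of "\<lambda>i. g (s i)"] gs by blast
  have "?f l : L" "g (?f l) = l" using l g by (auto simp: L_def)
  thus "\<exists>l\<in>L. \<forall>n. \<exists>N. \<forall>i\<ge>N. val_ge alg_closure (v \<circ> g) n (s i \<ominus>\<^bsub>alg_closure\<^esub> l)" using l(2) eq[of "?f l"] by (intro bexI[of _ "?f l"]) auto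
 qed
 have ex: "\<exists>c. (\<forall>j. c j : K') \<and> (\<forall>a\<in>C. \<zeta> [^]\<^bsub>alg_closure\<^esub> (a * i) =
   (\<Oplus>\<^bsub>alg_closure\<^esub>j\<in>{..<d}. c j \<otimes>\<^bsub>alg_closure\<^esub> \<zeta> [^]\<^bsub>alg_closure\<^esub> (a * j)))" for i
  unfolding d_def by (rule M.conjugate_expand[OF K' z(1) alg]) (use conj(3) in blast)
 obtain kk where kk': "\<forall>i. (\<forall>j. kk i j : K') \<and> (\<forall>a\<in>C. \<zeta> [^]\<^bsub>alg_closure\<^esub> (a * i) =
   (\<Oplus>\<^bsub>alg_closure\<^esub>j\<in>{..<d}. kk i j \<otimes>\<^bsub>alg_closure\<^esub> \<zeta> [^]\<^bsub>alg_closure\<^esub> (a * j)))" using choice[OF allI[OF ex]] by (rule exE)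
 have kk: "kk i j : K'" "a : C ==> \<zeta> [^]\<^bsub>alg_closure\<^esub> (a * i) =
   (\<Oplus>\<^bsub>alg_closure\<^esub>j\<in>{..<d}. kk i j \<otimes>\<^bsub>alg_closure\<^esub> \<zeta> [^]\<^bsub>alg_closure\<^esub> (a * j))" for i j a using kk'[THEN spec, of i] by (blast, blast)
 have vS: "val_ge ?S (v \<circ> g) 1 z \<longleftrightarrow> val_ge alg_closure (v \<circ> g) 1 z" for z by (simp add: val_ge_def)
 have natS: "[i] \<cdot>\<^bsub>?S\<^esub> \<one>\<^bsub>?S\<^esub> = [i] \<cdot>\<^bsub>alg_closure\<^esub> \<one>\<^bsub>alg_closure\<^esub>" for i :: nat by (induct i) auto
 have cyc: "cyclotomic ?S L (v \<circ> g) d \<zeta> p H k C kk"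
 proof (intro cyclotomic.intro CE cyclotomic_axioms.intro)
  show "ab_ram_aut (?S\<lparr>carrier := L\<rparr>) H (v \<circ> g)" unfolding carr by (rule H.ab_ram_aut_axioms)
  show "prime p" "card H = p ^ k" "0 < k" by (fact p, fact cardH, fact card_G(2))
  show "\<zeta> [^]\<^bsub>?S\<^esub> i = \<one>\<^bsub>?S\<^esub> \<longleftrightarrow> p dvd i" for i using zord by (simp add: powS)
  show "1 < d" "d < p" using d1 dp p1 by auto
  show "C \<subseteq> {..<p}" "card C = d" using conj(2) by (auto simp: C_def d_def)
  show "1 : C" using p1 M.IrrE(4)[OF K' z(1) alg] z(1) by (simp add: C_def)
  show "kk i j : fixed_field (?S\<lparr>carrier := L\<rparr>) H" for i j unfolding carr fixH by (rule kk(1))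
  show "\<zeta> [^]\<^bsub>?S\<^esub> (c * i) = (\<Oplus>\<^bsub>?S\<^esub>j\<in>{..<d}. kk i j \<otimes>\<^bsub>?S\<^esub> \<zeta> [^]\<^bsub>?S\<^esub> (c * j))" if "c : C" for c i
  proof -
   have t: "kk i j \<otimes>\<^bsub>alg_closure\<^esub> \<zeta> [^]\<^bsub>alg_closure\<^esub> (c * j) : S" for j by (rule Sc(6)[OF subsetD[OF LS subsetD[OF K'L kk(1)]] zSp])
   have "(\<Oplus>\<^bsub>?S\<^esub>j\<in>{..<d}. kk i j \<otimes>\<^bsub>alg_closure\<^esub> \<zeta> [^]\<^bsub>alg_closure\<^esub> (c * j)) = \<zeta> [^]\<^bsub>alg_closure\<^esub> (c * i)"
    unfolding kk(2)[OF that, of i] by (rule sumS[OF finite_lessThan t])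
   thus ?thesis unfolding powS by simp
  qed
  have "val_ge R v 1 (g (?f ([p] \<cdot> \<one>)))" using char(2) g[of "[p] \<cdot> \<one>"] by simp
  moreover have "?f ([p] \<cdot> \<one>) : L" unfolding L_def by (rule imageI) simp
  ultimately show "val_ge ?S (v \<circ> g) 1 ([p] \<cdot>\<^bsub>?S\<^esub> \<one>\<^bsub>?S\<^esub>)" using vgL[of "?f ([p] \<cdot> \<one>)" 1] unfolding fnat natS vS by blast
 qed
 then interpret Cy: cyclotomic ?S L "v \<circ> g" d \<zeta> p H k C kk .
 show ?thesis unfolding units_in_submodules_def
 proof (intro allI impI)
  fix N assume N: "submodule N" "N ~= {\<zero>}"
  have "aut_group.submodule ?L H (?f ` N)" by (rule T(4)) (use N in auto)
  hence sub: "aut_group.submodule (?S\<lparr>carrier := L\<rparr>) H (?f ` N)" unfolding carr .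
  obtain x0 where x0: "x0 : N" "x0 ~= \<zero>" using N(2) submoduleD(3)[OF N(1)] by blast
  have "?f x0 ~= \<zero>\<^bsub>alg_closure\<^esub>" using gzero[of "?f x0"] g[of x0] x0 submoduleD(2)[OF N(1)] by (auto simp: L_def)
  hence "?f ` N ~= {\<zero>\<^bsub>?S\<^esub>}" using x0(1) by auto
  then obtain y where y: "y : ?f ` N" "y ~= \<zero>\<^bsub>?S\<^esub>" "(v \<circ> g) y = 0" using Cy.unit_in_submodule[OF sub] by blast
  then obtain x where "x : N" "y = ?f x" by blast
  thus "\<exists>x\<in>N. x ~= \<zero> \<and> v x = 0" using y fzero g[of x] submoduleD(2)[OF N(1)] by (intro bexI[of _ x]) auto
 qed
qed

end

section \<open>Valuation criterion for local fields\<close>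

lemma (in local_field) valuation: "valuation R v" by (intro valuation.intro field_axioms valuation_axioms.intro val_mult val_add)

text \<open>A multiple \<open>i\<close> of 1 lies in the valuation ideal exactly when
  \<open>p\<close> divides \<open>i\<close>. Factors of \<open>p\<close> not divisible by
  \<open>p\<close> would therefore write an element of positive value as a product of units.\<close>

lemma (in valuation) residue_char:
 assumes p: "p = ring_char (residue_field R v)" "p > 0"
 shows "prime p" "vge 1 ([p] \<cdot> \<one>)"
proof -
 let ?O = "valuation_ring R v" and ?I = "valuation_ideal R v"
 let ?A = "R\<lparr>carrier := ?O\<rparr>"
 have Oc: "x : ?O \<longleftrightarrow> x : carrier R \<and> vge 0 x" and Ic: "x : ?I \<longleftrightarrow> x : carrier R \<and> vge 1 x" for x
  by (auto simp: valuation_ring_def valuation_ideal_def)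
 have IO: "?I \<subseteq> ?O" using Oc Ic vge_mono[of 1 _ 0] by auto
 have one: "vge 0 \<one>" "\<not> vge 1 \<one>" by (auto simp: vge_nonzero)
 have "subring ?O R" using vge_uminus vge_add vge_mult[of _ _ 0 0] one by (intro subringI) (auto simp: Oc)
 then interpret A: ring ?A by (rule subring_is_ring)
 have um: "\<ominus>\<^bsub>?A\<^esub> x = \<ominus> x" if "x : ?O" for x using A.minus_equality[of "\<ominus> x" x] that l_neg[of x] vge_uminus[of x] by (simp add: Oc)
 have "ideal ?I ?A"
 proof (rule idealI)
  show "ring ?A" by (rule A.ring_axioms)
  show "subgroup ?I (add_monoid ?A)"
  proof (rule A.add.subgroupI)
   show "?I \<subseteq> carrier ?A" using IO by simp
   show "?I ~= {}" using Ic[of \<zero>] by auto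
   show "\<ominus>\<^bsub>?A\<^esub> a : ?I" if a: "a : ?I" for a using um[of a] a IO vge_uminus[of a] by (auto simp: Ic)
   show "a \<oplus>\<^bsub>?A\<^esub> b : ?I" if "a : ?I" "b : ?I" for a b using that vge_add by (simp add: Ic)
  qed
  show "x \<otimes>\<^bsub>?A\<^esub> a : ?I" "a \<otimes>\<^bsub>?A\<^esub> x : ?I" if "a : ?I" "x : carrier ?A" for a x
   using that vge_mult[of x a 0 1] vge_mult[of a x 1 0] by (auto simp: Ic Oc)
 qed
 then interpret I: ideal ?I ?A .
 interpret Q: ring "residue_field R v" unfolding residue_field_def by (rule I.quotient_is_ring)
 have nat: "[(i::nat)] \<cdot> \<one> : ?O" for i by (induct i) (use vge_add one in \<open>auto simp: Oc\<close>)
 have natc: "[(i::nat)] \<cdot> \<one> : carrier R" for i using nat Oc by blast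
 have coset: "[i] \<cdot>\<^bsub>residue_field R v\<^esub> \<one>\<^bsub>residue_field R v\<^esub> = ?I +>\<^bsub>?A\<^esub> ([i] \<cdot> \<one>)" for i :: nat
 proof (induct i)
  case 0
  have "[(0::nat)] \<cdot>\<^bsub>residue_field R v\<^esub> \<one>\<^bsub>residue_field R v\<^esub> = \<zero>\<^bsub>residue_field R v\<^esub>" using Q.add.nat_pow_0 by simp
  moreover have "\<zero>\<^bsub>residue_field R v\<^esub> = ?I" by (simp add: residue_field_def FactRing_def)
  ultimately show ?case using I.a_rcos_const[of \<zero>] Ic[of \<zero>] by simp
 next
  case (Suc i)
  have "[Suc i] \<cdot>\<^bsub>residue_field R v\<^esub> \<one>\<^bsub>residue_field R v\<^esub> =
    [i] \<cdot>\<^bsub>residue_field R v\<^esub> \<one>\<^bsub>residue_field R v\<^esub> \<oplus>\<^bsub>residue_field R v\<^esub> \<one>\<^bsub>residue_field R v\<^esub>" by simp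
  also have "\<dots> = (?I +>\<^bsub>?A\<^esub> ([i] \<cdot> \<one>)) <+>\<^bsub>?A\<^esub> (?I +>\<^bsub>?A\<^esub> \<one>)" unfolding Suc by (simp add: residue_field_def FactRing_def)
  also have "\<dots> = ?I +>\<^bsub>?A\<^esub> ([i] \<cdot> \<one> \<oplus> \<one>)" using I.a_rcos_sum[of "[i] \<cdot> \<one>" \<one>] nat[of i] nat[of 1] by simp
  finally show ?case by simp
 qed
 have iff: "[i] \<cdot> \<one> : ?I \<longleftrightarrow> p dvd i" for i :: nat
 proof -
  have "p dvd i \<longleftrightarrow> [i] \<cdot>\<^bsub>residue_field R v\<^esub> \<one>\<^bsub>residue_field R v\<^esub> = \<zero>\<^bsub>residue_field R v\<^esub>"
   using Q.add.pow_eq_id[of "\<one>\<^bsub>residue_field R v\<^esub>" i] p by (simp add: ring_char_def add_pow_def)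
  also have "\<dots> \<longleftrightarrow> ?I +>\<^bsub>?A\<^esub> ([i] \<cdot> \<one>) = ?I" unfolding coset by (simp add: residue_field_def FactRing_def)
  also have "\<dots> \<longleftrightarrow> [i] \<cdot> \<one> : ?I" using I.a_rcos_const[of "[i] \<cdot> \<one>"] I.a_rcos_self[of "[i] \<cdot> \<one>"] nat[of i] by auto
  finally show ?thesis by blast
 qed
 show "vge 1 ([p] \<cdot> \<one>)" using iff[of p] Ic by auto
 have natmult: "[(i * j)] \<cdot> \<one> = [i] \<cdot> \<one> \<otimes> [j] \<cdot> \<one>" for i j :: nat
  using add_pow_ldistr[of \<one> "[j] \<cdot> \<one>" i] add.nat_pow_pow[of \<one> i j] natc by (simp add: mult.commute[of i j])
 have "p ~= 1" using iff[of 1] Ic[of \<one>] one by auto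
 moreover have "p dvd a \<or> p dvd b" if "p = a * b" for a b
 proof (rule ccontr)
  assume n: "\<not> (p dvd a \<or> p dvd b)"
  have "\<not> vge 1 ([i] \<cdot> \<one>) \<and> vge 0 ([i] \<cdot> \<one>)" if "\<not> p dvd i" for i using iff[of i] that Ic natc[of i] nat[of i] Oc by auto
  hence nv: "[i] \<cdot> \<one> ~= \<zero> \<and> v ([i] \<cdot> \<one>) = 0" if "\<not> p dvd i" for i using that by (fastforce simp: val_ge_def)
  have "[p] \<cdot> \<one> = [a] \<cdot> \<one> \<otimes> [b] \<cdot> \<one>" using natmult that by simp
  moreover have "v ([a] \<cdot> \<one> \<otimes> [b] \<cdot> \<one>) = 0" "[a] \<cdot> \<one> \<otimes> [b] \<cdot> \<one> ~= \<zero>"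
   using nv[of a] nv[of b] n v_mult[of "[a] \<cdot> \<one>" "[b] \<cdot> \<one>"] natc integral_iff by auto
  ultimately show False using \<open>vge 1 ([p] \<cdot> \<one>)\<close> by (simp add: vge_nonzero)
 qed
 ultimately show "prime p"
  using p(2) by (auto simp: prime_nat_iff elim!: dvdE) (metis dvd_antisym dvd_triv_left dvd_triv_right mult_is_0 nat_mult_eq_cancel1 mult.right_neutral neq0_conv)
qed

context ram_aut
begin

lemma ram_index_eq: "ram_index R v K = int n"
proof -
 obtain x where x: "x : K - {\<zero>}" "v x = int n" using v_K_gen by blast
 have "ram_index R v K dvd int n" using x by (auto simp: ram_index_def intro!: Gcd_dvd image_eqI[of _ _ x])
 moreover have "int n dvd ram_index R v K" unfolding ram_index_def using v_K by (intro Gcd_greatest) auto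
 ultimately show ?thesis by (intro zdvd_antisym_nonneg) (auto simp: ram_index_def)
qed

text \<open>On elements of \<open>K\<close>, integrality for the valuation divided by
  \<open>n\<close> is integrality for \<open>v\<close>. So the codifferent is
  \<open>inv_diff\<close>, and the different consists of the elements of value at least
  \<open>dif\<close>.\<close>

lemma different_exponent_eq: "different_exponent R v K = dif"
proof -
 have tr: "galois_trace R K y = tr y" for y by (simp add: galois_trace_def tr_def galois_group_eq)
 have sub: "x : valuation_ring (R\<lparr>carrier := K\<rparr>) (sub_valuation R v K) \<longleftrightarrow> x : K \<and> vge 0 x" for x
  using n0 by (auto simp: valuation_ring_def val_ge_def sub_valuation_def ram_index_eq pos_imp_zdiv_nonneg_iff)
 have cod: "codifferent R v K = inv_diff"
  using tr_fixed Kc(2) unfolding codifferent_def inv_diff_def tr sub by (auto simp: valuation_ring_def)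
 have "different R v K - {\<zero>} = {x : carrier R - {\<zero>}. dif \<le> v x}"
 proof (intro Set.set_eqI iffI)
  fix x assume x: "x : different R v K - {\<zero>}"
  obtain y where y: "y : carrier R" "y ~= \<zero>" "v y = - dif" using ex_val by blast
  hence "y : inv_diff" using inv_diff_iff by simp
  hence "vge 0 (x \<otimes> y)" using x by (auto simp: different_def cod valuation_ring_def)
  thus "x : {x : carrier R - {\<zero>}. dif \<le> v x}" using x y integral_iff[of x y] by (auto simp: different_def vge_nonzero v_mult)
 next
  fix x assume x: "x : {x : carrier R - {\<zero>}. dif \<le> v x}"
  have "x \<otimes> y : valuation_ring R v" if y: "y : inv_diff" for y
  proof (cases "y = \<zero>")
   case False
   have yc: "y : carrier R" using y by (simp add: inv_diff_def)
   hence "- dif \<le> v y" using inv_diff_iff y False by simp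
   thus ?thesis using x yc False by (auto simp: valuation_ring_def val_ge_def v_mult)
  qed (use x in \<open>auto simp: valuation_ring_def\<close>)
  thus "x : different R v K - {\<zero>}" using x by (auto simp: different_def cod)
 qed
 moreover have "v ` {x : carrier R - {\<zero>}. dif \<le> v x} = {dif..}"
 proof
  show "{dif..} \<subseteq> v ` {x : carrier R - {\<zero>}. dif \<le> v x}"
  proof
   fix i assume "i : {dif..}"
   moreover obtain x where "x : carrier R" "x ~= \<zero>" "v x = i" using ex_val by blast
   ultimately show "i : v ` {x : carrier R - {\<zero>}. dif \<le> v x}" by (intro image_eqI[of _ _ x]) auto
  qed
 qed auto
 ultimately show ?thesis by (simp add: different_exponent_def)
qed

theorem VC_iff_units: "VC R v K \<longleftrightarrow> units_in_submodules" unfolding VC_def ram_index_eq different_exponent_eq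
 using normal_if_units units_if_normal by auto

lemma unit_if_fixed:
 assumes N: "submodule N" and y: "y : N" "y ~= \<zero>" "y : K"
 shows "\<exists>x\<in>N. x ~= \<zero> \<and> v x = 0"
proof -
 have "inv y \<otimes> y : N" using submoduleD(5)[OF N] Kc(9) y by blast
 hence "\<one> : N" using y Kc(2) by simp
 thus ?thesis by (intro bexI[of _ \<one>]) auto
qed

end

lemma (in aut_group) group_exponent_properties:
 "group_exponent GG > 0" "!!g. g : G ==> g \<up> group_exponent GG = \<one>\<^bsub>GG\<^esub>" "group_exponent GG dvd card G"
 "!!l. [|0 < l; l < group_exponent GG|] ==> \<exists>g\<in>G. g \<up> l ~= \<one>\<^bsub>GG\<^esub>"
proof -
 let ?P = "\<lambda>n. 0 < n \<and> (\<forall>g\<in>carrier GG. g \<up> (n::nat) = \<one>\<^bsub>GG\<^esub>)"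
 define m where "m = group_exponent GG"
 have "card G > 0" using finite_G aut_id card_gt_0_iff by blast
 hence P: "?P (card G)" using GG.pow_order_eq_1 by (simp add: order_def)
 have m: "?P m" unfolding m_def group_exponent_def by (rule LeastI[of ?P, OF P])
 have least: "\<not> ?P l" if "l < m" for l using that not_less_Least[of l ?P] unfolding m_def group_exponent_def by blast
 show "group_exponent GG > 0" "!!g. g : G ==> g \<up> group_exponent GG = \<one>\<^bsub>GG\<^esub>" using m by (auto simp: m_def)
 show "!!l. [|0 < l; l < group_exponent GG|] ==> \<exists>g\<in>G. g \<up> l ~= \<one>\<^bsub>GG\<^esub>" using least by (auto simp: m_def)
 \<comment> \<open>The remainder annihilates the group as well, so minimality of the exponent makes
   it 0.\<close>
 let ?c = "card G mod m"
 have "g \<up> ?c = \<one>\<^bsub>GG\<^esub>" if g: "g : carrier GG" for g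
 proof -
  have "GG.ord g dvd m" "GG.ord g dvd card G" using m P g GG.pow_eq_id[OF g] by auto
  hence "GG.ord g dvd ?c" by (simp add: dvd_mod)
  thus ?thesis using GG.pow_eq_id[OF g] by simp
 qed
 hence "?c = 0" using least[of ?c] m by auto
 thus "group_exponent GG dvd card G" by (simp add: m_def dvd_eq_mod_eq_0)
qed

theorem theorem2:
 fixes L :: "('a, 'b) ring_scheme" (structure) and v :: "'a \<Rightarrow> int" and K :: "'a set" and p m r :: nat
 assumes "local_field_extension L v K" and "abelian_extension L K" and "totally_ramified L v K"
  and "p = ring_char (residue_field (L\<lparr>carrier := K\<rparr>) (sub_valuation L v K))" and "0 < p" and "\<exists>k. ring.dimension L (p ^ k) K (carrier L)"
  and "m = group_exponent (galois_group L K)" and "r = card {x \<in> K. x [^] m = \<one>}" and "p = 2 \<and> 8 dvd m \<longrightarrow> r \<noteq> 2"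
 shows "VC L v K \<longleftrightarrow> (\<forall>E F. subfield E L \<and> subfield F L \<and> K \<subseteq> E \<and> E \<subseteq> F \<and> cyclic_extension (L\<lparr>carrier := F\<rparr>) E r \<longrightarrow>
      unit_root_kummer_extension (L\<lparr>carrier := F\<rparr>) E (sub_valuation L v E))"
proof -
 interpret LF: local_field L v using assms(1) by (simp add: local_field_extension_def)
 have K: "subfield K L" and KF: "local_field (L\<lparr>carrier := K\<rparr>) (sub_valuation L v K)"
  using assms(1) by (auto simp: local_field_extension_def)
 have gal: "galois_extension L K" and comm: "comm_group (galois_group L K)" using assms(2) by (auto simp: abelian_extension_def)
 define G where "G = carrier (galois_group L K)"
 have fK: "fixed_field L G = K" unfolding G_def by (rule galois_extensionD(2)[OF gal])
 interpret A: aut_group L G unfolding G_def by (rule galois_extensionD(1)[OF gal])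
 interpret VL: valuation L v by (rule LF.valuation)
 note Kc = LF.subfield_closed[OF K]
 have ab: "ab_aut_group L G"
 proof
  fix g h x assume gh: "g : G" "h : G" and x: "x : carrier L"
  have "g \<otimes>\<^bsub>galois_group L K\<^esub> h = h \<otimes>\<^bsub>galois_group L K\<^esub> g" using comm_groupE(4)[OF comm] gh by (simp add: G_def)
  thus "g (h x) = h (g x)" using A.mult_apply[OF gh x] A.mult_apply[OF gh(2,1) x] unfolding fK by simp
 qed
 \<comment> \<open>Dimensions are unique, so the degree occurring in \<open>totally_ramified\<close>
   is \<open>card G\<close> by Artin's theorem.\<close>
 have ram: "ram_index L v K = int (card G)"
  using assms(3) LF.dimension_is_inj[OF K] A.artin_dimension unfolding totally_ramified_def fK by auto
 have cG: "card G > 0" using A.finite_G A.aut_id card_gt_0_iff by blast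
 have "ram_aut L G v"
 proof (intro ram_aut.intro A.aut_group_axioms VL.valuation_axioms ram_aut_axioms.intro)
  show "int (card G) dvd v x" if "x : fixed_field L G - {\<zero>}" for x
   using that unfolding fK ram[symmetric] ram_index_def by (intro Gcd_dvd) auto
  show "\<exists>x\<in>carrier L - {\<zero>}. v x = 1" using LF.val_normalized by (metis UNIV_I imageE)
  \<comment> \<open>If all values were 0, their \<open>Gcd\<close> would be 0, against a positive
    ramification index; a positive value makes the \<open>Gcd\<close> an actual value.\<close>
  have "\<exists>x\<in>K - {\<zero>}. v x > 0"
  proof (rule ccontr)
   assume no: "\<not> ?thesis"
   have "v x = 0" if x: "x : K - {\<zero>}" for x
    using no[simplified, rule_format, of x] no[simplified, rule_format, of "inv x"] x Kc(2,9) VL.v_inv[of x] by force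
   hence "ram_index L v K = 0" by (auto simp: ram_index_def Gcd_0_iff)
   thus False using ram cG by simp
  qed
  hence "Gcd (v ` (K - {\<zero>})) : v ` (K - {\<zero>})" using VL.Gcd_values(1)[OF K] by blast
  thus "\<exists>x\<in>fixed_field L G - {\<zero>}. v x = int (card G)" unfolding fK using ram by (auto simp: ram_index_def)
 qed
 then interpret AR: ab_ram_aut L G v using ab by (rule ab_ram_aut.intro[rotated])
 interpret KV: valuation "L\<lparr>carrier := K\<rparr>" "sub_valuation L v K" by (rule local_field.valuation[OF KF])
 have p: "prime p" using KV.residue_char(1) assms(4,5) by blast
 have natK: "[i] \<cdot>\<^bsub>L\<lparr>carrier := K\<rparr>\<^esub> \<one>\<^bsub>L\<lparr>carrier := K\<rparr>\<^esub> = [i] \<cdot> \<one>" for i :: nat by (induct i) auto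
 \<comment> \<open>A positive value over \<open>K\<close> is at least \<open>card G\<close> in the
   extension, in particular at least 1.\<close>
 have vp: "val_ge L v 1 ([p] \<cdot> \<one>)"
 proof (cases "[p] \<cdot> \<one> = \<zero>")
  case False
  hence "1 \<le> v ([p] \<cdot> \<one>) div int (card G)"
   using KV.residue_char(2)[OF assms(4,5)] unfolding natK by (simp add: val_ge_def sub_valuation_def ram)
  hence "int (card G) * 1 \<le> int (card G) * (v ([p] \<cdot> \<one>) div int (card G))" by (intro mult_left_mono) auto
  also have "\<dots> \<le> v ([p] \<cdot> \<one>)"
   using mult_div_mod_eq[of "int (card G)" "v ([p] \<cdot> \<one>)"] pos_mod_sign[of "int (card G)" "v ([p] \<cdot> \<one>)"] cG by linarith
  finally show ?thesis using cG by (simp add: val_ge_def)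
 qed (simp add: val_ge_def)
 obtain k where k: "card G = p ^ k" using assms(6) LF.dimension_is_inj[OF K] A.artin_dimension unfolding fK by blast
 note ex = A.group_exponent_properties[unfolded fK, folded assms(7)]
 obtain \<mu> where m: "m = p ^ \<mu>" using ex(3) k divides_primepow_nat[OF p] by auto
 obtain \<zeta> r' where z: "\<zeta> : K" "r' dvd m" "!!i::nat. \<zeta> [^] i = \<one> \<longleftrightarrow> r' dvd i" "!!x. x : K ==> x [^] m = \<one> ==> \<exists>i::nat. x = \<zeta> [^] i"
  using LF.prime_power_roots_of_unity[OF K p, of \<mu>] unfolding m by blast
 have zc: "\<zeta> : carrier L" using z(1) Kc by auto
 have r'0: "r' > 0" using z(2) ex(1) by (auto intro: gr0I)
 have z0: "\<zeta> ~= \<zero>"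
 proof
  assume "\<zeta> = \<zero>"
  thus False using z(3)[of r'] r'0 LF.nat_pow_zero[of r'] by simp
 qed
 note zeq = LF.pow_eq_pow_cong[OF zc z0 z(3)]
 \<comment> \<open>Identifies the number \<open>r\<close> of the theorem with the order of a
   generating root of unity.\<close>
 have "{x : K. x [^] m = \<one>} = (\<lambda>i. \<zeta> [^] i) ` {..<r'}"
 proof (intro Set.set_eqI iffI)
  fix x assume "x : {x : K. x [^] m = \<one>}"
  then obtain i :: nat where i: "x = \<zeta> [^] i" using z(4) by blast
  have "\<zeta> [^] i = \<zeta> [^] (i mod r')" using zeq by (simp add: cong_def)
  thus "x : (\<lambda>i. \<zeta> [^] i) ` {..<r'}" using i r'0 by auto
 next
  fix x assume "x : (\<lambda>i. \<zeta> [^] i) ` {..<r'}"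
  then obtain i :: nat where i: "x = \<zeta> [^] i" by blast
  have "x [^] m = \<zeta> [^] (i * m)" using zc by (simp add: i LF.nat_pow_pow)
  also have "\<dots> = \<one>" using z(2,3) by simp
  finally show "x : {x : K. x [^] m = \<one>}" using Kc(10)[OF z(1)] by (simp add: i)
 qed
 moreover have "inj_on (\<lambda>i. \<zeta> [^] i) {..<r'}" using zeq cong_less_modulus_unique_nat by (auto simp: inj_on_def)
 ultimately have r: "r = r'" using assms(8) by (simp add: card_image)
 note zeta = z[folded r]
 have r0: "r > 0" using r'0 r by simp
 show ?thesis
 proof
  assume "VC L v K"
  hence U: AR.units_in_submodules using AR.VC_iff_units unfolding fK by simp
  show "\<forall>E F. subfield E L \<and> subfield F L \<and> K \<subseteq> E \<and> E \<subseteq> F \<and> cyclic_extension (L\<lparr>carrier := F\<rparr>) E r -->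
    unit_root_kummer_extension (L\<lparr>carrier := F\<rparr>) E (sub_valuation L v E)"
   using AR.units_imp_unit_root[OF U _ zeta(3) r0, unfolded fK] zeta(1) by blast
 next
  assume RHS: "\<forall>E F. subfield E L \<and> subfield F L \<and> K \<subseteq> E \<and> E \<subseteq> F \<and> cyclic_extension (L\<lparr>carrier := F\<rparr>) E r -->
    unit_root_kummer_extension (L\<lparr>carrier := F\<rparr>) E (sub_valuation L v E)"
  have "AR.units_in_submodules"
  proof (cases "p dvd r")
   case True
   hence pm: "p dvd m" using zeta(2) by (rule dvd_trans)
   \<comment> \<open>For \<open>p = 2\<close> and \<open>8 dvd m\<close>, \<open>r\<close> is a
     power of 2 different from 1 and 2, hence divisible by 4.\<close>
   have cond: "p ~= 2 \<or> 4 dvd r \<or> \<not> 8 dvd m"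
   proof (cases "p = 2 \<and> 8 dvd m")
    case c: True
    obtain j where j: "r = p ^ j" using zeta(2) m divides_primepow_nat[OF p] by blast
    have "j ~= 0" using True j c by (cases j) auto
    moreover have "j ~= 1" using assms(9) j c by auto
    ultimately have "2 \<le> j" by simp
    hence "(2::nat) ^ 2 dvd 2 ^ j" by (rule le_imp_power_dvd)
    thus ?thesis using j c by simp
   qed auto
   interpret KD: kummer_data L G p r m \<zeta>
    using p m True zeta ex(2) cond by unfold_locales (auto simp: fK A.GG_simps(1)[unfolded fK] A.GG_simps(2)[unfolded fK])
   interpret KR: kummer_ram L G p r m \<zeta> v
   proof unfold_locales
    show "unit_root_kummer_extension (L\<lparr>carrier := F\<rparr>) E (sub_valuation L v E)"
     if "subfield E L" "subfield F L" "fixed_field L G \<subseteq> E" "E \<subseteq> F" "cyclic_extension (L\<lparr>carrier := F\<rparr>) E r" for E F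
     using that RHS unfolding fK by blast
    have "0 < m div p" "m div p < m" using dvd_imp_le[OF pm ex(1)] ex(1) prime_gt_1_nat[OF p] by (auto simp: div_greater_zero_iff)
    then obtain h where h: "h : G" "h [^]\<^bsub>galois_group L K\<^esub> (m div p) ~= \<one>\<^bsub>galois_group L K\<^esub>" using ex(4) by blast
    show "\<exists>h\<in>G. \<exists>x\<in>carrier L. (h [^]\<^bsub>galois_group L (fixed_field L G)\<^esub> (m div p)) x ~= x"
    proof (rule ccontr)
     assume "\<not> ?thesis"
     hence "(h [^]\<^bsub>galois_group L K\<^esub> (m div p)) x = x" if "x : carrier L" for x using h(1) that unfolding fK by blast
     hence "h [^]\<^bsub>galois_group L K\<^esub> (m div p) = (\<lambda>x\<in>carrier L. x)"
      using A.pow_in[OF h(1), of "m div p"] A.aut_id unfolding fK by (intro A.aut_eqI) auto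
     thus False using h(2) A.GG_simps(2) unfolding fK by simp
    qed
   qed
   show ?thesis by (rule KR.unit_root_imp_units)
  next
   case False
   have r1: "r = 1"
   proof -
    obtain j where "r = p ^ j" using zeta(2) m divides_primepow_nat[OF p] by blast
    thus ?thesis using False by (cases j) auto
   qed
   have fixed: "AR.units_in_submodules" if "!!N. A.submodule N ==> N ~= {\<zero>} ==> \<exists>y\<in>N. y ~= \<zero> \<and> y : fixed_field L G"
    unfolding AR.units_in_submodules_def using that AR.unit_if_fixed by blast
   \<comment> \<open>The trivial extension is separated because the descent assumes
     \<open>k > 0\<close>; there every vector is fixed.\<close>
   consider "k = 0" | "k > 0" "[p] \<cdot> \<one> = \<zero>" | "k > 0" "[p] \<cdot> \<one> ~= \<zero>" by auto
   thus ?thesis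
   proof cases
    case 1
    hence "card G = 1" using k by simp
    hence "G = {\<lambda>x\<in>carrier L. x}" using A.aut_id by (metis card_1_singletonE singletonD)
    hence "fixed_field L G = carrier L" by (auto simp: fixed_field_def)
    thus ?thesis using A.submoduleD(2,3) by (intro fixed) blast
   next
    case 2
    show ?thesis by (intro fixed AR.char_p_fixed_vector[OF p 2(2) k])
   next
    case 3
    \<comment> \<open>A nontrivial \<open>p\<close>-group has exponent divisible by
      \<open>p\<close>, so \<open>r = 1\<close> excludes nontrivial \<open>p\<close>-th roots of
      unity from \<open>K\<close>.\<close>
    have "m ~= 1"
    proof
     assume m1: "m = 1"
     have "g = (\<lambda>x\<in>carrier L. x)" if "g : G" for g using ex(2)[OF that] that A.GG.nat_pow_eone[of g] A.GG_simps(1,2) unfolding m1 fK by simp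
     hence "card G \<le> card {\<lambda>x\<in>carrier L. x}" by (intro card_mono) auto
     hence "p ^ k \<le> 1" using k by simp
     moreover have "p ^ k > 1" by (rule one_less_power[OF prime_gt_1_nat[OF p] 3(1)])
     ultimately show False by simp
    qed
    hence "p dvd m" using m by (cases \<mu>) auto
    have "x = \<one>" if x: "x : fixed_field L G" "x [^] p = \<one>" for x
    proof -
     have xK: "x : K" using x fK by simp
     have "x [^] m = \<one>" by (rule LF.pow_dvd_eq_one[OF _ x(2) \<open>p dvd m\<close>]) (use xK Kc in auto)
     then obtain i :: nat where "x = \<zeta> [^] i" using zeta(4) xK by blast
     thus ?thesis using zeta(3)[of i] r1 by simp
    qed
    thus ?thesis using AR.units_without_roots[OF p k 3(1) _ _ 3(2) vp] LF.complete by blast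
   qed
  qed
  thus "VC L v K" using AR.VC_iff_units unfolding fK by simp
 qed
qed

end
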